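(* Let $n\ge 4$, let $S^{\lambda,\mu}$ be an irreducible representation of $B_{n-2}$, where $\lambda,\mu$ are partitions with $|\lambda|+|\mu|=n-2$, and let $W$ be an irreducible representation of $D_2$. Then: 1. if $\mathrm{ind}^{B_2}_{D_2}W=S^{(2),\emptyset}\oplus S^{\emptyset,(2)}$, then $\mathrm{ind}^{B_n}_{B_{n-2}\times D_2}S^{\lambda,\mu}\boxtimes W=\bigoplus_{\tau\in\bar{\bar{\lambda}}}S^{\tau,\mu}\oplus\bigoplus_{\rho\in\bar{\bar{\mu}}}S^{\lambda,\rho}$; 2. if $\mathrm{ind}^{B_2}_{D_2}W=S^{(1^2),\emptyset}\oplus S^{\emptyset,(1^2)}$, then $\mathrm{ind}^{B_n}_{B_{n-2}\times D_2}S^{\lambda,\mu}\boxtimes W=\bigoplus_{\tau\in\tilde{\bar{\lambda}}}S^{\tau,\mu}\oplus\bigoplus_{\rho\in\tilde{\bar{\mu}}}S^{\lambda,\rho}$; 3. if $\mathrm{ind}^{B_2}_{D_2}W=S^{(1),(1)}$, then $\mathrm{ind}^{B_n}_{B_{n-2}\times D_2}S^{\lambda,\mu}\boxtimes W=\bigoplus_{\tau\in\bar{\lambda},\,\rho\in\bar{\mu}}S^{\tau,\rho}$.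
   Context: All representations are finite-dimensional over $\mathbb{C}$. Let $F=\mathbb{Z}/2=\{0,1\}$ and $B_m=F\wr S_m=F^m\rtimes S_m$, where $S_m$ permutes the coordinates of $F^m$. $B_{m-k}\times B_k$ is identified with $F\wr(S_{m-k}\times S_k)\leqslant B_m$. $D_2=\{(f,\sigma)\in B_2: f \text{ has an even number of } 1\text{'s}\}$. $\mathbf 1$ denotes the trivial and $\epsilon$ the sign (nontrivial one-dimensional) representation of $F$. For $D\in\{\mathbf 1,\epsilon\}$ and a representation $E$ of $S_m$, $(D;E)$ is the representation of $B_m$ on the space of $E$ in which $(f,\sigma)$ acts as $D(f_1)\cdots D(f_m)$ times the action of $\sigma$. For partitions $\lambda\vdash m-k$, $\mu\vdash k$, with Specht modules $S^\lambda,S^\mu$, set $S^{\lambda,\mu}:=\mathrm{ind}^{B_m}_{B_{m-k}\times B_k}(\mathbf 1;S^\lambda)\boxtimes(\epsilon;S^\mu)$; these are the irreducible representations of $B_m$. For a partition $\lambda$ of $m$: $\bar\lambda$ is the set of $\tau\vdash m+1$ such that $S^\tau$ is a summand of $\mathrm{ind}^{S_{m+1}}_{S_m\times S_1}S^\lambda\boxtimes\mathbf 1$; $\bar{\bar\lambda}$ is the set of $\tau\vdash m+2$ such that $S^\tau$ is a summand of $\mathrm{ind}^{S_{m+2}}_{S_m\times S_2}S^\lambda\boxtimes\mathbf 1_{S_2}$; $\tilde{\bar\lambda}$ is the set of $\tau\vdash m+2$ such that $S^\tau$ is a summand of $\mathrm{ind}^{S_{m+2}}_{S_m\times S_2}S^\lambda\boxtimes\epsilon_{S_2}$,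 where $\epsilon_{S_2}$ is the sign representation of $S_2$. *)

theory Defs
  imports
    Complex_Main
    "HOL-Library.Function_Algebras"
    "HOL-Library.Z2"
    "HOL-Combinatorics.Permutations"
    "HOL-Algebra.Sym_Groups"
begin

section \<open>Finite-dimensional complex representations\<close>

text \<open>
  All vector spaces are subspaces of function spaces \<^typ>\<open>'a \<Rightarrow> complex\<close>. Every finite-dimensional
  complex vector space is isomorphic to one of these, and tensor products, direct sums and induced
  modules of such spaces are again such spaces, over index types \<^typ>\<open>'a \<times> 'b\<close>, \<^typ>\<open>'i \<times> 'a\<close>,
  \<^typ>\<open>'a + 'b\<close> and \<^typ>\<open>'g \<times> 'a\<close>.
\<close>

definition cscale :: "complex \<Rightarrow> ('a \<Rightarrow> complex) \<Rightarrow> 'a \<Rightarrow> complex"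
  where "cscale c v = (\<lambda>a. c * v a)"

global_interpretation cfun: vector_space "cscale :: complex \<Rightarrow> ('a \<Rightarrow> complex) \<Rightarrow> 'a \<Rightarrow> complex"
  by unfold_locales (auto simp: cscale_def algebra_simps)

text \<open>The value of the action on vectors outside \<open>rep_space\<close> is irrelevant.\<close>

record ('g, 'a) rep =
  rep_space :: "('a \<Rightarrow> complex) set"
  rep_act :: "'g \<Rightarrow> ('a \<Rightarrow> complex) \<Rightarrow> 'a \<Rightarrow> complex"

definition linear_on_space ::
    "('a \<Rightarrow> complex) set \<Rightarrow> (('a \<Rightarrow> complex) \<Rightarrow> ('b \<Rightarrow> complex)) \<Rightarrow> bool"
  where "linear_on_space V T \<longleftrightarrow>
    (\<forall>u\<in>V. \<forall>v\<in>V. T (u + v) = T u + T v) \<and> (\<forall>c. \<forall>v\<in>V. T (cscale c v) = cscale c (T v))"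

definition is_rep :: "('g, 'm) monoid_scheme \<Rightarrow> ('g, 'a) rep \<Rightarrow> bool"
  where "is_rep G R \<longleftrightarrow>
    cfun.subspace (rep_space R) \<and>
    (\<exists>B. finite B \<and> rep_space R = cfun.span B) \<and>
    (\<forall>g\<in>carrier G. rep_act R g ` rep_space R \<subseteq> rep_space R \<and>
       linear_on_space (rep_space R) (rep_act R g)) \<and>
    (\<forall>v\<in>rep_space R. rep_act R \<one>\<^bsub>G\<^esub> v = v) \<and>
    (\<forall>g\<in>carrier G. \<forall>h\<in>carrier G. \<forall>v\<in>rep_space R.
       rep_act R (g \<otimes>\<^bsub>G\<^esub> h) v = rep_act R g (rep_act R h v))"

definition invariant_subspace ::
    "('g, 'm) monoid_scheme \<Rightarrow> ('g, 'a) rep \<Rightarrow> ('a \<Rightarrow> complex) set \<Rightarrow> bool"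
  where "invariant_subspace G R U \<longleftrightarrow>
    cfun.subspace U \<and> U \<subseteq> rep_space R \<and> (\<forall>g\<in>carrier G. rep_act R g ` U \<subseteq> U)"

definition irreducible_rep :: "('g, 'm) monoid_scheme \<Rightarrow> ('g, 'a) rep \<Rightarrow> bool"
  where "irreducible_rep G R \<longleftrightarrow>
    is_rep G R \<and> rep_space R \<noteq> {0} \<and>
    (\<forall>U. invariant_subspace G R U \<longrightarrow> U = {0} \<or> U = rep_space R)"

definition rep_iso :: "('g, 'm) monoid_scheme \<Rightarrow> ('g, 'a) rep \<Rightarrow> ('g, 'b) rep \<Rightarrow> bool"
  where "rep_iso G R S \<longleftrightarrow>
    (\<exists>T. linear_on_space (rep_space R) T \<and> bij_betw T (rep_space R) (rep_space S) \<and>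
       (\<forall>g\<in>carrier G. \<forall>v\<in>rep_space R. T (rep_act R g v) = rep_act S g (T v)))"

definition is_summand :: "('g, 'm) monoid_scheme \<Rightarrow> ('g, 'a) rep \<Rightarrow> ('g, 'b) rep \<Rightarrow> bool"
  where "is_summand G S R \<longleftrightarrow>
    (\<exists>U U'. invariant_subspace G R U \<and> invariant_subspace G R U' \<and>
       U \<inter> U' = {0} \<and> {u + u' |u u'. u \<in> U \<and> u' \<in> U'} = rep_space R \<and>
       rep_iso G S (R\<lparr>rep_space := U\<rparr>))"

definition one_dim_rep :: "('g \<Rightarrow> complex) \<Rightarrow> ('g, unit) rep"
  where "one_dim_rep \<chi> = \<lparr>rep_space = UNIV, rep_act = (\<lambda>g. cscale (\<chi> g))\<rparr>"

definition direct_sum2 :: "('g, 'a) rep \<Rightarrow> ('g, 'b) rep \<Rightarrow> ('g, 'a + 'b) rep"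
  where "direct_sum2 R S =
    \<lparr>rep_space = {v. v \<circ> Inl \<in> rep_space R \<and> v \<circ> Inr \<in> rep_space S},
     rep_act = (\<lambda>g v. case_sum (rep_act R g (v \<circ> Inl)) (rep_act S g (v \<circ> Inr)))\<rparr>"

text \<open>This is the direct product, hence the direct sum for finite \<open>I\<close>.\<close>

definition direct_sum :: "'i set \<Rightarrow> ('i \<Rightarrow> ('g, 'a) rep) \<Rightarrow> ('g, 'i \<times> 'a) rep"
  where "direct_sum I R =
    \<lparr>rep_space = {v. \<forall>i. if i \<in> I then curry v i \<in> rep_space (R i) else curry v i = 0},
     rep_act = (\<lambda>g v (i, a). if i \<in> I then rep_act (R i) g (curry v i) a else 0)\<rparr>"

text \<open>
  The outer tensor product, a representation of \<^term>\<open>G \<times>\<times> H\<close>; \<open>u \<otimes> w\<close> is the function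
  \<open>(a, b) \<mapsto> u a * w b\<close>. For an element \<open>t\<close> of the tensor product, every slice \<open>t (_, b)\<close> lies in the
  first factor and every slice \<open>t (a, _)\<close> in the second. Applying \<open>g\<close> to all slices of the first kind
  and then \<open>h\<close> to all slices of the second kind is the linear map \<open>u \<otimes> w \<mapsto> g u \<otimes> h w\<close>.
\<close>

definition outer_tensor :: "('g, 'a) rep \<Rightarrow> ('h, 'b) rep \<Rightarrow> ('g \<times> 'h, 'a \<times> 'b) rep"
    (infixl "\<boxtimes>" 75)
  where "R \<boxtimes> S =
    \<lparr>rep_space = cfun.span {\<lambda>(a, b). u a * w b |u w. u \<in> rep_space R \<and> w \<in> rep_space S},
     rep_act = (\<lambda>(g, h) t (a, b).
       rep_act S h (\<lambda>b'. rep_act R g (\<lambda>a'. t (a', b')) a) b)\<rparr>"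

text \<open>
  Induction from \<open>H\<close> to \<open>G\<close> along an injective homomorphism \<open>\<iota>\<close>, which identifies \<open>H\<close> with a subgroup
  of \<open>G\<close>. For finite groups, the function \<open>\<phi>\<close> with \<open>\<phi> (x \<iota>(h)) = h\<inverse> \<phi> x\<close> corresponds to the element
  \<open>\<Sum>\<^sub>x x \<otimes> \<phi> x\<close> (over left coset representatives \<open>x\<close>) of the tensor product of the group algebra of
  \<open>G\<close> with the module over that of \<open>H\<close>.
\<close>

definition induced_rep ::
    "('g, 'm) monoid_scheme \<Rightarrow> ('h, 'n) monoid_scheme \<Rightarrow> ('h \<Rightarrow> 'g) \<Rightarrow> ('h, 'a) rep \<Rightarrow> ('g, 'g \<times> 'a) rep"
  where "induced_rep G H \<iota> R =
    \<lparr>rep_space = {\<phi>.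
       (\<forall>x. x \<notin> carrier G \<longrightarrow> curry \<phi> x = 0) \<and>
       (\<forall>x\<in>carrier G. curry \<phi> x \<in> rep_space R) \<and>
       (\<forall>x\<in>carrier G. \<forall>h\<in>carrier H.
          curry \<phi> (x \<otimes>\<^bsub>G\<^esub> \<iota> h) = rep_act R (inv\<^bsub>H\<^esub> h) (curry \<phi> x))},
     rep_act = (\<lambda>g \<phi> (x, a). if x \<in> carrier G then \<phi> (inv\<^bsub>G\<^esub> g \<otimes>\<^bsub>G\<^esub> x, a) else 0)\<rparr>"


section \<open>Symmetric and hyperoctahedral groups\<close>

text \<open>The embedding of \<open>S\<^sub>k \<times> S\<^sub>l\<close> into \<open>S\<^bsub>k+l\<^esub>\<close>, with \<open>S\<^sub>l\<close> acting on \<open>{k+1..k+l}\<close>.\<close>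

definition sym_juxt :: "nat \<Rightarrow> (nat \<Rightarrow> nat) \<times> (nat \<Rightarrow> nat) \<Rightarrow> nat \<Rightarrow> nat"
  where "sym_juxt k = (\<lambda>(\<sigma>, \<tau>) i. if i \<le> k then \<sigma> i else \<tau> (i - k) + k)"

text \<open>
  \<open>F\<close> is the additive group of \<^typ>\<open>bit\<close>. Elements of \<open>F\<^sup>m\<close> are functions vanishing outside \<open>{1..m}\<close>.
\<close>

definition hyperoctahedral :: "nat \<Rightarrow> ((nat \<Rightarrow> bit) \<times> (nat \<Rightarrow> nat)) monoid"
  where "hyperoctahedral m =
    \<lparr>carrier = {(f, \<sigma>). (\<forall>i. i \<notin> {1..m} \<longrightarrow> f i = 0) \<and> \<sigma> \<in> carrier (sym_group m)},
     mult = (\<lambda>(f, \<sigma>) (g, \<tau>). (\<lambda>i. f i + g (Hilbert_Choice.inv \<sigma> i), \<sigma> \<otimes>\<^bsub>sym_group m\<^esub> \<tau>)),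
     one = (\<lambda>_. 0, \<one>\<^bsub>sym_group m\<^esub>)\<rparr>"

definition hyp_juxt ::
    "nat \<Rightarrow> ((nat \<Rightarrow> bit) \<times> (nat \<Rightarrow> nat)) \<times> ((nat \<Rightarrow> bit) \<times> (nat \<Rightarrow> nat)) \<Rightarrow> (nat \<Rightarrow> bit) \<times> (nat \<Rightarrow> nat)"
  where "hyp_juxt k = (\<lambda>((f, \<sigma>), (g, \<tau>)).
    (\<lambda>i. if i \<le> k then f i else g (i - k), sym_juxt k (\<sigma>, \<tau>)))"

definition D2 :: "((nat \<Rightarrow> bit) \<times> (nat \<Rightarrow> nat)) monoid"
  where "D2 = (hyperoctahedral 2)
    \<lparr>carrier := {(f, \<sigma>) \<in> carrier (hyperoctahedral 2). even (card {i \<in> {1..2}. f i = 1})}\<rparr>"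


section \<open>Specht modules\<close>

definition partitions :: "nat \<Rightarrow> nat list set"
  where "partitions m = {lam. sorted_wrt (\<ge>) lam \<and> (\<forall>p\<in>set lam. 0 < p) \<and> sum_list lam = m}"

definition young_diagram :: "nat list \<Rightarrow> (nat \<times> nat) set"
  where "young_diagram lam = {(i, j). i < length lam \<and> j < lam ! i}"

definition tableau :: "nat list \<Rightarrow> (nat \<times> nat \<Rightarrow> nat) \<Rightarrow> bool"
  where "tableau lam t \<longleftrightarrow> bij_betw t (young_diagram lam) {1..sum_list lam}"

text \<open>A tabloid is the list of the rows of a tableau, each row being considered as a set.\<close>

definition tabloid :: "nat list \<Rightarrow> (nat \<times> nat \<Rightarrow> nat) \<Rightarrow> nat set list"
  where "tabloid lam t = map (\<lambda>i. t ` {c \<in> young_diagram lam. fst c = i}) [0..<length lam]"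

definition act_tabloid :: "(nat \<Rightarrow> nat) \<Rightarrow> nat set list \<Rightarrow> nat set list"
  where "act_tabloid \<sigma> = map ((`) \<sigma>)"

definition column_stabilizer :: "nat list \<Rightarrow> (nat \<times> nat \<Rightarrow> nat) \<Rightarrow> (nat \<Rightarrow> nat) set"
  where "column_stabilizer lam t =
    {\<pi> \<in> carrier (sym_group (sum_list lam)).
       \<forall>j. \<pi> ` (t ` {c \<in> young_diagram lam. snd c = j}) = t ` {c \<in> young_diagram lam. snd c = j}}"

definition polytabloid :: "nat list \<Rightarrow> (nat \<times> nat \<Rightarrow> nat) \<Rightarrow> nat set list \<Rightarrow> complex"
  where "polytabloid lam t = (\<lambda>T. \<Sum>\<pi>\<in>column_stabilizer lam t.
    if T = act_tabloid \<pi> (tabloid lam t) then of_int (sign \<pi>) else 0)"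

text \<open>
  A function \<open>v\<close> on tabloids stands for the formal sum \<open>\<Sum>\<^sub>T v(T) T\<close>, whence the inverse in the action.
\<close>

definition specht :: "nat list \<Rightarrow> (nat \<Rightarrow> nat, nat set list) rep"
  where "specht lam =
    \<lparr>rep_space = cfun.span {polytabloid lam t |t. tableau lam t},
     rep_act = (\<lambda>\<sigma> v T. v (act_tabloid (Hilbert_Choice.inv \<sigma>) T))\<rparr>"


section \<open>The irreducible representations of the hyperoctahedral groups\<close>

text \<open>
  The representation \<open>(D; E)\<close> of \<open>B\<^sub>m\<close>, for a one-dimensional representation of \<open>F\<close> given by its
  character \<open>D\<close> and a representation \<open>E\<close> of \<open>S\<^sub>m\<close>.
\<close>

definition wreath_rep ::
    "nat \<Rightarrow> (bit \<Rightarrow> complex) \<Rightarrow> (nat \<Rightarrow> nat, 'a) rep \<Rightarrow> ((nat \<Rightarrow> bit) \<times> (nat \<Rightarrow> nat), 'a) rep"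
  where "wreath_rep m D E =
    \<lparr>rep_space = rep_space E,
     rep_act = (\<lambda>(f, \<sigma>) v. cscale (\<Prod>i\<in>{1..m}. D (f i)) (rep_act E \<sigma> v))\<rparr>"

definition triv_F :: "bit \<Rightarrow> complex"
  where "triv_F x = 1"

definition sign_F :: "bit \<Rightarrow> complex"
  where "sign_F x = (if x = 0 then 1 else - 1)"

type_synonym hyp_index =
  "((nat \<Rightarrow> bit) \<times> (nat \<Rightarrow> nat)) \<times> (nat set list \<times> nat set list)"

definition bispecht :: "nat list \<Rightarrow> nat list \<Rightarrow> ((nat \<Rightarrow> bit) \<times> (nat \<Rightarrow> nat), hyp_index) rep"
  where "bispecht lam mu = (let k = sum_list lam; l = sum_list mu in
    induced_rep (hyperoctahedral (k + l)) (hyperoctahedral k \<times>\<times> hyperoctahedral l) (hyp_juxt k)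
      (wreath_rep k triv_F (specht lam) \<boxtimes> wreath_rep l sign_F (specht mu)))"


section \<open>Adding boxes to a partition\<close>

definition summands_ind :: "nat list \<Rightarrow> nat \<Rightarrow> ((nat \<Rightarrow> nat) \<Rightarrow> complex) \<Rightarrow> nat list set"
  where "summands_ind lam k \<chi> = (let m = sum_list lam in
    {\<tau> \<in> partitions (m + k). is_summand (sym_group (m + k)) (specht \<tau>)
       (induced_rep (sym_group (m + k)) (sym_group m \<times>\<times> sym_group k) (sym_juxt m)
          (specht lam \<boxtimes> one_dim_rep \<chi>))})"

text \<open>
  In the order of the following definitions: \<open>\<lambda>\<close> with one bar, with two bars, and with a bar and a
  tilde.
\<close>

definition add_box :: "nat list \<Rightarrow> nat list set"
  where "add_box lam = summands_ind lam 1 (\<lambda>_. 1)"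

definition add_two_triv :: "nat list \<Rightarrow> nat list set"
  where "add_two_triv lam = summands_ind lam 2 (\<lambda>_. 1)"

definition add_two_sign :: "nat list \<Rightarrow> nat list set"
  where "add_two_sign lam = summands_ind lam 2 (\<lambda>\<sigma>. of_int (sign \<sigma>))"

end

theory Submission
  imports Defs "HOL-Combinatorics.Orbits" "HOL-Computational_Algebra.Fundamental_Theorem_Algebra"
begin

text \<open>
  All representations are compared through their characters: by Maschke's theorem and Schur's lemma,
  representations of a finite group with equal characters are isomorphic.

  For the symmetric groups, James' argument shows that the Specht modules are irreducible and pairwise
  non-isomorphic; as there are as many partitions as conjugacy classes, their characters form an
  orthonormal basis of the class functions. Inducing \<open>S\<^sup>\<lambda> \<boxtimes> \<chi>\<close> from \<open>S\<^sub>m \<times> S\<^sub>k\<close> with \<open>k \<le> 2\<close> and \<open>\<chi>\<close>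
  one-dimensional gives a multiplicity-free representation, by Frobenius reciprocity and Gelfand's trick.
  Its character is therefore the plain sum over the set of its irreducible summands.

  For the hyperoctahedral groups, conjugation by the permutation that exchanges two adjacent blocks of
  coordinates shows that inducing \<open>S\<^bsup>\<lambda>,\<mu>\<^esup> \<boxtimes> S\<^bsup>\<nu>,\<xi>\<^esup>\<close> amounts to inducing \<open>S\<^sup>\<lambda> \<boxtimes> S\<^sup>\<nu>\<close> and \<open>S\<^sup>\<mu> \<boxtimes> S\<^sup>\<xi>\<close>
  separately. Induction from \<open>B\<^bsub>n-2\<^esub> \<times> D\<^sub>2\<close> in stages, through \<open>B\<^bsub>n-2\<^esub> \<times> B\<^sub>2\<close>, reduces all three
  cases to this product formula.
\<close>

section \<open>Linear algebra in function spaces\<close>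

text \<open>The sets \<open>add_box\<close>, \<open>add_two_triv\<close> and
  \<open>add_two_sign\<close> only record which Specht modules occur, while the theorem takes each
  of them exactly once; the obstacle is thus to show that no multiplicity exceeds one. Conjugating a
  permutation to its inverse inside the subgroup settles this when the added points lie in different
  cycles. Two added points in one cycle call for the scalar by which their transposition acts, which
  is why \<open>multiplicity_free\<close> speaks of elements acting by scalars.

  The modules to be compared are function spaces over unrelated index types, so explicit
  isomorphisms for induction in stages or a change of embedding would be unwieldy; for class
  functions these facts are reindexings of finite sums. Traces are taken in frames, which may be
  linearly dependent, so that an induced module has a frame indexed by the whole group, without
  coset representatives. The inner product pairs the value at \<open>inv g\<close> with that at
  \<open>g\<close>; it is bilinear, and no invariant Hermitian form has to be constructed.\<close>

definition fdim :: "('a \<Rightarrow> complex) set \<Rightarrow> bool"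
  where "fdim V \<longleftrightarrow> cfun.subspace V \<and> (\<exists>B. finite B \<and> V = cfun.span B)"

definition lin_fun :: "('a \<Rightarrow> complex) set \<Rightarrow> (('a \<Rightarrow> complex) \<Rightarrow> complex) \<Rightarrow> bool"
  where "lin_fun V f \<longleftrightarrow>
    (\<forall>u\<in>V. \<forall>v\<in>V. f (u + v) = f u + f v) \<and> (\<forall>c. \<forall>v\<in>V. f (cscale c v) = c * f v)"

text \<open>A finite spanning family together with linear coordinate functionals, possibly linearly
  dependent. Traces can then be computed in redundant families such as the one used for induced
  modules.\<close>

definition frame :: "('a \<Rightarrow> complex) set \<Rightarrow> 'i set \<Rightarrow> ('i \<Rightarrow> 'a \<Rightarrow> complex) \<Rightarrow>
    ('i \<Rightarrow> ('a \<Rightarrow> complex) \<Rightarrow> complex) \<Rightarrow> bool"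
  where "frame V I v f \<longleftrightarrow> finite I \<and> (\<forall>i\<in>I. v i \<in> V) \<and> (\<forall>i\<in>I. lin_fun V (f i)) \<and>
    (\<forall>w\<in>V. w = (\<Sum>i\<in>I. cscale (f i w) (v i)))"

definition dual_basis :: "('a \<Rightarrow> complex) set \<Rightarrow> nat \<Rightarrow> (nat \<Rightarrow> 'a \<Rightarrow> complex) \<Rightarrow>
    (nat \<Rightarrow> ('a \<Rightarrow> complex) \<Rightarrow> complex) \<Rightarrow> bool"
  where "dual_basis V d v f \<longleftrightarrow> frame V {..<d} v f \<and>
    (\<forall>i<d. \<forall>j<d. f i (v j) = (if i = j then 1 else 0))"

text \<open>Coordinates must be picked to write a trace down; \<open>trace_frames_eq\<close> shows
  that for an endomorphism of a finite-dimensional space the pick does not matter.\<close>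

definition tr :: "('a \<Rightarrow> complex) set \<Rightarrow> (('a \<Rightarrow> complex) \<Rightarrow> 'a \<Rightarrow> complex) \<Rightarrow> complex"
  where "tr V T = (SOME c. \<exists>d v f. frame V {..<d::nat} v f \<and> c = (\<Sum>i<d. f i (T (v i))))"

lemma cscale_apply: "cscale c v a = c * v a"
  by (simp add: cscale_def)

lemma sum_apply: "(\<Sum>i\<in>I. F i) a = (\<Sum>i\<in>I. F i a)"
  by (induction I rule: infinite_finite_induct) auto

lemma lin_0: "cfun.subspace V \<Longrightarrow> linear_on_space V T \<Longrightarrow> T 0 = 0"
  unfolding linear_on_space_def
  by (metis cfun.scale_zero_left cfun.subspace_0)

lemma lin_add: "linear_on_space V T \<Longrightarrow> u \<in> V \<Longrightarrow> v \<in> V \<Longrightarrow> T (u + v) = T u + T v"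
  by (simp add: linear_on_space_def)

lemma lin_scale: "linear_on_space V T \<Longrightarrow> v \<in> V \<Longrightarrow> T (cscale c v) = cscale c (T v)"
  by (simp add: linear_on_space_def)

lemma lin_sum:
  assumes "cfun.subspace V" "linear_on_space V T" "\<And>i. i \<in> I \<Longrightarrow> v i \<in> V"
  shows "T (\<Sum>i\<in>I. v i) = (\<Sum>i\<in>I. T (v i))"
  using assms(3)
proof (induction I rule: infinite_finite_induct)
  case (insert x F)
  have "T (v x + sum v F) = T (v x) + T (sum v F)"
    using insert.prems by (intro lin_add[OF assms(2)] cfun.subspace_sum[OF assms(1)]) auto
  then show ?case
    using insert.IH insert.prems by (simp only: sum.insert[OF insert.hyps]) simp
qed (simp_all add: lin_0[OF assms(1,2)])

lemma lin_minus:
  assumes "cfun.subspace V" "linear_on_space V T" "u \<in> V" "v \<in> V"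
  shows "T (u - v) = T u - T v"
proof -
  have "T ((u - v) + v) = T (u - v) + T v"
    using assms by (intro lin_add[OF assms(2)] cfun.subspace_diff) auto
  then show ?thesis by simp
qed

lemma lin_fun_0: "cfun.subspace V \<Longrightarrow> lin_fun V T \<Longrightarrow> T 0 = 0"
  unfolding lin_fun_def
  by (metis cfun.scale_zero_left cfun.subspace_0 mult_zero_left)

lemma lin_fun_add: "lin_fun V T \<Longrightarrow> u \<in> V \<Longrightarrow> v \<in> V \<Longrightarrow> T (u + v) = T u + T v"
  by (simp add: lin_fun_def)

lemma lin_fun_scale: "lin_fun V T \<Longrightarrow> v \<in> V \<Longrightarrow> T (cscale c v) = c * (T v)"
  by (simp add: lin_fun_def)

lemma lin_fun_sum:
  assumes "cfun.subspace V" "lin_fun V T" "\<And>i. i \<in> I \<Longrightarrow> v i \<in> V"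
  shows "T (\<Sum>i\<in>I. v i) = (\<Sum>i\<in>I. T (v i))"
  using assms(3)
proof (induction I rule: infinite_finite_induct)
  case (insert x F)
  have "T (v x + sum v F) = T (v x) + T (sum v F)"
    using insert.prems by (intro lin_fun_add[OF assms(2)] cfun.subspace_sum[OF assms(1)]) auto
  then show ?case
    using insert.IH insert.prems by (simp only: sum.insert[OF insert.hyps]) simp
qed (simp_all add: lin_fun_0[OF assms(1,2)])

lemma fdim_subspace: "fdim V \<Longrightarrow> cfun.subspace V"
  by (simp add: fdim_def)

lemma fdim_zero: "fdim V \<Longrightarrow> 0 \<in> V"
  by (simp add: fdim_def cfun.subspace_0)

lemma fdimI:
  assumes "cfun.subspace V" "frame V I v f"
  shows "fdim V"
proof -
  have "V = cfun.span (v ` I)"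
  proof
    show "V \<subseteq> cfun.span (v ` I)"
    proof
      fix w assume "w \<in> V"
      then have "w = (\<Sum>i\<in>I. cscale (f i w) (v i))"
        using assms(2) unfolding frame_def by blast
      moreover have "(\<Sum>i\<in>I. cscale (f i w) (v i)) \<in> cfun.span (v ` I)"
        by (intro cfun.span_sum cfun.span_scale cfun.span_base) auto
      ultimately show "w \<in> cfun.span (v ` I)" by simp
    qed
    show "cfun.span (v ` I) \<subseteq> V"
      using assms by (intro cfun.span_minimal) (auto simp: frame_def)
  qed
  then show ?thesis using assms unfolding fdim_def frame_def by blast
qed

lemma fdim_span: "finite B \<Longrightarrow> fdim (cfun.span B)"
  unfolding fdim_def by (auto)

text \<open>A basis adapted to \<open>U\<close>: dropping the coordinates outside \<open>C\<close>
  is the linear projection from which Maschke's theorem starts.\<close>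

lemma independent_basis_exists:
  assumes "fdim V" "cfun.subspace U" "U \<subseteq> V"
  obtains C B where "finite B" "cfun.independent B" "cfun.span B = V" "C \<subseteq> B" "cfun.span C = U"
proof -
  obtain B0 where B0: "finite B0" "V = cfun.span B0" using assms by (auto simp: fdim_def)
  obtain C where C: "C \<subseteq> U" "cfun.independent C" "U \<subseteq> cfun.span C"
    using cfun.maximal_independent_subset[of U] by blast
  obtain B where B: "C \<subseteq> B" "B \<subseteq> V" "cfun.independent B" "V \<subseteq> cfun.span B"
    using cfun.maximal_independent_subset_extend[of C V] C assms(3) by blast
  have "finite B"
    using cfun.independent_span_bound[OF B0(1) B(3)] B(2) B0(2) by simp
  moreover have "cfun.span B = V"
    using B assms(1) by (simp add: cfun.span_minimal fdim_subspace subset_antisym)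
  moreover have "cfun.span C = U"
    using C assms(2) by (simp add: cfun.span_minimal subset_antisym)
  ultimately show thesis using that B C by blast
qed

lemma fdim_sub: "fdim V \<Longrightarrow> cfun.subspace U \<Longrightarrow> U \<subseteq> V \<Longrightarrow> fdim U"
  by (metis fdim_def finite_subset independent_basis_exists)

lemma dual_basis_exists:
  assumes "fdim V"
  obtains d v f where "dual_basis V d v f"
proof -
  obtain B where B: "finite B" "cfun.independent B" "cfun.span B = V"
    using independent_basis_exists[OF assms fdim_subspace[OF assms]] by blast
  obtain e where e: "bij_betw e {..<card B} B"
    using B(1) ex_bij_betw_nat_finite[of B] by (auto simp: atLeast0LessThan)
  define f where "f i w = cfun.representation B w (e i)" for i w
  have eB: "e i \<in> B" if "i < card B" for i using e that by (auto simp: bij_betw_def)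
  have fr: "frame V {..<card B} e f"
    unfolding frame_def lin_fun_def
  proof (intro conjI ballI allI)
    fix i assume "i \<in> {..<card B}"
    show "e i \<in> V" using eB \<open>i \<in> _\<close> B cfun.span_base by fastforce
    fix u c assume u: "u \<in> V"
    show "f i (cscale c u) = c * f i u"
      using u B by (simp add: f_def cfun.representation_scale)
    fix w assume "w \<in> V"
    then show "f i (u + w) = f i u + f i w"
      using u B by (simp add: f_def cfun.representation_add)
  next
    fix w assume w: "w \<in> V"
    have "w = (\<Sum>b\<in>B. cscale (cfun.representation B w b) b)"
      using cfun.sum_representation_eq[OF B(2) _ B(1) order_refl, of w] w B(3) by simp
    also have "\<dots> = (\<Sum>i\<in>{..<card B}. cscale (f i w) (e i))"
      unfolding f_def by (subst sum.reindex_bij_betw[OF e, symmetric]) simp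
    finally show "w = (\<Sum>i\<in>{..<card B}. cscale (f i w) (e i))" .
  qed simp
  moreover have "f i (e j) = (if i = j then 1 else 0)" if "i < card B" "j < card B" for i j
  proof -
    have "e i = e j \<longleftrightarrow> i = j"
      using e that by (auto simp: bij_betw_def inj_on_def)
    then show ?thesis
      using that cfun.representation_basis[OF B(2) eB[OF that(2)]] by (auto simp: f_def)
  qed
  ultimately show thesis using that unfolding dual_basis_def by blast
qed

section \<open>The trace and its independence of the frame\<close>

lemma dual_basis_frame: "dual_basis V d v f \<Longrightarrow> frame V {..<d} v f"
  by (simp add: dual_basis_def)

text \<open>Both sides equal the double sum of \<open>g j (T (v i)) * f i (w j)\<close>: expand
  \<open>T (v i)\<close> in the second frame on the left and \<open>w j\<close> in the first frame
  on the right. This is tr(AB) = tr(BA) for coordinate matrices, and it works for dependent families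
  as well.\<close>

lemma trace_frames_eq:
  assumes V: "cfun.subspace V" and F: "frame V I v f" and G: "frame V J w g"
    and T: "linear_on_space V T" "T ` V \<subseteq> V"
  shows "(\<Sum>i\<in>I. f i (T (v i))) = (\<Sum>j\<in>J. g j (T (w j)))"
proof -
  have TV: "T u \<in> V" if "u \<in> V" for u using T that by blast
  have v: "v i \<in> V" "lin_fun V (f i)" if "i \<in> I" for i using F that by (auto simp: frame_def)
  have w: "w i \<in> V" "lin_fun V (g i)" if "i \<in> J" for i using G that by (auto simp: frame_def)
  have "(\<Sum>i\<in>I. f i (T (v i))) = (\<Sum>i\<in>I. \<Sum>j\<in>J. g j (T (v i)) * f i (w j))"
  proof (rule sum.cong[OF refl])
    fix i assume i: "i \<in> I"
    have "T (v i) = (\<Sum>j\<in>J. cscale (g j (T (v i))) (w j))"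
      using G TV v(1)[OF i] unfolding frame_def by blast
    then have "f i (T (v i)) = f i (\<Sum>j\<in>J. cscale (g j (T (v i))) (w j))"
      by simp
    also have "\<dots> = (\<Sum>j\<in>J. g j (T (v i)) * f i (w j))"
      using w V by (subst lin_fun_sum[OF V v(2)[OF i]])
        (auto simp: cfun.subspace_scale lin_fun_scale[OF v(2)[OF i]])
    finally show "f i (T (v i)) = (\<Sum>j\<in>J. g j (T (v i)) * f i (w j))" .
  qed
  also have "\<dots> = (\<Sum>j\<in>J. \<Sum>i\<in>I. f i (w j) * g j (T (v i)))"
    by (subst sum.swap) (simp add: mult.commute)
  also have "\<dots> = (\<Sum>j\<in>J. g j (T (w j)))"
  proof (rule sum.cong[OF refl])
    fix j assume j: "j \<in> J"
    have "w j = (\<Sum>i\<in>I. cscale (f i (w j)) (v i))"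
      using F w(1)[OF j] unfolding frame_def by blast
    then have "T (w j) = T (\<Sum>i\<in>I. cscale (f i (w j)) (v i))" by simp
    also have "\<dots> = (\<Sum>i\<in>I. cscale (f i (w j)) (T (v i)))"
      using v V by (subst lin_sum[OF V T(1)]) (auto simp: cfun.subspace_scale lin_scale[OF T(1)])
    finally have "g j (T (w j)) = g j (\<Sum>i\<in>I. cscale (f i (w j)) (T (v i)))" by simp
    also have "\<dots> = (\<Sum>i\<in>I. f i (w j) * g j (T (v i)))"
      using v TV V by (subst lin_fun_sum[OF V w(2)[OF j]])
        (auto simp: cfun.subspace_scale lin_fun_scale[OF w(2)[OF j]])
    finally show "(\<Sum>i\<in>I. f i (w j) * g j (T (v i))) = g j (T (w j))" by simp
  qed
  finally show ?thesis .
qed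

lemma tr_frame:
  assumes V: "cfun.subspace V" and F: "frame V I v f"
    and T: "linear_on_space V T" "T ` V \<subseteq> V"
  shows "tr V T = (\<Sum>i\<in>I. f i (T (v i)))"
proof -
  obtain d v' f' where "dual_basis V d v' f'"
    using dual_basis_exists[OF fdimI[OF V F]] .
  then have F': "frame V {..<d} v' f'" by (rule dual_basis_frame)
  show ?thesis
    unfolding tr_def
  proof (rule some_equality)
    show "\<exists>d va fa. frame V {..<d::nat} va fa \<and> (\<Sum>i\<in>I. f i (T (v i))) = (\<Sum>i<d. fa i (T (va i)))"
      using trace_frames_eq[OF V F F' T] F' by blast
  qed (metis trace_frames_eq[OF V _ F T])
qed

lemma tr_cong: "fdim V \<Longrightarrow> linear_on_space V T \<Longrightarrow> T ` V \<subseteq> V \<Longrightarrow> (\<And>v. v \<in> V \<Longrightarrow> T v = S v)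
  \<Longrightarrow> tr V T = tr V S"
proof -
  assume a: "fdim V" "linear_on_space V T" "T ` V \<subseteq> V" "\<And>v. v \<in> V \<Longrightarrow> T v = S v"
  obtain d v f where "dual_basis V d v f" using dual_basis_exists[OF a(1)] .
  then have F: "frame V {..<d} v f" by (rule dual_basis_frame)
  have S: "linear_on_space V S" "S ` V \<subseteq> V"
    using a fdim_subspace[OF a(1)] 
    by (auto simp: linear_on_space_def cfun.subspace_add cfun.subspace_scale image_subset_iff)
  show ?thesis
    unfolding tr_frame[OF fdim_subspace[OF a(1)] F a(2,3)] tr_frame[OF fdim_subspace[OF a(1)] F S]
    using F a(4) by (auto intro!: sum.cong simp: frame_def)
qed

lemma tr_id:
  assumes "dual_basis V d v f" "cfun.subspace V"
  shows "tr V (\<lambda>v. v) = of_nat d"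
proof -
  have "tr V (\<lambda>v. v) = (\<Sum>i<d. f i (v i))"
    using assms by (intro tr_frame) (auto simp: linear_on_space_def dual_basis_def)
  also have "\<dots> = of_nat d" using assms by (simp add: dual_basis_def)
  finally show ?thesis .
qed

lemma dual_basis_0:
  assumes "dual_basis V d v f" "cfun.subspace V"
  shows "d = 0 \<longleftrightarrow> V = {0}"
proof
  assume "d = 0"
  then have "\<forall>w\<in>V. w = 0" using assms by (simp add: dual_basis_def frame_def)
  then show "V = {0}" using assms(2) cfun.subspace_0 by blast
next
  assume V: "V = {0}"
  show "d = 0"
  proof (rule ccontr)
    assume "d \<noteq> 0"
    then have "v 0 = 0" "f 0 (v 0) = 1" "lin_fun V (f 0)"
      using assms V by (auto simp: dual_basis_def frame_def)
    then show False using lin_fun_0[OF assms(2)] by fastforce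
  qed
qed

text \<open>Coordinates are pulled back along the inverse map. Isomorphic representations then have
  corresponding frames, in which their characters are the same sums.\<close>

lemma frame_transport:
  assumes F: "frame V I v f" and V: "cfun.subspace V" and
   T: "linear_on_space V T" "bij_betw T V W"
  shows "frame W I (\<lambda>i. T (v i)) (\<lambda>i w. f i (inv_into V T w))"
proof -
  have inv: "inv_into V T w \<in> V" "T (inv_into V T w) = w" if "w \<in> W" for w
    using T(2) that by (auto simp: bij_betw_def inv_into_into f_inv_into_f)
  have inv': "inv_into V T (T w) = w" if "w \<in> V" for w
    using T(2) that by (auto simp: bij_betw_def)
  have lin: "lin_fun W (\<lambda>w. f i (inv_into V T w))" if "i \<in> I" for i
  proof -
    have L: "lin_fun V (f i)" using F that by (auto simp: frame_def)
    have "inv_into V T (u + w) = inv_into V T u + inv_into V T w" if "u \<in> W" "w \<in> W" for u w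
    proof -
      have "T (inv_into V T u + inv_into V T w) = u + w"
        using inv that by (simp add: lin_add[OF T(1)])
      then show ?thesis using inv' inv(1) that V by (metis cfun.subspace_add)
    qed
    moreover have "inv_into V T (cscale c u) = cscale c (inv_into V T u)" if "u \<in> W" for u c
    proof -
      have "T (cscale c (inv_into V T u)) = cscale c u"
        using inv that by (simp add: lin_scale[OF T(1)])
      then show ?thesis using inv' inv(1) that V by (metis cfun.subspace_scale)
    qed
    ultimately show ?thesis
      unfolding lin_fun_def using inv lin_fun_add[OF L] lin_fun_scale[OF L] by simp
  qed
  show ?thesis
    unfolding frame_def
  proof (intro conjI ballI)
    show "finite I" using F by (simp add: frame_def)
    show "T (v i) \<in> W" if "i \<in> I" for i
      using F T(2) that by (auto simp: frame_def bij_betw_def)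
    show "lin_fun W (\<lambda>w. f i (inv_into V T w))" if "i \<in> I" for i
      using lin that by simp
    show "w = (\<Sum>i\<in>I. cscale (f i (inv_into V T w)) (T (v i)))" if "w \<in> W" for w
    proof -
      have *: "cscale c (v i) \<in> V" if "i \<in> I" for c i
        using F that V by (auto simp: frame_def cfun.subspace_scale)
      have "inv_into V T w = (\<Sum>i\<in>I. cscale (f i (inv_into V T w)) (v i))"
        using F inv that unfolding frame_def by blast
      then have "w = T (\<Sum>i\<in>I. cscale (f i (inv_into V T w)) (v i))"
        using inv(2)[OF that] by simp
      also have "\<dots> = (\<Sum>i\<in>I. cscale (f i (inv_into V T w)) (T (v i)))"
        using * F by (subst lin_sum[OF V T(1)]) (auto simp: lin_scale[OF T(1)] frame_def)
      finally show ?thesis .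
    qed
  qed
qed

section \<open>Representations\<close>

definition character :: "('g, 'a) rep \<Rightarrow> 'g \<Rightarrow> complex"
  where "character R g = tr (rep_space R) (rep_act R g)"

definition rep_hom :: "('g, 'm) monoid_scheme \<Rightarrow> ('g, 'a) rep \<Rightarrow> ('g, 'b) rep \<Rightarrow>
    (('a \<Rightarrow> complex) \<Rightarrow> 'b \<Rightarrow> complex) \<Rightarrow> bool"
  where "rep_hom G R S T \<longleftrightarrow> linear_on_space (rep_space R) T \<and> T ` rep_space R \<subseteq> rep_space S \<and>
    (\<forall>g\<in>carrier G. \<forall>v\<in>rep_space R. T (rep_act R g v) = rep_act S g (T v))"

abbreviation subrep :: "('g, 'a) rep \<Rightarrow> ('a \<Rightarrow> complex) set \<Rightarrow> ('g, 'a) rep"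
  where "subrep R U \<equiv> R\<lparr>rep_space := U\<rparr>"

lemma rep_iso_alt: "rep_iso G R S \<longleftrightarrow> (\<exists>T. rep_hom G R S T \<and> bij_betw T (rep_space R) (rep_space S))"
  unfolding rep_iso_def rep_hom_def bij_betw_def by blast

lemma rep_fdim: "is_rep G R \<Longrightarrow> fdim (rep_space R)"
  by (simp add: is_rep_def fdim_def)

lemma rep_subspace: "is_rep G R \<Longrightarrow> cfun.subspace (rep_space R)"
  by (simp add: is_rep_def)

lemma rep_closed: "is_rep G R \<Longrightarrow> g \<in> carrier G \<Longrightarrow> v \<in> rep_space R \<Longrightarrow> rep_act R g v \<in> rep_space R"
  by (auto simp add: is_rep_def)

lemma rep_lin: "is_rep G R \<Longrightarrow> g \<in> carrier G \<Longrightarrow> linear_on_space (rep_space R) (rep_act R g)"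
  by (simp add: is_rep_def)

lemma rep_one: "is_rep G R \<Longrightarrow> v \<in> rep_space R \<Longrightarrow> rep_act R \<one>\<^bsub>G\<^esub> v = v"
  by (simp add: is_rep_def)

lemma rep_mult: "is_rep G R \<Longrightarrow> g \<in> carrier G \<Longrightarrow> h \<in> carrier G \<Longrightarrow> v \<in> rep_space R
  \<Longrightarrow> rep_act R (g \<otimes>\<^bsub>G\<^esub> h) v = rep_act R g (rep_act R h v)"
  by (simp add: is_rep_def)

lemma is_repI:
  assumes "fdim (rep_space R)"
    and "\<And>g v. g \<in> carrier G \<Longrightarrow> v \<in> rep_space R \<Longrightarrow> rep_act R g v \<in> rep_space R"
    and "\<And>g. g \<in> carrier G \<Longrightarrow> linear_on_space (rep_space R) (rep_act R g)"
    and "\<And>v. v \<in> rep_space R \<Longrightarrow> rep_act R \<one>\<^bsub>G\<^esub> v = v"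
    and "\<And>g h v. g \<in> carrier G \<Longrightarrow> h \<in> carrier G \<Longrightarrow> v \<in> rep_space R
          \<Longrightarrow> rep_act R (g \<otimes>\<^bsub>G\<^esub> h) v = rep_act R g (rep_act R h v)"
  shows "is_rep G R"
  using assms by (auto simp: is_rep_def fdim_def)

lemma is_rep_sub:
  assumes "is_rep G R" "invariant_subspace G R U"
  shows "is_rep G (subrep R U)"
proof (rule is_repI)
  have U: "cfun.subspace U" "U \<subseteq> rep_space R"
    using assms(2) by (auto simp: invariant_subspace_def)
  then show "fdim (rep_space (subrep R U))"
    using fdim_sub[OF rep_fdim[OF assms(1)]] by simp
  show "\<And>g. g \<in> carrier G \<Longrightarrow> linear_on_space (rep_space (subrep R U)) (rep_act (subrep R U) g)"
    using rep_lin[OF assms(1)] U by (auto simp: linear_on_space_def subset_iff)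
  show "\<And>v. v \<in> rep_space (subrep R U) \<Longrightarrow> rep_act (subrep R U) \<one>\<^bsub>G\<^esub> v = v"
    using rep_one[OF assms(1)] U by auto
  show "\<And>g h v. g \<in> carrier G \<Longrightarrow> h \<in> carrier G \<Longrightarrow> v \<in> rep_space (subrep R U)
     \<Longrightarrow> rep_act (subrep R U) (g \<otimes>\<^bsub>G\<^esub> h) v = rep_act (subrep R U) g (rep_act (subrep R U) h v)"
    using rep_mult[OF assms(1)] U by auto
qed (use assms(2) in \<open>auto simp: invariant_subspace_def\<close>)

lemma char_frame:
  assumes "is_rep G R" "frame (rep_space R) I v f" "g \<in> carrier G"
  shows "character R g = (\<Sum>i\<in>I. f i (rep_act R g (v i)))"
  unfolding character_def
  using assms by (intro tr_frame) (auto simp: is_rep_def)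

lemma rep_iso_char:
  assumes "is_rep G R" "is_rep G S" "rep_iso G R S" "g \<in> carrier G"
  shows "character R g = character S g"
proof -
  obtain T where T: "linear_on_space (rep_space R) T" "bij_betw T (rep_space R) (rep_space S)"
    "\<forall>g\<in>carrier G. \<forall>v\<in>rep_space R. T (rep_act R g v) = rep_act S g (T v)"
    using assms(3) unfolding rep_iso_def by blast
  obtain d v f where D: "dual_basis (rep_space R) d v f"
    using dual_basis_exists[OF rep_fdim[OF assms(1)]] .
  note F = dual_basis_frame[OF D]
  note F' = frame_transport[OF F rep_subspace[OF assms(1)] T(1,2)]
  have vR: "v i \<in> rep_space R" if "i < d" for i using F that by (auto simp: frame_def)
  have "character S g = (\<Sum>i<d. f i (inv_into (rep_space R) T (rep_act S g (T (v i)))))"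
    by (rule char_frame[OF assms(2) F' assms(4)])
  also have "\<dots> = (\<Sum>i<d. f i (rep_act R g (v i)))"
  proof (rule sum.cong[OF refl])
    fix i assume "i \<in> {..<d}"
    then have "rep_act S g (T (v i)) = T (rep_act R g (v i))" "rep_act R g (v i) \<in> rep_space R"
      using T(3) vR assms by (auto simp: rep_closed)
    then have "inv_into (rep_space R) T (rep_act S g (T (v i))) = rep_act R g (v i)"
      using T(2) by (auto simp: bij_betw_def inv_into_f_f)
    then show "f i (inv_into (rep_space R) T (rep_act S g (T (v i)))) = f i (rep_act R g (v i))"
      by simp
  qed
  also have "\<dots> = character R g"
    using char_frame[OF assms(1) F assms(4)] by simp
  finally show ?thesis by simp
qed

lemma rep_hom_comp:
  assumes "rep_hom G R S T" "rep_hom G S Q T'"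
  shows "rep_hom G R Q (\<lambda>v. T' (T v))"
  using assms unfolding rep_hom_def linear_on_space_def by (auto simp: image_subset_iff)

lemma rep_iso_sym:
  assumes "is_rep G R" "is_rep G S" "rep_iso G R S"
  shows "rep_iso G S R"
proof -
  obtain T where T: "linear_on_space (rep_space R) T" "bij_betw T (rep_space R) (rep_space S)"
    "\<forall>g\<in>carrier G. \<forall>v\<in>rep_space R. T (rep_act R g v) = rep_act S g (T v)"
    using assms(3) unfolding rep_iso_def by blast
  let ?I = "inv_into (rep_space R) T"
  have inv: "?I w \<in> rep_space R" "T (?I w) = w" if "w \<in> rep_space S" for w
    using T(2) that by (auto simp: bij_betw_def inv_into_into f_inv_into_f)
  have inv': "?I (T w) = w" if "w \<in> rep_space R" for w
    using T(2) that by (auto simp: bij_betw_def)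
  note V = rep_subspace[OF assms(1)]
  have "linear_on_space (rep_space S) ?I"
    unfolding linear_on_space_def
  proof (intro conjI ballI allI)
    fix u c assume u: "u \<in> rep_space S"
    show "?I (cscale c u) = cscale c (?I u)"
    proof -
      have "T (cscale c (?I u)) = cscale c u"
        using inv[OF u] by (simp add: lin_scale[OF T(1)])
      moreover have "cscale c (?I u) \<in> rep_space R"
        using inv(1)[OF u] V by (simp add: cfun.subspace_scale)
      ultimately show ?thesis using inv' by metis
    qed
    fix w assume w: "w \<in> rep_space S"
    show "?I (u + w) = ?I u + ?I w"
    proof -
      have "T (?I u + ?I w) = u + w"
        using inv[OF u] inv[OF w] by (simp add: lin_add[OF T(1)])
      moreover have "?I u + ?I w \<in> rep_space R"
        using inv(1)[OF u] inv(1)[OF w] V by (simp add: cfun.subspace_add)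
      ultimately show ?thesis using inv' by metis
    qed
  qed
  moreover have "bij_betw ?I (rep_space S) (rep_space R)"
    using T(2) bij_betw_inv_into by blast
  moreover have "\<forall>g\<in>carrier G. \<forall>v\<in>rep_space S. ?I (rep_act S g v) = rep_act R g (?I v)"
  proof (intro ballI)
    fix g v assume g: "g \<in> carrier G" and v: "v \<in> rep_space S"
    have "T (rep_act R g (?I v)) = rep_act S g v"
      using T(3) g inv[OF v] by simp
    moreover have "rep_act R g (?I v) \<in> rep_space R"
      using rep_closed[OF assms(1) g] inv[OF v] by simp
    ultimately show "?I (rep_act S g v) = rep_act R g (?I v)" using inv' by metis
  qed
  ultimately show ?thesis unfolding rep_iso_def by blast
qed

lemma rep_iso_trans:
  assumes "rep_iso G R S" "rep_iso G S Q"
  shows "rep_iso G R Q"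
proof -
  obtain T T' where "rep_hom G R S T" "bij_betw T (rep_space R) (rep_space S)"
    "rep_hom G S Q T'" "bij_betw T' (rep_space S) (rep_space Q)"
    using assms unfolding rep_iso_alt by blast
  then have "rep_hom G R Q (\<lambda>v. T' (T v))" "bij_betw (\<lambda>v. T' (T v)) (rep_space R) (rep_space Q)"
    using rep_hom_comp bij_betw_trans[of T _ _ T'] by (auto simp: comp_def)
  then show ?thesis unfolding rep_iso_alt by blast
qed

subsection \<open>Direct sums\<close>

lemma frame_direct_sum2:
  assumes "frame (rep_space R) I v f" "frame (rep_space S) J w g"
    "cfun.subspace (rep_space R)" "cfun.subspace (rep_space S)"
  shows "frame (rep_space (direct_sum2 R S)) (I <+> J)
    (case_sum (\<lambda>i. case_sum (v i) 0) (\<lambda>j. case_sum 0 (w j)))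
    (case_sum (\<lambda>i x. f i (x \<circ> Inl)) (\<lambda>j x. g j (x \<circ> Inr)))"
proof -
  have c: "case_sum a b \<circ> Inl = a" "case_sum a b \<circ> Inr = b" for a :: "'x \<Rightarrow> 'z" and b :: "'y \<Rightarrow> 'z"
    by (auto simp: fun_eq_iff)
  have p: "(x + y) \<circ> h = (x \<circ> h) + (y \<circ> h)" "cscale e x \<circ> h = cscale e (x \<circ> h)"
    for x y :: "'q \<Rightarrow> complex" and h :: "'p \<Rightarrow> 'q" and e
    by (auto simp: fun_eq_iff cscale_def)
  show ?thesis
    unfolding frame_def
  proof (intro conjI ballI)
    show "finite (I <+> J)" using assms by (auto simp: frame_def)
  next
    fix i assume "i \<in> I <+> J"
    then show "case_sum (\<lambda>i. case_sum (v i) 0) (\<lambda>j. case_sum 0 (w j)) i \<in> rep_space (direct_sum2 R S)"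
      using assms by (auto simp: frame_def direct_sum2_def c cfun.subspace_0)
  next
    fix i assume "i \<in> I <+> J"
    then show "lin_fun (rep_space (direct_sum2 R S))
        (case_sum (\<lambda>i x. f i (x \<circ> Inl)) (\<lambda>j x. g j (x \<circ> Inr)) i)"
      using assms by (auto simp: frame_def direct_sum2_def lin_fun_def p)
  next
    fix x assume "x \<in> rep_space (direct_sum2 R S)"
    then have x: "x \<circ> Inl \<in> rep_space R" "x \<circ> Inr \<in> rep_space S"
      by (auto simp: direct_sum2_def)
    have 1: "x \<circ> Inl = (\<Sum>i\<in>I. cscale (f i (x \<circ> Inl)) (v i))"
      and 2: "x \<circ> Inr = (\<Sum>i\<in>J. cscale (g i (x \<circ> Inr)) (w i))"
      using x assms unfolding frame_def by blast+
    show "x = (\<Sum>i\<in>I <+> J. cscale (case_sum (\<lambda>i x. f i (x \<circ> Inl)) (\<lambda>j x. g j (x \<circ> Inr)) i x)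
        (case_sum (\<lambda>i. case_sum (v i) 0) (\<lambda>j. case_sum 0 (w j)) i))" (is "_ = ?r")
    proof
      fix a
      have "?r = (\<Sum>i\<in>I. cscale (f i (x \<circ> Inl)) (case_sum (v i) 0)) +
        (\<Sum>j\<in>J. cscale (g j (x \<circ> Inr)) (case_sum 0 (w j)))"
        using assms by (subst sum.Plus) (auto simp: frame_def)
      then show "x a = ?r a"
        using fun_cong[OF 1] fun_cong[OF 2]
        by (cases a) (auto simp: sum_apply cscale_def)
    qed
  qed
qed

lemma direct_sum2_rep:
  assumes "is_rep G R" "is_rep G S"
  shows "is_rep G (direct_sum2 R S)"
    and "g \<in> carrier G \<Longrightarrow> character (direct_sum2 R S) g = character R g + character S g"
proof -
  note V = rep_subspace[OF assms(1)] rep_subspace[OF assms(2)]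
  have c: "case_sum a b \<circ> Inl = a" "case_sum a b \<circ> Inr = b" for a :: "'x \<Rightarrow> 'z" and b :: "'y \<Rightarrow> 'z"
    by (auto simp: fun_eq_iff)
  have p: "(x + y) \<circ> h = (x \<circ> h) + (y \<circ> h)" "cscale e x \<circ> h = cscale e (x \<circ> h)"
    "0 \<circ> h = (0 :: 'p \<Rightarrow> complex)"
    for x y :: "'q \<Rightarrow> complex" and h :: "'p \<Rightarrow> 'q" and e
    by (auto simp: fun_eq_iff cscale_def)
  obtain d v f where D: "dual_basis (rep_space R) d v f"
    using dual_basis_exists[OF rep_fdim[OF assms(1)]] .
  obtain e w h where E: "dual_basis (rep_space S) e w h"
    using dual_basis_exists[OF rep_fdim[OF assms(2)]] .
  note F = frame_direct_sum2[OF dual_basis_frame[OF D] dual_basis_frame[OF E] V]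
  have sub: "cfun.subspace (rep_space (direct_sum2 R S))"
    using V unfolding cfun.subspace_def by (auto simp: direct_sum2_def p)
  show rep: "is_rep G (direct_sum2 R S)"
  proof (rule is_repI)
    show "fdim (rep_space (direct_sum2 R S))" by (rule fdimI[OF sub F])
    show "\<And>g. g \<in> carrier G \<Longrightarrow>
         linear_on_space (rep_space (direct_sum2 R S)) (rep_act (direct_sum2 R S) g)"
      using rep_lin[OF assms(1)] rep_lin[OF assms(2)]
      by (auto simp: linear_on_space_def direct_sum2_def p cscale_apply intro!: ext split: sum.splits)
    show "rep_act (direct_sum2 R S) \<one>\<^bsub>G\<^esub> v = v" if "v \<in> rep_space (direct_sum2 R S)" for v
      using rep_one[OF assms(1)] rep_one[OF assms(2)] that
      by (auto simp: direct_sum2_def fun_eq_iff split: sum.splits)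
  qed (use rep_closed[OF assms(1)] rep_closed[OF assms(2)] rep_mult[OF assms(1)] rep_mult[OF assms(2)]
       in \<open>auto simp: direct_sum2_def c\<close>)
  assume g: "g \<in> carrier G"
  show "character (direct_sum2 R S) g = character R g + character S g"
    unfolding char_frame[OF rep F g] char_frame[OF assms(1) dual_basis_frame[OF D] g]
      char_frame[OF assms(2) dual_basis_frame[OF E] g]
    by (subst sum.Plus) (auto simp: direct_sum2_def c)
qed

lemma direct_sum2_cong:
  assumes "rep_iso G R R'" "rep_iso G S S'"
  shows "rep_iso G (direct_sum2 R S) (direct_sum2 R' S')"
proof -
  obtain T T' where T: "rep_hom G R R' T" "bij_betw T (rep_space R) (rep_space R')"
    "rep_hom G S S' T'" "bij_betw T' (rep_space S) (rep_space S')"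
    using assms unfolding rep_iso_alt by blast
  have c: "case_sum a b \<circ> Inl = a" "case_sum a b \<circ> Inr = b" for a :: "'x \<Rightarrow> 'z" and b :: "'y \<Rightarrow> 'z"
    by (auto simp: fun_eq_iff)
  have c': "case_sum (x \<circ> Inl) (x \<circ> Inr) = x" for x :: "'x + 'y \<Rightarrow> 'z"
    by (auto simp: fun_eq_iff split: sum.splits)
  have p: "(x + y) \<circ> h = (x \<circ> h) + (y \<circ> h)" "cscale e x \<circ> h = cscale e (x \<circ> h)"
    for x y :: "'q \<Rightarrow> complex" and h :: "'p \<Rightarrow> 'q" and e
    by (auto simp: fun_eq_iff cscale_def)
  let ?T = "\<lambda>x. case_sum (T (x \<circ> Inl)) (T' (x \<circ> Inr))"
  have "rep_hom G (direct_sum2 R S) (direct_sum2 R' S') ?T"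
    using T unfolding rep_hom_def
    by (auto simp: linear_on_space_def direct_sum2_def p c cscale_apply image_subset_iff
        intro!: ext split: sum.splits)
  moreover have "bij_betw ?T (rep_space (direct_sum2 R S)) (rep_space (direct_sum2 R' S'))"
  proof (rule bij_betwI[where g = "\<lambda>y. case_sum (inv_into (rep_space R) T (y \<circ> Inl))
      (inv_into (rep_space S) T' (y \<circ> Inr))"])
    show "?T \<in> rep_space (direct_sum2 R S) \<rightarrow> rep_space (direct_sum2 R' S')"
      using T by (auto simp: direct_sum2_def c rep_hom_def)
  qed (use T in \<open>auto simp: direct_sum2_def c c' bij_betw_def inv_into_into f_inv_into_f inv_into_f_f\<close>)
  ultimately show ?thesis unfolding rep_iso_alt by blast
qed

section \<open>Finite groups and reindexing of sums over them\<close>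

locale finite_group = group +
  assumes fin: "finite (carrier G)"
begin

lemma sum_inv: "(\<Sum>g\<in>carrier G. F (inv g)) = (\<Sum>g\<in>carrier G. F g)"
  by (rule sum.reindex_bij_witness[of _ "\<lambda>g. inv g" "\<lambda>g. inv g"]) auto

lemma sum_lmult: "x \<in> carrier G \<Longrightarrow> (\<Sum>g\<in>carrier G. F (x \<otimes> g)) = (\<Sum>g\<in>carrier G. F g)"
  by (rule sum.reindex_bij_witness[of _ "\<lambda>g. inv x \<otimes> g" "\<lambda>g. x \<otimes> g"])
     (auto simp: m_assoc[symmetric])

lemma sum_rmult: "x \<in> carrier G \<Longrightarrow> (\<Sum>g\<in>carrier G. F (g \<otimes> x)) = (\<Sum>g\<in>carrier G. F g)"
  by (rule sum.reindex_bij_witness[of _ "\<lambda>g. g \<otimes> inv x" "\<lambda>g. g \<otimes> x"])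
     (auto simp: m_assoc)

lemma card_pos: "of_nat (card (carrier G)) \<noteq> (0 :: complex)"
  using fin one_closed by auto

lemma rep_inv: "is_rep G R \<Longrightarrow> g \<in> carrier G \<Longrightarrow> v \<in> rep_space R \<Longrightarrow>
    rep_act R (inv g) (rep_act R g v) = v"
  by (metis inv_closed l_inv rep_mult rep_one)

lemma rep_inv': "is_rep G R \<Longrightarrow> g \<in> carrier G \<Longrightarrow> v \<in> rep_space R \<Longrightarrow>
    rep_act R g (rep_act R (inv g) v) = v"
  by (metis inv_closed r_inv rep_mult rep_one)

end

lemma lin_comp:
  assumes "linear_on_space V S" "linear_on_space W T" "S ` V \<subseteq> W"
  shows "linear_on_space V (\<lambda>v. T (S v))"
  using assms by (auto simp: linear_on_space_def image_subset_iff)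

lemma lin_sum_maps:
  assumes "\<And>i. i \<in> I \<Longrightarrow> linear_on_space V (T i)"
  shows "linear_on_space V (\<lambda>v. \<Sum>i\<in>I. T i v)"
  unfolding linear_on_space_def
proof (intro conjI ballI allI)
  fix u v assume "u \<in> V" "v \<in> V"
  then have "T i (u + v) = T i u + T i v" if "i \<in> I" for i
    using lin_add[OF assms[OF that]] by blast
  then show "(\<Sum>i\<in>I. T i (u + v)) = (\<Sum>i\<in>I. T i u) + (\<Sum>i\<in>I. T i v)"
    by (simp only: sum.distrib[symmetric] cong: sum.cong)
next
  fix c v assume "v \<in> V"
  then have "T i (cscale c v) = cscale c (T i v)" if "i \<in> I" for i
    using lin_scale[OF assms[OF that]] by blast
  then show "(\<Sum>i\<in>I. T i (cscale c v)) = cscale c (\<Sum>i\<in>I. T i v)"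
    by (simp only: cfun.scale_sum_right cong: sum.cong)
qed

lemma lin_cscale_map:
  assumes "linear_on_space V T"
  shows "linear_on_space V (\<lambda>v. cscale c (T v))"
  using lin_add[OF assms] lin_scale[OF assms] unfolding linear_on_space_def
  by (auto simp: cfun.scale_right_distrib mult.commute)

text \<open>The induction step keeps the membership of \<open>y\<close> in the span, since the maps
  to which it is applied are additive only on a subspace.\<close>

lemma span_induct_mem [consumes 1, case_names base step]:
  assumes "x \<in> cfun.span B" "P 0"
    and "\<And>c x y. x \<in> B \<Longrightarrow> y \<in> cfun.span B \<Longrightarrow> P y \<Longrightarrow> P (cscale c x + y)"
  shows "P x"
proof -
  have "x \<in> cfun.span B \<and> P x"
    using assms(1)
  proof (induction rule: cfun.span_induct_alt)
    case base
    show ?case using assms(2) cfun.span_zero by blast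
  next
    case (step c x y)
    then show ?case
      using assms(3) cfun.span_add[OF cfun.span_scale[OF cfun.span_base]] by blast
  qed
  then show ?thesis ..
qed

subsection \<open>Indexed direct sums\<close>

text \<open>The frame is the disjoint union of the frames of the summands, each placed in its own
  block. Vanishing outside \<open>I\<close> is part of the space, so these coordinates see the whole
  vector.\<close>

lemma direct_sum_rep:
  fixes R :: "'i \<Rightarrow> ('g, 'a) rep"
  assumes I: "finite I" and R: "\<And>i. i \<in> I \<Longrightarrow> is_rep G (R i)" and G: "group G"
  shows "is_rep G (direct_sum I R)"
    and "g \<in> carrier G \<Longrightarrow> character (direct_sum I R) g = (\<Sum>i\<in>I. character (R i) g)"
proof -
  interpret group G by fact
  have c: "curry (x + y) i = curry x i + curry y i" "curry (cscale e x) i = cscale e (curry x i)"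
    "curry 0 i = (0 :: 'z \<Rightarrow> complex)"
    for x y :: "'i \<times> 'z \<Rightarrow> complex" and i e
    by (auto simp: fun_eq_iff cscale_def)
  have "\<forall>i\<in>I. \<exists>d v f. dual_basis (rep_space (R i)) d v f"
    using dual_basis_exists[OF rep_fdim[OF R]] by metis
  then obtain d v f where D: "\<And>i. i \<in> I \<Longrightarrow> dual_basis (rep_space (R i)) (d i) (v i) (f i)"
    by metis
  note Fr = dual_basis_frame[OF D]
  have fl: "lin_fun (rep_space (R i)) (f i j)" "v i j \<in> rep_space (R i)" if "i \<in> I" "j < d i" for i j
    using Fr that by (auto simp: frame_def)
  note V = rep_subspace[OF R]
  let ?v = "\<lambda>(i, j) (i', a). if i' = i then v i j a else (0 :: complex)"
  let ?f = "\<lambda>(i, j) x. f i j (curry x i)"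
  have mem: "x \<in> rep_space (direct_sum I R) \<longleftrightarrow>
      (\<forall>i\<in>I. curry x i \<in> rep_space (R i)) \<and> (\<forall>i. i \<notin> I \<longrightarrow> curry x i = 0)" for x
    by (auto simp: direct_sum_def)
  have act: "curry (rep_act (direct_sum I R) g x) i = (if i \<in> I then rep_act (R i) g (curry x i) else 0)"
    for g x i by (auto simp: direct_sum_def fun_eq_iff)
  have sub: "cfun.subspace (rep_space (direct_sum I R))"
    using V unfolding cfun.subspace_def by (auto simp: mem c)
  have eqI: "x = y" if "\<And>i. curry x i = curry y i" for x y :: "'i \<times> 'z \<Rightarrow> complex"
    using that by (metis curry_case_prod case_prod_curry ext)
  have cv: "curry (?v (i, j)) i' = (if i' = i then v i j else 0)" for i j i'
    by (auto simp: fun_eq_iff)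
  have F: "frame (rep_space (direct_sum I R)) (Sigma I (\<lambda>i. {..<d i})) ?v ?f"
    unfolding frame_def
  proof (intro conjI ballI)
    show "finite (Sigma I (\<lambda>i. {..<d i}))" using I by auto
  next
    fix p assume p: "p \<in> Sigma I (\<lambda>i. {..<d i})"
    obtain i j where ij: "p = (i, j)" by (cases p)
    show "?v p \<in> rep_space (direct_sum I R)"
      unfolding mem ij cv using p fl(2) V by (auto simp: ij cfun.subspace_0)
    show "lin_fun (rep_space (direct_sum I R)) (?f p)"
      using p fl(1)[of i j] by (auto simp: ij lin_fun_def mem c)
  next
    fix x assume x: "x \<in> rep_space (direct_sum I R)"
    show "x = (\<Sum>p\<in>Sigma I (\<lambda>i. {..<d i}). cscale (?f p x) (?v p))"
    proof
      fix ia :: "'i \<times> 'a"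
      obtain i0 a where ia: "ia = (i0, a)" by (cases ia)
      have "(\<Sum>p\<in>Sigma I (\<lambda>i. {..<d i}). cscale (?f p x) (?v p)) ia
          = (\<Sum>(i,j)\<in>Sigma I (\<lambda>i. {..<d i}). if i0 = i then f i j (curry x i) * v i j a else 0)"
        by (auto simp: sum_apply cscale_def ia intro!: sum.cong)
      also have "\<dots> = (\<Sum>i\<in>I. \<Sum>j<d i. if i0 = i then f i j (curry x i) * v i j a else 0)"
        using I by (subst sum.Sigma) auto
      also have "\<dots> = (\<Sum>i\<in>I. if i0 = i then \<Sum>j<d i. f i j (curry x i) * v i j a else 0)"
        by (intro sum.cong) auto
      also have "\<dots> = (if i0 \<in> I then \<Sum>j<d i0. f i0 j (curry x i0) * v i0 j a else 0)"
        using I by simp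
      also have "\<dots> = x ia"
      proof (cases "i0 \<in> I")
        case True
        then have "curry x i0 \<in> rep_space (R i0)" using x by (simp add: mem)
        then have "curry x i0 = (\<Sum>j<d i0. cscale (f i0 j (curry x i0)) (v i0 j))"
          using Fr[OF True] unfolding frame_def by blast
        then have "curry x i0 a = (\<Sum>j<d i0. cscale (f i0 j (curry x i0)) (v i0 j)) a"
          by (rule fun_cong)
        then show ?thesis using True by (simp add: sum_apply cscale_def ia)
      next
        case False
        then have "curry x i0 a = 0" using x by (simp add: mem)
        then show ?thesis using False ia by simp
      qed
      finally show "x ia = (\<Sum>p\<in>Sigma I (\<lambda>i. {..<d i}). cscale (?f p x) (?v p)) ia" by simp
    qed
  qed
  show rep: "is_rep G (direct_sum I R)"
  proof (rule is_repI)
    show "fdim (rep_space (direct_sum I R))" by (rule fdimI[OF sub F])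
    show "linear_on_space (rep_space (direct_sum I R)) (rep_act (direct_sum I R) g)"
      if "g \<in> carrier G" for g
      unfolding linear_on_space_def
    proof (intro conjI ballI allI)
      fix x y c assume x: "x \<in> rep_space (direct_sum I R)"
      show "rep_act (direct_sum I R) g (cscale c x) = cscale c (rep_act (direct_sum I R) g x)"
        using x lin_scale[OF rep_lin[OF R that]]
        by (intro eqI) (auto simp: act c mem)
      assume y: "y \<in> rep_space (direct_sum I R)"
      show "rep_act (direct_sum I R) g (x + y) = rep_act (direct_sum I R) g x + rep_act (direct_sum I R) g y"
        using x y lin_add[OF rep_lin[OF R that]]
        by (intro eqI) (auto simp: act c mem)
    qed
    show "rep_act (direct_sum I R) g x \<in> rep_space (direct_sum I R)"
      if "g \<in> carrier G" "x \<in> rep_space (direct_sum I R)" for g x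
      using that rep_closed[OF R] by (auto simp: mem act)
    show "rep_act (direct_sum I R) \<one>\<^bsub>G\<^esub> x = x" if "x \<in> rep_space (direct_sum I R)" for x
      using that rep_one[OF R] by (intro eqI) (auto simp: mem act)
    show "rep_act (direct_sum I R) (g \<otimes>\<^bsub>G\<^esub> h) x = rep_act (direct_sum I R) g (rep_act (direct_sum I R) h x)"
      if "g \<in> carrier G" "h \<in> carrier G" "x \<in> rep_space (direct_sum I R)" for g h x
      using that rep_mult[OF R] by (intro eqI) (auto simp: mem act)
  qed
  assume g: "g \<in> carrier G"
  have "character (direct_sum I R) g = (\<Sum>(i,j)\<in>Sigma I (\<lambda>i. {..<d i}). f i j (rep_act (R i) g (v i j)))"
    unfolding char_frame[OF rep F g]
  proof (intro sum.cong refl)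
    fix p assume p: "p \<in> Sigma I (\<lambda>i. {..<d i})"
    obtain i j where ij: "p = (i, j)" by (cases p)
    show "?f p (rep_act (direct_sum I R) g (?v p)) = (case p of (i, j) \<Rightarrow> f i j (rep_act (R i) g (v i j)))"
      using p unfolding ij prod.case act cv[unfolded prod.case] by simp
  qed
  also have "\<dots> = (\<Sum>i\<in>I. \<Sum>j<d i. f i j (rep_act (R i) g (v i j)))"
    using I by (subst sum.Sigma) auto
  also have "\<dots> = (\<Sum>i\<in>I. character (R i) g)"
    by (intro sum.cong refl) (simp add: char_frame[OF R Fr g])
  finally show "character (direct_sum I R) g = (\<Sum>i\<in>I. character (R i) g)" .
qed

subsection \<open>Outer tensor products\<close>

definition tensor :: "('a \<Rightarrow> complex) \<Rightarrow> ('b \<Rightarrow> complex) \<Rightarrow> 'a \<times> 'b \<Rightarrow> complex"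
  where "tensor u w = (\<lambda>(a, b). u a * w b)"

lemma outer_space: "rep_space (R \<boxtimes> S) = cfun.span {tensor u w |u w. u \<in> rep_space R \<and> w \<in> rep_space S}"
  by (simp add: outer_tensor_def tensor_def)

lemma slice_simps:
  "(\<lambda>a. (x + y) (a, b)) = (\<lambda>a. x (a, b)) + (\<lambda>a. y (a, b :: 'b))"
  "(\<lambda>a. cscale c x (a, b)) = cscale c (\<lambda>a. x (a, b))"
  "(\<lambda>b. (z + t) b * k) = (\<lambda>b. z b * k) + (\<lambda>b. t b * k)"
  for x y :: "'a \<times> 'b \<Rightarrow> complex" and k :: complex and z t :: "'c \<Rightarrow> complex"
  by (auto simp: cscale_def fun_eq_iff algebra_simps)

text \<open>The action on \<open>R \<boxtimes> S\<close> is defined slice by slice, so each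
  intermediate slice must be known to lie in a factor. The third claim covers slices to which a
  functional of the first factor has been applied, the situation both of tensor coordinates and of
  the action after its first half.\<close>

lemma tensor_slices:
  fixes V :: "('c \<Rightarrow> complex) set" and W :: "('d \<Rightarrow> complex) set"
  assumes V: "cfun.subspace V" "cfun.subspace W"
   and t: "t \<in> cfun.span {tensor u w |u w. u \<in> V \<and> w \<in> W}"
  shows "(\<lambda>a. t (a, b)) \<in> V" "(\<lambda>b. t (a, b)) \<in> W"
    "lin_fun V p \<Longrightarrow> (\<lambda>b. p (\<lambda>a. t (a, b))) \<in> W"
proof -
  have "(\<forall>b. (\<lambda>a. t (a, b)) \<in> V) \<and> (\<forall>a. (\<lambda>b. t (a, b)) \<in> W) \<and>
     (\<forall>p. lin_fun V p \<longrightarrow> (\<lambda>b. p (\<lambda>a. t (a, b))) \<in> W)"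
    using t
  proof (induction rule: span_induct_mem)
    case base
    have z: "(\<lambda>a. 0 (a, b)) = (0 :: 'c \<Rightarrow> complex)" "(\<lambda>b. 0 (a, b)) = (0 :: 'd \<Rightarrow> complex)"
      for a :: 'c and b :: 'd
      by auto
    have "(\<lambda>b. p 0) = (0 :: 'd \<Rightarrow> complex)" if "lin_fun V p" for p
      using lin_fun_0[OF V(1) that] by auto
    then show ?case
      unfolding z using V by (auto simp: cfun.subspace_0 simp del: zero_fun_apply)
  next
    case (step c x y)
    then obtain u w where x: "x = tensor u w" "u \<in> V" "w \<in> W" by blast
    have s1: "(\<lambda>a. (cscale c x + y) (a, b)) = cscale (c * w b) u + (\<lambda>a. y (a, b))" for b
      by (auto simp: x tensor_def cscale_def fun_eq_iff)
    have s2: "(\<lambda>b. (cscale c x + y) (a, b)) = cscale (c * u a) w + (\<lambda>b. y (a, b))" for a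
      by (auto simp: x tensor_def cscale_def fun_eq_iff)
    have s3: "(\<lambda>b. p (\<lambda>a. (cscale c x + y) (a, b))) = cscale (c * p u) w + (\<lambda>b. p (\<lambda>a. y (a, b)))"
      if p: "lin_fun V p" for p
    proof
      fix b
      have "p (\<lambda>a. (cscale c x + y) (a, b)) = p (cscale (c * w b) u) + p (\<lambda>a. y (a, b))"
        unfolding s1 using step V x by (intro lin_fun_add[OF p] cfun.subspace_scale) auto
      then show "p (\<lambda>a. (cscale c x + y) (a, b)) = (cscale (c * p u) w + (\<lambda>b. p (\<lambda>a. y (a, b)))) b"
        using lin_fun_scale[OF p x(2)] by (simp add: cscale_def)
    qed
    have "(\<lambda>b. p (\<lambda>a. (cscale c x + y) (a, b))) \<in> W" if p: "lin_fun V p" for p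
      unfolding s3[OF p] using step.IH x V p by (intro cfun.subspace_add cfun.subspace_scale) auto
    then show ?case
      using step.IH x V unfolding s1 s2
      by (auto simp del: plus_fun_apply intro!: cfun.subspace_add cfun.subspace_scale)
  qed
  then show "(\<lambda>a. t (a, b)) \<in> V" "(\<lambda>b. t (a, b)) \<in> W"
    "lin_fun V p \<Longrightarrow> (\<lambda>b. p (\<lambda>a. t (a, b))) \<in> W" by auto
qed

text \<open>Coordinates multiply: applying \<open>f i\<close> to the slices in the first variable
  and then \<open>h j\<close> to the resulting vector sends \<open>tensor u u'\<close> to
  \<open>f i u * h j u'\<close>. The expansion is checked on such products and spreads over the span
  by linearity.\<close>

lemma frame_tensor:
  fixes V :: "('a \<Rightarrow> complex) set" and W :: "('c \<Rightarrow> complex) set"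
  assumes V: "cfun.subspace V" "cfun.subspace W"
   and F: "frame V I v f" "frame W J w h"
  shows "frame (cfun.span {tensor u w |u w. u \<in> V \<and> w \<in> W}) (I \<times> J) (\<lambda>(i, j). tensor (v i) (w j))
    (\<lambda>(i, j) t. h j (\<lambda>b. f i (\<lambda>a. t (a, b))))" (is "frame ?S _ ?v ?f")
proof -
  have f: "lin_fun V (f i)" "v i \<in> V" if "i \<in> I" for i using F(1) that by (auto simp: frame_def)
  have h: "lin_fun W (h i)" "w i \<in> W" if "i \<in> J" for i using F(2) that by (auto simp: frame_def)
  have lin: "lin_fun ?S (?f (i, j))" if "i \<in> I" "j \<in> J" for i j
  proof -
    note sl = tensor_slices[OF V]
    show ?thesis
      unfolding lin_fun_def prod.case
    proof (intro conjI ballI allI)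
      fix x y c assume x: "x \<in> ?S"
      have "(\<lambda>b. f i (\<lambda>a. (cscale c x) (a, b))) = cscale c (\<lambda>b. f i (\<lambda>a. x (a, b)))"
        unfolding slice_simps using lin_fun_scale[OF f(1)[OF that(1)] sl(1)[OF x]]
        by (simp add: cscale_def)
      then show "h j (\<lambda>b. f i (\<lambda>a. (cscale c x) (a, b))) = c * h j (\<lambda>b. f i (\<lambda>a. x (a, b)))"
        using lin_fun_scale[OF h(1)[OF that(2)] sl(3)[OF x f(1)[OF that(1)]]] by simp
      assume y: "y \<in> ?S"
      have "(\<lambda>b. f i (\<lambda>a. (x + y) (a, b))) = (\<lambda>b. f i (\<lambda>a. x (a, b))) + (\<lambda>b. f i (\<lambda>a. y (a, b)))"
        unfolding slice_simps using lin_fun_add[OF f(1)[OF that(1)] sl(1)[OF x] sl(1)[OF y]]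
        by (auto simp: fun_eq_iff)
      then show "h j (\<lambda>b. f i (\<lambda>a. (x + y) (a, b))) =
          h j (\<lambda>b. f i (\<lambda>a. x (a, b))) + h j (\<lambda>b. f i (\<lambda>a. y (a, b)))"
        using lin_fun_add[OF h(1)[OF that(2)] sl(3)[OF x f(1)[OF that(1)]] sl(3)[OF y f(1)[OF that(1)]]]
        by simp
    qed
  qed
  have subS: "cfun.subspace ?S" by (rule cfun.subspace_span)
  have vS: "?v p \<in> ?S" if "p \<in> I \<times> J" for p
    using that f h by (auto intro!: cfun.span_base exI)
  show ?thesis
    unfolding frame_def
  proof (intro conjI ballI)
    show "finite (I \<times> J)" using F by (auto simp: frame_def)
    show "?v p \<in> ?S" if "p \<in> I \<times> J" for p using vS[OF that] .
    show "lin_fun ?S (?f p)" if "p \<in> I \<times> J" for p using that lin by (cases p) auto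
    fix t assume "t \<in> ?S"
    then show "t = (\<Sum>p\<in>I \<times> J. cscale (?f p t) (?v p))"
    proof (induction rule: span_induct_mem)
      case base
      have "?f p 0 = 0" if "p \<in> I \<times> J" for p
        using lin_fun_0[OF subS] lin that by (cases p) blast
      then show ?case by (simp add: sum.neutral del: zero_fun_apply)
    next
      case (step c x y)
      then obtain u u' where x: "x = tensor u u'" "u \<in> V" "u' \<in> W" by blast
      have xS: "x \<in> ?S" using step by (auto intro: cfun.span_base)
      have yS: "y \<in> ?S" by fact
      have fx: "h j (\<lambda>b. f i (\<lambda>a. x (a, b))) = f i u * h j u'" if "i \<in> I" "j \<in> J" for i j
      proof -
        have "(\<lambda>a. x (a, b)) = cscale (u' b) u" for b
          by (auto simp: x tensor_def cscale_def fun_eq_iff)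
        then have "f i (\<lambda>a. x (a, b)) = u' b * f i u" for b
          using lin_fun_scale[OF f(1)[OF that(1)] x(2)] by simp
        then have "(\<lambda>b. f i (\<lambda>a. x (a, b))) = cscale (f i u) u'" by (auto simp: cscale_def)
        then show ?thesis using lin_fun_scale[OF h(1)[OF that(2)] x(3)] by simp
      qed
      have "x = (\<Sum>p\<in>I \<times> J. cscale (?f p x) (?v p))"
      proof
        fix ab :: "'a \<times> 'c"
        obtain a b where ab: "ab = (a, b)" by (cases ab)
        have u: "u = (\<Sum>i\<in>I. cscale (f i u) (v i))" and u': "u' = (\<Sum>i\<in>J. cscale (h i u') (w i))"
          using F x unfolding frame_def by blast+
        have "(\<Sum>p\<in>I \<times> J. cscale (?f p x) (?v p)) ab
            = (\<Sum>(i,j)\<in>I \<times> J. (f i u * v i a) * (h j u' * w j b))"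
          unfolding sum_apply
          by (intro sum.cong refl) (clarsimp simp: fx ab cscale_def tensor_def)
        also have "\<dots> = (\<Sum>i\<in>I. f i u * v i a) * (\<Sum>j\<in>J. h j u' * w j b)"
          by (simp add: sum_product sum.cartesian_product)
        also have "\<dots> = u a * u' b"
          using fun_cong[OF u, of a] fun_cong[OF u', of b] by (simp add: sum_apply cscale_def)
        finally show "x ab = (\<Sum>p\<in>I \<times> J. cscale (?f p x) (?v p)) ab"
          by (simp add: ab x tensor_def)
      qed
      moreover have "?f p (cscale c x + y) = c * ?f p x + ?f p y" if "p \<in> I \<times> J" for p
      proof -
        have L: "lin_fun ?S (?f p)" using that lin by (cases p) auto
        have "?f p (cscale c x + y) = ?f p (cscale c x) + ?f p y"
          by (rule lin_fun_add[OF L cfun.subspace_scale[OF subS xS] yS])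
        then show ?thesis by (simp only: lin_fun_scale[OF L xS])
      qed
      then have "(\<Sum>p\<in>I \<times> J. cscale (?f p (cscale c x + y)) (?v p)) =
         (\<Sum>p\<in>I \<times> J. cscale c (cscale (?f p x) (?v p)) + cscale (?f p y) (?v p))"
        by (intro sum.cong refl) (simp only: cfun.scale_left_distrib cfun.scale_scale)
      then have "(\<Sum>p\<in>I \<times> J. cscale (?f p (cscale c x + y)) (?v p)) =
         cscale c (\<Sum>p\<in>I \<times> J. cscale (?f p x) (?v p)) + (\<Sum>p\<in>I \<times> J. cscale (?f p y) (?v p))"
        by (simp only: sum.distrib cfun.scale_sum_right)
      ultimately show ?case using step.IH by metis
    qed
  qed
qed

lemma outer_act_tensor:
  assumes "is_rep G R" "is_rep H S" "g \<in> carrier G" "h \<in> carrier H" "u \<in> rep_space R" "w \<in> rep_space S"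
  shows "rep_act (R \<boxtimes> S) (g, h) (tensor u w) = tensor (rep_act R g u) (rep_act S h w)"
proof -
  have "(\<lambda>a'. tensor u w (a', b)) = cscale (w b) u" for b
    by (auto simp: tensor_def cscale_def)
  then have "rep_act R g (\<lambda>a'. tensor u w (a', b)) = cscale (w b) (rep_act R g u)" for b
    using lin_scale[OF rep_lin[OF assms(1,3)] assms(5)] by simp
  then have "(\<lambda>b'. rep_act R g (\<lambda>a'. tensor u w (a', b')) a) = cscale (rep_act R g u a) w" for a
    by (auto simp: cscale_def)
  then have "rep_act S h (\<lambda>b'. rep_act R g (\<lambda>a'. tensor u w (a', b')) a) =
      cscale (rep_act R g u a) (rep_act S h w)" for a
    using lin_scale[OF rep_lin[OF assms(2,4)] assms(6)] by simp
  then show ?thesis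
    by (simp add: outer_tensor_def tensor_def[of "rep_act R g u"]) (simp add: cscale_def)
qed

lemma outer_act_lin:
  assumes R: "is_rep G R" "is_rep H S" "g \<in> carrier G" "h \<in> carrier H"
  shows "linear_on_space (rep_space (R \<boxtimes> S)) (rep_act (R \<boxtimes> S) (g, h))"
proof -
  note V = rep_subspace[OF R(1)] rep_subspace[OF R(2)]
  note sl = tensor_slices[OF V, folded outer_space]
  \<comment> \<open>Acting by \<open>g\<close> and evaluating at \<open>a\<close> is a functional on
    the first factor, so the third claim of \<open>tensor_slices\<close> applies to the
    half-finished action.\<close>
  have ev: "lin_fun (rep_space R) (\<lambda>u. rep_act R g u a)" for a
    using rep_lin[OF R(1,3)] by (auto simp: lin_fun_def linear_on_space_def cscale_def)
  have act: "rep_act (R \<boxtimes> S) (g, h) x = (\<lambda>(a, b). rep_act S h (\<lambda>b'. rep_act R g (\<lambda>a'. x (a', b')) a) b)" for x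
    by (simp add: outer_tensor_def)
  note la = lin_add[OF rep_lin[OF R(1,3)]] lin_scale[OF rep_lin[OF R(1,3)]]
  note lb = lin_add[OF rep_lin[OF R(2,4)]] lin_scale[OF rep_lin[OF R(2,4)]]
  show ?thesis
    unfolding linear_on_space_def
  proof (intro conjI ballI allI)
    fix x y c assume x: "x \<in> rep_space (R \<boxtimes> S)"
    have "(\<lambda>b'. rep_act R g (\<lambda>a'. cscale c x (a', b')) a) = cscale c (\<lambda>b'. rep_act R g (\<lambda>a'. x (a', b')) a)" for a
      unfolding slice_simps la(2)[OF sl(1)[OF x]] by (simp add: cscale_def)
    then show "rep_act (R \<boxtimes> S) (g, h) (cscale c x) = cscale c (rep_act (R \<boxtimes> S) (g, h) x)"
      by (simp add: act lb(2)[OF sl(3)[OF x ev]]) (simp add: cscale_def fun_eq_iff)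
    assume y: "y \<in> rep_space (R \<boxtimes> S)"
    have "(\<lambda>b'. rep_act R g (\<lambda>a'. (x + y) (a', b')) a) = (\<lambda>b'. rep_act R g (\<lambda>a'. x (a', b')) a) +
      (\<lambda>b'. rep_act R g (\<lambda>a'. y (a', b')) a)" for a
      unfolding slice_simps la(1)[OF sl(1)[OF x] sl(1)[OF y]] by (simp add: plus_fun_def)
    then have "rep_act S h (\<lambda>b'. rep_act R g (\<lambda>a'. (x + y) (a', b')) a) =
       rep_act S h (\<lambda>b'. rep_act R g (\<lambda>a'. x (a', b')) a) +
       rep_act S h (\<lambda>b'. rep_act R g (\<lambda>a'. y (a', b')) a)" for a
      by (simp only: lb(1)[OF sl(3)[OF x ev] sl(3)[OF y ev]])
    then show "rep_act (R \<boxtimes> S) (g, h) (x + y) = rep_act (R \<boxtimes> S) (g, h) x + rep_act (R \<boxtimes> S) (g, h) y"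
      unfolding act by (auto simp del: plus_fun_apply simp: fun_eq_iff) simp
  qed
qed

lemma outer_tensor_rep:
  fixes R :: "('g, 'b) rep" and S :: "('h, 'd) rep"
  assumes R: "is_rep G R" "is_rep H S" and GH: "group G" "group H"
  shows "is_rep (G \<times>\<times> H) (R \<boxtimes> S)"
    and "g \<in> carrier G \<Longrightarrow> h \<in> carrier H \<Longrightarrow> character (R \<boxtimes> S) (g, h) = character R g * character S h"
proof -
  note V = rep_subspace[OF R(1)] rep_subspace[OF R(2)]
  obtain d v f where D: "dual_basis (rep_space R) d v f"
    using dual_basis_exists[OF rep_fdim[OF R(1)]] .
  obtain e w k where E: "dual_basis (rep_space S) e w k"
    using dual_basis_exists[OF rep_fdim[OF R(2)]] .
  note F = frame_tensor[OF V dual_basis_frame[OF D] dual_basis_frame[OF E], folded outer_space]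
  have sub: "cfun.subspace (rep_space (R \<boxtimes> S))" unfolding outer_space by (rule cfun.subspace_span)
  \<comment> \<open>Linear maps are determined by their values on pure tensors; the unit and product
    laws are verified there.\<close>
  have tens_ext: "T x = T' x" if T: "linear_on_space (rep_space (R \<boxtimes> S)) T" "linear_on_space (rep_space (R \<boxtimes> S)) T'"
     "\<And>u w. u \<in> rep_space R \<Longrightarrow> w \<in> rep_space S \<Longrightarrow> T (tensor u w) = T' (tensor u w)"
     and x: "x \<in> rep_space (R \<boxtimes> S)" for T T' :: "('b \<times> 'd \<Rightarrow> complex) \<Rightarrow> ('b \<times> 'd \<Rightarrow> complex)" and x
    using x unfolding outer_space
  proof (induction rule: span_induct_mem)
    case base
    then show ?case using lin_0[OF sub T(1)] lin_0[OF sub T(2)] by metis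
  next
    case (step c x y)
    have xs: "x \<in> rep_space (R \<boxtimes> S)" unfolding outer_space using step by (auto intro: cfun.span_base)
    have ys: "y \<in> rep_space (R \<boxtimes> S)" unfolding outer_space by fact
    have "T x = T' x" using step T(3) by blast
    then show ?case
      unfolding lin_add[OF T(1) cfun.subspace_scale[OF sub xs] ys] lin_add[OF T(2) cfun.subspace_scale[OF sub xs] ys]
       lin_scale[OF T(1) xs] lin_scale[OF T(2) xs] using step.IH by simp
  qed
  have cl: "rep_act (R \<boxtimes> S) (g, h) x \<in> rep_space (R \<boxtimes> S)"
    if gh: "g \<in> carrier G" "h \<in> carrier H" and "x \<in> rep_space (R \<boxtimes> S)" for g h x
    using that(3) unfolding outer_space
  proof (induction rule: span_induct_mem)
    case base
    show ?case unfolding lin_0[OF sub outer_act_lin[OF R gh]] by (rule cfun.span_zero)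
  next
    case (step c x y)
    have xs: "x \<in> rep_space (R \<boxtimes> S)" unfolding outer_space using step by (auto intro: cfun.span_base)
    have ys: "y \<in> rep_space (R \<boxtimes> S)" unfolding outer_space by fact
    obtain u w where x: "x = tensor u w" "u \<in> rep_space R" "w \<in> rep_space S" using step by blast
    have "rep_act (R \<boxtimes> S) (g, h) x \<in> rep_space (R \<boxtimes> S)"
      unfolding x(1) outer_act_tensor[OF R gh x(2,3)] outer_space
      using rep_closed[OF R(1) gh(1) x(2)] rep_closed[OF R(2) gh(2) x(3)]
      by (auto intro!: cfun.span_base)
    then show ?case
      unfolding lin_add[OF outer_act_lin[OF R gh] cfun.subspace_scale[OF sub xs] ys]
        lin_scale[OF outer_act_lin[OF R gh] xs]
      using step.IH unfolding outer_space by (intro cfun.span_add cfun.span_scale)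
  qed
  show rep: "is_rep (G \<times>\<times> H) (R \<boxtimes> S)"
  proof (rule is_repI)
    show "fdim (rep_space (R \<boxtimes> S))" by (rule fdimI[OF sub F])
    show "linear_on_space (rep_space (R \<boxtimes> S)) (rep_act (R \<boxtimes> S) p)" if "p \<in> carrier (G \<times>\<times> H)" for p
      using that outer_act_lin[OF R] by (cases p) auto
    show "rep_act (R \<boxtimes> S) p v \<in> rep_space (R \<boxtimes> S)"
      if "p \<in> carrier (G \<times>\<times> H)" "v \<in> rep_space (R \<boxtimes> S)" for p v
      using that cl by (cases p) auto
    show "rep_act (R \<boxtimes> S) \<one>\<^bsub>G \<times>\<times> H\<^esub> x = x" if "x \<in> rep_space (R \<boxtimes> S)" for x
      unfolding one_DirProd
    proof (rule tens_ext[where T' = "\<lambda>x. x", OF _ _ _ that])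
      have m: "\<one>\<^bsub>G\<^esub> \<in> carrier G" "\<one>\<^bsub>H\<^esub> \<in> carrier H"
        using group.is_monoid[OF GH(1)] group.is_monoid[OF GH(2)] by auto
      then show "linear_on_space (rep_space (R \<boxtimes> S)) (rep_act (R \<boxtimes> S) (\<one>\<^bsub>G\<^esub>, \<one>\<^bsub>H\<^esub>))"
        by (rule outer_act_lin[OF R])
      show "rep_act (R \<boxtimes> S) (\<one>\<^bsub>G\<^esub>, \<one>\<^bsub>H\<^esub>) (tensor u w) = tensor u w"
        if "u \<in> rep_space R" "w \<in> rep_space S" for u w
        using that m by (simp add: outer_act_tensor[OF R] rep_one[OF R(1)] rep_one[OF R(2)])
    qed (simp add: linear_on_space_def)
    show "rep_act (R \<boxtimes> S) (p \<otimes>\<^bsub>G \<times>\<times> H\<^esub> q) x = rep_act (R \<boxtimes> S) p (rep_act (R \<boxtimes> S) q x)"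
      if "p \<in> carrier (G \<times>\<times> H)" "q \<in> carrier (G \<times>\<times> H)" and x: "x \<in> rep_space (R \<boxtimes> S)" for p q x
    proof -
      obtain g h where p: "p = (g, h)" by (cases p)
      obtain g' h' where q: "q = (g', h')" by (cases q)
      have m: "g \<in> carrier G" "h \<in> carrier H" "g' \<in> carrier G" "h' \<in> carrier H"
        "g \<otimes>\<^bsub>G\<^esub> g' \<in> carrier G" "h \<otimes>\<^bsub>H\<^esub> h' \<in> carrier H"
        using that group.is_monoid[OF GH(1)] group.is_monoid[OF GH(2)]
        by (auto simp: p q monoid.m_closed)
      show ?thesis
        unfolding p q mult_DirProd
      proof (rule tens_ext[OF _ _ _ x])
        show "linear_on_space (rep_space (R \<boxtimes> S)) (rep_act (R \<boxtimes> S) (g \<otimes>\<^bsub>G\<^esub> g', h \<otimes>\<^bsub>H\<^esub> h'))"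
          using m by (intro outer_act_lin[OF R])
        show "linear_on_space (rep_space (R \<boxtimes> S)) (\<lambda>x. rep_act (R \<boxtimes> S) (g, h) (rep_act (R \<boxtimes> S) (g', h') x))"
          using m cl[OF m(3,4)] by (intro lin_comp[OF outer_act_lin[OF R] outer_act_lin[OF R]]) auto
      qed (use m in \<open>simp add: outer_act_tensor[OF R] rep_closed[OF R(1)] rep_closed[OF R(2)]
              rep_mult[OF R(1)] rep_mult[OF R(2)]\<close>)
    qed
  qed
  assume g: "g \<in> carrier G" and h: "h \<in> carrier H"
  have f: "lin_fun (rep_space R) (f i)" "v i \<in> rep_space R" if "i < d" for i
    using dual_basis_frame[OF D] that by (auto simp: frame_def)
  have k: "lin_fun (rep_space S) (k i)" "w i \<in> rep_space S" if "i < e" for i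
    using dual_basis_frame[OF E] that by (auto simp: frame_def)
  have t: "k j (\<lambda>b. f i (\<lambda>a. rep_act (R \<boxtimes> S) (g, h) (tensor (v i) (w j)) (a, b))) =
       f i (rep_act R g (v i)) * k j (rep_act S h (w j))" if i: "i < d" and j: "j < e" for i j
  proof -
    have sl: "(\<lambda>a. tensor u u' (a, b)) = cscale (u' b) u" for b and u :: "'b \<Rightarrow> complex" and u' :: "'d \<Rightarrow> complex"
      by (auto simp: tensor_def cscale_def)
    have m: "rep_act R g (v i) \<in> rep_space R" "rep_act S h (w j) \<in> rep_space S"
      using i j f k g h R by (auto simp: rep_closed)
    have "(\<lambda>b. f i (\<lambda>a. tensor (rep_act R g (v i)) (rep_act S h (w j)) (a, b)))
        = cscale (f i (rep_act R g (v i))) (rep_act S h (w j))"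
      unfolding sl using i by (simp add: lin_fun_scale[OF f(1) m(1)]) (simp add: cscale_def mult.commute)
    then show ?thesis
      using i j f k g h by (simp add: outer_act_tensor[OF R] lin_fun_scale[OF k(1) m(2)])
  qed
  have gh: "(g, h) \<in> carrier (G \<times>\<times> H)" using g h by simp
  have "character (R \<boxtimes> S) (g, h) = (\<Sum>(i,j)\<in>{..<d} \<times> {..<e}. f i (rep_act R g (v i)) * k j (rep_act S h (w j)))"
    unfolding char_frame[OF rep F gh] using t by (intro sum.cong refl) auto
  also have "\<dots> = character R g * character S h"
    unfolding char_frame[OF R(1) dual_basis_frame[OF D] g] char_frame[OF R(2) dual_basis_frame[OF E] h]
    by (simp add: sum_product sum.cartesian_product)
  finally show "character (R \<boxtimes> S) (g, h) = character R g * character S h" .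
qed

subsection \<open>Induced representations\<close>

text \<open>Frobenius' formula for the induced character. The equation
  \<open>g x = x \<iota>(h)\<close> replaces membership of the conjugate of \<open>g\<close> in the
  subgroup, and as \<open>x\<close> runs over the whole group rather than over coset
  representatives, the sum is divided by the order of \<open>H\<close>.\<close>

definition ind_cf :: "('g, 'm) monoid_scheme \<Rightarrow> ('h, 'n) monoid_scheme \<Rightarrow> ('h \<Rightarrow> 'g) \<Rightarrow>
    ('h \<Rightarrow> complex) \<Rightarrow> 'g \<Rightarrow> complex"
  where "ind_cf G H \<iota> \<phi> g = (\<Sum>x\<in>carrier G. \<Sum>h\<in>carrier H.
    if g \<otimes>\<^bsub>G\<^esub> x = x \<otimes>\<^bsub>G\<^esub> \<iota> h then \<phi> h else 0) / of_nat (card (carrier H))"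

lemma curry_simps:
  "curry (x + y) i = curry x i + curry y i" "curry (cscale e x) i = cscale e (curry x i)"
  "curry 0 i = (0 :: 'z \<Rightarrow> complex)" "curry (\<Sum>j\<in>J. F j) i = (\<Sum>j\<in>J. curry (F j) i)"
  for x y :: "'i \<times> 'z \<Rightarrow> complex"
  by (auto simp: fun_eq_iff cscale_def sum_apply)

lemma curry_eqI: "x = y" if "\<And>i. curry x i = curry y i" for x y :: "'i \<times> 'z \<Rightarrow> complex"
  using that by (metis curry_case_prod case_prod_curry ext)

text \<open>The module has a frame indexed by all pairs of a group element \<open>x\<close> and a
  basis index \<open>i\<close>: the functional is the \<open>i\<close>-th coordinate of the value at
  \<open>x\<close>, the vector is an average concentrated on the coset of \<open>x\<close>. The
  trace of \<open>g\<close> in this frame is, term by term, the sum in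
  \<open>ind_cf\<close>.\<close>

lemma induced_rep_rep:
  fixes R :: "('h, 'a) rep" and G :: "('g, 'm) monoid_scheme" and H :: "('h, 'n) monoid_scheme"
  assumes G: "finite_group G" and H: "finite_group H" and hom: "\<iota> \<in> hom H G" and R: "is_rep H R"
  shows "is_rep G (induced_rep G H \<iota> R)"
    and "g \<in> carrier G \<Longrightarrow> character (induced_rep G H \<iota> R) g = ind_cf G H \<iota> (character R) g"
proof -
  interpret G: finite_group G by fact
  interpret H: finite_group H by fact
  let ?S = "induced_rep G H \<iota> R"
  let ?n = "of_nat (card (carrier H)) :: complex"
  have \<iota>: "\<iota> h \<in> carrier G" if "h \<in> carrier H" for h using hom that by (auto simp: hom_def)
  have \<iota>m: "\<iota> (h \<otimes>\<^bsub>H\<^esub> k) = \<iota> h \<otimes>\<^bsub>G\<^esub> \<iota> k" if "h \<in> carrier H" "k \<in> carrier H" for h k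
    using hom that by (auto simp: hom_def)
  note V = rep_subspace[OF R]
  obtain d v f where D: "dual_basis (rep_space R) d v f"
    using dual_basis_exists[OF rep_fdim[OF R]] .
  note Fr = dual_basis_frame[OF D]
  have f: "lin_fun (rep_space R) (f i)" "v i \<in> rep_space R" if "i < d" for i
    using Fr that by (auto simp: frame_def)
  have mem: "\<phi> \<in> rep_space ?S \<longleftrightarrow> (\<forall>x. x \<notin> carrier G \<longrightarrow> curry \<phi> x = 0) \<and>
       (\<forall>x\<in>carrier G. curry \<phi> x \<in> rep_space R) \<and>
       (\<forall>x\<in>carrier G. \<forall>h\<in>carrier H.
          curry \<phi> (x \<otimes>\<^bsub>G\<^esub> \<iota> h) = rep_act R (inv\<^bsub>H\<^esub> h) (curry \<phi> x))" for \<phi>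
    by (simp add: induced_rep_def)
  have act: "curry (rep_act ?S g \<phi>) x = (if x \<in> carrier G then curry \<phi> (inv\<^bsub>G\<^esub> g \<otimes>\<^bsub>G\<^esub> x) else 0)"
    for g \<phi> x by (auto simp: induced_rep_def fun_eq_iff)
  have sub: "cfun.subspace (rep_space ?S)"
  proof (rule cfun.subspaceI)
    show "0 \<in> rep_space ?S"
      using V lin_0[OF V rep_lin[OF R]] by (simp add: mem curry_simps cfun.subspace_0 del: zero_fun_apply)
    show "x + y \<in> rep_space ?S" if "x \<in> rep_space ?S" "y \<in> rep_space ?S" for x y
      using that lin_add[OF rep_lin[OF R]]
      by (simp add: mem curry_simps cfun.subspace_add[OF V] del: plus_fun_apply)
    show "cscale c x \<in> rep_space ?S" if "x \<in> rep_space ?S" for c x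
      using that lin_scale[OF rep_lin[OF R]]
      by (simp add: mem curry_simps cfun.subspace_scale[OF V] del: plus_fun_apply)
  qed
  \<comment> \<open>The projection onto equivariant functions of the function that is
    \<open>v i\<close> at \<open>x\<close> and zero elsewhere. Its value at \<open>y\<close>
    collects those \<open>h\<close> with \<open>y \<iota>(h) = x\<close>, and equivariance turns
    \<open>v i\<close> at \<open>x\<close> into \<open>h\<close> applied to \<open>v i\<close> at
    \<open>y\<close>.\<close>
  define e where "e x i y = (if y \<in> carrier G then cscale (1 / ?n)
      (\<Sum>h\<in>carrier H. if y \<otimes>\<^bsub>G\<^esub> \<iota> h = x then rep_act R h (v i) else 0) else 0)" for x i y
  let ?v = "\<lambda>(x, i) (y, a). e x i y a"
  let ?f = "\<lambda>(x, i) \<phi>. f i (curry \<phi> x)"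
  have cv: "curry (?v (x, i)) y = e x i y" for x i y by (auto simp: fun_eq_iff)
  have eR: "e x i y \<in> rep_space R" if "i < d" for x i y
    using f that V rep_closed[OF R]
    by (auto simp: e_def intro!: cfun.subspace_0 cfun.subspace_scale cfun.subspace_sum)
  have vS: "?v (x, i) \<in> rep_space ?S" if "i < d" for x i
    unfolding mem cv
  proof (intro conjI ballI allI impI)
    show "e x i y = 0" if "y \<notin> carrier G" for y using that by (simp add: e_def)
    show "e x i y \<in> rep_space R" for y using eR[OF that] .
    fix y k assume y: "y \<in> carrier G" and k: "k \<in> carrier H"
    have act_v: "rep_act R h (v i) \<in> rep_space R" if "h \<in> carrier H" for h
      using that f(2)[OF \<open>i < d\<close>] rep_closed[OF R] by blast
    note L = rep_lin[OF R H.inv_closed[OF k]]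
    let ?F = "\<lambda>h. if y \<otimes>\<^bsub>G\<^esub> \<iota> h = x then rep_act R (inv\<^bsub>H\<^esub> k \<otimes>\<^bsub>H\<^esub> h) (v i) else 0"
    have "(\<Sum>h\<in>carrier H. if y \<otimes>\<^bsub>G\<^esub> \<iota> k \<otimes>\<^bsub>G\<^esub> \<iota> h = x then rep_act R h (v i) else 0) =
      (\<Sum>h\<in>carrier H. ?F (k \<otimes>\<^bsub>H\<^esub> h))"
      using y k by (intro sum.cong refl) (simp add: \<iota>m \<iota> G.m_assoc H.m_assoc[symmetric])
    also have "\<dots> = (\<Sum>h\<in>carrier H. ?F h)" by (rule H.sum_lmult[OF k])
    also have "\<dots> = (\<Sum>h\<in>carrier H. rep_act R (inv\<^bsub>H\<^esub> k) (if y \<otimes>\<^bsub>G\<^esub> \<iota> h = x then rep_act R h (v i) else 0))"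
      using k f(2)[OF \<open>i < d\<close>] lin_0[OF V L] by (intro sum.cong refl) (simp add: rep_mult[OF R])
    also have "\<dots> = rep_act R (inv\<^bsub>H\<^esub> k) (\<Sum>h\<in>carrier H. if y \<otimes>\<^bsub>G\<^esub> \<iota> h = x then rep_act R h (v i) else 0)"
      using act_v V by (subst lin_sum[OF V L]) (auto intro: cfun.subspace_0)
    finally show "e x i (y \<otimes>\<^bsub>G\<^esub> \<iota> k) = rep_act R (inv\<^bsub>H\<^esub> k) (e x i y)"
      using y k act_v V unfolding e_def
      by (simp add: \<iota>) (subst lin_scale[OF L], auto intro!: cfun.subspace_0 cfun.subspace_sum)
  qed
  have F: "frame (rep_space ?S) (carrier G \<times> {..<d}) ?v ?f"
    unfolding frame_def
  proof (intro conjI ballI)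
    show "finite (carrier G \<times> {..<d})" using G.fin by auto
  next
    fix p assume "p \<in> carrier G \<times> {..<d}"
    then show "?v p \<in> rep_space ?S" using vS by auto
  next
    fix p assume p: "p \<in> carrier G \<times> {..<d}"
    obtain x i where xi: "p = (x, i)" by (cases p)
    have cm: "curry u x \<in> rep_space R" if "u \<in> rep_space ?S" for u
      using that p by (simp add: mem xi)
    have "i < d" using p by (simp add: xi)
    then show "lin_fun (rep_space ?S) (?f p)"
      using lin_fun_add[OF f(1)] lin_fun_scale[OF f(1)] cm
      unfolding xi prod.case lin_fun_def curry_simps by simp
  next
    fix \<phi> assume \<phi>: "\<phi> \<in> rep_space ?S"
    show "\<phi> = (\<Sum>p\<in>carrier G \<times> {..<d}. cscale (?f p \<phi>) (?v p))"
    proof (rule curry_eqI)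
      fix y
      have "curry (\<Sum>p\<in>carrier G \<times> {..<d}. cscale (?f p \<phi>) (?v p)) y =
        (\<Sum>(x, i)\<in>carrier G \<times> {..<d}. cscale (f i (curry \<phi> x)) (e x i y))"
        unfolding curry_simps by (intro sum.cong refl) (auto simp: cv[unfolded prod.case])
      also have "\<dots> = (\<Sum>x\<in>carrier G. \<Sum>i<d. cscale (f i (curry \<phi> x)) (e x i y))"
        by (simp add: sum.cartesian_product)
      also have "\<dots> = curry \<phi> y"
      proof (cases "y \<in> carrier G")
        case False
        then have "e x i y = 0" for x i by (simp add: e_def)
        then show ?thesis using \<phi> False by (simp add: mem)
      next
        case y: True
        have inner: "(\<Sum>i<d. cscale (f i (curry \<phi> x)) (e x i y)) =
          cscale (1 / ?n) (\<Sum>h\<in>carrier H. if y \<otimes>\<^bsub>G\<^esub> \<iota> h = x then rep_act R h (curry \<phi> x) else 0)"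
          if x: "x \<in> carrier G" for x
        proof -
          have px: "curry \<phi> x \<in> rep_space R" using \<phi> x by (simp add: mem)
          have ex: "curry \<phi> x = (\<Sum>i<d. cscale (f i (curry \<phi> x)) (v i))"
            using Fr px unfolding frame_def by blast
          have ea: "rep_act R h (curry \<phi> x) = (\<Sum>i<d. cscale (f i (curry \<phi> x)) (rep_act R h (v i)))"
            if h: "h \<in> carrier H" for h
          proof -
            have "rep_act R h (curry \<phi> x) = rep_act R h (\<Sum>i<d. cscale (f i (curry \<phi> x)) (v i))"
              by (rule arg_cong[OF ex])
            also have "\<dots> = (\<Sum>i<d. rep_act R h (cscale (f i (curry \<phi> x)) (v i)))"
              using f(2) V by (intro lin_sum[OF V rep_lin[OF R h]] cfun.subspace_scale) auto
            also have "\<dots> = (\<Sum>i<d. cscale (f i (curry \<phi> x)) (rep_act R h (v i)))"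
              using f(2) by (intro sum.cong refl lin_scale[OF rep_lin[OF R h]]) auto
            finally show ?thesis .
          qed
          have "(\<Sum>h\<in>carrier H. if y \<otimes>\<^bsub>G\<^esub> \<iota> h = x then rep_act R h (curry \<phi> x) else 0) =
            (\<Sum>h\<in>carrier H. \<Sum>i<d. cscale (f i (curry \<phi> x)) (if y \<otimes>\<^bsub>G\<^esub> \<iota> h = x then rep_act R h (v i) else 0))"
            using ea by (intro sum.cong refl) (simp add: sum.neutral)
          also have "\<dots> = (\<Sum>i<d. cscale (f i (curry \<phi> x))
              (\<Sum>h\<in>carrier H. if y \<otimes>\<^bsub>G\<^esub> \<iota> h = x then rep_act R h (v i) else 0))"
            unfolding cfun.scale_sum_right by (rule sum.swap)
          finally show ?thesis
            using y by (simp add: e_def cfun.scale_sum_right mult.commute)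
        qed
        have "(\<Sum>x\<in>carrier G. \<Sum>i<d. cscale (f i (curry \<phi> x)) (e x i y)) =
          (\<Sum>x\<in>carrier G. cscale (1 / ?n) (\<Sum>h\<in>carrier H. if y \<otimes>\<^bsub>G\<^esub> \<iota> h = x then rep_act R h (curry \<phi> x) else 0))"
          by (intro sum.cong refl inner)
        also have "\<dots> = cscale (1 / ?n) (\<Sum>h\<in>carrier H. \<Sum>x\<in>carrier G.
            if y \<otimes>\<^bsub>G\<^esub> \<iota> h = x then rep_act R h (curry \<phi> x) else 0)"
          unfolding cfun.scale_sum_right[symmetric] by (subst sum.swap) rule
        \<comment> \<open>By equivariance each \<open>h\<close> returns the value at
          \<open>y\<close>; the number of these summands cancels the normalising factor.\<close>
        also have "(\<Sum>h\<in>carrier H. \<Sum>x\<in>carrier G.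
            if y \<otimes>\<^bsub>G\<^esub> \<iota> h = x then rep_act R h (curry \<phi> x) else 0) = (\<Sum>h\<in>carrier H. curry \<phi> y)"
        proof (intro sum.cong refl)
          fix h assume h: "h \<in> carrier H"
          have "(\<Sum>x\<in>carrier G. if y \<otimes>\<^bsub>G\<^esub> \<iota> h = x then rep_act R h (curry \<phi> x) else 0) =
              rep_act R h (curry \<phi> (y \<otimes>\<^bsub>G\<^esub> \<iota> h))"
            using G.fin y h \<iota> by simp
          also have "\<dots> = curry \<phi> y"
            using \<phi> y h H.rep_inv'[OF R h] by (simp add: mem)
          finally show "(\<Sum>x\<in>carrier G. if y \<otimes>\<^bsub>G\<^esub> \<iota> h = x then rep_act R h (curry \<phi> x) else 0) = curry \<phi> y" .
        qed
        also have "cscale (1 / ?n) (\<Sum>h\<in>carrier H. curry \<phi> y) = curry \<phi> y"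
          using H.card_pos by (auto simp: cscale_def fun_eq_iff sum_apply)
        finally show ?thesis .
      qed
      finally show "curry \<phi> y = curry (\<Sum>p\<in>carrier G \<times> {..<d}. cscale (?f p \<phi>) (?v p)) y" by simp
    qed
  qed
  show rep: "is_rep G ?S"
  proof (rule is_repI)
    show "fdim (rep_space ?S)" by (rule fdimI[OF sub F])
    show "rep_act ?S g \<phi> \<in> rep_space ?S" if "g \<in> carrier G" "\<phi> \<in> rep_space ?S" for g \<phi>
      unfolding mem act
    proof (intro conjI ballI allI impI)
      show "(if x \<in> carrier G then curry \<phi> (inv\<^bsub>G\<^esub> g \<otimes>\<^bsub>G\<^esub> x) else 0) \<in> rep_space R" if "x \<in> carrier G" for x
        using that \<open>g \<in> _\<close> \<open>\<phi> \<in> _\<close> by (simp add: mem)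
      fix x h assume x: "x \<in> carrier G" and h: "h \<in> carrier H"
      have "curry \<phi> (inv\<^bsub>G\<^esub> g \<otimes>\<^bsub>G\<^esub> (x \<otimes>\<^bsub>G\<^esub> \<iota> h)) = curry \<phi> (inv\<^bsub>G\<^esub> g \<otimes>\<^bsub>G\<^esub> x \<otimes>\<^bsub>G\<^esub> \<iota> h)"
        using that x h \<iota> by (simp add: G.m_assoc)
      also have "\<dots> = rep_act R (inv\<^bsub>H\<^esub> h) (curry \<phi> (inv\<^bsub>G\<^esub> g \<otimes>\<^bsub>G\<^esub> x))"
        using that x h unfolding mem by simp
      finally show "(if x \<otimes>\<^bsub>G\<^esub> \<iota> h \<in> carrier G then curry \<phi> (inv\<^bsub>G\<^esub> g \<otimes>\<^bsub>G\<^esub> (x \<otimes>\<^bsub>G\<^esub> \<iota> h)) else 0) =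
         rep_act R (inv\<^bsub>H\<^esub> h) (if x \<in> carrier G then curry \<phi> (inv\<^bsub>G\<^esub> g \<otimes>\<^bsub>G\<^esub> x) else 0)"
        using x h \<iota> by simp
    qed auto
    show "linear_on_space (rep_space ?S) (rep_act ?S g)" for g
      unfolding linear_on_space_def
      by (intro conjI ballI allI; rule curry_eqI; simp only: act curry_simps split: if_split; simp)
    show "rep_act ?S \<one>\<^bsub>G\<^esub> \<phi> = \<phi>" if "\<phi> \<in> rep_space ?S" for \<phi>
      using that by (intro curry_eqI) (simp add: act mem)
    show "rep_act ?S (g \<otimes>\<^bsub>G\<^esub> h) \<phi> = rep_act ?S g (rep_act ?S h \<phi>)"
      if "g \<in> carrier G" "h \<in> carrier G" for g h \<phi>
      using that by (intro curry_eqI) (simp add: act G.inv_mult_group G.m_assoc)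
  qed
  assume g: "g \<in> carrier G"
  have t: "f i (curry (rep_act ?S g (\<lambda>(y, a). e x i y a)) x) =
      (\<Sum>h\<in>carrier H. if g \<otimes>\<^bsub>G\<^esub> x = x \<otimes>\<^bsub>G\<^esub> \<iota> h then f i (rep_act R h (v i)) else 0) / ?n"
    if x: "x \<in> carrier G" and i: "i < d" for x i
  proof -
    have act_v: "rep_act R h (v i) \<in> rep_space R" if "h \<in> carrier H" for h
      using that f(2)[OF i] rep_closed[OF R] by blast
    have eq: "inv\<^bsub>G\<^esub> g \<otimes>\<^bsub>G\<^esub> x \<otimes>\<^bsub>G\<^esub> \<iota> h = x \<longleftrightarrow> g \<otimes>\<^bsub>G\<^esub> x = x \<otimes>\<^bsub>G\<^esub> \<iota> h" if "h \<in> carrier H" for h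
      using g x \<iota>[OF that] by (metis G.inv_closed G.inv_solve_left G.m_assoc G.m_closed)
    have "curry (rep_act ?S g (\<lambda>(y, a). e x i y a)) x = e x i (inv\<^bsub>G\<^esub> g \<otimes>\<^bsub>G\<^esub> x)"
      using x by (simp add: act fun_eq_iff)
    also have "\<dots> = cscale (1 / ?n) (\<Sum>h\<in>carrier H. if g \<otimes>\<^bsub>G\<^esub> x = x \<otimes>\<^bsub>G\<^esub> \<iota> h then rep_act R h (v i) else 0)"
      using g x eq by (auto simp: e_def intro!: arg_cong[where f = "cscale _"] sum.cong)
    finally have "f i (curry (rep_act ?S g (\<lambda>(y, a). e x i y a)) x) = (1 / ?n) *
      f i (\<Sum>h\<in>carrier H. if g \<otimes>\<^bsub>G\<^esub> x = x \<otimes>\<^bsub>G\<^esub> \<iota> h then rep_act R h (v i) else 0)"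
      using act_v V by (simp only:) (subst lin_fun_scale[OF f(1)[OF i]],
          auto intro!: cfun.subspace_0 cfun.subspace_sum)
    also have "f i (\<Sum>h\<in>carrier H. if g \<otimes>\<^bsub>G\<^esub> x = x \<otimes>\<^bsub>G\<^esub> \<iota> h then rep_act R h (v i) else 0) =
      (\<Sum>h\<in>carrier H. f i (if g \<otimes>\<^bsub>G\<^esub> x = x \<otimes>\<^bsub>G\<^esub> \<iota> h then rep_act R h (v i) else 0))"
      using act_v V by (intro lin_fun_sum[OF V f(1)[OF i]]) (auto intro: cfun.subspace_0)
    also have "\<dots> = (\<Sum>h\<in>carrier H. if g \<otimes>\<^bsub>G\<^esub> x = x \<otimes>\<^bsub>G\<^esub> \<iota> h then f i (rep_act R h (v i)) else 0)"
      using lin_fun_0[OF V f(1)[OF i]] by (intro sum.cong refl) simp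
    finally show ?thesis by (simp only: times_divide_eq_left mult_1_left)
  qed
  have "character ?S g = (\<Sum>(x,i)\<in>carrier G \<times> {..<d}.
     (\<Sum>h\<in>carrier H. if g \<otimes>\<^bsub>G\<^esub> x = x \<otimes>\<^bsub>G\<^esub> \<iota> h then f i (rep_act R h (v i)) else 0) / ?n)"
    unfolding char_frame[OF rep F g] using t by (intro sum.cong refl) auto
  also have "\<dots> = (\<Sum>x\<in>carrier G. \<Sum>i<d.
     (\<Sum>h\<in>carrier H. if g \<otimes>\<^bsub>G\<^esub> x = x \<otimes>\<^bsub>G\<^esub> \<iota> h then f i (rep_act R h (v i)) else 0) / ?n)"
    by (simp add: sum.cartesian_product)
  also have "\<dots> = (\<Sum>x\<in>carrier G. (\<Sum>h\<in>carrier H. \<Sum>i<d.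
     if g \<otimes>\<^bsub>G\<^esub> x = x \<otimes>\<^bsub>G\<^esub> \<iota> h then f i (rep_act R h (v i)) else 0) / ?n)"
    unfolding sum_divide_distrib[symmetric] by (subst sum.swap) rule
  also have "\<dots> = ind_cf G H \<iota> (character R) g"
    unfolding ind_cf_def sum_divide_distrib[symmetric]
    by (intro arg_cong[where f = "\<lambda>z. z / _"] sum.cong refl) (simp add: char_frame[OF R Fr])
  finally show "character ?S g = ind_cf G H \<iota> (character R) g" .
qed

section \<open>Complete reducibility and orthogonality of characters\<close>

subsection \<open>Eigenvectors\<close>

text \<open>There are more vectors than elements of the spanning set. A repetition among the vectors
  is invisible in their image set, so that case gets its own relation, with coefficients 1 and
  -1.\<close>

lemma linear_relation:
  fixes w :: "nat \<Rightarrow> 'a \<Rightarrow> complex"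
  assumes "finite B" "\<And>i. w i \<in> cfun.span B"
  obtains c where "\<exists>i\<le>card B. c i \<noteq> 0" "(\<Sum>i\<le>card B. cscale (c i) (w i)) = 0"
proof (cases "inj_on w {..card B}")
  case True
  have "cfun.dependent (w ` {..card B})"
  proof (rule ccontr)
    assume "cfun.independent (w ` {..card B})"
    then have "card (w ` {..card B}) \<le> card B"
      using cfun.independent_span_bound[OF assms(1), of "w ` {..card B}"] assms(2) by auto
    then show False using True by (simp add: card_image)
  qed
  then obtain u where u: "\<exists>v\<in>w ` {..card B}. u v \<noteq> 0" "(\<Sum>v\<in>w ` {..card B}. cscale (u v) v) = 0"
    using cfun.dependent_finite[of "w ` {..card B}"] by auto
  have "(\<Sum>i\<le>card B. cscale (u (w i)) (w i)) = 0"
    using u(2) True by (simp add: sum.reindex)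
  then show ?thesis using that[of "\<lambda>i. u (w i)"] u(1) by auto
next
  case False
  then obtain i j where ij: "i \<le> card B" "j \<le> card B" "i \<noteq> j" "w i = w j"
    by (auto simp: inj_on_def)
  define c where "c k = (if k = i then 1 else if k = j then -1 else (0 :: complex))" for k
  have "(\<Sum>k\<le>card B. cscale (c k) (w k)) = (\<Sum>k\<in>{i, j}. cscale (c k) (w k))"
    using ij by (intro sum.mono_neutral_right) (auto simp: c_def)
  also have "\<dots> = 0" using ij by (simp add: c_def)
  finally show ?thesis by (rule that[rotated]) (use ij in \<open>auto simp: c_def intro!: exI[of _ i]\<close>)
qed

text \<open>Among the nonzero polynomials \<open>p\<close> with \<open>p(T) v0 = 0\<close> one of
  minimal degree has a root \<open>a\<close>. Dividing by \<open>X - a\<close> yields a polynomial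
  \<open>q\<close> with \<open>q(T) v0\<close> nonzero by minimality, and \<open>T - a\<close> kills
  this vector.\<close>

lemma eigenvector_exists:
  fixes V :: "('a \<Rightarrow> complex) set"
  assumes V: "fdim V" "V \<noteq> {0}" and T: "linear_on_space V T" "T ` V \<subseteq> V"
  obtains c v where "v \<in> V" "v \<noteq> 0" "T v = cscale c v"
proof -
  note sV = fdim_subspace[OF V(1)]
  obtain v0 where v0: "v0 \<in> V" "v0 \<noteq> 0" using V fdim_zero by blast
  obtain B where B: "finite B" "V = cfun.span B" using V by (auto simp: fdim_def)
  define w where "w i = (T ^^ i) v0" for i
  have wV: "w i \<in> V" for i unfolding w_def by (induction i) (use v0 T in auto)
  have wS: "T (w i) = w (Suc i)" for i by (simp add: w_def)
  obtain c where c: "\<exists>i\<le>card B. c i \<noteq> 0" "(\<Sum>i\<le>card B. cscale (c i) (w i)) = 0"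
    using linear_relation[OF B(1), of w] wV B(2) by blast
  \<comment> \<open>\<open>ev p\<close> is the vector \<open>p(T) v0\<close>.\<close>
  define ev where "ev p = (\<Sum>i\<le>degree p. cscale (coeff p i) (w i))" for p :: "complex poly"
  have ev_bound: "ev p = (\<Sum>i\<le>n. cscale (coeff p i) (w i))" if "degree p \<le> n" for p n
    unfolding ev_def using that
    by (intro sum.mono_neutral_left) (auto simp: coeff_eq_0)
  define q0 where "q0 = (\<Sum>i\<le>card B. monom (c i) i)"
  have q0c: "coeff q0 i = (if i \<le> card B then c i else 0)" for i
    by (simp add: q0_def coeff_sum)
  have q0: "q0 \<noteq> 0" "ev q0 = 0"
  proof -
    obtain i where "i \<le> card B" "c i \<noteq> 0" using c(1) by blast
    then have "coeff q0 i \<noteq> 0" by (simp add: q0c)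
    then show "q0 \<noteq> 0" by auto
    have "degree q0 \<le> card B" by (rule degree_le) (simp add: q0c)
    then show "ev q0 = 0" using c(2) ev_bound q0c by simp
  qed
  define p where "p = (ARG_MIN degree p. p \<noteq> 0 \<and> ev p = 0)"
  have p: "p \<noteq> 0" "ev p = 0" and pmin: "\<And>q. q \<noteq> 0 \<Longrightarrow> ev q = 0 \<Longrightarrow> degree p \<le> degree q"
    using arg_min_natI[of "\<lambda>p. p \<noteq> 0 \<and> ev p = 0" q0 degree]
      arg_min_nat_le[of "\<lambda>p. p \<noteq> 0 \<and> ev p = 0" _ degree] q0 unfolding p_def by blast+
  have "degree p \<noteq> 0"
  proof
    assume "degree p = 0"
    then have "ev p = cscale (coeff p 0) v0" "coeff p 0 \<noteq> 0"
      using p(1) by (auto simp: ev_def w_def) (metis leading_coeff_0_iff)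
    then show False using p(2) v0 by simp
  qed
  then obtain a where "poly p a = 0"
    using fundamental_theorem_of_algebra[of p] by (auto simp: constant_degree)
  then obtain q where q: "p = [:-a, 1:] * q" by (auto simp: poly_eq_0_iff_dvd elim: dvdE)
  have q0: "q \<noteq> 0" using p q by auto
  have dq: "degree p = Suc (degree q)" unfolding q using q0 by (subst degree_mult_eq) auto
  have "ev q \<noteq> 0" using pmin[OF q0] dq by auto
  moreover have evV: "ev q \<in> V" unfolding ev_def using wV sV by (intro cfun.subspace_sum cfun.subspace_scale)
  moreover have "T (ev q) = cscale a (ev q)"
  proof -
    have "T (ev q) = (\<Sum>i\<le>degree q. cscale (coeff q i) (w (Suc i)))"
      unfolding ev_def using wV sV
      by (subst lin_sum[OF sV T(1)]) (auto simp: cfun.subspace_scale lin_scale[OF T(1)] wS)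
    also have "\<dots> = (\<Sum>i\<le>Suc (degree q). cscale (coeff (pCons 0 q) i) (w i))"
      by (simp only: sum.atMost_Suc_shift coeff_pCons_Suc coeff_pCons_0 cfun.scale_zero_left add_0)
    finally have 1: "T (ev q) = (\<Sum>i\<le>Suc (degree q). cscale (coeff (pCons 0 q) i) (w i))" .
    have "0 = ev p" using p by simp
    also have "\<dots> = (\<Sum>i\<le>Suc (degree q). cscale (coeff (pCons 0 q) i) (w i) - cscale a (cscale (coeff q i) (w i)))"
      unfolding ev_bound[OF eq_refl[OF dq]]
      by (intro sum.cong refl) (simp add: q cfun.scale_left_diff_distrib[symmetric])
    also have "\<dots> = (\<Sum>i\<le>Suc (degree q). cscale (coeff (pCons 0 q) i) (w i)) -
        cscale a (\<Sum>i\<le>Suc (degree q). cscale (coeff q i) (w i))"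
      by (simp only: sum_subtractf cfun.scale_sum_right)
    also have "\<dots> = T (ev q) - cscale a (ev q)"
      using 1 ev_bound[of q "Suc (degree q)", OF le_SucI[OF order_refl]] by metis
    finally show ?thesis by simp
  qed
  ultimately show ?thesis using that by blast
qed

subsection \<open>Averaging\<close>

definition rdim :: "('a \<Rightarrow> complex) set \<Rightarrow> nat"
  where "rdim V = (SOME d. \<exists>v f. dual_basis V d v f)"

lemma rdim_tr: "fdim V \<Longrightarrow> tr V (\<lambda>v. v) = of_nat (rdim V)"
  and rdim_0: "fdim V \<Longrightarrow> rdim V = 0 \<longleftrightarrow> V = {0}"
proof -
  assume V: "fdim V"
  have "\<exists>v f. dual_basis V (rdim V) v f"
    unfolding rdim_def
  proof (rule someI_ex)
    show "\<exists>d v f. dual_basis V d v f" by (rule dual_basis_exists[OF V]) blast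
  qed
  then obtain v f where D: "dual_basis V (rdim V) v f" by blast
  show "tr V (\<lambda>v. v) = of_nat (rdim V)" by (rule tr_id[OF D fdim_subspace[OF V]])
  show "rdim V = 0 \<longleftrightarrow> V = {0}" by (rule dual_basis_0[OF D fdim_subspace[OF V]])
qed

definition kernel :: "('a \<Rightarrow> complex) set \<Rightarrow> (('a \<Rightarrow> complex) \<Rightarrow> 'b \<Rightarrow> complex) \<Rightarrow> ('a \<Rightarrow> complex) set"
  where "kernel V T = {v \<in> V. T v = 0}"

section \<open>Kernels, images and invariant complements\<close>

lemma rep_homD:
  assumes "rep_hom G R S T"
  shows "linear_on_space (rep_space R) T" "\<And>v. v \<in> rep_space R \<Longrightarrow> T v \<in> rep_space S"
    "\<And>g v. g \<in> carrier G \<Longrightarrow> v \<in> rep_space R \<Longrightarrow> T (rep_act R g v) = rep_act S g (T v)"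
  using assms by (auto simp: rep_hom_def)

lemma kernel_invariant:
  assumes R: "is_rep G R" and S: "is_rep G S" and T: "rep_hom G R S T"
  shows "invariant_subspace G R (kernel (rep_space R) T)"
proof -
  note V = rep_subspace[OF R]
  note T' = rep_homD[OF T]
  have "cfun.subspace (kernel (rep_space R) T)"
    unfolding kernel_def
    using V lin_0[OF V T'(1)] lin_add[OF T'(1)] lin_scale[OF T'(1)]
    by (intro cfun.subspaceI) (auto simp: cfun.subspace_0 cfun.subspace_add cfun.subspace_scale
       simp del: plus_fun_apply zero_fun_apply)
  then show ?thesis
    using rep_closed[OF R] T' lin_0[OF rep_subspace[OF S] rep_lin[OF S]]
    by (auto simp: invariant_subspace_def kernel_def)
qed

lemma image_invariant:
  assumes R: "is_rep G R" and S: "is_rep G S" and T: "rep_hom G R S T"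
  shows "invariant_subspace G S (T ` rep_space R)"
proof -
  note V = rep_subspace[OF R]
  note T' = rep_homD[OF T]
  have "cfun.subspace (T ` rep_space R)"
  proof (rule cfun.subspaceI)
    show "0 \<in> T ` rep_space R" using lin_0[OF V T'(1)] cfun.subspace_0[OF V] by (metis image_eqI)
    fix x y c assume "x \<in> T ` rep_space R"
    then obtain u where u: "u \<in> rep_space R" "x = T u" by blast
    show "cscale c x \<in> T ` rep_space R"
      using lin_scale[OF T'(1) u(1)] cfun.subspace_scale[OF V u(1)] u(2) by (metis image_eqI)
    assume "y \<in> T ` rep_space R"
    then obtain v where v: "v \<in> rep_space R" "y = T v" by blast
    show "x + y \<in> T ` rep_space R"
      using lin_add[OF T'(1) u(1) v(1)] cfun.subspace_add[OF V u(1) v(1)] u(2) v(2) by (metis image_eqI)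
  qed
  then show ?thesis
    using rep_closed[OF R] T' by (auto simp: invariant_subspace_def image_subset_iff) (metis image_eqI)
qed

text \<open>The isomorphism sends \<open>v\<close> to the pair of \<open>P v\<close> and
  \<open>v - P v\<close>; its inverse is addition.\<close>

lemma projection_split:
  assumes R: "is_rep G R" and U: "invariant_subspace G R U" and P: "rep_hom G R R P"
    and PU: "\<And>v. v \<in> rep_space R \<Longrightarrow> P v \<in> U" "\<And>u. u \<in> U \<Longrightarrow> P u = u"
  defines "K \<equiv> kernel (rep_space R) P"
  shows "invariant_subspace G R K" "U \<inter> K = {0}" "{u + u' |u u'. u \<in> U \<and> u' \<in> K} = rep_space R"
    "rep_iso G R (direct_sum2 (subrep R U) (subrep R K))"
proof -
  note V = rep_subspace[OF R]
  note P' = rep_homD[OF P]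
  show Kinv: "invariant_subspace G R K" unfolding K_def by (rule kernel_invariant[OF R R P])
  have sub: "U \<subseteq> rep_space R" "cfun.subspace U" "K \<subseteq> rep_space R" "cfun.subspace K"
    using U Kinv by (auto simp: invariant_subspace_def)
  show "U \<inter> K = {0}"
    using PU(2) sub cfun.subspace_0 by (fastforce simp: K_def kernel_def)
  have diff: "v - P v \<in> K" if "v \<in> rep_space R" for v
  proof -
    have "P (v - P v) = P v - P (P v)"
      using that P'(2) by (intro lin_minus[OF V P'(1)])
    then show ?thesis
      using that PU P'(2) V by (simp add: K_def kernel_def cfun.subspace_diff)
  qed
  show "{u + u' |u u'. u \<in> U \<and> u' \<in> K} = rep_space R"
  proof (intro equalityI subsetI)
    fix x assume "x \<in> {u + u' |u u'. u \<in> U \<and> u' \<in> K}"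
    then show "x \<in> rep_space R" using sub V by (auto simp del: plus_fun_apply intro: cfun.subspace_add)
  next
    fix x assume x: "x \<in> rep_space R"
    then have "x = P x + (x - P x)" by simp
    then show "x \<in> {u + u' |u u'. u \<in> U \<and> u' \<in> K}" using diff[OF x] PU(1)[OF x] by blast
  qed
  define T where "T v = case_sum (P v) (v - P v)" for v
  have c: "case_sum a b \<circ> Inl = a" "case_sum a b \<circ> Inr = b" for a :: "'x \<Rightarrow> 'z" and b :: "'y \<Rightarrow> 'z"
    by (auto simp: fun_eq_iff)
  have c': "case_sum (x \<circ> Inl) (x \<circ> Inr) = x" for x :: "'x + 'y \<Rightarrow> 'z"
    by (auto simp: fun_eq_iff split: sum.splits)
  have "rep_hom G R (direct_sum2 (subrep R U) (subrep R K)) T"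
    unfolding rep_hom_def
  proof (intro conjI ballI)
    show "linear_on_space (rep_space R) T"
      unfolding linear_on_space_def T_def
    proof (intro conjI ballI allI; rule ext)
      fix u v x assume "u \<in> rep_space R" "v \<in> rep_space R"
      then show "case_sum (P (u + v)) (u + v - P (u + v)) x =
          (case_sum (P u) (u - P u) + case_sum (P v) (v - P v)) x"
        using lin_add[OF P'(1)] by (cases x) auto
    next
      fix v c x assume "v \<in> rep_space R"
      then show "case_sum (P (cscale c v)) (cscale c v - P (cscale c v)) x = cscale c (case_sum (P v) (v - P v)) x"
        using lin_scale[OF P'(1)] by (cases x) (auto simp: cscale_def algebra_simps)
    qed
    show "T ` rep_space R \<subseteq> rep_space (direct_sum2 (subrep R U) (subrep R K))"
      using PU diff by (auto simp: direct_sum2_def T_def c)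
    fix g v assume g: "g \<in> carrier G" and v: "v \<in> rep_space R"
    have "rep_act R g (v - P v) = rep_act R g v - rep_act R g (P v)"
      using v P'(2) by (intro lin_minus[OF V rep_lin[OF R g]]) auto
    then show "T (rep_act R g v) = rep_act (direct_sum2 (subrep R U) (subrep R K)) g (T v)"
      using P'(3)[OF g v] by (simp add: direct_sum2_def T_def c)
  qed
  moreover have "bij_betw T (rep_space R) (rep_space (direct_sum2 (subrep R U) (subrep R K)))"
  proof (rule bij_betwI[where g = "\<lambda>y. (y \<circ> Inl) + (y \<circ> Inr)"])
    show "T \<in> rep_space R \<rightarrow> rep_space (direct_sum2 (subrep R U) (subrep R K))"
      using PU diff by (auto simp: direct_sum2_def T_def c)
    show "(\<lambda>y. (y \<circ> Inl) + (y \<circ> Inr)) \<in> rep_space (direct_sum2 (subrep R U) (subrep R K)) \<rightarrow> rep_space R"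
      using sub V by (auto simp: direct_sum2_def intro!: cfun.subspace_add simp del: plus_fun_apply)
    show "(T x \<circ> Inl) + (T x \<circ> Inr) = x" for x by (simp add: T_def c)
    fix y assume "y \<in> rep_space (direct_sum2 (subrep R U) (subrep R K))"
    then have y: "y \<circ> Inl \<in> U" "y \<circ> Inr \<in> K" by (auto simp: direct_sum2_def)
    have "P ((y \<circ> Inl) + (y \<circ> Inr)) = P (y \<circ> Inl) + P (y \<circ> Inr)"
      using y sub by (intro lin_add[OF P'(1)]) auto
    also have "\<dots> = y \<circ> Inl" using y PU(2) by (simp add: K_def kernel_def)
    finally show "T ((y \<circ> Inl) + (y \<circ> Inr)) = y" unfolding T_def by (simp add: c')
  qed
  ultimately show "rep_iso G R (direct_sum2 (subrep R U) (subrep R K))"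
    unfolding rep_iso_alt by blast
qed

context finite_group
begin

text \<open>Left undivided by the group order, because Schur's lemma is applied to averages of
  arbitrary linear maps and the order then appears as a factor of the trace.\<close>

definition avg :: "('a, 'x) rep \<Rightarrow> ('a, 'y) rep \<Rightarrow> (('x \<Rightarrow> complex) \<Rightarrow> 'y \<Rightarrow> complex) \<Rightarrow>
    ('x \<Rightarrow> complex) \<Rightarrow> 'y \<Rightarrow> complex"
  where "avg R S X v = (\<Sum>g\<in>carrier G. rep_act S g (X (rep_act R (inv g) v)))"

lemma avg_hom:
  assumes R: "is_rep G R" and S: "is_rep G S"
    and X: "linear_on_space (rep_space R) X" "\<And>v. v \<in> rep_space R \<Longrightarrow> X v \<in> rep_space S"
  shows "rep_hom G R S (avg R S X)"
  unfolding rep_hom_def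
proof (intro conjI ballI)
  note VS = rep_subspace[OF S]
  have t: "rep_act S g (X (rep_act R (inv g) v)) \<in> rep_space S" if "g \<in> carrier G" "v \<in> rep_space R" for g v
    using that X rep_closed[OF R] rep_closed[OF S] by simp
  have "linear_on_space (rep_space R) (\<lambda>v. X (rep_act R (inv g) v))" if g: "g \<in> carrier G" for g
    using g rep_closed[OF R] by (intro lin_comp[OF rep_lin[OF R] X(1)]) auto
  then have "linear_on_space (rep_space R) (\<lambda>v. rep_act S g (X (rep_act R (inv g) v)))"
    if g: "g \<in> carrier G" for g
    using g rep_closed[OF R] X by (intro lin_comp[OF _ rep_lin[OF S g]]) auto
  then show "linear_on_space (rep_space R) (avg R S X)"
    unfolding avg_def[abs_def] by (rule lin_sum_maps)
  show "avg R S X ` rep_space R \<subseteq> rep_space S"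
    using t VS by (auto simp: avg_def intro!: cfun.subspace_sum)
  fix k v assume k: "k \<in> carrier G" and v: "v \<in> rep_space R"
  let ?F = "\<lambda>g. rep_act S g (X (rep_act R (inv g) (rep_act R k v)))"
  have "avg R S X (rep_act R k v) = (\<Sum>g\<in>carrier G. ?F (k \<otimes> g))"
    unfolding avg_def by (rule sum_lmult[OF k, symmetric])
  also have "\<dots> = (\<Sum>g\<in>carrier G. rep_act S k (rep_act S g (X (rep_act R (inv g) v))))"
  proof (intro sum.cong refl)
    fix g assume g: "g \<in> carrier G"
    have "rep_act R (inv (k \<otimes> g)) (rep_act R k v) = rep_act R (inv g) (rep_act R (inv k) (rep_act R k v))"
      using g k v by (simp add: inv_mult_group rep_mult[OF R] rep_closed[OF R])
    also have "\<dots> = rep_act R (inv g) v"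
      using rep_inv[OF R k v] by simp
    finally show "?F (k \<otimes> g) = rep_act S k (rep_act S g (X (rep_act R (inv g) v)))"
      using g k v X by (simp add: rep_mult[OF S] rep_closed[OF R])
  qed
  also have "\<dots> = rep_act S k (avg R S X v)"
    unfolding avg_def using t v by (intro lin_sum[OF VS rep_lin[OF S k], symmetric])
  finally show "avg R S X (rep_act R k v) = rep_act S k (avg R S X v)" .
qed

text \<open>A linear projection onto \<open>U\<close>, read off an adapted basis, is averaged over
  the group and divided by the order. Since the projection fixes \<open>U\<close> pointwise and
  \<open>U\<close> is invariant, the average fixes \<open>U\<close> pointwise too.\<close>

lemma maschke:
  assumes R: "is_rep G R" and U: "invariant_subspace G R U"
  obtains P where "rep_hom G R R P" "\<And>v. v \<in> rep_space R \<Longrightarrow> P v \<in> U" "\<And>u. u \<in> U \<Longrightarrow> P u = u"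
proof -
  note V = rep_subspace[OF R]
  have sub: "U \<subseteq> rep_space R" "cfun.subspace U" and inv: "\<And>g u. g \<in> carrier G \<Longrightarrow> u \<in> U \<Longrightarrow> rep_act R g u \<in> U"
    using U by (auto simp: invariant_subspace_def)
  obtain C B where B: "finite B" "cfun.independent B" "cfun.span B = rep_space R" "C \<subseteq> B" "cfun.span C = U"
    using independent_basis_exists[OF rep_fdim[OF R] sub(2,1)] .
  define p where "p w = (\<Sum>b\<in>C. cscale (cfun.representation B w b) b)" for w
  have pU: "p w \<in> U" for w
    unfolding p_def B(5)[symmetric] by (intro cfun.span_sum cfun.span_scale cfun.span_base)
  have plin: "linear_on_space (rep_space R) p"
    unfolding linear_on_space_def p_def
    using B(2,3) by (simp add: cfun.representation_add cfun.representation_scale cfun.scale_left_distrib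
        sum.distrib cfun.scale_sum_right)
  have pid: "p u = u" if "u \<in> U" for u
  proof -
    have iC: "cfun.independent C" using B(2,4) cfun.independent_mono by blast
    have "p u = (\<Sum>b\<in>C. cscale (cfun.representation C u b) b)"
      unfolding p_def using cfun.representation_extend[OF B(2), of u C] that B by simp
    also have "\<dots> = u"
      using cfun.sum_representation_eq[OF iC, of u C] that B finite_subset[OF B(4)] by simp
    finally show ?thesis .
  qed
  define P where "P v = cscale (1 / of_nat (card (carrier G))) (avg R R p v)" for v
  have h: "rep_hom G R R (avg R R p)"
    using pU sub by (intro avg_hom[OF R R plin]) auto
  note h' = rep_homD[OF h]
  have "rep_hom G R R P"
    unfolding rep_hom_def P_def[abs_def]
    using lin_cscale_map[OF h'(1)] h' V lin_scale[OF rep_lin[OF R]]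
    by (auto simp: cfun.subspace_scale)
  moreover have "P v \<in> U" if "v \<in> rep_space R" for v
    unfolding P_def avg_def using sub(2) pU inv
    by (intro cfun.subspace_scale cfun.subspace_sum) auto
  moreover have "P u = u" if "u \<in> U" for u
  proof -
    have "avg R R p u = (\<Sum>g\<in>carrier G. u)"
      unfolding avg_def
    proof (intro sum.cong refl)
      fix g assume g: "g \<in> carrier G"
      have "p (rep_act R (inv g) u) = rep_act R (inv g) u" using g that inv pid by simp
      then show "rep_act R g (p (rep_act R (inv g) u)) = u"
        using rep_inv'[OF R g] that sub by auto
    qed
    then show ?thesis
      using card_pos unfolding P_def by (auto simp: cscale_def sum_apply fun_eq_iff)
  qed
  ultimately show thesis using that by blast
qed

section \<open>Schur's lemma and splitting off an irreducible piece\<close>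

lemma irreducible_hom_inj:
  assumes U: "irreducible_rep G U" and S: "is_rep G S" and T: "rep_hom G U S T"
    and nz: "\<exists>u\<in>rep_space U. T u \<noteq> 0"
  shows "inj_on T (rep_space U)"
proof -
  have R: "is_rep G U" using U by (simp add: irreducible_rep_def)
  note T' = rep_homD[OF T]
  have "kernel (rep_space U) T = {0} \<or> kernel (rep_space U) T = rep_space U"
    using kernel_invariant[OF R S T] U by (auto simp: irreducible_rep_def)
  then have K: "kernel (rep_space U) T = {0}" using nz by (auto simp: kernel_def)
  show ?thesis
  proof (rule inj_onI)
    fix x y assume xy: "x \<in> rep_space U" "y \<in> rep_space U" "T x = T y"
    have "T (x - y) = 0" using lin_minus[OF rep_subspace[OF R] T'(1) xy(1,2)] xy(3) by simp
    then have "x - y \<in> kernel (rep_space U) T"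
      using xy rep_subspace[OF R] by (simp add: kernel_def cfun.subspace_diff)
    then show "x = y" using K by simp
  qed
qed

text \<open>The dimension is a character value, hence additive wherever characters are. This
  supplies the decreasing measure for the inductions that split off irreducible pieces.\<close>

lemma character_one: "is_rep G Q \<Longrightarrow> character Q \<one> = of_nat (rdim (rep_space Q))"
  unfolding character_def
  by (subst rdim_tr[OF rep_fdim, symmetric], assumption)
     (intro tr_cong rep_fdim, auto simp: rep_one rep_closed rep_lin image_subset_iff)

text \<open>Peels one copy of \<open>U\<close> off \<open>S\<close>. The list of conclusions is what
  the later inductions on dimension consume: the splitting itself, the additivity of characters, and
  the strict drop in dimension of the complement.\<close>

lemma irreducible_hom_split:
  assumes U: "irreducible_rep G U" and S: "is_rep G S" and T: "rep_hom G U S T"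
    and nz: "\<exists>u\<in>rep_space U. T u \<noteq> 0"
  obtains P where "rep_hom G S S P" "\<And>v. v \<in> rep_space S \<Longrightarrow> P v \<in> T ` rep_space U"
    "\<And>u. u \<in> T ` rep_space U \<Longrightarrow> P u = u"
    "rep_iso G U (subrep S (T ` rep_space U))"
    "invariant_subspace G S (T ` rep_space U)" "invariant_subspace G S (kernel (rep_space S) P)"
    "rep_iso G S (direct_sum2 (subrep S (T ` rep_space U)) (subrep S (kernel (rep_space S) P)))"
    "\<And>g. g \<in> carrier G \<Longrightarrow> character S g = character U g + character (subrep S (kernel (rep_space S) P)) g"
    "rdim (rep_space S) = rdim (rep_space U) + rdim (kernel (rep_space S) P)"
    "rdim (rep_space U) > 0"
proof -
  have R: "is_rep G U" using U by (simp add: irreducible_rep_def)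
  note I = image_invariant[OF R S T]
  let ?I = "T ` rep_space U"
  obtain P where P: "rep_hom G S S P" "\<And>v. v \<in> rep_space S \<Longrightarrow> P v \<in> ?I" "\<And>u. u \<in> ?I \<Longrightarrow> P u = u"
    by (rule maschke[OF S I]) blast
  let ?K = "kernel (rep_space S) P"
  note sp = projection_split[OF S I P]
  have iso: "rep_iso G U (subrep S ?I)"
    unfolding rep_iso_alt
    using irreducible_hom_inj[OF U S T nz] T
    by (intro exI[of _ T]) (auto simp: rep_hom_def bij_betw_def)
  have reps: "is_rep G (subrep S ?I)" "is_rep G (subrep S ?K)"
    using is_rep_sub[OF S] I sp(1) by auto
  have ch: "character S g = character U g + character (subrep S ?K) g" if g: "g \<in> carrier G" for g
    using rep_iso_char[OF S direct_sum2_rep(1)[OF reps] sp(4) g] direct_sum2_rep(2)[OF reps g]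
      rep_iso_char[OF R reps(1) iso g] by simp
  have "of_nat (rdim (rep_space S)) = (of_nat (rdim (rep_space U) + rdim ?K) :: complex)"
    using ch[OF one_closed] character_one[OF S] character_one[OF R] character_one[OF reps(2)] by simp
  then have "rdim (rep_space S) = rdim (rep_space U) + rdim ?K" using of_nat_eq_iff by blast
  moreover have "rdim (rep_space U) > 0"
    using U rdim_0[OF rep_fdim[OF R]] by (auto simp: irreducible_rep_def)
  ultimately show thesis using that[OF P iso I sp(1) sp(4) ch] by blast
qed

text \<open>Over the complex numbers \<open>T\<close> has an eigenvector; subtracting the eigenvalue
  produces a homomorphism that is not injective, hence zero.\<close>

lemma schur_scalar:
  assumes U: "irreducible_rep G U" and T: "rep_hom G U U T"
  obtains c where "\<And>v. v \<in> rep_space U \<Longrightarrow> T v = cscale c v"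
proof -
  have R: "is_rep G U" and nz: "rep_space U \<noteq> {0}" using U by (auto simp: irreducible_rep_def)
  note T' = rep_homD[OF T]
  obtain c v where v: "v \<in> rep_space U" "v \<noteq> 0" "T v = cscale c v"
    using eigenvector_exists[OF rep_fdim[OF R] nz T'(1)] T'(2) by blast
  define k where "k = -c"
  define T2 where "T2 u = T u + cscale k u" for u
  have "rep_hom G U U T2"
    unfolding rep_hom_def
  proof (intro conjI ballI)
    show "linear_on_space (rep_space U) T2"
      unfolding linear_on_space_def T2_def
      using lin_add[OF T'(1)] lin_scale[OF T'(1)]
      by (auto simp: cfun.scale_right_distrib mult.commute simp del: plus_fun_apply)
    show "T2 ` rep_space U \<subseteq> rep_space U"
      using T'(2) rep_subspace[OF R] by (auto simp: T2_def cfun.subspace_add cfun.subspace_scale simp del: plus_fun_apply)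
    fix g u assume g: "g \<in> carrier G" and u: "u \<in> rep_space U"
    have "rep_act U g (T u + cscale k u) = rep_act U g (T u) + rep_act U g (cscale k u)"
      using T'(2)[OF u] u rep_subspace[OF R] by (intro lin_add[OF rep_lin[OF R g]] cfun.subspace_scale)
    then show "T2 (rep_act U g u) = rep_act U g (T2 u)"
      unfolding T2_def using T'(3)[OF g u] lin_scale[OF rep_lin[OF R g] u] by metis
  qed
  moreover have "T2 v = 0" using v(3) by (simp add: T2_def k_def cscale_def fun_eq_iff)
  ultimately have "T2 u = 0" if "u \<in> rep_space U" for u
  proof -
    assume h: "rep_hom G U U T2" and "T2 v = 0"
    have "T2 0 = 0" using lin_0[OF rep_subspace[OF R] rep_homD(1)[OF h]] .
    then have "\<not> inj_on T2 (rep_space U)"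
      using v \<open>T2 v = 0\<close> cfun.subspace_0[OF rep_subspace[OF R]] by (metis inj_onD)
    then show ?thesis using irreducible_hom_inj[OF U R h] that by blast
  qed
  then have "T u = cscale c u" if "u \<in> rep_space U" for u
    using that by (metis T2_def k_def cfun.scale_minus_left eq_neg_iff_add_eq_0 minus_minus)
  then show thesis using that by blast
qed

end

subsection \<open>The inner product of characters\<close>

context finite_group
begin

text \<open>On characters the value at the inverse is the complex conjugate, so this is the usual
  inner product, written as a symmetric bilinear form.\<close>

definition cip :: "('a \<Rightarrow> complex) \<Rightarrow> ('a \<Rightarrow> complex) \<Rightarrow> complex"
  where "cip \<phi> \<psi> = (\<Sum>g\<in>carrier G. \<phi> (inv g) * \<psi> g) / of_nat (card (carrier G))"

lemma cip_cong: "(\<And>g. g \<in> carrier G \<Longrightarrow> \<phi> g = \<phi>' g) \<Longrightarrow> (\<And>g. g \<in> carrier G \<Longrightarrow> \<psi> g = \<psi>' g) \<Longrightarrow>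
    cip \<phi> \<psi> = cip \<phi>' \<psi>'"
  by (simp add: cip_def)

lemma cip_commute: "cip \<phi> \<psi> = cip \<psi> \<phi>"
  unfolding cip_def
  by (subst sum_inv[symmetric]) (simp add: mult.commute)

lemma cip_add: "cip \<phi> (\<lambda>g. \<psi> g + \<psi>' g) = cip \<phi> \<psi> + cip \<phi> \<psi>'"
  by (simp add: cip_def algebra_simps sum.distrib add_divide_distrib)

text \<open>Invariance of the trace under conjugation is obtained by moving the frame instead of the
  operator.\<close>

lemma conj_frame:
  assumes R: "is_rep G R" and F: "frame (rep_space R) I v f" and g: "g \<in> carrier G"
  shows "frame (rep_space R) I (\<lambda>i. rep_act R (inv g) (v i)) (\<lambda>i w. f i (rep_act R g w))"
  unfolding frame_def
proof (intro conjI ballI)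
  note V = rep_subspace[OF R]
  show "finite I" using F by (simp add: frame_def)
  show "rep_act R (inv g) (v i) \<in> rep_space R" if "i \<in> I" for i
    using F that rep_closed[OF R inv_closed[OF g]] by (auto simp: frame_def)
  show "lin_fun (rep_space R) (\<lambda>w. f i (rep_act R g w))" if "i \<in> I" for i
  proof -
    have "lin_fun (rep_space R) (f i)" using F that by (auto simp: frame_def)
    then show ?thesis
      using lin_add[OF rep_lin[OF R g]] lin_scale[OF rep_lin[OF R g]] rep_closed[OF R g]
      by (simp add: lin_fun_def)
  qed
  fix w assume w: "w \<in> rep_space R"
  have v: "v i \<in> rep_space R" if "i \<in> I" for i using F that by (auto simp: frame_def)
  have "rep_act R g w = (\<Sum>i\<in>I. cscale (f i (rep_act R g w)) (v i))"
    using F rep_closed[OF R g w] unfolding frame_def by blast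
  then have "w = rep_act R (inv g) (\<Sum>i\<in>I. cscale (f i (rep_act R g w)) (v i))"
    using rep_inv[OF R g w] by simp
  also have "\<dots> = (\<Sum>i\<in>I. rep_act R (inv g) (cscale (f i (rep_act R g w)) (v i)))"
    using v V by (intro lin_sum[OF V rep_lin[OF R inv_closed[OF g]]] cfun.subspace_scale)
  also have "\<dots> = (\<Sum>i\<in>I. cscale (f i (rep_act R g w)) (rep_act R (inv g) (v i)))"
    using v by (intro sum.cong refl lin_scale[OF rep_lin[OF R inv_closed[OF g]]])
  finally show "w = (\<Sum>i\<in>I. cscale (f i (rep_act R g w)) (rep_act R (inv g) (v i)))" .
qed

lemma trace_conj:
  assumes R: "is_rep G R" and F: "frame (rep_space R) I v f" and g: "g \<in> carrier G"
    and X: "linear_on_space (rep_space R) X" "X ` rep_space R \<subseteq> rep_space R"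
  shows "(\<Sum>i\<in>I. f i (rep_act R g (X (rep_act R (inv g) (v i))))) = tr (rep_space R) X"
  using tr_frame[OF rep_subspace[OF R] conj_frame[OF R F g] X] by simp

lemma character_class:
  assumes R: "is_rep G R" and g: "g \<in> carrier G" and h: "h \<in> carrier G"
  shows "character R (h \<otimes> g \<otimes> inv h) = character R g"
proof -
  obtain d v f where D: "dual_basis (rep_space R) d v f"
    using dual_basis_exists[OF rep_fdim[OF R]] .
  note F = dual_basis_frame[OF D]
  have v: "v i \<in> rep_space R" if "i < d" for i using F that by (auto simp: frame_def)
  have "character R (h \<otimes> g \<otimes> inv h) = (\<Sum>i<d. f i (rep_act R (h \<otimes> g \<otimes> inv h) (v i)))"
    using g h by (intro char_frame[OF R F]) auto
  also have "\<dots> = (\<Sum>i<d. f i (rep_act R h (rep_act R g (rep_act R (inv h) (v i)))))"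
    using g h v by (intro sum.cong refl) (simp add: rep_mult[OF R] rep_closed[OF R])
  also have "\<dots> = character R g"
    using trace_conj[OF R F h rep_lin[OF R g]] rep_closed[OF R g] by (auto simp: character_def)
  finally show ?thesis .
qed

text \<open>Averaging the rank-one map that takes \<open>x\<close> to \<open>f i x\<close> times
  \<open>w j\<close> produces a homomorphism, hence zero. Its coordinate at \<open>(i, j)\<close> is
  a sum of products of diagonal matrix coefficients, and these sums add up to the inner
  product.\<close>

lemma no_hom_cip:
  assumes R: "is_rep G R" and S: "is_rep G S"
    and no: "\<And>T v. rep_hom G R S T \<Longrightarrow> v \<in> rep_space R \<Longrightarrow> T v = 0"
  shows "cip (character R) (character S) = 0"
proof -
  obtain d v f where D: "dual_basis (rep_space R) d v f"
    using dual_basis_exists[OF rep_fdim[OF R]] .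
  note F = dual_basis_frame[OF D]
  have v: "lin_fun (rep_space R) (f i)" "v i \<in> rep_space R" if "i < d" for i
    using F that by (auto simp: frame_def)
  obtain e w h where E: "dual_basis (rep_space S) e w h"
    using dual_basis_exists[OF rep_fdim[OF S]] .
  note F' = dual_basis_frame[OF E]
  have w: "lin_fun (rep_space S) (h i)" "w i \<in> rep_space S" if "i < e" for i
    using F' that by (auto simp: frame_def)
  note VS = rep_subspace[OF S]
  have z: "(\<Sum>g\<in>carrier G. f i (rep_act R (inv g) (v i)) * h j (rep_act S g (w j))) = 0"
    if i: "i < d" and j: "j < e" for i j
  proof -
    define X where "X = (\<lambda>x. cscale (f i x) (w j))"
    have "rep_hom G R S (avg R S X)"
    proof (rule avg_hom[OF R S])
      show "linear_on_space (rep_space R) X"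
        unfolding linear_on_space_def X_def
        using lin_fun_add[OF v(1)[OF i]] lin_fun_scale[OF v(1)[OF i]]
        by (simp add: cfun.scale_left_distrib)
      show "X u \<in> rep_space S" for u
        using w(2)[OF j] VS by (simp add: X_def cfun.subspace_scale)
    qed
    then have "avg R S X (v i) = 0" using no v(2)[OF i] by blast
    then have "0 = h j (avg R S X (v i))"
      using lin_fun_0[OF VS w(1)[OF j]] by metis
    also have "\<dots> = (\<Sum>g\<in>carrier G. h j (rep_act S g (X (rep_act R (inv g) (v i)))))"
      unfolding avg_def using w(2)[OF j] VS rep_closed[OF S]
      by (intro lin_fun_sum[OF VS w(1)[OF j]]) (simp add: X_def cfun.subspace_scale)
    also have "\<dots> = (\<Sum>g\<in>carrier G. f i (rep_act R (inv g) (v i)) * h j (rep_act S g (w j)))"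
    proof (intro sum.cong refl)
      fix g assume g: "g \<in> carrier G"
      show "h j (rep_act S g (X (rep_act R (inv g) (v i)))) = f i (rep_act R (inv g) (v i)) * h j (rep_act S g (w j))"
        unfolding X_def lin_scale[OF rep_lin[OF S g] w(2)[OF j]]
        by (rule lin_fun_scale[OF w(1)[OF j] rep_closed[OF S g w(2)[OF j]]])
    qed
    finally show ?thesis by simp
  qed
  have "(\<Sum>g\<in>carrier G. character R (inv g) * character S g) =
    (\<Sum>g\<in>carrier G. \<Sum>i<d. \<Sum>j<e. f i (rep_act R (inv g) (v i)) * h j (rep_act S g (w j)))"
    by (intro sum.cong refl) (simp add: char_frame[OF R F] char_frame[OF S F'] sum_product)
  also have "\<dots> = (\<Sum>i<d. \<Sum>g\<in>carrier G. \<Sum>j<e. f i (rep_act R (inv g) (v i)) * h j (rep_act S g (w j)))"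
    by (rule sum.swap)
  also have "\<dots> = (\<Sum>i<d. \<Sum>j<e. \<Sum>g\<in>carrier G. f i (rep_act R (inv g) (v i)) * h j (rep_act S g (w j)))"
    by (intro sum.cong refl sum.swap)
  also have "\<dots> = 0" using z by simp
  finally show ?thesis by (simp add: cip_def)
qed

text \<open>The average is a scalar by Schur's lemma, and conjugation invariance makes its trace
  equal to the group order times the trace of \<open>X\<close>.\<close>

lemma schur_average:
  assumes U: "irreducible_rep G U"
    and X: "linear_on_space (rep_space U) X" "X ` rep_space U \<subseteq> rep_space U"
    and v: "v \<in> rep_space U"
  shows "avg U U X v = cscale (of_nat (card (carrier G)) * tr (rep_space U) X / of_nat (rdim (rep_space U))) v"
proof -
  have R: "is_rep G U" and nz: "rep_space U \<noteq> {0}" using U by (auto simp: irreducible_rep_def)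
  note V = rep_subspace[OF R]
  have h: "rep_hom G U U (avg U U X)"
    using X by (intro avg_hom[OF R R]) auto
  obtain c where c: "\<And>u. u \<in> rep_space U \<Longrightarrow> avg U U X u = cscale c u"
    by (rule schur_scalar[OF U h]) blast
  obtain d w f where D: "dual_basis (rep_space U) d w f"
    using dual_basis_exists[OF rep_fdim[OF R]] .
  note F = dual_basis_frame[OF D]
  have w: "lin_fun (rep_space U) (f i)" "w i \<in> rep_space U" if "i < d" for i
    using F that by (auto simp: frame_def)
  have d: "d = rdim (rep_space U)"
    using tr_id[OF D V] rdim_tr[OF rep_fdim[OF R]] by simp
  have "(\<Sum>i<d. f i (avg U U X (w i))) = (\<Sum>i<d. c)"
  proof (intro sum.cong refl)
    fix i assume "i \<in> {..<d}"
    then have i: "i < d" by simp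
    have "f i (w i) = 1" using D i by (simp add: dual_basis_def)
    then show "f i (avg U U X (w i)) = c"
      unfolding c[OF w(2)[OF i]] by (simp add: lin_fun_scale[OF w[OF i]])
  qed
  moreover have "(\<Sum>i<d. f i (avg U U X (w i))) = (\<Sum>i<d. \<Sum>g\<in>carrier G. f i (rep_act U g (X (rep_act U (inv g) (w i)))))"
  proof (intro sum.cong refl)
    fix i assume "i \<in> {..<d}"
    then have i: "i < d" by simp
    show "f i (avg U U X (w i)) = (\<Sum>g\<in>carrier G. f i (rep_act U g (X (rep_act U (inv g) (w i)))))"
      unfolding avg_def using w(2)[OF i] rep_closed[OF R] X(2)
      by (intro lin_fun_sum[OF V w(1)[OF i]]) (auto simp: image_subset_iff)
  qed
  moreover have "\<dots> = (\<Sum>g\<in>carrier G. tr (rep_space U) X)"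
    by (subst sum.swap) (intro sum.cong refl trace_conj[OF R F _ X])
  ultimately have "of_nat d * c = of_nat (card (carrier G)) * tr (rep_space U) X" by simp
  moreover have "d \<noteq> 0" using rdim_0[OF rep_fdim[OF R]] nz d by simp
  ultimately have "c = of_nat (card (carrier G)) * tr (rep_space U) X / of_nat (rdim (rep_space U))"
    using d by (simp add: field_simps)
  then show ?thesis using c[OF v] by simp
qed

lemma irreducible_cip:
  assumes U: "irreducible_rep G U"
  shows "cip (character U) (character U) = 1"
proof -
  have R: "is_rep G U" and nz: "rep_space U \<noteq> {0}" using U by (auto simp: irreducible_rep_def)
  note V = rep_subspace[OF R]
  obtain d w f where D: "dual_basis (rep_space U) d w f"
    using dual_basis_exists[OF rep_fdim[OF R]] .
  note F = dual_basis_frame[OF D]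
  have w: "lin_fun (rep_space U) (f i)" "w i \<in> rep_space U" if "i < d" for i
    using F that by (auto simp: frame_def)
  have fw: "f i (w j) = (if i = j then 1 else 0)" if "i < d" "j < d" for i j
    using D that by (simp add: dual_basis_def)
  have d: "d = rdim (rep_space U)"
    using tr_id[OF D V] rdim_tr[OF rep_fdim[OF R]] by simp
  have d0: "d \<noteq> 0" using rdim_0[OF rep_fdim[OF R]] nz d by simp
  let ?N = "of_nat (card (carrier G)) :: complex"
  have z: "(\<Sum>g\<in>carrier G. f i (rep_act U (inv g) (w i)) * f j (rep_act U g (w j))) =
      (if i = j then ?N / of_nat d else 0)"
    if i: "i < d" and j: "j < d" for i j
  proof -
    define X where "X = (\<lambda>x. cscale (f i x) (w j))"
    have X: "linear_on_space (rep_space U) X" "X ` rep_space U \<subseteq> rep_space U"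
      unfolding linear_on_space_def X_def
      using lin_fun_add[OF w(1)[OF i]] lin_fun_scale[OF w(1)[OF i]] w(2)[OF j] V
      by (auto simp add: cfun.scale_left_distrib cfun.subspace_scale)
    \<comment> \<open>The rank-one map has trace \<open>f i (w j)\<close>, so only the diagonal
      pairs contribute.\<close>
    have "tr (rep_space U) X = (\<Sum>k<d. f k (X (w k)))" by (rule tr_frame[OF V F X])
    also have "\<dots> = (\<Sum>k<d. if k = i then (if i = j then 1 else 0) else 0)"
      using i j by (intro sum.cong refl) (auto simp: X_def fw lin_fun_scale[OF w(1) w(2)])
    also have "\<dots> = (if i = j then 1 else 0)" using i by simp
    finally have trX: "tr (rep_space U) X = (if i = j then 1 else 0)" .
    have "(\<Sum>g\<in>carrier G. f i (rep_act U (inv g) (w i)) * f j (rep_act U g (w j))) =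
      (\<Sum>g\<in>carrier G. f j (rep_act U g (X (rep_act U (inv g) (w i)))))"
    proof (intro sum.cong refl)
      fix g assume g: "g \<in> carrier G"
      show "f i (rep_act U (inv g) (w i)) * f j (rep_act U g (w j)) = f j (rep_act U g (X (rep_act U (inv g) (w i))))"
        unfolding X_def lin_scale[OF rep_lin[OF R g] w(2)[OF j]]
        by (rule lin_fun_scale[OF w(1)[OF j] rep_closed[OF R g w(2)[OF j]], symmetric])
    qed
    also have "\<dots> = f j (avg U U X (w i))"
      unfolding avg_def using w(2)[OF i] rep_closed[OF R] X(2)
      by (intro lin_fun_sum[OF V w(1)[OF j], symmetric]) (auto simp: image_subset_iff)
    also have "\<dots> = ?N * (if i = j then 1 else 0) / of_nat d * f j (w i)"
      unfolding schur_average[OF U X w(2)[OF i]] trX d[symmetric]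
      by (rule lin_fun_scale[OF w(1)[OF j] w(2)[OF i]])
    also have "\<dots> = (if i = j then ?N / of_nat d else 0)" using i j by (simp add: fw)
    finally show ?thesis .
  qed
  have "(\<Sum>g\<in>carrier G. character U (inv g) * character U g) =
    (\<Sum>g\<in>carrier G. \<Sum>i<d. \<Sum>j<d. f i (rep_act U (inv g) (w i)) * f j (rep_act U g (w j)))"
    by (intro sum.cong refl) (simp add: char_frame[OF R F] sum_product)
  also have "\<dots> = (\<Sum>i<d. \<Sum>g\<in>carrier G. \<Sum>j<d. f i (rep_act U (inv g) (w i)) * f j (rep_act U g (w j)))"
    by (rule sum.swap)
  also have "\<dots> = (\<Sum>i<d. \<Sum>j<d. \<Sum>g\<in>carrier G. f i (rep_act U (inv g) (w i)) * f j (rep_act U g (w j)))"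
    by (intro sum.cong refl sum.swap)
  also have "\<dots> = (\<Sum>i<d. \<Sum>j<d. if i = j then ?N / of_nat d else 0)"
    by (intro sum.cong refl z) auto
  also have "\<dots> = ?N" using d0 by simp
  finally show ?thesis using card_pos by (simp add: cip_def)
qed

section \<open>Multiplicities of irreducible representations\<close>

lemma sub_hom:
  "rep_hom G U (subrep S K) T \<Longrightarrow> K \<subseteq> rep_space S \<Longrightarrow> rep_hom G U S T"
  by (auto simp: rep_hom_def)

lemma cip_split:
  assumes U: "irreducible_rep G U"
    and "\<And>g. g \<in> carrier G \<Longrightarrow> character S g = character U g + \<chi> g"
  shows "cip (character U) (character S) = 1 + cip (character U) \<chi>"
  using irreducible_cip[OF U] cip_add[of "character U" "character U" \<chi>] cip_cong[of "character U" "character U" "character S"]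
    assms(2) by (metis (no_types, lifting))

text \<open>Each copy of \<open>U\<close> that is split off contributes exactly one, and when no
  nonzero homomorphism is left the product vanishes.\<close>

lemma cip_nat:
  fixes S :: "('a, 'y) rep" and U :: "('a, 'x) rep"
  assumes U: "irreducible_rep G U" and "is_rep G S"
  obtains m where "cip (character U) (character S) = of_nat m"
proof -
  have "\<exists>m. cip (character U) (character S) = of_nat m"
    using assms(2)
  proof (induction "rdim (rep_space S)" arbitrary: S rule: less_induct)
    case less
    note S = less.prems
    have R: "is_rep G U" using U by (auto simp: irreducible_rep_def)
    show ?case
    proof (cases "\<exists>T. rep_hom G U S T \<and> (\<exists>u\<in>rep_space U. T u \<noteq> 0)")
      case False
      then have "cip (character U) (character S) = 0"
        by (intro no_hom_cip[OF R S]) blast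
      then show ?thesis by (intro exI[of _ 0]) simp
    next
      case True
      then obtain T where T: "rep_hom G U S T" "\<exists>u\<in>rep_space U. T u \<noteq> 0" by blast
      show ?thesis
      proof (rule irreducible_hom_split[OF U S T])
        fix P :: "('y \<Rightarrow> complex) \<Rightarrow> 'y \<Rightarrow> complex"
        let ?K = "subrep S (kernel (rep_space S) P)"
        assume K: "invariant_subspace G S (kernel (rep_space S) P)"
          and ch: "\<And>g. g \<in> carrier G \<Longrightarrow> character S g = character U g + character ?K g"
          and dim: "rdim (rep_space S) = rdim (rep_space U) + rdim (kernel (rep_space S) P)"
            "rdim (rep_space U) > 0"
        obtain m where "cip (character U) (character ?K) = of_nat m"
          using less.hyps[of ?K] is_rep_sub[OF S K] dim by auto
        then have "cip (character U) (character S) = of_nat (Suc m)"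
          using cip_split[OF U ch] by simp
        then show ?thesis by blast
      qed
    qed
  qed
  then show thesis using that by blast
qed

lemma hom_cip_pos:
  fixes S :: "('a, 'y) rep" and U :: "('a, 'x) rep"
  assumes U: "irreducible_rep G U" and S: "is_rep G S" and T: "rep_hom G U S T" "\<exists>u\<in>rep_space U. T u \<noteq> 0"
  obtains m where "cip (character U) (character S) = of_nat (Suc m)"
proof (rule irreducible_hom_split[OF U S T])
  fix P :: "('y \<Rightarrow> complex) \<Rightarrow> 'y \<Rightarrow> complex"
  let ?K = "subrep S (kernel (rep_space S) P)"
  assume K: "invariant_subspace G S (kernel (rep_space S) P)"
    and ch: "\<And>g. g \<in> carrier G \<Longrightarrow> character S g = character U g + character ?K g"
  obtain m where "cip (character U) (character ?K) = of_nat m"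
    using cip_nat[OF U is_rep_sub[OF S K]] .
  then show thesis using that[of m] cip_split[OF U ch] by simp
qed

lemma cip_hom:
  assumes U: "irreducible_rep G U" and S: "is_rep G S" and nz: "cip (character U) (character S) \<noteq> 0"
  obtains T where "rep_hom G U S T" "\<exists>u\<in>rep_space U. T u \<noteq> 0"
  using no_hom_cip[OF _ S, of U] U nz unfolding irreducible_rep_def by blast

text \<open>\<open>T2\<close> maps \<open>U\<close> into the complement of the image of
  \<open>T1\<close>, while \<open>\<pi>\<close> inverts \<open>T1\<close> and kills that complement.
  The composites of \<open>T1\<close> and \<open>T2\<close> with \<open>\<pi>\<close> are then two
  endomorphisms that do not commute, which is the use made of them.\<close>

lemma cip_two:
  fixes S :: "('a, 'y) rep" and U :: "('a, 'x) rep"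
  assumes U: "irreducible_rep G U" and S: "is_rep G S"
    and cip: "cip (character U) (character S) = of_nat m" "m \<ge> 2"
  obtains T1 T2 \<pi> where "rep_hom G U S T1" "rep_hom G U S T2" "rep_hom G S U \<pi>"
    "\<And>u. u \<in> rep_space U \<Longrightarrow> \<pi> (T1 u) = u" "\<And>u. u \<in> rep_space U \<Longrightarrow> \<pi> (T2 u) = 0"
    "\<exists>u\<in>rep_space U. T2 u \<noteq> 0"
proof -
  have R: "is_rep G U" using U by (auto simp: irreducible_rep_def)
  have "cip (character U) (character S) \<noteq> 0" using cip by simp
  then obtain T where T: "rep_hom G U S T" "\<exists>u\<in>rep_space U. T u \<noteq> 0"
    using cip_hom[OF U S] by blast
  show thesis
  proof (rule irreducible_hom_split[OF U S T])
    fix P :: "('y \<Rightarrow> complex) \<Rightarrow> 'y \<Rightarrow> complex"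
    let ?I = "T ` rep_space U"
    let ?K = "subrep S (kernel (rep_space S) P)"
    assume K: "invariant_subspace G S (kernel (rep_space S) P)" and I: "invariant_subspace G S ?I"
      and ch: "\<And>g. g \<in> carrier G \<Longrightarrow> character S g = character U g + character ?K g"
      and P: "rep_hom G S S P" "\<And>v. v \<in> rep_space S \<Longrightarrow> P v \<in> ?I" "\<And>u. u \<in> ?I \<Longrightarrow> P u = u"
    have eq1: "cip (character U) (character ?K) = of_nat m - 1"
      using cip_split[OF U ch] cip by simp
    have "cip (character U) (character ?K) \<noteq> 0"
    proof
      assume "cip (character U) (character ?K) = 0"
      then have "of_nat m = (1 :: complex)" using eq1 by simp
      then have "m = 1" by (simp only: of_nat_eq_1_iff)
      then show False using cip(2) by simp
    qed
    then obtain T2 where T2: "rep_hom G U ?K T2" "\<exists>u\<in>rep_space U. T2 u \<noteq> 0"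
      using cip_hom[OF U is_rep_sub[OF S K]] by blast
    have "rep_iso G (subrep S ?I) U"
    proof (rule rep_iso_sym[OF R is_rep_sub[OF S I]])
      show "rep_iso G U (subrep S ?I)"
        unfolding rep_iso_alt
        using irreducible_hom_inj[OF U S T] T(1)
        by (intro exI[of _ T]) (auto simp: rep_hom_def bij_betw_def)
    qed
    let ?J = "inv_into (rep_space U) T"
    have inj: "inj_on T (rep_space U)" by (rule irreducible_hom_inj[OF U S T])
    note T' = rep_homD[OF T(1)]
    have J: "?J (T u) = u" if "u \<in> rep_space U" for u using inj that by (rule inv_into_f_f)
    note V = rep_subspace[OF R]
    have JI: "rep_hom G (subrep S ?I) U ?J"
      unfolding rep_hom_def
    proof (intro conjI ballI)
      show "linear_on_space (rep_space (subrep S ?I)) ?J"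
        unfolding linear_on_space_def
        using lin_add[OF T'(1), symmetric] lin_scale[OF T'(1), symmetric] V
        by (auto simp: J cfun.subspace_add cfun.subspace_scale simp del: plus_fun_apply)
      show "?J ` rep_space (subrep S ?I) \<subseteq> rep_space U" using J by auto
      show "?J (rep_act (subrep S ?I) g v) = rep_act U g (?J v)"
        if "g \<in> carrier G" "v \<in> rep_space (subrep S ?I)" for g v
        using that J rep_closed[OF R] T'(3)[symmetric] by auto
    qed
    have PI: "rep_hom G S (subrep S ?I) P" using P by (auto simp: rep_hom_def)
    have Ksub: "kernel (rep_space S) P \<subseteq> rep_space S" by (auto simp: kernel_def)
    have PT2: "?J (P (T2 u)) = 0" if "u \<in> rep_space U" for u
    proof -
      have "P (T2 u) = 0" using rep_homD(2)[OF T2(1) that] by (simp add: kernel_def)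
      moreover have "?J 0 = 0" using J[OF cfun.subspace_0[OF V]] lin_0[OF V T'(1)] by metis
      ultimately show ?thesis by metis
    qed
    show thesis
    proof (rule that[OF T(1) sub_hom[OF T2(1) Ksub] rep_hom_comp[OF PI JI] _ PT2 T2(2)])
      show "?J (P (T u)) = u" if "u \<in> rep_space U" for u
        using P(3)[of "T u"] J[OF that] that by simp
    qed
  qed
qed

text \<open>A nonzero invariant subspace of minimal dimension is irreducible. If it contained a
  nonzero invariant \<open>W\<close>, additivity of characters would leave dimension zero for a
  Maschke complement of \<open>W\<close>.\<close>

lemma irreducible_sub_exists:
  assumes S: "is_rep G S" and nz: "rep_space S \<noteq> {0}"
  obtains U where "invariant_subspace G S U" "irreducible_rep G (subrep S U)"
proof -
  let ?Q = "\<lambda>U. invariant_subspace G S U \<and> U \<noteq> {0}"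
  have "?Q (rep_space S)"
    using S nz rep_closed[OF S] by (auto simp: invariant_subspace_def is_rep_def)
  define U where "U = (ARG_MIN rdim U. ?Q U)"
  have U: "?Q U" and min: "\<And>W. ?Q W \<Longrightarrow> rdim U \<le> rdim W"
    using arg_min_natI[of ?Q "rep_space S" rdim] arg_min_nat_le[of ?Q _ rdim] \<open>?Q (rep_space S)\<close>
    unfolding U_def by blast+
  have rU: "is_rep G (subrep S U)" using is_rep_sub[OF S] U by blast
  have "irreducible_rep G (subrep S U)"
    unfolding irreducible_rep_def
  proof (intro conjI allI impI rU)
    show "rep_space (subrep S U) \<noteq> {0}" using U by simp
    fix W assume W: "invariant_subspace G (subrep S U) W"
    have WS: "invariant_subspace G S W" using W U by (auto simp: invariant_subspace_def)
    show "W = {0} \<or> W = rep_space (subrep S U)"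
    proof (cases "W = {0}")
      case False
      have rW: "is_rep G (subrep S W)" by (rule is_rep_sub[OF S WS])
      obtain P where P: "rep_hom G (subrep S U) (subrep S U) P"
        "\<And>v. v \<in> rep_space (subrep S U) \<Longrightarrow> P v \<in> W" "\<And>u. u \<in> W \<Longrightarrow> P u = u"
        by (rule maschke[OF rU W]) blast
      let ?K = "kernel (rep_space (subrep S U)) P"
      note sp = projection_split[OF rU W P]
      have KS: "invariant_subspace G S ?K" using sp(1) U by (auto simp: invariant_subspace_def)
      have rK: "is_rep G (subrep S ?K)" by (rule is_rep_sub[OF S KS])
      have sub: "subrep (subrep S U) W = subrep S W" "subrep (subrep S U) ?K = subrep S ?K" by auto
      have "character (subrep S U) \<one> = character (subrep S W) \<one> + character (subrep S ?K) \<one>"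
        using rep_iso_char[OF rU direct_sum2_rep(1)[OF rW rK] sp(4)[unfolded sub] one_closed]
          direct_sum2_rep(2)[OF rW rK one_closed] by simp
      then have "of_nat (rdim U) = (of_nat (rdim W + rdim ?K) :: complex)"
        using character_one[OF rU] character_one[OF rW] character_one[OF rK] by simp
      then have "rdim U = rdim W + rdim ?K" using of_nat_eq_iff by blast
      moreover have "rdim U \<le> rdim W" using min WS False by blast
      ultimately have "rdim ?K = 0" by simp
      then have K0: "?K = {0}" using rdim_0[OF rep_fdim[OF rK]] by simp
      have "W = U"
      proof (intro equalityI subsetI)
        fix x assume "x \<in> W" then show "x \<in> U" using W by (auto simp: invariant_subspace_def)
      next
        fix x assume "x \<in> U"
        then have "x \<in> {u + u' |u u'. u \<in> W \<and> u' \<in> ?K}" using sp(3) by simp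
        then obtain u u' where "x = u + u'" "u \<in> W" "u' \<in> ?K" by blast
        then show "x \<in> W" using K0 by simp
      qed
      then show ?thesis by simp
    qed simp
  qed
  then show thesis using that U by blast
qed

text \<open>Induction on dimension: an irreducible subrepresentation of \<open>R\<close> has nonzero
  product with the character of \<open>R\<close>, hence with that of \<open>S\<close>, so it can be
  split off on both sides, leaving complements with equal characters.\<close>

lemma character_eq_iso:
  fixes R :: "('a, 'x) rep" and S :: "('a, 'y) rep"
  assumes "is_rep G R" "is_rep G S" "\<And>g. g \<in> carrier G \<Longrightarrow> character R g = character S g"
  shows "rep_iso G R S"
  using assms
proof (induction "rdim (rep_space R)" arbitrary: R S rule: less_induct)
  case less
  note R = less.prems(1) and S = less.prems(2) and ch = less.prems(3)
  show ?case
  proof (cases "rep_space R = {0}")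
    case True
    have "rdim (rep_space S) = 0"
      using ch[OF one_closed] character_one[OF R] character_one[OF S] rdim_0[OF rep_fdim[OF R]] True by simp
    then have "rep_space S = {0}" using rdim_0[OF rep_fdim[OF S]] by simp
    then show ?thesis
      unfolding rep_iso_def using True rep_closed[OF R] rep_closed[OF S]
      by (intro exI[of _ "\<lambda>_. 0"]) (auto simp: linear_on_space_def bij_betw_def)
  next
    case False
    obtain U where U: "invariant_subspace G R U" "irreducible_rep G (subrep R U)"
      using irreducible_sub_exists[OF R False] .
    have T: "rep_hom G (subrep R U) R (\<lambda>v. v)"
      using U(1) by (auto simp: rep_hom_def linear_on_space_def invariant_subspace_def)
    have "\<exists>u\<in>U. u \<noteq> 0"
      using U cfun.subspace_0 by (fastforce simp: irreducible_rep_def invariant_subspace_def)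
    then have nz: "\<exists>u\<in>rep_space (subrep R U). u \<noteq> 0" by simp
    obtain m where "cip (character (subrep R U)) (character R) = of_nat (Suc m)"
      using hom_cip_pos[OF U(2) R T nz] .
    then have "cip (character (subrep R U)) (character S) \<noteq> 0"
      using cip_cong[of "character (subrep R U)" "character (subrep R U)" "character R" "character S"] ch
      by (metis Zero_not_Suc of_nat_eq_0_iff)
    then obtain T' where T': "rep_hom G (subrep R U) S T'" "\<exists>u\<in>rep_space (subrep R U). T' u \<noteq> 0"
      using cip_hom[OF U(2) S] by blast
    show ?thesis
    proof (rule irreducible_hom_split[OF U(2) R T nz])
      fix P :: "('x \<Rightarrow> complex) \<Rightarrow> 'x \<Rightarrow> complex"
      let ?I = "(\<lambda>v. v) ` rep_space (subrep R U)"
      let ?K = "subrep R (kernel (rep_space R) P)"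
      assume a: "rep_iso G (subrep R U) (subrep R ?I)"
        "invariant_subspace G R ?I" "invariant_subspace G R (kernel (rep_space R) P)"
        "rep_iso G R (direct_sum2 (subrep R ?I) ?K)"
        "\<And>g. g \<in> carrier G \<Longrightarrow> character R g = character (subrep R U) g + character ?K g"
        "rdim (rep_space R) = rdim (rep_space (subrep R U)) + rdim (kernel (rep_space R) P)"
        "rdim (rep_space (subrep R U)) > 0"
      show ?thesis
      proof (rule irreducible_hom_split[OF U(2) S T'])
        fix P' :: "('y \<Rightarrow> complex) \<Rightarrow> 'y \<Rightarrow> complex"
        let ?I' = "T' ` rep_space (subrep R U)"
        let ?K' = "subrep S (kernel (rep_space S) P')"
        assume b: "rep_iso G (subrep R U) (subrep S ?I')"
          "invariant_subspace G S ?I'" "invariant_subspace G S (kernel (rep_space S) P')"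
          "rep_iso G S (direct_sum2 (subrep S ?I') ?K')"
          "\<And>g. g \<in> carrier G \<Longrightarrow> character S g = character (subrep R U) g + character ?K' g"
        have rK: "is_rep G ?K" "is_rep G ?K'" "is_rep G (subrep R U)" "is_rep G (subrep R ?I)" "is_rep G (subrep S ?I')"
          using is_rep_sub[OF R] is_rep_sub[OF S] a(2,3) b(2,3) U(1) by auto
        have "rep_iso G ?K ?K'"
        proof (rule less.hyps[OF _ rK(1,2)])
          show "rdim (rep_space ?K) < rdim (rep_space R)" using a(6,7) by simp
          show "character ?K g = character ?K' g" if "g \<in> carrier G" for g
            using a(5)[OF that] b(5)[OF that] ch[OF that] by simp
        qed
        moreover have "rep_iso G (subrep R ?I) (subrep S ?I')"
          using rep_iso_trans[OF rep_iso_sym[OF rK(3,4) a(1)] b(1)] .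
        ultimately have "rep_iso G (direct_sum2 (subrep R ?I) ?K) (direct_sum2 (subrep S ?I') ?K')"
          by (intro direct_sum2_cong)
        then show ?thesis
          using rep_iso_trans[OF rep_iso_trans[OF a(4)]
             rep_iso_sym[OF S direct_sum2_rep(1)[OF rK(5,2)] b(4)]] by blast
      qed
    qed
  qed
qed

text \<open>Turns membership in the sets of added boxes into a condition on class functions: a
  nonzero product yields a nonzero homomorphism, whose image has a complement by Maschke's
  theorem.\<close>

lemma is_summand_iff:
  fixes S :: "('a, 'y) rep" and U :: "('a, 'x) rep"
  assumes U: "irreducible_rep G U" and S: "is_rep G S"
  shows "is_summand G U S \<longleftrightarrow> cip (character U) (character S) \<noteq> 0"
proof
  have R: "is_rep G U" and nz: "rep_space U \<noteq> {0}" using U by (auto simp: irreducible_rep_def)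
  assume "is_summand G U S"
  then obtain W W' where W: "invariant_subspace G S W" "rep_iso G U (subrep S W)"
    by (auto simp: is_summand_def)
  then obtain T where T: "rep_hom G U (subrep S W) T" "bij_betw T (rep_space U) W"
    by (auto simp: rep_iso_alt)
  have "rep_hom G U S T"
    using T(1) W(1) by (intro sub_hom[OF T(1)]) (auto simp: invariant_subspace_def)
  moreover have "\<exists>u\<in>rep_space U. T u \<noteq> 0"
  proof (rule ccontr)
    assume *: "\<not> ?thesis"
    obtain u where "u \<in> rep_space U" "u \<noteq> 0"
      using nz rep_subspace[OF R] cfun.subspace_0 by blast
    then show False
      using * T(2) cfun.subspace_0[OF rep_subspace[OF R]] by (metis bij_betw_def inj_onD)
  qed
  ultimately obtain m where "cip (character U) (character S) = of_nat (Suc m)"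
    using hom_cip_pos[OF U S] by blast
  then show "cip (character U) (character S) \<noteq> 0" by (metis Zero_not_Suc of_nat_eq_0_iff)
next
  assume "cip (character U) (character S) \<noteq> 0"
  then obtain T where T: "rep_hom G U S T" "\<exists>u\<in>rep_space U. T u \<noteq> 0"
    using cip_hom[OF U S] by blast
  show "is_summand G U S"
  proof (rule irreducible_hom_split[OF U S T])
    fix P :: "('y \<Rightarrow> complex) \<Rightarrow> 'y \<Rightarrow> complex"
    assume a: "rep_hom G S S P" "\<And>v. v \<in> rep_space S \<Longrightarrow> P v \<in> T ` rep_space U"
      "\<And>u. u \<in> T ` rep_space U \<Longrightarrow> P u = u" "rep_iso G U (subrep S (T ` rep_space U))"
      "invariant_subspace G S (T ` rep_space U)"
    show ?thesis
      unfolding is_summand_def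
      by (intro exI[of _ "T ` rep_space U"] exI[of _ "kernel (rep_space S) P"] conjI a(4,5)
          projection_split(1-3)[OF S a(5,1,2,3)])
  qed
qed

text \<open>When every group element acts by a scalar, every line is invariant, so irreducibility
  leaves dimension one.\<close>

lemma scalar_irreducible:
  assumes U: "irreducible_rep G U"
    and sc: "\<And>g v. g \<in> carrier G \<Longrightarrow> v \<in> rep_space U \<Longrightarrow> rep_act U g v = cscale (c g) v"
    and g: "g \<in> carrier G"
  shows "character U g = c g"
proof -
  have R: "is_rep G U" and nz: "rep_space U \<noteq> {0}" using U by (auto simp: irreducible_rep_def)
  note V = rep_subspace[OF R]
  obtain d w f where D: "dual_basis (rep_space U) d w f"
    using dual_basis_exists[OF rep_fdim[OF R]] .
  note F = dual_basis_frame[OF D]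
  have w: "lin_fun (rep_space U) (f i)" "w i \<in> rep_space U" if "i < d" for i
    using F that by (auto simp: frame_def)
  have fw: "f i (w j) = (if i = j then 1 else 0)" if "i < d" "j < d" for i j
    using D that by (simp add: dual_basis_def)
  have d0: "d \<noteq> 0" using dual_basis_0[OF D V] nz by simp
  have "cfun.span {w 0} = rep_space U"
  proof -
    have "invariant_subspace G U (cfun.span {w 0})"
      unfolding invariant_subspace_def
    proof (intro conjI ballI)
      show sub: "cfun.span {w 0} \<subseteq> rep_space U" using w(2)[of 0] d0 V by (intro cfun.span_minimal) auto
      show "rep_act U h ` cfun.span {w 0} \<subseteq> cfun.span {w 0}" if "h \<in> carrier G" for h
        using sub sc[OF that] by (auto simp: subset_iff intro: cfun.span_scale)
    qed (rule cfun.subspace_span)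
    moreover have "w 0 \<noteq> 0" using fw[of 0 0] lin_fun_0[OF V w(1)[of 0]] d0 by auto
    ultimately show ?thesis using U cfun.span_base[of "w 0" "{w 0}"] by (auto simp: irreducible_rep_def)
  qed
  have "d = 1"
  proof (rule ccontr)
    assume "d \<noteq> 1"
    then have d1: "1 < d" using d0 by simp
    have "w 1 \<in> cfun.span {w 0}" using w(2)[OF d1] \<open>cfun.span {w 0} = rep_space U\<close> by simp
    then obtain k where k: "w 1 = cscale k (w 0)" by (auto simp: cfun.span_singleton)
    have "f 0 (w 1) = k" unfolding k using lin_fun_scale[OF w(1) w(2), of 0 0] d0 fw[of 0 0] by simp
    then have "k = 0" using fw[of 0 1] d1 by simp
    then have "w 1 = 0" using k by (simp add: cscale_def fun_eq_iff)
    then show False using fw[of 1 1] d1 lin_fun_0[OF V w(1)[OF d1]] by simp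
  qed
  then show ?thesis
    using char_frame[OF R F g] sc[OF g w(2)[of 0]] lin_fun_scale[OF w(1)[of 0] w(2)[of 0]] fw[of 0 0] by simp
qed

end

section \<open>Multiplicity-free restriction\<close>

lemma tr_commute:
  assumes V: "fdim V" and X: "linear_on_space V X" "X ` V \<subseteq> V" and Y: "linear_on_space V Y" "Y ` V \<subseteq> V"
  shows "tr V (\<lambda>v. X (Y v)) = tr V (\<lambda>v. Y (X v))"
proof -
  note sV = fdim_subspace[OF V]
  obtain d w f where D: "dual_basis V d w f"
    using dual_basis_exists[OF V] .
  note F = dual_basis_frame[OF D]
  have w: "lin_fun V (f i)" "w i \<in> V" if "i < d" for i
    using F that by (auto simp: frame_def)
  have half: "tr V (\<lambda>v. X (Y v)) = (\<Sum>i<d. \<Sum>j<d. f j (Y (w i)) * f i (X (w j)))"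
    if X: "linear_on_space V X" "X ` V \<subseteq> V" and Y: "linear_on_space V Y" "Y ` V \<subseteq> V" for X Y
  proof -
    have "tr V (\<lambda>v. X (Y v)) = (\<Sum>i<d. f i (X (Y (w i))))"
      using X Y by (intro tr_frame[OF sV F] lin_comp[OF Y(1) X(1) Y(2)]) auto
    also have "\<dots> = (\<Sum>i<d. \<Sum>j<d. f j (Y (w i)) * f i (X (w j)))"
    proof (intro sum.cong refl)
      fix i assume "i \<in> {..<d}"
      then have i: "i < d" by simp
      have "Y (w i) = (\<Sum>j<d. cscale (f j (Y (w i))) (w j))"
        using F Y(2) w(2)[OF i] unfolding frame_def by blast
      then have "X (Y (w i)) = X (\<Sum>j<d. cscale (f j (Y (w i))) (w j))" by (rule arg_cong)
      also have "\<dots> = (\<Sum>j<d. X (cscale (f j (Y (w i))) (w j)))"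
        using w sV by (intro lin_sum[OF sV X(1)] cfun.subspace_scale) auto
      also have "\<dots> = (\<Sum>j<d. cscale (f j (Y (w i))) (X (w j)))"
        using w by (intro sum.cong refl lin_scale[OF X(1)]) auto
      finally have "f i (X (Y (w i))) = f i (\<Sum>j<d. cscale (f j (Y (w i))) (X (w j)))" by (rule arg_cong)
      also have "\<dots> = (\<Sum>j<d. f i (cscale (f j (Y (w i))) (X (w j))))"
        using w sV X(2) by (intro lin_fun_sum[OF sV w(1)[OF i]] cfun.subspace_scale) auto
      also have "\<dots> = (\<Sum>j<d. f j (Y (w i)) * f i (X (w j)))"
        using w X(2) by (intro sum.cong refl lin_fun_scale[OF w(1)[OF i]]) auto
      finally show "f i (X (Y (w i))) = (\<Sum>j<d. f j (Y (w i)) * f i (X (w j)))" .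
    qed
    finally show ?thesis .
  qed
  show ?thesis
    unfolding half[OF X Y] half[OF Y X]
    by (subst sum.swap) (simp add: mult.commute)
qed

lemma tr_cscale:
  assumes V: "fdim V" and X: "linear_on_space V X" "X ` V \<subseteq> V"
  shows "tr V (\<lambda>v. cscale c (X v)) = c * tr V X"
proof -
  note sV = fdim_subspace[OF V]
  obtain d w f where D: "dual_basis V d w f"
    using dual_basis_exists[OF V] .
  note F = dual_basis_frame[OF D]
  have w: "lin_fun V (f i)" "w i \<in> V" if "i < d" for i
    using F that by (auto simp: frame_def)
  have "tr V (\<lambda>v. cscale c (X v)) = (\<Sum>i<d. f i (cscale c (X (w i))))"
    using X sV by (intro tr_frame[OF sV F] lin_cscale_map) (auto simp: cfun.subspace_scale)
  also have "\<dots> = (\<Sum>i<d. c * f i (X (w i)))"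
  proof (intro sum.cong refl)
    fix i assume "i \<in> {..<d}"
    then have i: "i < d" by simp
    show "f i (cscale c (X (w i))) = c * f i (X (w i))"
      using w(2)[OF i] X(2) by (intro lin_fun_scale[OF w(1)[OF i]]) auto
  qed
  also have "\<dots> = c * tr V X"
    unfolding tr_frame[OF sV F X] by (simp add: sum_distrib_left)
  finally show ?thesis .
qed

section \<open>Fourier coefficients of endomorphisms and Gelfand's trick\<close>

context finite_group
begin

definition endo :: "('a, 'x) rep \<Rightarrow> (('x \<Rightarrow> complex) \<Rightarrow> 'x \<Rightarrow> complex) \<Rightarrow> bool"
  where "endo U X \<longleftrightarrow> linear_on_space (rep_space U) X \<and> X ` rep_space U \<subseteq> rep_space U"

lemma endo_comp: "endo U X \<Longrightarrow> endo U Y \<Longrightarrow> endo U (\<lambda>v. X (Y v))"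
  using lin_comp[of "rep_space U" Y "rep_space U" X] by (auto simp: endo_def)

lemma endo_act: "is_rep G U \<Longrightarrow> g \<in> carrier G \<Longrightarrow> endo U (rep_act U g)"
  by (auto simp: endo_def intro: rep_lin rep_closed)

lemma endo_closed: "endo U X \<Longrightarrow> v \<in> rep_space U \<Longrightarrow> X v \<in> rep_space U"
  unfolding endo_def by auto

text \<open>The function \<open>coef U X\<close> consists, up to a factor and inversion of the argument, of the coefficients
  in the expansion of \<open>X\<close> as a combination of the operators \<open>rep_act U g\<close>.\<close>

definition coef :: "('a, 'x) rep \<Rightarrow> (('x \<Rightarrow> complex) \<Rightarrow> 'x \<Rightarrow> complex) \<Rightarrow> 'a \<Rightarrow> complex"
  where "coef U X g = tr (rep_space U) (\<lambda>v. X (rep_act U g v))"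

text \<open>Schur averaging of the rank-one map that takes \<open>x\<close> to
  \<open>f i (X x)\<close> times \<open>v\<close>, whose trace is \<open>f i (X v)\<close>, recovers
  the \<open>i\<close>-th coordinate of \<open>X v\<close>; summing over \<open>i\<close> recovers
  \<open>X v\<close> itself.\<close>

lemma fourier_inversion:
  assumes U: "irreducible_rep G U" and X: "endo U X" and v: "v \<in> rep_space U"
  shows "X v = cscale (of_nat (rdim (rep_space U)) / of_nat (card (carrier G)))
    (\<Sum>g\<in>carrier G. cscale (coef U X (inv g)) (rep_act U g v))"
proof -
  have R: "is_rep G U" and nz: "rep_space U \<noteq> {0}" using U by (auto simp: irreducible_rep_def)
  note V = rep_subspace[OF R]
  obtain d w f where D: "dual_basis (rep_space U) d w f"
    using dual_basis_exists[OF rep_fdim[OF R]] .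
  note F = dual_basis_frame[OF D]
  have w: "lin_fun (rep_space U) (f i)" "w i \<in> rep_space U" if "i < d" for i
    using F that by (auto simp: frame_def)
  have Xl: "linear_on_space (rep_space U) X" using X by (simp add: endo_def)
  have Xv: "X v \<in> rep_space U" using endo_closed[OF X v] .
  let ?N = "of_nat (card (carrier G)) :: complex"
  let ?d = "of_nat (rdim (rep_space U)) :: complex"
  have d0: "?d \<noteq> 0" using rdim_0[OF rep_fdim[OF R]] nz by simp
  have z: "(\<Sum>g\<in>carrier G. cscale (f i (X (rep_act U (inv g) (w i)))) (rep_act U g v)) =
      cscale (?N * f i (X v) / ?d) (w i)" if i: "i < d" for i
  proof -
    define Y where "Y = (\<lambda>x. cscale (f i (X x)) v)"
    have Y: "linear_on_space (rep_space U) Y" "Y ` rep_space U \<subseteq> rep_space U"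
      unfolding linear_on_space_def Y_def
      using lin_fun_add[OF w(1)[OF i]] lin_fun_scale[OF w(1)[OF i]] endo_closed[OF X] v V
        lin_add[OF Xl] lin_scale[OF Xl]
      by (auto simp add: cfun.scale_left_distrib cfun.subspace_scale)
    have "tr (rep_space U) Y = (\<Sum>k<d. f k (Y (w k)))" by (rule tr_frame[OF V F Y])
    also have "\<dots> = (\<Sum>k<d. f k v * f i (X (w k)))"
      by (intro sum.cong refl) (simp add: Y_def lin_fun_scale[OF w(1) v])
    also have "\<dots> = f i (X v)"
    proof -
      have "v = (\<Sum>k<d. cscale (f k v) (w k))" using F v unfolding frame_def by blast
      then have "X v = X (\<Sum>k<d. cscale (f k v) (w k))" by (rule arg_cong)
      also have "\<dots> = (\<Sum>k<d. X (cscale (f k v) (w k)))"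
        using w V by (intro lin_sum[OF V Xl] cfun.subspace_scale) auto
      also have "\<dots> = (\<Sum>k<d. cscale (f k v) (X (w k)))"
        using w by (intro sum.cong refl lin_scale[OF Xl]) auto
      finally have "f i (X v) = f i (\<Sum>k<d. cscale (f k v) (X (w k)))" by (rule arg_cong)
      also have "\<dots> = (\<Sum>k<d. f i (cscale (f k v) (X (w k))))"
        using w V endo_closed[OF X] by (intro lin_fun_sum[OF V w(1)[OF i]] cfun.subspace_scale) auto
      also have "\<dots> = (\<Sum>k<d. f k v * f i (X (w k)))"
        using w endo_closed[OF X] by (intro sum.cong refl lin_fun_scale[OF w(1)[OF i]]) auto
      finally show ?thesis by simp
    qed
    finally have trY: "tr (rep_space U) Y = f i (X v)" .
    have "(\<Sum>g\<in>carrier G. cscale (f i (X (rep_act U (inv g) (w i)))) (rep_act U g v)) = avg U U Y (w i)"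
      unfolding avg_def Y_def by (intro sum.cong refl lin_scale[OF rep_lin[OF R] v, symmetric])
    then show ?thesis unfolding schur_average[OF U Y w(2)[OF i]] trY .
  qed
  have c: "coef U X (inv g) = (\<Sum>i<d. f i (X (rep_act U (inv g) (w i))))" if "g \<in> carrier G" for g
    unfolding coef_def using endo_comp[OF X endo_act[OF R inv_closed[OF that]]]
    by (intro tr_frame[OF V F]) (auto simp: endo_def)
  have "(\<Sum>g\<in>carrier G. cscale (coef U X (inv g)) (rep_act U g v)) =
     (\<Sum>g\<in>carrier G. \<Sum>i<d. cscale (f i (X (rep_act U (inv g) (w i)))) (rep_act U g v))"
    by (intro sum.cong refl) (simp add: c cfun.scale_sum_left)
  also have "\<dots> = (\<Sum>i<d. cscale (?N * f i (X v) / ?d) (w i))"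
    by (subst sum.swap) (intro sum.cong refl z, simp)
  also have "\<dots> = cscale (?N / ?d) (\<Sum>i<d. cscale (f i (X v)) (w i))"
    by (simp add: cfun.scale_sum_right)
  also have "(\<Sum>i<d. cscale (f i (X v)) (w i)) = X v"
    using F Xv unfolding frame_def by metis
  finally show ?thesis using d0 card_pos by simp
qed

text \<open>The operators \<open>rep_act U g\<close> span all endomorphisms of an irreducible
  representation, so the traces against them determine an endomorphism.\<close>

lemma endo_eqI:
  assumes U: "irreducible_rep G U" and X: "endo U X" and Y: "endo U Y"
    and eq: "\<And>g. g \<in> carrier G \<Longrightarrow> coef U X g = coef U Y g" and v: "v \<in> rep_space U"
  shows "X v = Y v"
  unfolding fourier_inversion[OF U X v] fourier_inversion[OF U Y v]
  by (intro arg_cong[where f = "cscale _"] sum.cong refl) (simp add: eq)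

lemma tr_sum_cscale:
  assumes V: "fdim V" and X: "\<And>i. i \<in> I \<Longrightarrow> linear_on_space V (X i)" "\<And>i v. i \<in> I \<Longrightarrow> v \<in> V \<Longrightarrow> X i v \<in> V"
  shows "tr V (\<lambda>v. \<Sum>i\<in>I. cscale (c i) (X i v)) = (\<Sum>i\<in>I. c i * tr V (X i))"
proof -
  note sV = fdim_subspace[OF V]
  obtain d w f where D: "dual_basis V d w f"
    using dual_basis_exists[OF V] .
  note F = dual_basis_frame[OF D]
  have w: "lin_fun V (f j)" "w j \<in> V" if "j < d" for j
    using F that by (auto simp: frame_def)
  have "tr V (\<lambda>v. \<Sum>i\<in>I. cscale (c i) (X i v)) = (\<Sum>j<d. f j (\<Sum>i\<in>I. cscale (c i) (X i (w j))))"
    using X sV by (intro tr_frame[OF sV F] lin_sum_maps lin_cscale_map)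
      (auto intro!: cfun.subspace_sum cfun.subspace_scale)
  also have "\<dots> = (\<Sum>j<d. \<Sum>i\<in>I. c i * f j (X i (w j)))"
  proof (intro sum.cong refl)
    fix j assume "j \<in> {..<d}"
    then have j: "j < d" by simp
    have "f j (\<Sum>i\<in>I. cscale (c i) (X i (w j))) = (\<Sum>i\<in>I. f j (cscale (c i) (X i (w j))))"
      using w(2)[OF j] X sV by (intro lin_fun_sum[OF sV w(1)[OF j]] cfun.subspace_scale) auto
    also have "\<dots> = (\<Sum>i\<in>I. c i * f j (X i (w j)))"
      using w(2)[OF j] X by (intro sum.cong refl lin_fun_scale[OF w(1)[OF j]]) auto
    finally show "f j (\<Sum>i\<in>I. cscale (c i) (X i (w j))) = (\<Sum>i\<in>I. c i * f j (X i (w j)))" .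
  qed
  also have "\<dots> = (\<Sum>i\<in>I. \<Sum>j<d. c i * f j (X i (w j)))" by (rule sum.swap)
  also have "\<dots> = (\<Sum>i\<in>I. c i * tr V (X i))"
  proof (intro sum.cong refl)
    fix i assume i: "i \<in> I"
    have "tr V (X i) = (\<Sum>j<d. f j (X i (w j)))"
      using X i by (intro tr_frame[OF sV F]) auto
    then show "(\<Sum>j<d. c i * f j (X i (w j))) = c i * tr V (X i)" by (simp add: sum_distrib_left)
  qed
  finally show ?thesis .
qed

text \<open>Expanding \<open>X\<close> by Fourier inversion and moving the group element around the
  trace turns composition of endomorphisms into convolution of functions on the group.\<close>

lemma coef_comp:
  assumes U: "irreducible_rep G U" and X: "endo U X" and Y: "endo U Y" and g: "g \<in> carrier G"
  shows "coef U (\<lambda>v. X (Y v)) g = of_nat (rdim (rep_space U)) / of_nat (card (carrier G)) *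
    (\<Sum>x\<in>carrier G. coef U X (inv x) * coef U Y (g \<otimes> x))"
proof -
  have R: "is_rep G U" using U by (auto simp: irreducible_rep_def)
  note V = rep_fdim[OF R]
  let ?k = "of_nat (rdim (rep_space U)) / of_nat (card (carrier G)) :: complex"
  have Yg: "endo U (\<lambda>v. Y (rep_act U g v))" by (rule endo_comp[OF Y endo_act[OF R g]])
  have lin: "endo U (\<lambda>v. rep_act U x (Y (rep_act U g v)))" if "x \<in> carrier G" for x
    by (rule endo_comp[OF endo_act[OF R that] Yg])
  have "coef U (\<lambda>v. X (Y v)) g = tr (rep_space U) (\<lambda>v. \<Sum>x\<in>carrier G. cscale (?k * coef U X (inv x))
      (rep_act U x (Y (rep_act U g v))))"
    unfolding coef_def
  proof (rule tr_cong[OF V])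
    have "endo U (\<lambda>v. X (Y (rep_act U g v)))" by (rule endo_comp[OF X Yg])
    then show "linear_on_space (rep_space U) (\<lambda>v. X (Y (rep_act U g v)))"
      "(\<lambda>v. X (Y (rep_act U g v))) ` rep_space U \<subseteq> rep_space U" by (auto simp: endo_def)
    fix v assume v: "v \<in> rep_space U"
    show "X (Y (rep_act U g v)) = (\<Sum>x\<in>carrier G. cscale (?k * tr (rep_space U) (\<lambda>v. X (rep_act U (inv x) v)))
        (rep_act U x (Y (rep_act U g v))))"
      using fourier_inversion[OF U X endo_closed[OF Yg v]] by (simp add: cfun.scale_sum_right coef_def)
  qed
  also have "\<dots> = (\<Sum>x\<in>carrier G. (?k * coef U X (inv x)) * tr (rep_space U) (\<lambda>v. rep_act U x (Y (rep_act U g v))))"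
    using lin by (intro tr_sum_cscale[OF V]) (auto simp: endo_def)
  also have "\<dots> = (\<Sum>x\<in>carrier G. (?k * coef U X (inv x)) * coef U Y (g \<otimes> x))"
  proof (intro sum.cong refl arg_cong[where f = "(*) _"])
    fix x assume x: "x \<in> carrier G"
    have "tr (rep_space U) (\<lambda>v. rep_act U x (Y (rep_act U g v))) = tr (rep_space U) (\<lambda>v. Y (rep_act U g (rep_act U x v)))"
      using tr_commute[OF V, of "rep_act U x" "\<lambda>v. Y (rep_act U g v)"] endo_act[OF R x] Yg
      by (simp add: endo_def)
    also have "\<dots> = coef U Y (g \<otimes> x)"
      unfolding coef_def
      using endo_comp[OF Yg endo_act[OF R x]] rep_mult[OF R g x]
      by (intro tr_cong[OF V]) (auto simp: endo_def)
    finally show "tr (rep_space U) (\<lambda>v. rep_act U x (Y (rep_act U g v))) = coef U Y (g \<otimes> x)" .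
  qed
  also have "\<dots> = ?k * (\<Sum>x\<in>carrier G. coef U X (inv x) * coef U Y (g \<otimes> x))"
    by (simp add: sum_distrib_left mult.assoc)
  finally show ?thesis .
qed

text \<open>Gelfand's trick: inversion is an antiautomorphism of the group algebra. If it fixes a subalgebra
  pointwise, this subalgebra is commutative.\<close>

lemma gelfand_trick:
  assumes U: "irreducible_rep G U" and X: "endo U X" and Y: "endo U Y"
    and sX: "\<And>g. g \<in> carrier G \<Longrightarrow> coef U X (inv g) = coef U X g"
    and sY: "\<And>g. g \<in> carrier G \<Longrightarrow> coef U Y (inv g) = coef U Y g"
    and sXY: "\<And>g. g \<in> carrier G \<Longrightarrow> coef U (\<lambda>v. X (Y v)) (inv g) = coef U (\<lambda>v. X (Y v)) g"
    and v: "v \<in> rep_space U"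
  shows "X (Y v) = Y (X v)"
proof (rule endo_eqI[OF U endo_comp[OF X Y] endo_comp[OF Y X] _ v])
  fix g assume g: "g \<in> carrier G"
  have "(\<Sum>x\<in>carrier G. coef U X (inv x) * coef U Y (inv g \<otimes> x)) =
    (\<Sum>x\<in>carrier G. coef U X x * coef U Y (inv x \<otimes> g))"
  proof (intro sum.cong refl)
    fix x assume x: "x \<in> carrier G"
    have "coef U Y (inv g \<otimes> x) = coef U Y (inv (inv g \<otimes> x))"
      using sY[of "inv g \<otimes> x"] g x by simp
    then show "coef U X (inv x) * coef U Y (inv g \<otimes> x) = coef U X x * coef U Y (inv x \<otimes> g)"
      using g x sX[OF x] by (simp add: inv_mult_group)
  qed
  \<comment> \<open>The substitution of \<open>inv x \<otimes> g\<close> for the summation variable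
    exchanges the two factors of the convolution; this is the antiautomorphism at work.\<close>
  also have "\<dots> = (\<Sum>y\<in>carrier G. coef U Y y * coef U X (g \<otimes> inv y))"
    using g by (intro sum.reindex_bij_witness[of _ "\<lambda>y. g \<otimes> inv y" "\<lambda>x. inv x \<otimes> g"])
      (auto simp: inv_mult_group m_assoc[symmetric] mult.commute, auto simp: m_assoc)
  also have "\<dots> = (\<Sum>y\<in>carrier G. coef U Y (inv y) * coef U X (g \<otimes> y))"
    by (subst sum_inv[symmetric]) simp
  finally have eq: "(\<Sum>x\<in>carrier G. coef U X (inv x) * coef U Y (inv g \<otimes> x)) =
    (\<Sum>y\<in>carrier G. coef U Y (inv y) * coef U X (g \<otimes> y))" .
  have "coef U (\<lambda>v. X (Y v)) g = coef U (\<lambda>v. X (Y v)) (inv g)" using sXY[OF g] by simp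
  also have "\<dots> = coef U (\<lambda>v. Y (X v)) g"
    unfolding coef_comp[OF U X Y inv_closed[OF g]] coef_comp[OF U Y X g] eq ..
  finally show "coef U (\<lambda>v. X (Y v)) g = coef U (\<lambda>v. Y (X v)) g" .
qed

end

section \<open>Restriction, multiplicity at most one, and reciprocity\<close>

definition res_rep :: "('h \<Rightarrow> 'g) \<Rightarrow> ('g, 'a) rep \<Rightarrow> ('h, 'a) rep"
  where "res_rep \<iota> R = \<lparr>rep_space = rep_space R, rep_act = (\<lambda>h. rep_act R (\<iota> h))\<rparr>"

lemma res_rep_rep:
  assumes "group G" "group H" "\<iota> \<in> hom H G" "is_rep G R"
  shows "is_rep H (res_rep \<iota> R)"
proof (rule is_repI)
  have \<iota>: "\<iota> h \<in> carrier G" if "h \<in> carrier H" for h using assms(3) that by (auto simp: hom_def)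
  have one: "\<iota> \<one>\<^bsub>H\<^esub> = \<one>\<^bsub>G\<^esub>"
    using hom_one[OF assms(3,2,1)] .
  show "\<And>v. v \<in> rep_space (res_rep \<iota> R) \<Longrightarrow> rep_act (res_rep \<iota> R) \<one>\<^bsub>H\<^esub> v = v"
    using rep_one[OF assms(4)] one by (simp add: res_rep_def)
  show "\<And>g h v. g \<in> carrier H \<Longrightarrow> h \<in> carrier H \<Longrightarrow> v \<in> rep_space (res_rep \<iota> R) \<Longrightarrow>
    rep_act (res_rep \<iota> R) (g \<otimes>\<^bsub>H\<^esub> h) v = rep_act (res_rep \<iota> R) g (rep_act (res_rep \<iota> R) h v)"
    using rep_mult[OF assms(4)] \<iota> hom_mult[OF assms(3)] by (simp add: res_rep_def)
qed (use rep_fdim[OF assms(4)] rep_closed[OF assms(4)] rep_lin[OF assms(4)] assms(3)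
     in \<open>auto simp: res_rep_def hom_def\<close>)

lemma res_rep_character: "character (res_rep \<iota> R) h = character R (\<iota> h)"
  by (simp add: character_def res_rep_def)

text \<open>If \<open>L\<close> occurred twice in the restriction of \<open>U\<close>, the
  composites of \<open>T1\<close> and \<open>T2\<close> with \<open>\<pi>\<close> from
  \<open>cip_two\<close> would not commute. Their coefficient functions are invariant under
  conjugation by the subgroup and are multiplied by \<open>c s\<close> under translation by an
  element \<open>s\<close> of \<open>B\<close>, because both maps factor through \<open>L\<close>.
  The assumption \<open>sym\<close> makes such functions invariant under inversion, and Gelfand's
  trick gives commutativity.\<close>

lemma multiplicity_free:
  fixes U :: "('g, 'x) rep" and L :: "('h, 'y) rep"
  assumes G: "finite_group G" and H: "finite_group H" and \<iota>: "\<iota> \<in> hom H G"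
    and U: "irreducible_rep G U" and L: "irreducible_rep H L"
    and B: "B \<subseteq> carrier H" "\<And>s v. s \<in> B \<Longrightarrow> v \<in> rep_space L \<Longrightarrow> rep_act L s v = cscale (c s) v"
    and sym: "\<And>a g. (\<And>h g. h \<in> carrier H \<Longrightarrow> g \<in> carrier G \<Longrightarrow> a (\<iota> h \<otimes>\<^bsub>G\<^esub> g \<otimes>\<^bsub>G\<^esub> inv\<^bsub>G\<^esub> (\<iota> h)) = (a g :: complex)) \<Longrightarrow>
      (\<And>s g. s \<in> B \<Longrightarrow> g \<in> carrier G \<Longrightarrow> a (\<iota> s \<otimes>\<^bsub>G\<^esub> g) = c s * a g) \<Longrightarrow>
      (\<And>s g. s \<in> B \<Longrightarrow> g \<in> carrier G \<Longrightarrow> a (g \<otimes>\<^bsub>G\<^esub> \<iota> s) = c s * a g) \<Longrightarrow>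
      g \<in> carrier G \<Longrightarrow> a (inv\<^bsub>G\<^esub> g) = a g"
  shows "finite_group.cip H (character L) (\<lambda>h. character U (\<iota> h)) \<in> {0, 1}"
proof -
  interpret G: finite_group G by fact
  interpret H: finite_group H by fact
  have R: "is_rep G U" using U by (auto simp: irreducible_rep_def)
  have RL: "is_rep H L" using L by (auto simp: irreducible_rep_def)
  let ?U = "res_rep \<iota> U"
  have RH: "is_rep H ?U" by (rule res_rep_rep[OF G.is_group H.is_group \<iota> R])
  have sp: "rep_space ?U = rep_space U" by (simp add: res_rep_def)
  have \<iota>c: "\<iota> h \<in> carrier G" if "h \<in> carrier H" for h using \<iota> that by (auto simp: hom_def)
  note V = rep_fdim[OF R]
  obtain m where m: "H.cip (character L) (character ?U) = of_nat m"
    using H.cip_nat[OF L RH] .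
  have "m < 2"
  proof (rule ccontr)
    assume "\<not> m < 2"
    then have m2: "2 \<le> m" by simp
    obtain T1 T2 \<pi> where T: "rep_hom H L ?U T1" "rep_hom H L ?U T2" "rep_hom H ?U L \<pi>"
      "\<And>u. u \<in> rep_space L \<Longrightarrow> \<pi> (T1 u) = u" "\<And>u. u \<in> rep_space L \<Longrightarrow> \<pi> (T2 u) = 0"
      "\<exists>u\<in>rep_space L. T2 u \<noteq> 0"
      by (rule H.cip_two[OF L RH m m2]) blast
    have key: "G.endo U X \<and> (\<forall>g\<in>carrier G. G.coef U X (inv\<^bsub>G\<^esub> g) = G.coef U X g)"
      if X: "rep_hom H ?U ?U X" "\<And>s v. s \<in> B \<Longrightarrow> v \<in> rep_space U \<Longrightarrow> X (rep_act U (\<iota> s) v) = cscale (c s) (X v)"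
      for X
    proof
      show XE: "G.endo U X" using X(1) by (auto simp: G.endo_def rep_hom_def sp)
      have comm: "X (rep_act U (\<iota> h) v) = rep_act U (\<iota> h) (X v)" if "h \<in> carrier H" "v \<in> rep_space U" for h v
        using rep_homD(3)[OF X(1) that(1)] that(2) by (simp add: res_rep_def)
      note E = G.endo_act[OF R]
      have cong: "tr (rep_space U) S = tr (rep_space U) S'" if "G.endo U S" "\<And>v. v \<in> rep_space U \<Longrightarrow> S v = S' v" for S S'
        using that by (intro tr_cong[OF V]) (auto simp: G.endo_def)
      have cyc: "tr (rep_space U) (\<lambda>v. S (S' v)) = tr (rep_space U) (\<lambda>v. S' (S v))" if "G.endo U S" "G.endo U S'" for S S'
        using that by (intro tr_commute[OF V]) (auto simp: G.endo_def)
      show "\<forall>g\<in>carrier G. G.coef U X (inv\<^bsub>G\<^esub> g) = G.coef U X g"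
      proof
        fix g assume "g \<in> carrier G"
        then show "G.coef U X (inv\<^bsub>G\<^esub> g) = G.coef U X g"
        proof (rule sym[rotated -1])
          fix h g assume h: "h \<in> carrier H" and g: "g \<in> carrier G"
          have "G.coef U X (\<iota> h \<otimes>\<^bsub>G\<^esub> g \<otimes>\<^bsub>G\<^esub> inv\<^bsub>G\<^esub> \<iota> h) =
              tr (rep_space U) (\<lambda>v. X (rep_act U (\<iota> h) (rep_act U g (rep_act U (inv\<^bsub>G\<^esub> \<iota> h) v))))"
            unfolding G.coef_def using h g \<iota>c
            by (intro cong G.endo_comp[OF XE] E)
               (auto simp: rep_mult[OF R] rep_closed[OF R])
          also have "\<dots> = tr (rep_space U) (\<lambda>v. rep_act U (inv\<^bsub>G\<^esub> \<iota> h) (X (rep_act U (\<iota> h) (rep_act U g v))))"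
            using h g \<iota>c
            by (intro cyc[of "\<lambda>v. X (rep_act U (\<iota> h) (rep_act U g v))" "rep_act U (inv\<^bsub>G\<^esub> \<iota> h)"]
                G.endo_comp[OF XE] G.endo_comp[OF E] E) auto
          also have "\<dots> = G.coef U X g"
            unfolding G.coef_def using h g \<iota>c G.endo_closed[OF XE]
            by (intro cong G.endo_comp[OF E] G.endo_comp[OF XE] E)
               (auto simp: comm rep_closed[OF R] G.rep_inv[OF R])
          finally show "G.coef U X (\<iota> h \<otimes>\<^bsub>G\<^esub> g \<otimes>\<^bsub>G\<^esub> inv\<^bsub>G\<^esub> \<iota> h) = G.coef U X g" .
        next
          fix s g assume s: "s \<in> B" and g: "g \<in> carrier G"
          then have sc: "s \<in> carrier H" using B by auto
          have Eg: "G.endo U (\<lambda>v. X (rep_act U g v))" by (rule G.endo_comp[OF XE E[OF g]])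
          have "G.coef U X (\<iota> s \<otimes>\<^bsub>G\<^esub> g) = tr (rep_space U) (\<lambda>v. cscale (c s) (X (rep_act U g v)))"
            unfolding G.coef_def using s g sc \<iota>c
            by (intro cong G.endo_comp[OF XE] E)
               (auto simp: rep_mult[OF R] rep_closed[OF R] X(2))
          also have "\<dots> = c s * G.coef U X g"
            unfolding G.coef_def using Eg by (intro tr_cscale[OF V]) (auto simp: G.endo_def)
          finally show "G.coef U X (\<iota> s \<otimes>\<^bsub>G\<^esub> g) = c s * G.coef U X g" .
          have "G.coef U X (g \<otimes>\<^bsub>G\<^esub> \<iota> s) = tr (rep_space U) (\<lambda>v. X (rep_act U g (rep_act U (\<iota> s) v)))"
            unfolding G.coef_def using s g sc \<iota>c
            by (intro cong G.endo_comp[OF XE] E) (auto simp: rep_mult[OF R] rep_closed[OF R])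
          also have "\<dots> = tr (rep_space U) (\<lambda>v. rep_act U (\<iota> s) (X (rep_act U g v)))"
            using sc \<iota>c by (intro cyc[OF Eg] E) auto
          also have "\<dots> = tr (rep_space U) (\<lambda>v. cscale (c s) (X (rep_act U g v)))"
            using s g sc \<iota>c
            by (intro cong G.endo_comp[OF E] Eg)
               (auto simp: comm[symmetric] rep_closed[OF R] X(2))
          also have "\<dots> = c s * G.coef U X g"
            unfolding G.coef_def using Eg by (intro tr_cscale[OF V]) (auto simp: G.endo_def)
          finally show "G.coef U X (g \<otimes>\<^bsub>G\<^esub> \<iota> s) = c s * G.coef U X g" .
        qed
      qed
    qed
    \<comment> \<open>Factoring through \<open>L\<close> is what passes the scalars of
      \<open>B\<close> on to an endomorphism of the restriction.\<close>
    have comb: "rep_hom H ?U ?U (\<lambda>v. S (\<pi> v)) \<and> (\<forall>s\<in>B. \<forall>v\<in>rep_space U. S (\<pi> (rep_act U (\<iota> s) v)) = cscale (c s) (S (\<pi> v)))"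
      if S: "rep_hom H L ?U S" for S
    proof (intro conjI ballI)
      show "rep_hom H ?U ?U (\<lambda>v. S (\<pi> v))" by (rule rep_hom_comp[OF T(3) S])
      fix s v assume s: "s \<in> B" and v: "v \<in> rep_space U"
      have "\<pi> (rep_act U (\<iota> s) v) = cscale (c s) (\<pi> v)"
        using rep_homD(3)[OF T(3), of s v] rep_homD(2)[OF T(3), of v] B s v
        by (auto simp: res_rep_def)
      then show "S (\<pi> (rep_act U (\<iota> s) v)) = cscale (c s) (S (\<pi> v))"
        using lin_scale[OF rep_homD(1)[OF S]] rep_homD(2)[OF T(3)] v by (simp add: sp)
    qed
    let ?P = "\<lambda>v. T1 (\<pi> v)" and ?Q = "\<lambda>v. T2 (\<pi> v)"
    have P: "rep_hom H ?U ?U ?P" "\<And>s v. s \<in> B \<Longrightarrow> v \<in> rep_space U \<Longrightarrow> ?P (rep_act U (\<iota> s) v) = cscale (c s) (?P v)"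
      and Q: "rep_hom H ?U ?U ?Q" "\<And>s v. s \<in> B \<Longrightarrow> v \<in> rep_space U \<Longrightarrow> ?Q (rep_act U (\<iota> s) v) = cscale (c s) (?Q v)"
      using comb[OF T(1)] comb[OF T(2)] by auto
    have PQ: "rep_hom H ?U ?U (\<lambda>v. ?P (?Q v))" by (rule rep_hom_comp[OF Q(1) P(1)])
    have PQs: "?P (?Q (rep_act U (\<iota> s) v)) = cscale (c s) (?P (?Q v))" if "s \<in> B" "v \<in> rep_space U" for s v
      using Q(2)[OF that] lin_scale[OF rep_homD(1)[OF P(1)]] rep_homD(2)[OF Q(1)] that(2) by (simp add: sp)
    have com: "?P (?Q v) = ?Q (?P v)" if "v \<in> rep_space U" for v
      using G.gelfand_trick[OF U _ _ _ _ _ that] key[OF P] key[OF Q] key[OF PQ PQs] by blast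
    \<comment> \<open>On the vector \<open>T1 u\<close> one order of composition gives
      \<open>T2 u\<close> and the other gives zero.\<close>
    obtain u where u: "u \<in> rep_space L" "T2 u \<noteq> 0" using T(6) by blast
    have T1u: "T1 u \<in> rep_space U" using rep_homD(2)[OF T(1) u(1)] by (simp add: sp)
    have "?Q (?P (T1 u)) = T2 u" using T(4)[OF u(1)] by simp
    moreover have "?P (?Q (T1 u)) = T1 0" using T(4)[OF u(1)] T(5)[OF u(1)] by simp
    moreover have "T1 0 = 0" by (rule lin_0[OF rep_subspace[OF RL] rep_homD(1)[OF T(1)]])
    ultimately show False using com[OF T1u] u(2) by metis
  qed
  then have "m = 0 \<or> m = 1" by auto
  moreover have "H.cip (character L) (\<lambda>h. character U (\<iota> h)) = of_nat m"
    using m by (simp add: res_rep_character[abs_def])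
  ultimately show ?thesis by auto
qed

lemma (in finite_group) frobenius:
  assumes H: "finite_group H" and \<iota>: "\<iota> \<in> hom H G"
    and \<phi>: "\<And>g x. g \<in> carrier G \<Longrightarrow> x \<in> carrier G \<Longrightarrow> \<phi> (x \<otimes> g \<otimes> inv x) = \<phi> g"
  shows "cip \<phi> (ind_cf G H \<iota> \<psi>) = finite_group.cip H (\<lambda>h. \<phi> (\<iota> h)) \<psi>"
proof -
  interpret H: finite_group H by fact
  have \<iota>c: "\<iota> h \<in> carrier G" if "h \<in> carrier H" for h using \<iota> that by (auto simp: hom_def)
  have inv: "\<iota> (inv\<^bsub>H\<^esub> h) = inv (\<iota> h)" if "h \<in> carrier H" for h
    using group_hom.hom_inv[of H G \<iota> h] \<iota> that H.is_group is_group
    by (simp add: group_hom_def group_hom_axioms_def)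
  let ?N = "of_nat (card (carrier G)) :: complex" and ?M = "of_nat (card (carrier H)) :: complex"
  have "(\<Sum>g\<in>carrier G. \<phi> (inv g) * (\<Sum>x\<in>carrier G. \<Sum>h\<in>carrier H. if g \<otimes> x = x \<otimes> \<iota> h then \<psi> h else 0)) =
    (\<Sum>g\<in>carrier G. \<Sum>x\<in>carrier G. \<Sum>h\<in>carrier H. if g \<otimes> x = x \<otimes> \<iota> h then \<phi> (inv g) * \<psi> h else 0)"
    by (simp add: sum_distrib_left if_distrib cong: if_cong)
  also have "\<dots> = (\<Sum>x\<in>carrier G. \<Sum>g\<in>carrier G. \<Sum>h\<in>carrier H. if g \<otimes> x = x \<otimes> \<iota> h then \<phi> (inv g) * \<psi> h else 0)"
    by (rule sum.swap)
  also have "\<dots> = (\<Sum>x\<in>carrier G. \<Sum>h\<in>carrier H. \<Sum>g\<in>carrier G. if g \<otimes> x = x \<otimes> \<iota> h then \<phi> (inv g) * \<psi> h else 0)"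
    by (intro sum.cong refl sum.swap)
  \<comment> \<open>For given \<open>x\<close> and \<open>h\<close> only the conjugate of
    \<open>\<iota> h\<close> by \<open>x\<close> contributes, and the class function
    \<open>\<phi>\<close> does not see the conjugation.\<close>
  also have "\<dots> = (\<Sum>x\<in>carrier G. \<Sum>h\<in>carrier H. \<phi> (\<iota> (inv\<^bsub>H\<^esub> h)) * \<psi> h)"
  proof (intro sum.cong refl)
    fix x h assume x: "x \<in> carrier G" and h: "h \<in> carrier H"
    have eq: "g \<otimes> x = x \<otimes> \<iota> h \<longleftrightarrow> g = x \<otimes> \<iota> h \<otimes> inv x" if "g \<in> carrier G" for g
      using that x \<iota>c[OF h] by (metis inv_solve_right m_closed)
    have "(\<Sum>g\<in>carrier G. if g \<otimes> x = x \<otimes> \<iota> h then \<phi> (inv g) * \<psi> h else 0) =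
       (\<Sum>g\<in>carrier G. if g = x \<otimes> \<iota> h \<otimes> inv x then \<phi> (inv g) * \<psi> h else 0)"
      by (intro sum.cong refl) (simp add: eq)
    also have "\<dots> = \<phi> (inv (x \<otimes> \<iota> h \<otimes> inv x)) * \<psi> h"
      using fin x \<iota>c[OF h] by simp
    also have "inv (x \<otimes> \<iota> h \<otimes> inv x) = x \<otimes> inv (\<iota> h) \<otimes> inv x"
      using x \<iota>c[OF h] by (simp add: inv_mult_group m_assoc)
    also have "\<phi> \<dots> = \<phi> (\<iota> (inv\<^bsub>H\<^esub> h))"
      using x \<iota>c[OF h] inv[OF h] by (simp add: \<phi>)
    finally show "(\<Sum>g\<in>carrier G. if g \<otimes> x = x \<otimes> \<iota> h then \<phi> (inv g) * \<psi> h else 0) = \<phi> (\<iota> (inv\<^bsub>H\<^esub> h)) * \<psi> h" .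
  qed
  finally have "(\<Sum>g\<in>carrier G. \<phi> (inv g) * (\<Sum>x\<in>carrier G. \<Sum>h\<in>carrier H. if g \<otimes> x = x \<otimes> \<iota> h then \<psi> h else 0)) =
    ?N * (\<Sum>h\<in>carrier H. \<phi> (\<iota> (inv\<^bsub>H\<^esub> h)) * \<psi> h)" by simp
  then show ?thesis
    using card_pos H.card_pos
    by (simp add: cip_def H.cip_def ind_cf_def sum_divide_distrib[symmetric] field_simps)
qed

section \<open>Specht modules\<close>

lemma finite_group_sym: "finite_group (sym_group n)"
proof -
  interpret group "sym_group n" by (rule sym_group_is_group)
  show ?thesis
    by unfold_locales (simp add: sym_group_def finite_permutations)
qed

abbreviation Cst :: "nat list \<Rightarrow> (nat \<times> nat \<Rightarrow> nat) \<Rightarrow> (nat \<Rightarrow> nat) set"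
  where "Cst \<equiv> column_stabilizer"

abbreviation act :: "(nat \<Rightarrow> nat) \<Rightarrow> nat set list \<Rightarrow> nat set list"
  where "act \<equiv> act_tabloid"

definition tabloids :: "nat list \<Rightarrow> nat set list set"
  where "tabloids lam = {tabloid lam t |t. tableau lam t}"

text \<open>The signed column sum of James, acting on functions on tabloids. The data
  \<open>lam\<close> and \<open>t\<close> determine only the stabiliser; the argument may be a
  function on tabloids of another shape, as in the comparison of two partitions.\<close>

definition kap :: "nat list \<Rightarrow> (nat \<times> nat \<Rightarrow> nat) \<Rightarrow> (nat set list \<Rightarrow> complex) \<Rightarrow> nat set list \<Rightarrow> complex"
  where "kap lam t v = (\<lambda>T. \<Sum>\<pi>\<in>Cst lam t. of_int (sign \<pi>) * v (act (inv' \<pi>) T))"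

definition delta :: "nat set list \<Rightarrow> nat set list \<Rightarrow> complex"
  where "delta T T' = (if T' = T then 1 else 0)"

section \<open>Tableaux, tabloids and column stabilisers\<close>

lemma finite_young_diagram: "finite (young_diagram lam)"
  and card_young_diagram: "card (young_diagram lam) = sum_list lam"
proof -
  have *: "young_diagram lam = Sigma {..<length lam} (\<lambda>i. {..<lam ! i})"
    by (auto simp: young_diagram_def)
  show "finite (young_diagram lam)" unfolding * by auto
  show "card (young_diagram lam) = sum_list lam"
    unfolding * by (simp add: sum_list_sum_nth atLeast0LessThan)
qed

lemma tableau_exists: "\<exists>t. tableau lam t"
  unfolding tableau_def
  by (rule finite_same_card_bij[OF finite_young_diagram]) (auto simp: card_young_diagram)

lemma act_comp: "act (\<sigma> \<circ> \<tau>) T = act \<sigma> (act \<tau> T)"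
  by (simp add: act_tabloid_def image_comp comp_def)

lemma act_id: "act id T = T"
  by (simp add: act_tabloid_def map_idI)

lemma act_inv: "\<sigma> permutes S \<Longrightarrow> act (inv' \<sigma>) (act \<sigma> T) = T"
  and act_inv': "\<sigma> permutes S \<Longrightarrow> act \<sigma> (act (inv' \<sigma>) T) = T"
  by (simp_all add: act_comp[symmetric] permutes_inv_o act_id)

lemma act_eq_iff: "\<sigma> permutes S \<Longrightarrow> T = act \<sigma> T' \<longleftrightarrow> act (inv' \<sigma>) T = T'"
  by (auto simp: act_inv act_inv')

lemma tabloid_comp: "tabloid lam (\<sigma> \<circ> t) = act \<sigma> (tabloid lam t)"
  by (simp add: tabloid_def act_tabloid_def image_comp)

lemma tableau_comp: "tableau lam t \<Longrightarrow> \<sigma> permutes {1..sum_list lam} \<Longrightarrow> tableau lam (\<sigma> \<circ> t)"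
  unfolding tableau_def by (rule bij_betw_trans[OF _ permutes_imp_bij])

lemma cs_iff: "\<pi> \<in> Cst lam t \<longleftrightarrow> \<pi> permutes {1..sum_list lam} \<and>
    (\<forall>j. \<pi> ` t ` {c \<in> young_diagram lam. snd c = j} = t ` {c \<in> young_diagram lam. snd c = j})"
  by (simp add: column_stabilizer_def sym_group_def)

lemma cs_perm: "\<pi> \<in> Cst lam t \<Longrightarrow> \<pi> permutes {1..sum_list lam}"
  by (simp add: cs_iff)

lemma finite_cs: "finite (Cst lam t)"
  by (rule finite_subset[OF _ finite_permutations[of "{1..sum_list lam}"]]) (auto simp: cs_iff)

lemma cs_id: "id \<in> Cst lam t"
  by (simp add: cs_iff permutes_id)

lemma cs_comp: "\<pi> \<in> Cst lam t \<Longrightarrow> \<rho> \<in> Cst lam t \<Longrightarrow> \<pi> \<circ> \<rho> \<in> Cst lam t"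
  by (auto simp: cs_iff image_comp[symmetric] simp del: o_apply intro: permutes_compose)

lemma cs_inv:
  assumes "\<pi> \<in> Cst lam t"
  shows "inv' \<pi> \<in> Cst lam t"
proof -
  have "inv' \<pi> ` t ` {c \<in> young_diagram lam. snd c = j} = t ` {c \<in> young_diagram lam. snd c = j}" for j
  proof -
    let ?X = "t ` {c \<in> young_diagram lam. snd c = j}"
    have "inv' \<pi> ` ?X = inv' \<pi> ` \<pi> ` ?X" using assms by (simp add: cs_iff)
    also have "\<dots> = ?X" by (simp add: image_image permutes_inverses[OF cs_perm[OF assms]])
    finally show ?thesis .
  qed
  then show ?thesis using assms by (simp add: cs_iff permutes_inv)
qed

lemma cs_conj:
  assumes "\<pi> \<in> Cst lam t" "\<sigma> permutes {1..sum_list lam}"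
  shows "\<sigma> \<circ> \<pi> \<circ> inv' \<sigma> \<in> Cst lam (\<sigma> \<circ> t)"
proof -
  have im: "(\<sigma> \<circ> \<pi> \<circ> inv' \<sigma>) ` (\<sigma> \<circ> t) ` X = \<sigma> ` \<pi> ` t ` X" for X
    by (simp add: image_image permutes_inverses[OF assms(2)])
  have im2: "(\<sigma> \<circ> t) ` X = \<sigma> ` t ` X" for X by (simp add: image_image)
  show ?thesis
    unfolding cs_iff im unfolding im2
    using assms by (auto simp: cs_iff intro!: permutes_compose permutes_inv)
qed

lemma perm_sign: "\<pi> permutes {1..n::nat} \<Longrightarrow> \<rho> permutes {1..n} \<Longrightarrow> sign (\<pi> \<circ> \<rho>) = sign \<pi> * sign \<rho>"
  by (intro sign_compose) (auto intro: permutes_imp_permutation)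

lemma sign_inv: "\<pi> permutes {1..n::nat} \<Longrightarrow> sign (inv' \<pi>) = sign \<pi>"
  by (intro sign_inverse) (auto intro: permutes_imp_permutation)

lemma sign_sq: "sign \<pi> * sign \<pi> = (1::int)"
  by (simp add: sign_def)

lemma sum_cs_right: "\<rho> \<in> Cst lam t \<Longrightarrow> (\<Sum>\<pi>\<in>Cst lam t. F (\<pi> \<circ> \<rho>)) = (\<Sum>\<pi>\<in>Cst lam t. F \<pi>)"
  by (rule sum.reindex_bij_witness[of _ "\<lambda>\<pi>. \<pi> \<circ> inv' \<rho>" "\<lambda>\<pi>. \<pi> \<circ> \<rho>"])
     (auto simp: cs_comp cs_inv comp_assoc permutes_inv_o[OF cs_perm])

lemma sum_cs_inv: "(\<Sum>\<pi>\<in>Cst lam t. F (inv' \<pi>)) = (\<Sum>\<pi>\<in>Cst lam t. F \<pi>)"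
  by (rule sum.reindex_bij_witness[of _ "inv'" "inv'"])
     (auto simp: cs_inv permutes_inv_inv[OF cs_perm])

lemma polytabloid_kap: "polytabloid lam t = kap lam t (delta (tabloid lam t))"
proof
  fix T
  have "T = act \<pi> (tabloid lam t) \<longleftrightarrow> act (inv' \<pi>) T = tabloid lam t" if "\<pi> \<in> Cst lam t" for \<pi>
    by (rule act_eq_iff[OF cs_perm[OF that]])
  then show "polytabloid lam t T = kap lam t (delta (tabloid lam t)) T"
    unfolding polytabloid_def kap_def delta_def by (intro sum.cong refl) auto
qed

text \<open>Conjugation by \<open>\<sigma>\<close> carries the column stabiliser of \<open>t\<close>
  to that of the permuted tableau and preserves signs.\<close>

lemma act_polytabloid:
  assumes s: "\<sigma> permutes {1..sum_list lam}"
  shows "(\<lambda>T. polytabloid lam t (act (inv' \<sigma>) T)) = polytabloid lam (\<sigma> \<circ> t)"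
proof
  fix T
  have c: "inv' \<sigma> \<circ> (\<sigma> \<circ> t) = t" "inv' (inv' \<sigma>) = \<sigma>"
    using permutes_inv_o[OF s] permutes_inv_inv[OF s] by (auto simp: comp_assoc[symmetric])
  have c2: "inv' \<sigma> \<circ> \<pi> \<circ> \<sigma> \<in> Cst lam t" if "\<pi> \<in> Cst lam (\<sigma> \<circ> t)" for \<pi>
    using cs_conj[OF that permutes_inv[OF s]] unfolding c .
  have e: "inv' \<sigma> \<circ> (\<sigma> \<circ> x) = x" "\<sigma> \<circ> (inv' \<sigma> \<circ> x) = x" for x :: "nat \<Rightarrow> nat"
    using permutes_inv_o[OF s] by (auto simp: comp_assoc[symmetric])
  show "polytabloid lam t (act (inv' \<sigma>) T) = polytabloid lam (\<sigma> \<circ> t) T"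
    unfolding polytabloid_def
  proof (rule sum.reindex_bij_witness[of _ "\<lambda>\<pi>. inv' \<sigma> \<circ> \<pi> \<circ> \<sigma>" "\<lambda>\<pi>. \<sigma> \<circ> \<pi> \<circ> inv' \<sigma>"])
    fix \<pi> assume p: "\<pi> \<in> Cst lam t"
    show "\<sigma> \<circ> \<pi> \<circ> inv' \<sigma> \<in> Cst lam (\<sigma> \<circ> t)" by (rule cs_conj[OF p s])
    show "inv' \<sigma> \<circ> (\<sigma> \<circ> \<pi> \<circ> inv' \<sigma>) \<circ> \<sigma> = \<pi>"
      using permutes_inv_o[OF s] by (simp add: comp_assoc e)
    have sg: "sign (\<sigma> \<circ> \<pi> \<circ> inv' \<sigma>) = sign \<pi>"
      using s cs_perm[OF p] sign_sq[of \<sigma>]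
      by (simp add: perm_sign[of _ "sum_list lam"] permutes_compose permutes_inv sign_inv[OF s])
    have "T = act (\<sigma> \<circ> \<pi> \<circ> inv' \<sigma>) (tabloid lam (\<sigma> \<circ> t)) \<longleftrightarrow> T = act \<sigma> (act \<pi> (tabloid lam t))"
      by (simp add: tabloid_comp act_comp act_inv[OF s])
    also have "\<dots> \<longleftrightarrow> act (inv' \<sigma>) T = act \<pi> (tabloid lam t)"
      by (rule act_eq_iff[OF s])
    finally show "(if T = act (\<sigma> \<circ> \<pi> \<circ> inv' \<sigma>) (tabloid lam (\<sigma> \<circ> t)) then of_int (sign (\<sigma> \<circ> \<pi> \<circ> inv' \<sigma>)) else 0) =
       (if act (inv' \<sigma>) T = act \<pi> (tabloid lam t) then of_int (sign \<pi>) else (0::complex))"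
      using sg by simp
  next
    fix \<pi> assume "\<pi> \<in> Cst lam (\<sigma> \<circ> t)"
    then show "inv' \<sigma> \<circ> \<pi> \<circ> \<sigma> \<in> Cst lam t" by (rule c2)
    show "\<sigma> \<circ> (inv' \<sigma> \<circ> \<pi> \<circ> \<sigma>) \<circ> inv' \<sigma> = \<pi>"
      using permutes_inv_o[OF s] by (simp add: comp_assoc e)
  qed
qed

text \<open>Tableaux are total functions of which only the values on the diagram count;
  \<open>tableau_orbit\<close> moves one tableau to another only there.\<close>

lemma tableau_cong:
  assumes "\<And>c. c \<in> young_diagram lam \<Longrightarrow> t c = t' c"
  shows "polytabloid lam t = polytabloid lam t'" "tabloid lam t = tabloid lam t'"
proof -
  have im: "t ` {c \<in> young_diagram lam. P c} = t' ` {c \<in> young_diagram lam. P c}" for P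
    using assms by (intro image_cong) auto
  show "tabloid lam t = tabloid lam t'" unfolding tabloid_def im ..
  then show "polytabloid lam t = polytabloid lam t'"
    unfolding polytabloid_def column_stabilizer_def im by simp
qed

lemma tableau_orbit:
  assumes t: "tableau lam t" and t': "tableau lam t'"
  obtains \<sigma> where "\<sigma> permutes {1..sum_list lam}" "\<And>c. c \<in> young_diagram lam \<Longrightarrow> t' c = (\<sigma> \<circ> t) c"
proof -
  let ?N = "{1..sum_list lam}"
  let ?D = "young_diagram lam"
  define \<sigma> where "\<sigma> x = (if x \<in> ?N then t' (inv_into ?D t x) else x)" for x
  have "bij_betw (\<lambda>x. t' (inv_into ?D t x)) ?N ?N"
    using bij_betw_trans[OF bij_betw_inv_into[of t ?D ?N], of t' ?N] t t'
    by (simp add: tableau_def comp_def)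
  then have "bij_betw \<sigma> ?N ?N" by (rule bij_betw_cong[THEN iffD1, rotated]) (simp add: \<sigma>_def)
  then have "\<sigma> permutes ?N" by (rule bij_imp_permutes) (auto simp: \<sigma>_def)
  moreover have "t' c = (\<sigma> \<circ> t) c" if "c \<in> ?D" for c
    using t that by (auto simp: tableau_def bij_betw_def \<sigma>_def inv_into_f_f)
  ultimately show thesis using that by blast
qed

section \<open>Specht modules as representations\<close>

lemma specht_space: "rep_space (specht lam) = cfun.span {polytabloid lam t |t. tableau lam t}"
  and specht_act: "rep_act (specht lam) \<sigma> v = (\<lambda>T. v (act (inv' \<sigma>) T))"
  by (simp_all add: specht_def)

lemma specht_generators:
  assumes t: "tableau lam t"
  shows "{polytabloid lam t |t. tableau lam t} = (\<lambda>\<sigma>. polytabloid lam (\<sigma> \<circ> t)) ` {\<sigma>. \<sigma> permutes {1..sum_list lam}}"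
proof (intro equalityI subsetI)
  fix v assume "v \<in> {polytabloid lam t |t. tableau lam t}"
  then obtain t' where t': "tableau lam t'" "v = polytabloid lam t'" by blast
  obtain \<sigma> where "\<sigma> permutes {1..sum_list lam}" "\<And>c. c \<in> young_diagram lam \<Longrightarrow> t' c = (\<sigma> \<circ> t) c"
    using tableau_orbit[OF t t'(1)] by blast
  then show "v \<in> (\<lambda>\<sigma>. polytabloid lam (\<sigma> \<circ> t)) ` {\<sigma>. \<sigma> permutes {1..sum_list lam}}"
    using tableau_cong(1)[of lam t' "\<sigma> \<circ> t"] t'(2) by blast
next
  fix v assume "v \<in> (\<lambda>\<sigma>. polytabloid lam (\<sigma> \<circ> t)) ` {\<sigma>. \<sigma> permutes {1..sum_list lam}}"
  then show "v \<in> {polytabloid lam t |t. tableau lam t}" using tableau_comp[OF t] by blast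
qed

lemma tabloids_orbit:
  assumes t: "tableau lam t"
  shows "tabloids lam = (\<lambda>\<sigma>. act \<sigma> (tabloid lam t)) ` {\<sigma>. \<sigma> permutes {1..sum_list lam}}"
proof (intro equalityI subsetI)
  fix v assume "v \<in> tabloids lam"
  then obtain t' where t': "tableau lam t'" "v = tabloid lam t'" by (auto simp: tabloids_def)
  obtain \<sigma> where "\<sigma> permutes {1..sum_list lam}" "\<And>c. c \<in> young_diagram lam \<Longrightarrow> t' c = (\<sigma> \<circ> t) c"
    using tableau_orbit[OF t t'(1)] by blast
  then have "\<sigma> permutes {1..sum_list lam}" "v = act \<sigma> (tabloid lam t)"
    using tableau_cong(2)[of lam t' "\<sigma> \<circ> t"] t'(2) by (auto simp: tabloid_comp[symmetric])
  then show "v \<in> (\<lambda>\<sigma>. act \<sigma> (tabloid lam t)) ` {\<sigma>. \<sigma> permutes {1..sum_list lam}}" by blast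
next
  fix v assume "v \<in> (\<lambda>\<sigma>. act \<sigma> (tabloid lam t)) ` {\<sigma>. \<sigma> permutes {1..sum_list lam}}"
  then obtain \<sigma> where s: "\<sigma> permutes {1..sum_list lam}" "v = act \<sigma> (tabloid lam t)" by blast
  then show "v \<in> tabloids lam"
    using tableau_comp[OF t s(1)] unfolding tabloids_def s(2) tabloid_comp[symmetric] by blast
qed

lemma finite_tabloids: "finite (tabloids lam)"
  using tableau_exists[of lam] tabloids_orbit[of lam] finite_permutations[of "{1..sum_list lam}"] by auto

lemma act_tabloids:
  assumes "\<sigma> permutes {1..sum_list lam}" "T \<in> tabloids lam"
  shows "act \<sigma> T \<in> tabloids lam"
proof -
  obtain t where "tableau lam t" "T = tabloid lam t" using assms(2) by (auto simp: tabloids_def)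
  then show ?thesis
    using tableau_comp[of lam t, OF _ assms(1)] unfolding tabloids_def
    by (simp only: tabloid_comp[symmetric]) blast
qed

lemma specht_act_lin: "linear_on_space V (rep_act (specht lam) \<sigma>)"
  by (auto simp: linear_on_space_def specht_act cscale_def fun_eq_iff)

lemma specht_rep: "is_rep (sym_group (sum_list lam)) (specht lam)"
proof (rule is_repI)
  obtain t where t: "tableau lam t" using tableau_exists by blast
  show "fdim (rep_space (specht lam))"
    unfolding specht_space specht_generators[OF t]
    by (intro fdim_span finite_imageI finite_permutations) simp
  show "rep_act (specht lam) g v \<in> rep_space (specht lam)"
    if g: "g \<in> carrier (sym_group (sum_list lam))" and v: "v \<in> rep_space (specht lam)" for g v
    using v unfolding specht_space
  proof (induction rule: span_induct_mem)
    case base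
    have z: "rep_act (specht lam) g 0 = 0" by (auto simp: specht_act)
    show ?case unfolding z by (rule cfun.span_zero)
  next
    case (step c x y)
    then obtain t where t: "tableau lam t" "x = polytabloid lam t" by blast
    have gp: "g permutes {1..sum_list lam}" using g by (simp add: sym_group_def)
    have "rep_act (specht lam) g x = polytabloid lam (g \<circ> t)"
      unfolding specht_act t(2) by (rule act_polytabloid[OF gp])
    then have h: "rep_act (specht lam) g x \<in> cfun.span {polytabloid lam t |t. tableau lam t}"
      using tableau_comp[OF t(1) gp] by (auto intro!: cfun.span_base)
    have e: "rep_act (specht lam) g (cscale c x + y) = cscale c (rep_act (specht lam) g x) + rep_act (specht lam) g y"
      by (auto simp: specht_act cscale_def)
    show ?case
      unfolding e by (intro cfun.span_add cfun.span_scale h step.IH)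
  qed
  show "\<And>g. linear_on_space (rep_space (specht lam)) (rep_act (specht lam) g)" by (rule specht_act_lin)
  show "\<And>v. rep_act (specht lam) \<one>\<^bsub>sym_group (sum_list lam)\<^esub> v = v"
    by (simp add: specht_act sym_group_def act_id)
  show "\<And>g h v. g \<in> carrier (sym_group (sum_list lam)) \<Longrightarrow> h \<in> carrier (sym_group (sum_list lam)) \<Longrightarrow>
     rep_act (specht lam) (g \<otimes>\<^bsub>sym_group (sum_list lam)\<^esub> h) v = rep_act (specht lam) g (rep_act (specht lam) h v)"
    by (simp add: specht_act sym_group_def o_inv_distrib permutes_bij act_comp)
qed

lemma kap_lin: "kap lam t (\<Sum>i\<in>I. cscale (c i) (v i)) = (\<Sum>i\<in>I. cscale (c i) (kap lam t (v i)))"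
proof
  fix T
  have "kap lam t (\<Sum>i\<in>I. cscale (c i) (v i)) T =
     (\<Sum>\<pi>\<in>Cst lam t. \<Sum>i\<in>I. c i * (of_int (sign \<pi>) * v i (act (inv' \<pi>) T)))"
    unfolding kap_def by (simp add: sum_apply cscale_def sum_distrib_left mult.left_commute)
  also have "\<dots> = (\<Sum>i\<in>I. \<Sum>\<pi>\<in>Cst lam t. c i * (of_int (sign \<pi>) * v i (act (inv' \<pi>) T)))"
    by (rule sum.swap)
  also have "\<dots> = (\<Sum>i\<in>I. cscale (c i) (kap lam t (v i))) T"
    unfolding kap_def by (simp add: sum_apply cscale_def sum_distrib_left)
  finally show "kap lam t (\<Sum>i\<in>I. cscale (c i) (v i)) T = (\<Sum>i\<in>I. cscale (c i) (kap lam t (v i))) T" .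
qed

text \<open>The defining sum of \<open>kap\<close>, read as the action of a group algebra element on an arbitrary
  representation by permutations of tabloids.\<close>

lemma kap_sum: "kap lam t v = (\<Sum>\<pi>\<in>Cst lam t. cscale (of_int (sign \<pi>)) (rep_act (specht mu) \<pi> v))"
  by (auto simp: kap_def specht_act sum_apply cscale_def)

lemma kap_shift:
  assumes "\<rho> \<in> Cst lam t"
  shows "kap lam t (delta (act \<rho> T)) = cscale (of_int (sign \<rho>)) (kap lam t (delta T))"
proof
  fix T'
  have eq: "act (inv' \<pi>) T' = act \<rho> T \<longleftrightarrow> act (inv' (\<pi> \<circ> \<rho>)) T' = T" if "\<pi> \<in> Cst lam t" for \<pi>
  proof -
    have "inv' (\<pi> \<circ> \<rho>) = inv' \<rho> \<circ> inv' \<pi>"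
      using cs_perm[OF that] cs_perm[OF assms] by (simp add: o_inv_distrib permutes_bij)
    then show ?thesis
      using act_eq_iff[OF cs_perm[OF assms], of "act (inv' \<pi>) T'" T] by (simp only: act_comp)
  qed
  have sg: "sign \<pi> = sign \<rho> * sign (\<pi> \<circ> \<rho>)" if "\<pi> \<in> Cst lam t" for \<pi>
    using perm_sign[OF cs_perm[OF that] cs_perm[OF assms]] sign_sq[of \<rho>]
    by (simp add: algebra_simps)
  have "kap lam t (delta (act \<rho> T)) T' =
    (\<Sum>\<pi>\<in>Cst lam t. of_int (sign \<rho>) * (of_int (sign (\<pi> \<circ> \<rho>)) * delta T (act (inv' (\<pi> \<circ> \<rho>)) T')))"
    unfolding kap_def delta_def
  proof (intro sum.cong refl)
    fix \<pi> assume p: "\<pi> \<in> Cst lam t"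
    have "of_int (sign \<pi>) = of_int (sign \<rho>) * (of_int (sign (\<pi> \<circ> \<rho>)) :: complex)"
      using sg[OF p] by (simp only: of_int_mult)
    then show "of_int (sign \<pi>) * (if act (inv' \<pi>) T' = act \<rho> T then 1 else 0) =
      of_int (sign \<rho>) * (of_int (sign (\<pi> \<circ> \<rho>)) * (if act (inv' (\<pi> \<circ> \<rho>)) T' = T then 1 else (0::complex)))"
      using eq[OF p] by simp
  qed
  also have "\<dots> = of_int (sign \<rho>) * (\<Sum>\<pi>\<in>Cst lam t. of_int (sign \<pi>) * delta T (act (inv' \<pi>) T'))"
    unfolding sum_distrib_left[symmetric]
    by (rule arg_cong[where f = "(*) _"], rule sum_cs_right[OF assms, of "\<lambda>\<pi>. of_int (sign \<pi>) * delta T (act (inv' \<pi>) T')"])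
  finally show "kap lam t (delta (act \<rho> T)) T' = cscale (of_int (sign \<rho>)) (kap lam t (delta T)) T'"
    by (simp add: kap_def cscale_def)
qed

subsection \<open>James' combinatorial lemma\<close>

text \<open>The decreasing order of the parts enters James' argument here: the columns of the
  diagram are initial segments.\<close>

lemma column_length:
  assumes "sorted_wrt (\<ge>) lam"
  obtains n where "\<And>i. (i, c) \<in> young_diagram lam \<longleftrightarrow> i < n"
proof -
  define n where "n = card {i. (i, c) \<in> young_diagram lam}"
  let ?C = "{i. (i, c) \<in> young_diagram lam}"
  have fin: "finite ?C"
    by (rule finite_subset[of _ "{..<length lam}"]) (auto simp: young_diagram_def)
  have down: "j \<in> ?C" if "i \<in> ?C" "j \<le> i" for i j
  proof -
    have "lam ! i \<le> lam ! j" if "j < i" "i < length lam"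
      using assms that sorted_wrt_nth_less by blast
    then show ?thesis using that by (cases "j = i") (auto simp: young_diagram_def)
  qed
  have "?C = {..<n}"
  proof (cases "?C = {}")
    case False
    define M where "M = Max ?C"
    have M: "?C = {..M}"
      unfolding M_def using down[OF Max_in[OF fin False]] Max_ge[OF fin] by blast
    then have "n = Suc M" by (simp add: n_def)
    then show ?thesis using M by (simp add: lessThan_Suc_atMost)
  qed (simp add: n_def)
  then show thesis using that[of n] by blast
qed

text \<open>Comparing these numbers for all \<open>r\<close> is the dominance order.\<close>

definition psum :: "nat list \<Rightarrow> nat \<Rightarrow> nat"
  where "psum lam r = card {c \<in> young_diagram lam. fst c < r}"

lemma psum_take: "psum lam r = sum_list (take r lam)"
proof -
  have "{c \<in> young_diagram lam. fst c < r} = Sigma {..<min (length lam) r} (\<lambda>i. {..<lam ! i})"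
    by (auto simp: young_diagram_def)
  then have "psum lam r = (\<Sum>i<min (length lam) r. lam ! i)" by (simp add: psum_def)
  also have "\<dots> = sum_list (take r lam)"
    by (simp add: sum_list_sum_nth atLeast0LessThan)
  finally show ?thesis .
qed

text \<open>Consecutive differences of the partial sums recover the parts; positivity keeps trailing
  zeros from going unseen.\<close>

lemma psum_inj:
  assumes "\<forall>p\<in>set lam. 0 < p" "\<forall>p\<in>set mu. 0 < p" "\<And>r. psum lam r = psum mu r"
  shows "lam = mu"
  using assms unfolding psum_take
proof (induction lam arbitrary: mu)
  case Nil
  show ?case using Nil.prems(2) Nil.prems(3)[of 1] by (cases mu) auto
next
  case (Cons a lam)
  show ?case
  proof (cases mu)
    case Nil
    then show ?thesis using Cons.prems(1) Cons.prems(3)[of 1] by auto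
  next
    case (Cons b mu')
    have ab: "a = b" using Cons.prems(3)[of 1] Cons by simp
    have "lam = mu'"
    proof (rule Cons.IH)
      show "sum_list (take r lam) = sum_list (take r mu')" for r
        using Cons.prems(3)[of "Suc r"] Cons ab by simp
    qed (use Cons.prems Cons in auto)
    then show ?thesis using Cons ab by simp
  qed
qed

lemma transpose_cs:
  assumes t: "tableau lam t" and "(i, c) \<in> young_diagram lam" "(j, c) \<in> young_diagram lam"
  shows "transpose (t (i, c)) (t (j, c)) \<in> Cst lam t"
proof -
  let ?a = "t (i, c)" and ?b = "t (j, c)"
  have ab: "?a \<in> {1..sum_list lam}" "?b \<in> {1..sum_list lam}"
    using assms by (auto simp: tableau_def bij_betw_def)
  have "transpose ?a ?b ` t ` {x \<in> young_diagram lam. snd x = k} = t ` {x \<in> young_diagram lam. snd x = k}" for k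
  proof (cases "k = c")
    case True
    then have "?a \<in> t ` {x \<in> young_diagram lam. snd x = k}" "?b \<in> t ` {x \<in> young_diagram lam. snd x = k}"
      using assms by auto
    then show ?thesis by (simp add: transpose_image_eq)
  next
    case False
    have "inj_on t (young_diagram lam)" using t by (simp add: tableau_def bij_betw_def)
    then have "?a \<notin> t ` {x \<in> young_diagram lam. snd x = k}" "?b \<notin> t ` {x \<in> young_diagram lam. snd x = k}"
      using False assms by (auto simp: inj_on_image_mem_iff)
    then show ?thesis by (simp add: transpose_image_eq)
  qed
  then show ?thesis using ab by (simp add: cs_iff permutes_swap_id)
qed

text \<open>The transposition of two entries of one column that share a row of \<open>T\<close> lies
  in the column stabiliser and fixes \<open>T\<close>, so the signed sum equals its own
  negative.\<close>

lemma kap_zero: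
  assumes t: "tableau lam t" and ij: "(i, c) \<in> young_diagram lam" "(j, c) \<in> young_diagram lam" "i \<noteq> j"
    and same: "\<And>R. R \<in> set T \<Longrightarrow> t (i, c) \<in> R \<longleftrightarrow> t (j, c) \<in> R"
  shows "kap lam t (delta T) = 0"
proof -
  let ?\<tau> = "transpose (t (i, c)) (t (j, c))"
  have "inj_on t (young_diagram lam)" using t by (simp add: tableau_def bij_betw_def)
  then have ne: "t (i, c) \<noteq> t (j, c)" using ij by (auto simp: inj_on_def)
  have "act ?\<tau> T = T"
    unfolding act_tabloid_def using same by (intro map_idI) (simp add: transpose_image_eq)
  moreover have "sign ?\<tau> = -1" using ne by (simp add: sign_swap_id)
  ultimately have "kap lam t (delta T) = cscale (-1) (kap lam t (delta T))"
    using kap_shift[OF transpose_cs[OF t ij(1,2)], of T] by simp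
  then show ?thesis by (auto simp: cscale_def fun_eq_iff eq_neg_iff_add_eq_0)
qed

lemma row_iff:
  assumes t: "tableau mu t'" and R: "r < length mu" and x: "c \<in> young_diagram mu"
  shows "t' c \<in> tabloid mu t' ! r \<longleftrightarrow> fst c = r"
  using assms by (auto simp: tabloid_def tableau_def bij_betw_def inj_on_def)

definition row_of :: "nat list \<Rightarrow> (nat \<times> nat \<Rightarrow> nat) \<Rightarrow> nat \<Rightarrow> nat"
  where "row_of mu t' x = fst (inv_into (young_diagram mu) t' x)"

lemma row_of:
  assumes t: "tableau mu t'" and R: "r < length mu" and x: "x \<in> {1..sum_list mu}"
  shows "x \<in> tabloid mu t' ! r \<longleftrightarrow> row_of mu t' x = r"
proof -
  have "inv_into (young_diagram mu) t' x \<in> young_diagram mu" "t' (inv_into (young_diagram mu) t' x) = x"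
    using t x by (auto simp: tableau_def bij_betw_def inv_into_into f_inv_into_f)
  then show ?thesis using row_iff[OF t R, of "inv_into (young_diagram mu) t' x"] by (simp add: row_of_def)
qed

text \<open>The contrapositive of \<open>kap_zero\<close> in the form that is used: on each column
  of \<open>t\<close>, the row occupied in \<open>t'\<close> is an injective function.\<close>

lemma kap_nonzero:
  assumes t: "tableau lam t" and t': "tableau mu t'" and eqs: "sum_list lam = sum_list mu"
    and nz: "kap lam t (delta (tabloid mu t')) \<noteq> 0"
    and ij: "(i, c) \<in> young_diagram lam" "(j, c) \<in> young_diagram lam"
    and row: "row_of mu t' (t (i, c)) = row_of mu t' (t (j, c))"
  shows "i = j"
proof (rule ccontr)
  assume ne: "i \<noteq> j"
  have N: "t (i, c) \<in> {1..sum_list mu}" "t (j, c) \<in> {1..sum_list mu}"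
    using t ij eqs by (auto simp: tableau_def bij_betw_def)
  have "kap lam t (delta (tabloid mu t')) = 0"
  proof (rule kap_zero[OF t ij ne])
    fix R assume "R \<in> set (tabloid mu t')"
    then obtain r where "r < length mu" "R = tabloid mu t' ! r"
      by (auto simp: in_set_conv_nth tabloid_def)
    then show "t (i, c) \<in> R \<longleftrightarrow> t (j, c) \<in> R"
      using row_of[OF t' _ N(1)] row_of[OF t' _ N(2)] row by simp
  qed
  then show False using nz by simp
qed

text \<open>Both tableaux have the same entries, so the box of \<open>lam\<close> holding an entry
  can be matched with the box of \<open>mu\<close> holding it.\<close>

lemma count_rows:
  assumes t: "tableau lam t" and t': "tableau mu t'" and eqs: "sum_list lam = sum_list mu"
  shows "card {c \<in> young_diagram lam. row_of mu t' (t c) < r} = psum mu r"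
proof -
  let ?f = "\<lambda>c. inv_into (young_diagram mu) t' (t c)"
  have f: "bij_betw ?f (young_diagram lam) (young_diagram mu)"
    using bij_betw_trans[OF t[unfolded tableau_def eqs] bij_betw_inv_into[OF t'[unfolded tableau_def]]]
    by (simp add: comp_def)
  have "?f ` {c \<in> young_diagram lam. fst (?f c) < r} = {d \<in> ?f ` young_diagram lam. fst d < r}" by auto
  then have "bij_betw ?f {c \<in> young_diagram lam. row_of mu t' (t c) < r} {c \<in> young_diagram mu. fst c < r}"
    unfolding row_of_def bij_betw_imp_surj_on[OF f] by (intro bij_betw_subset[OF f]) auto
  then show ?thesis unfolding psum_def by (rule bij_betw_same_card)
qed

text \<open>Splits a count into columns, where \<open>column_bound\<close> is available. The number
  \<open>sum_list lam\<close> is a crude bound for the number of columns; the surplus columns are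
  empty.\<close>

lemma count_columns:
  "card {x \<in> young_diagram lam. P x} = (\<Sum>c<sum_list lam. card {i. (i, c) \<in> young_diagram lam \<and> P (i, c)})"
proof -
  have b: "c < sum_list lam" if "(i, c) \<in> young_diagram lam" for i c
    using that elem_le_sum_list[of i lam] by (auto simp: young_diagram_def)
  have fin: "finite {i. (i, c) \<in> young_diagram lam \<and> P (i, c)}" for c
    by (rule finite_subset[of _ "{..<length lam}"]) (auto simp: young_diagram_def)
  have "{x \<in> young_diagram lam. P x} =
     (\<lambda>(c, i). (i, c)) ` (Sigma {..<sum_list lam} (\<lambda>c. {i. (i, c) \<in> young_diagram lam \<and> P (i, c)}))"
    using b by (auto simp: image_iff)
  moreover have "inj_on (\<lambda>(c, i). (i, c)) A" for A :: "(nat \<times> nat) set"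
    by (auto simp: inj_on_def)
  ultimately have "card {x \<in> young_diagram lam. P x} =
      card (Sigma {..<sum_list lam} (\<lambda>c. {i. (i, c) \<in> young_diagram lam \<and> P (i, c)}))"
    by (simp add: card_image)
  then show ?thesis using fin by simp
qed

text \<open>The entries of one column lie in different rows of \<open>t'\<close>, so at most
  \<open>r\<close> of them, and at most all of them, are in the first \<open>r\<close> rows; the
  diagram itself attains this minimum.\<close>

lemma column_bound:
  assumes lam: "sorted_wrt (\<ge>) lam" and t: "tableau lam t" and t': "tableau mu t'"
    and eqs: "sum_list lam = sum_list mu" and nz: "kap lam t (delta (tabloid mu t')) \<noteq> 0"
  shows "card {i. (i, c) \<in> young_diagram lam \<and> row_of mu t' (t (i, c)) < r}
      \<le> card {i. (i, c) \<in> young_diagram lam \<and> fst (i, c) < r}"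
proof -
  obtain n where n: "\<And>i. (i, c) \<in> young_diagram lam \<longleftrightarrow> i < n" using column_length[OF lam] by blast
  let ?A = "{i. (i, c) \<in> young_diagram lam \<and> row_of mu t' (t (i, c)) < r}"
  have "inj_on (\<lambda>i. row_of mu t' (t (i, c))) ?A"
    using kap_nonzero[OF t t' eqs nz] by (auto simp: inj_on_def)
  then have "card ?A \<le> card {..<r}" by (rule card_inj_on_le) auto
  moreover have "card ?A \<le> card {..<n}" by (intro card_mono) (auto simp: n)
  moreover have "{i. (i, c) \<in> young_diagram lam \<and> fst (i, c) < r} = {..<min n r}" by (auto simp: n)
  ultimately show ?thesis by simp
qed

lemma dominance:
  assumes lam: "sorted_wrt (\<ge>) lam" and t: "tableau lam t" and t': "tableau mu t'"
    and eqs: "sum_list lam = sum_list mu" and nz: "kap lam t (delta (tabloid mu t')) \<noteq> 0"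
  shows "psum mu r \<le> psum lam r"
  unfolding count_rows[OF t t' eqs, symmetric] psum_def[of lam] count_columns[of lam]
  by (intro sum_mono column_bound[OF assms])

text \<open>The equality case of \<open>dominance\<close>. For equal shapes the bounds on the
  columns are attained, so in each column of \<open>t\<close> the rows occupied in \<open>t'\<close>
  are exactly the rows of that column; a permutation inside the columns therefore matches the two
  tabloids.\<close>

lemma kap_same_shape:
  assumes lam: "sorted_wrt (\<ge>) lam" and t: "tableau lam t" and t': "tableau lam t'"
    and nz: "kap lam t (delta (tabloid lam t')) \<noteq> 0"
  obtains \<omega> where "\<omega> \<in> Cst lam t" "tabloid lam t' = act \<omega> (tabloid lam t)"
proof -
  let ?D = "young_diagram lam"
  let ?N = "{1..sum_list lam}"
  define \<rho> where "\<rho> x = row_of lam t' (t x)" for x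
  have inj_t: "inj_on t ?D" and im_t: "t ` ?D = ?N" using t by (auto simp: tableau_def bij_betw_def)
  \<comment> \<open>Summed over all columns, both sides count the entries in the first
    \<open>r\<close> rows, so the termwise inequality \<open>column_bound\<close> is an equality in
    each column.\<close>
  have col: "card {i. (i, c) \<in> ?D \<and> \<rho> (i, c) < r} = card {i. (i, c) \<in> ?D \<and> fst (i, c) < r}"
    if "c < sum_list lam" for c r
  proof -
    have "(\<Sum>c<sum_list lam. card {i. (i, c) \<in> ?D \<and> \<rho> (i, c) < r}) =
       (\<Sum>c<sum_list lam. card {i. (i, c) \<in> ?D \<and> fst (i, c) < r})"
      unfolding \<rho>_def count_columns[symmetric, of lam "\<lambda>x. row_of lam t' (t x) < r"]
        count_columns[symmetric, of lam "\<lambda>x. fst x < r"] count_rows[OF t t' refl] psum_def ..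
    then show ?thesis
      using sum_mono_inv[of "\<lambda>c. card {i. (i, c) \<in> ?D \<and> \<rho> (i, c) < r}" "{..<sum_list lam}"
          "\<lambda>c. card {i. (i, c) \<in> ?D \<and> fst (i, c) < r}" c] column_bound[OF lam t t' refl nz] that
      unfolding \<rho>_def by auto
  qed
  have bij_col: "bij_betw (\<lambda>i. \<rho> (i, c)) {i. (i, c) \<in> ?D} {i. (i, c) \<in> ?D}" for c
  proof -
    obtain n where n: "\<And>i. (i, c) \<in> ?D \<longleftrightarrow> i < n" using column_length[OF lam] by blast
    have inj: "inj_on (\<lambda>i. \<rho> (i, c)) {..<n}"
    proof (rule inj_onI)
      fix i j assume "i \<in> {..<n}" "j \<in> {..<n}" "\<rho> (i, c) = \<rho> (j, c)"
      then show "i = j" using kap_nonzero[OF t t' refl nz, of i c j] by (simp add: \<rho>_def n)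
    qed
    have "\<rho> (i, c) < n" if "i < n" for i
    proof -
      have c: "c < sum_list lam"
        using that n[of i] elem_le_sum_list[of i lam] by (auto simp: young_diagram_def)
      \<comment> \<open>Here \<open>r\<close> is the length \<open>n\<close> of the column: all its
        entries lie in the first \<open>n\<close> rows of \<open>t'\<close>.\<close>
      have "card {i. i < n \<and> \<rho> (i, c) < n} = card {..<n}"
        using col[OF c, of n] by (simp add: n lessThan_def)
      then have "{i. i < n \<and> \<rho> (i, c) < n} = {..<n}"
        by (intro card_subset_eq) auto
      then show ?thesis using that by blast
    qed
    then have "(\<lambda>i. \<rho> (i, c)) ` {..<n} = {..<n}"
      using inj by (intro endo_inj_surj) auto
    then show ?thesis using inj n by (simp add: bij_betw_def lessThan_def)
  qed
  \<comment> \<open>\<open>q\<close> moves a box within its column to the row that its entry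
    occupies in \<open>t'\<close>; transported to entries by \<open>t\<close> it becomes the column
    permutation \<open>\<omega>\<close>.\<close>
  define q where "q x = (\<rho> x, snd x)" for x
  have qD: "q ` ?D \<subseteq> ?D"
  proof (intro image_subsetI)
    fix x assume "x \<in> ?D"
    then have "\<rho> (fst x, snd x) \<in> {i. (i, snd x) \<in> ?D}"
      using bij_betwE[OF bij_col[of "snd x"], rule_format, of "fst x"] by simp
    then show "q x \<in> ?D" by (simp add: q_def)
  qed
  have inj_q: "inj_on q ?D"
  proof (rule inj_onI)
    fix x y assume xy: "x \<in> ?D" "y \<in> ?D" "q x = q y"
    have "fst x = fst y"
      using inj_onD[OF bij_betw_imp_inj_on[OF bij_col[of "snd x"]], of "fst x" "fst y"] xy
      by (cases x; cases y) (simp add: q_def)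
    then show "x = y" using xy by (simp add: q_def prod_eq_iff)
  qed
  have q_im: "q ` ?D = ?D"
    using qD inj_q finite_young_diagram by (intro endo_inj_surj)
  define \<omega> where "\<omega> x = (if x \<in> ?N then t (q (inv_into ?D t x)) else x)" for x
  have \<omega>t: "\<omega> (t x) = t (q x)" if "x \<in> ?D" for x
    using that inj_t im_t by (auto simp: \<omega>_def inv_into_f_f)
  have "\<omega> ` t ` ?D = t ` q ` ?D"
    unfolding image_image by (intro image_cong refl \<omega>t)
  then have "\<omega> ` ?N = ?N" by (simp only: q_im im_t)
  then have "bij_betw \<omega> ?N ?N"
    by (intro bij_betw_imageI finite_surj_inj) auto
  then have perm: "\<omega> permutes ?N" by (rule bij_imp_permutes) (auto simp: \<omega>_def)
  have cs: "\<omega> \<in> Cst lam t"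
    unfolding cs_iff
  proof (intro conjI perm allI)
    fix j
    have "\<omega> ` t ` {c \<in> ?D. snd c = j} = t ` q ` {c \<in> ?D. snd c = j}"
      unfolding image_image by (intro image_cong) (auto simp: \<omega>t)
    also have "q ` {c \<in> ?D. snd c = j} = {c \<in> q ` ?D. snd c = j}"
      by (auto simp: q_def)
    also have "\<dots> = {c \<in> ?D. snd c = j}" by (simp only: q_im)
    finally show "\<omega> ` t ` {c \<in> ?D. snd c = j} = t ` {c \<in> ?D. snd c = j}" .
  qed
  have "act \<omega> (tabloid lam t') = tabloid lam t"
  proof (rule nth_equalityI)
    show "length (act \<omega> (tabloid lam t')) = length (tabloid lam t)" by (simp add: act_tabloid_def tabloid_def)
    fix r assume "r < length (act \<omega> (tabloid lam t'))"
    then have r: "r < length lam" by (simp add: act_tabloid_def tabloid_def)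
    have "tabloid lam t' ! r \<subseteq> ?N"
      using t' r by (auto simp: tabloid_def tableau_def bij_betw_def)
    have "x \<in> tabloid lam t' ! r \<longleftrightarrow> x \<in> t ` {c \<in> ?D. \<rho> c = r}" for x
    proof (cases "x \<in> ?N")
      case True
      then obtain c where c: "c \<in> ?D" "x = t c" unfolding im_t[symmetric] by blast
      have "x \<in> tabloid lam t' ! r \<longleftrightarrow> \<rho> c = r" using row_of[OF t' r True] c(2) by (simp add: \<rho>_def)
      also have "\<dots> \<longleftrightarrow> x \<in> t ` {c \<in> ?D. \<rho> c = r}" using c inj_t by (auto simp: inj_on_def)
      finally show ?thesis .
    next
      case False
      then show ?thesis using \<open>tabloid lam t' ! r \<subseteq> ?N\<close> im_t by blast
    qed
    then have "tabloid lam t' ! r = t ` {c \<in> ?D. \<rho> c = r}" by blast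
    then have "\<omega> ` (tabloid lam t' ! r) = \<omega> ` t ` {c \<in> ?D. \<rho> c = r}" by simp
    also have "\<dots> = t ` q ` {c \<in> ?D. \<rho> c = r}"
      unfolding image_image by (intro image_cong refl \<omega>t) simp
    also have "q ` {c \<in> ?D. \<rho> c = r} = {c \<in> q ` ?D. fst c = r}"
      by (auto simp: q_def)
    also have "\<dots> = {c \<in> ?D. fst c = r}" by (simp only: q_im)
    finally show "act \<omega> (tabloid lam t') ! r = tabloid lam t ! r"
      using r by (simp add: act_tabloid_def tabloid_def)
  qed
  then have "tabloid lam t' = act (inv' \<omega>) (tabloid lam t)" using act_inv[OF perm, of "tabloid lam t'"] by simp
  then show thesis using that cs_inv[OF cs] by blast
qed

lemma kap_multiple:
  assumes lam: "sorted_wrt (\<ge>) lam" and t: "tableau lam t" and T: "T \<in> tabloids lam"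
  obtains c where "kap lam t (delta T) = cscale c (polytabloid lam t)"
proof (cases "kap lam t (delta T) = 0")
  case True
  then show ?thesis using that[of 0] by (simp add: cscale_def fun_eq_iff)
next
  case False
  obtain t' where t': "tableau lam t'" "T = tabloid lam t'" using T by (auto simp: tabloids_def)
  obtain \<omega> where w: "\<omega> \<in> Cst lam t" "T = act \<omega> (tabloid lam t)"
    using kap_same_shape[OF lam t t'(1)] False unfolding t'(2) by blast
  show ?thesis
    using that[of "of_int (sign \<omega>)"] kap_shift[OF w(1), of "tabloid lam t"] w(2)
    by (simp add: polytabloid_kap)
qed


section \<open>Irreducibility of the Specht modules\<close>

lemma polytabloid_supp: "tableau lam t \<Longrightarrow> polytabloid lam t T \<noteq> 0 \<Longrightarrow> T \<in> tabloids lam"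
proof -
  assume t: "tableau lam t" and nz: "polytabloid lam t T \<noteq> 0"
  have "\<exists>\<pi>\<in>Cst lam t. T = act \<pi> (tabloid lam t)"
  proof (rule ccontr)
    assume "\<not> ?thesis"
    then have "polytabloid lam t T = 0" unfolding polytabloid_def by (intro sum.neutral) auto
    then show False using nz by simp
  qed
  then obtain \<pi> where p: "\<pi> \<in> Cst lam t" "T = act \<pi> (tabloid lam t)" by blast
  have "tabloid lam t \<in> tabloids lam" using t by (auto simp: tabloids_def)
  then show ?thesis using act_tabloids[OF cs_perm[OF p(1)]] p(2) by simp
qed

lemma specht_supp:
  assumes "v \<in> rep_space (specht lam)" "T \<notin> tabloids lam"
  shows "v T = 0"
  using assms(1) unfolding specht_space
proof (induction rule: span_induct_mem)
  case (step c x y)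
  then obtain t where "tableau lam t" "x = polytabloid lam t" by blast
  then have "x T = 0" using polytabloid_supp assms(2) by blast
  then show ?case using step.IH by (simp add: cscale_def)
qed simp

lemma delta_expand:
  assumes "\<And>T. T \<notin> tabloids lam \<Longrightarrow> v T = 0"
  shows "v = (\<Sum>T\<in>tabloids lam. cscale (v T) (delta T))"
proof
  fix T
  have "(\<Sum>T'\<in>tabloids lam. cscale (v T') (delta T')) T = (\<Sum>T'\<in>tabloids lam. if T = T' then v T' else 0)"
    unfolding sum_apply by (intro sum.cong refl) (simp add: cscale_def delta_def)
  also have "\<dots> = v T" using assms[of T] by (simp add: finite_tabloids)
  finally show "v T = (\<Sum>T\<in>tabloids lam. cscale (v T) (delta T)) T" by simp
qed

lemma kap_expand:
  assumes "v \<in> rep_space (specht mu)"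
  shows "kap lam t v = (\<Sum>T\<in>tabloids mu. cscale (v T) (kap lam t (delta T)))"
  by (subst delta_expand[OF specht_supp[OF assms]]) (simp_all add: kap_lin)

text \<open>The signed column sum of \<open>t\<close> takes each tabloid of the same shape to a
  multiple of one polytabloid, so it collapses the whole module to a line.\<close>

lemma kap_specht:
  assumes lam: "sorted_wrt (\<ge>) lam" and t: "tableau lam t" and v: "v \<in> rep_space (specht lam)"
  obtains c where "kap lam t v = cscale c (polytabloid lam t)"
proof -
  have "\<forall>T\<in>tabloids lam. \<exists>c. kap lam t (delta T) = cscale c (polytabloid lam t)"
    using kap_multiple[OF lam t] by blast
  then obtain c where c: "\<And>T. T \<in> tabloids lam \<Longrightarrow> kap lam t (delta T) = cscale (c T) (polytabloid lam t)"
    by metis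
  have "kap lam t v = (\<Sum>T\<in>tabloids lam. cscale (v T * c T) (polytabloid lam t))"
    unfolding kap_expand[OF v] by (intro sum.cong refl) (simp add: c)
  then show thesis using that[of "\<Sum>T\<in>tabloids lam. v T * c T"] by (simp add: cfun.scale_sum_left)
qed

text \<open>A column permutation that fixes the tabloid of \<open>t\<close> preserves both the row
  and the column of each entry, so it is the identity; the tabloid occurs once in its
  polytabloid.\<close>

lemma polytabloid_nonzero:
  assumes t: "tableau lam t"
  shows "polytabloid lam t (tabloid lam t) = 1"
proof -
  let ?D = "young_diagram lam"
  have inj_t: "inj_on t ?D" and im_t: "t ` ?D = {1..sum_list lam}"
    using t by (auto simp: tableau_def bij_betw_def)
  have "\<pi> = id" if p: "\<pi> \<in> Cst lam t" and fx: "tabloid lam t = act \<pi> (tabloid lam t)" for \<pi>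
  proof
    fix x
    show "\<pi> x = id x"
    proof (cases "x \<in> {1..sum_list lam}")
      case False
      then show ?thesis using cs_perm[OF p] by (simp add: permutes_not_in)
    next
      case True
      then obtain c where c: "c \<in> ?D" "x = t c" unfolding im_t[symmetric] by blast
      have col: "\<pi> (t c) \<in> t ` {d \<in> ?D. snd d = snd c}"
        using p c(1) by (force simp: cs_iff)
      have r: "fst c < length lam" using c(1) by (auto simp: young_diagram_def)
      have "tabloid lam t ! fst c = \<pi> ` (tabloid lam t ! fst c)"
        using arg_cong[OF fx, of "\<lambda>T. T ! fst c"] r by (simp add: act_tabloid_def tabloid_def)
      moreover have "t c \<in> tabloid lam t ! fst c" using row_iff[OF t r c(1)] by simp
      ultimately have row: "\<pi> (t c) \<in> tabloid lam t ! fst c" by blast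
      obtain d where d: "d \<in> ?D" "snd d = snd c" "\<pi> (t c) = t d" using col by blast
      have "fst d = fst c" using row row_iff[OF t r d(1)] d(3) by simp
      then have "d = c" using d(2) by (simp add: prod_eq_iff)
      then show ?thesis using d(3) c(2) by simp
    qed
  qed
  then have "polytabloid lam t (tabloid lam t) = (\<Sum>\<pi>\<in>Cst lam t. if \<pi> = id then 1 else 0)"
    unfolding polytabloid_def by (intro sum.cong refl) (auto simp: act_id sign_id)
  then show ?thesis using cs_id finite_cs by simp
qed

lemma polytabloid_mem: "tableau lam t \<Longrightarrow> polytabloid lam t \<in> rep_space (specht lam)"
  unfolding specht_space by (auto intro: cfun.span_base)

lemma partitionsD:
  assumes "lam \<in> partitions n"
  shows "sorted_wrt (\<ge>) lam" "\<forall>p\<in>set lam. 0 < p" "sum_list lam = n"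
  using assms by (auto simp: partitions_def)

lemma kap_invariant:
  assumes U: "invariant_subspace (sym_group (sum_list lam)) (specht mu) U" and u: "u \<in> U"
  shows "kap lam t u \<in> U"
  unfolding kap_sum[of lam t u mu]
  using U u by (intro cfun.subspace_sum cfun.subspace_scale)
    (auto simp: invariant_subspace_def sym_group_def image_subset_iff dest!: cs_perm)

text \<open>The inverse of a column permutation has the same sign, so the signed column sum is
  self-adjoint for the bilinear pairing of functions on tabloids, and its coefficient at the tabloid
  of \<open>t\<close> is the pairing with the polytabloid of \<open>t\<close>.\<close>

lemma kap_pairing:
  assumes u: "u \<in> rep_space (specht lam)" and t: "tableau lam t"
  shows "kap lam t u (tabloid lam t) = (\<Sum>T\<in>tabloids lam. u T * polytabloid lam t T)"
proof -
  have tt: "tabloid lam t \<in> tabloids lam" using t by (auto simp: tabloids_def)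
  have "(\<Sum>T\<in>tabloids lam. u T * polytabloid lam t T) =
    (\<Sum>T\<in>tabloids lam. \<Sum>\<pi>\<in>Cst lam t. if T = act \<pi> (tabloid lam t) then u T * of_int (sign \<pi>) else 0)"
    unfolding polytabloid_def by (simp add: sum_distrib_left if_distrib cong: if_cong)
  also have "\<dots> = (\<Sum>\<pi>\<in>Cst lam t. \<Sum>T\<in>tabloids lam. if T = act \<pi> (tabloid lam t) then u T * of_int (sign \<pi>) else 0)"
    by (rule sum.swap)
  also have "\<dots> = (\<Sum>\<pi>\<in>Cst lam t. u (act \<pi> (tabloid lam t)) * of_int (sign \<pi>))"
    using act_tabloids[OF cs_perm tt] by (intro sum.cong refl) (simp add: finite_tabloids)
  also have "\<dots> = (\<Sum>\<pi>\<in>Cst lam t. u (act (inv' \<pi>) (tabloid lam t)) * of_int (sign (inv' \<pi>)))"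
    by (rule sum_cs_inv[symmetric])
  also have "\<dots> = kap lam t u (tabloid lam t)"
    unfolding kap_def by (intro sum.cong refl) (simp add: sign_inv[OF cs_perm])
  finally show ?thesis by simp
qed

text \<open>Polytabloids have real coefficients. Stability under conjugation is what turns
  orthogonality for the bilinear pairing into the vanishing of a sum of squares.\<close>

lemma specht_cnj: "v \<in> rep_space (specht lam) \<Longrightarrow> (\<lambda>T. cnj (v T)) \<in> rep_space (specht lam)"
  unfolding specht_space
proof (induction rule: span_induct_mem)
  case base
  have "(\<lambda>T. cnj (0 T)) = (0 :: nat set list \<Rightarrow> complex)" by auto
  then show ?case by (simp only: cfun.span_zero)
next
  case (step c x y)
  then obtain t where t: "tableau lam t" "x = polytabloid lam t" by blast
  have "cnj (x T) = x T" for T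
    unfolding t(2) polytabloid_def by (simp add: if_distrib cong: if_cong)
  then have "(\<lambda>T. cnj ((cscale c x + y) T)) = cscale (cnj c) x + (\<lambda>T. cnj (y T))"
    by (auto simp: cscale_def)
  then show ?case
    using cfun.span_add[OF cfun.span_scale[OF cfun.span_base[OF step.hyps(1)]] step.IH] by (simp only:)
qed

text \<open>James' submodule theorem in characteristic zero. If some signed column sum does not kill
  \<open>U\<close>, its value is a nonzero multiple of a polytabloid, which generates the module. If
  all of them kill \<open>U\<close>, then by \<open>kap_pairing\<close> every element of
  \<open>U\<close> is orthogonal to all polytabloids, hence to its own conjugate, and
  vanishes.\<close>

lemma specht_irreducible:
  assumes lam: "lam \<in> partitions n"
  shows "irreducible_rep (sym_group n) (specht lam)"
  unfolding irreducible_rep_def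
proof (intro conjI allI impI)
  note L = partitionsD[OF lam]
  show "is_rep (sym_group n) (specht lam)" using specht_rep[of lam] L(3) by simp
  obtain t where t: "tableau lam t" using tableau_exists by blast
  show "rep_space (specht lam) \<noteq> {0}"
    using polytabloid_mem[OF t] polytabloid_nonzero[OF t] by auto
  fix U assume "invariant_subspace (sym_group n) (specht lam) U"
  then have U: "invariant_subspace (sym_group (sum_list lam)) (specht lam) U" using L(3) by simp
  then have sub: "cfun.subspace U" "U \<subseteq> rep_space (specht lam)" by (auto simp: invariant_subspace_def)
  show "U = {0} \<or> U = rep_space (specht lam)"
  proof (cases "\<exists>u\<in>U. \<exists>t. tableau lam t \<and> kap lam t u \<noteq> 0")
    case True
    then obtain u t where u: "u \<in> U" "tableau lam t" "kap lam t u \<noteq> 0" by blast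
    obtain c where c: "kap lam t u = cscale c (polytabloid lam t)"
      using kap_specht[OF L(1) u(2)] sub u(1) by blast
    have "c \<noteq> 0" using c u(3) by (auto simp: cscale_def)
    have "cscale c (polytabloid lam t) \<in> U" using kap_invariant[OF U u(1), of t] c by simp
    then have "cscale (1 / c) (cscale c (polytabloid lam t)) \<in> U" by (rule cfun.subspace_scale[OF sub(1)])
    then have e: "polytabloid lam t \<in> U" using \<open>c \<noteq> 0\<close> by (simp add: cscale_def)
    have "polytabloid lam t' \<in> U" if t': "tableau lam t'" for t'
    proof -
      obtain \<sigma> where s: "\<sigma> permutes {1..sum_list lam}" "\<And>c. c \<in> young_diagram lam \<Longrightarrow> t' c = (\<sigma> \<circ> t) c"
        using tableau_orbit[OF u(2) t'] by blast
      have eq: "rep_act (specht lam) \<sigma> (polytabloid lam t) = polytabloid lam t'"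
        unfolding specht_act act_polytabloid[OF s(1)]
        by (rule tableau_cong(1)[symmetric]) (rule s(2))
      have "rep_act (specht lam) \<sigma> (polytabloid lam t) \<in> U"
        using U e s(1) by (auto simp: invariant_subspace_def sym_group_def image_subset_iff)
      then show ?thesis unfolding eq .
    qed
    then have "rep_space (specht lam) \<subseteq> U"
      unfolding specht_space using sub by (intro cfun.span_minimal) auto
    then show ?thesis using sub by blast
  next
    case False
    have "u = 0" if u: "u \<in> U" for u
    proof -
      have uS: "u \<in> rep_space (specht lam)" using u sub by blast
      have gen: "(\<Sum>T\<in>tabloids lam. u T * polytabloid lam t T) = 0" if "tableau lam t" for t
        using kap_pairing[OF uS that] False u that by auto
      have all: "(\<Sum>T\<in>tabloids lam. u T * w T) = 0" if "w \<in> rep_space (specht lam)" for w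
        using that unfolding specht_space
      proof (induction rule: span_induct_mem)
        case (step c x y)
        then have "(\<Sum>T\<in>tabloids lam. u T * x T) = 0" using gen by auto
        moreover have "(\<Sum>T\<in>tabloids lam. u T * (cscale c x + y) T) =
          c * (\<Sum>T\<in>tabloids lam. u T * x T) + (\<Sum>T\<in>tabloids lam. u T * y T)"
          by (simp add: cscale_def sum_distrib_left sum.distrib[symmetric] algebra_simps)
        ultimately show ?case using step.IH by simp
      qed simp
      have "(\<Sum>T\<in>tabloids lam. u T * cnj (u T)) = 0" by (rule all[OF specht_cnj[OF uS]])
      then have "complex_of_real (\<Sum>T\<in>tabloids lam. (cmod (u T))\<^sup>2) = 0"
        by (simp only: complex_norm_square of_real_sum)
      then have "(\<Sum>T\<in>tabloids lam. (cmod (u T))\<^sup>2) = 0" by (simp only: of_real_eq_0_iff)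
      then have "\<forall>T\<in>tabloids lam. (cmod (u T))\<^sup>2 = 0"
        by (subst (asm) sum_nonneg_eq_0_iff) (auto simp: finite_tabloids)
      then have "u T = 0" for T using specht_supp[OF uS, of T] by (cases "T \<in> tabloids lam") auto
      then show ?thesis by auto
    qed
    then show ?thesis using sub cfun.subspace_0 by blast
  qed
qed

section \<open>Homomorphisms between Specht modules\<close>

lemma polytabloid_sign:
  assumes p: "\<pi> \<in> Cst lam t"
  shows "rep_act (specht lam) \<pi> (polytabloid lam t) = cscale (of_int (sign \<pi>)) (polytabloid lam t)"
proof
  fix T
  have eq: "act (inv' \<pi>) T = act \<rho> X \<longleftrightarrow> T = act (\<pi> \<circ> \<rho>) X" for \<rho> X
    using act_eq_iff[OF cs_perm[OF p], of T "act \<rho> X"] by (simp add: act_comp)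
  have "rep_act (specht lam) \<pi> (polytabloid lam t) T =
    (\<Sum>\<rho>\<in>Cst lam t. if T = act (\<pi> \<circ> \<rho>) (tabloid lam t) then of_int (sign \<pi>) * of_int (sign (\<pi> \<circ> \<rho>)) else 0)"
    unfolding specht_act polytabloid_def eq
  proof (intro sum.cong refl if_cong)
    fix \<rho> assume r: "\<rho> \<in> Cst lam t"
    have "sign \<rho> = sign \<pi> * sign (\<pi> \<circ> \<rho>)"
      using perm_sign[OF cs_perm[OF p] cs_perm[OF r]] sign_sq[of \<pi>] by (simp add: mult.assoc[symmetric])
    then show "of_int (sign \<rho>) = of_int (sign \<pi>) * (of_int (sign (\<pi> \<circ> \<rho>)) :: complex)"
      by (simp only: of_int_mult)
  qed
  also have "\<dots> = (\<Sum>\<rho>\<in>Cst lam t. if T = act \<rho> (tabloid lam t) then of_int (sign \<pi>) * of_int (sign \<rho>) else 0)"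
    using p by (intro sum.reindex_bij_witness[of _ "\<lambda>\<rho>. inv' \<pi> \<circ> \<rho>" "\<lambda>\<rho>. \<pi> \<circ> \<rho>"])
      (auto simp: cs_comp cs_inv comp_assoc[symmetric] permutes_inv_o[OF cs_perm[OF p]])
  also have "\<dots> = cscale (of_int (sign \<pi>)) (polytabloid lam t) T"
    by (simp add: cscale_def polytabloid_def sum_distrib_left if_distrib cong: if_cong)
  finally show "rep_act (specht lam) \<pi> (polytabloid lam t) T = cscale (of_int (sign \<pi>)) (polytabloid lam t) T" .
qed

text \<open>Column permutations act on the polytabloid by their sign, so every sign is
  squared.\<close>

lemma kap_polytabloid:
  "kap lam t (polytabloid lam t) = cscale (of_nat (card (Cst lam t))) (polytabloid lam t)"
proof -
  have "kap lam t (polytabloid lam t) =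
     (\<Sum>\<pi>\<in>Cst lam t. cscale (of_int (sign \<pi>)) (cscale (of_int (sign \<pi>)) (polytabloid lam t)))"
    unfolding kap_sum[of lam t _ lam] by (intro sum.cong refl) (simp add: polytabloid_sign)
  also have "\<dots> = (\<Sum>\<pi>\<in>Cst lam t. polytabloid lam t)"
    by (intro sum.cong refl) (simp add: of_int_mult[symmetric] sign_sq)
  also have "\<dots> = cscale (of_nat (card (Cst lam t))) (polytabloid lam t)"
    by (auto simp: sum_apply cscale_def)
  finally show ?thesis .
qed

text \<open>A signed column sum multiplies its polytabloid by a nonzero number, hence also the image
  of the polytabloid under the injective \<open>T\<close>. So it does not vanish on all tabloids of
  shape \<open>mu\<close>, and \<open>dominance\<close> applies.\<close>

lemma specht_hom_dominance:
  assumes lam: "lam \<in> partitions n" and mu: "mu \<in> partitions n"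
    and T: "rep_hom (sym_group n) (specht lam) (specht mu) T" "inj_on T (rep_space (specht lam))"
  shows "psum mu r \<le> psum lam r"
proof -
  note L = partitionsD[OF lam] and M = partitionsD[OF mu]
  note T' = rep_homD[OF T(1)]
  obtain t where t: "tableau lam t" using tableau_exists by blast
  let ?e = "polytabloid lam t"
  note eS = polytabloid_mem[OF t]
  have V: "cfun.subspace (rep_space (specht lam))" by (rule rep_subspace[OF specht_rep])
  have "T ?e \<noteq> 0"
  proof
    assume "T ?e = 0"
    then have "?e = 0"
      using lin_0[OF V T'(1)] T(2) eS cfun.subspace_0[OF V] by (metis inj_onD)
    then show False using polytabloid_nonzero[OF t] by simp
  qed
  have cN: "\<pi> \<in> carrier (sym_group n)" if "\<pi> \<in> Cst lam t" for \<pi>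
    using cs_perm[OF that] L(3) by (simp add: sym_group_def)
  have actS: "rep_act (specht lam) \<pi> ?e \<in> rep_space (specht lam)" if "\<pi> \<in> Cst lam t" for \<pi>
    using rep_closed[OF specht_rep, of \<pi> lam] cN[OF that] eS L(3) by simp
  have "kap lam t (T ?e) = (\<Sum>\<pi>\<in>Cst lam t. cscale (of_int (sign \<pi>)) (rep_act (specht mu) \<pi> (T ?e)))"
    by (rule kap_sum)
  also have "\<dots> = (\<Sum>\<pi>\<in>Cst lam t. T (cscale (of_int (sign \<pi>)) (rep_act (specht lam) \<pi> ?e)))"
    using T'(3)[OF cN eS] actS by (intro sum.cong refl) (simp add: lin_scale[OF T'(1)])
  also have "\<dots> = T (kap lam t ?e)"
    unfolding kap_sum[of lam t _ lam] using actS V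
    by (intro lin_sum[OF V T'(1), symmetric] cfun.subspace_scale)
  also have "\<dots> = cscale (of_nat (card (Cst lam t))) (T ?e)"
    unfolding kap_polytabloid by (rule lin_scale[OF T'(1) eS])
  finally have "kap lam t (T ?e) \<noteq> 0"
    using \<open>T ?e \<noteq> 0\<close> finite_cs[of lam t] cs_id[of lam t] by auto
  have "\<exists>X\<in>tabloids mu. kap lam t (delta X) \<noteq> 0"
  proof (rule ccontr)
    assume "\<not> ?thesis"
    then have "kap lam t (T ?e) = 0"
      unfolding kap_expand[OF T'(2)[OF eS]] by (intro sum.neutral) (metis cfun.scale_zero_right)
    then show False using \<open>kap lam t (T ?e) \<noteq> 0\<close> by simp
  qed
  then obtain X where X: "X \<in> tabloids mu" "kap lam t (delta X) \<noteq> 0" by blast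
  then obtain t' where "tableau mu t'" "X = tabloid mu t'" by (auto simp: tabloids_def)
  then show ?thesis using dominance[OF L(1) t, of mu t'] X L(3) M(3) by simp
qed

lemma specht_iso_eq:
  assumes lam: "lam \<in> partitions n" and mu: "mu \<in> partitions n"
    and iso: "rep_iso (sym_group n) (specht lam) (specht mu)"
  shows "lam = mu"
proof (rule psum_inj)
  note L = partitionsD[OF lam] and M = partitionsD[OF mu]
  have iso': "rep_iso (sym_group n) (specht mu) (specht lam)"
    using rep_iso_sym[OF _ _ iso] specht_rep[of lam] specht_rep[of mu] L(3) M(3) by simp
  show "psum lam r = psum mu r" for r
    using specht_hom_dominance[OF lam mu, of _ r] specht_hom_dominance[OF mu lam, of _ r] iso iso'
    unfolding rep_iso_alt bij_betw_def by (meson order_antisym)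
qed (use partitionsD[OF lam] partitionsD[OF mu] in auto)

lemma specht_cip:
  assumes lam: "lam \<in> partitions n" and mu: "mu \<in> partitions n"
  shows "finite_group.cip (sym_group n) (character (specht lam)) (character (specht mu)) = (if lam = mu then 1 else 0)"
proof -
  interpret finite_group "sym_group n" by (rule finite_group_sym)
  note irr = specht_irreducible[OF lam] specht_irreducible[OF mu]
  have reps: "is_rep (sym_group n) (specht lam)" "is_rep (sym_group n) (specht mu)"
    using irr by (auto simp: irreducible_rep_def)
  show ?thesis
  proof (cases "lam = mu")
    case True
    then show ?thesis using irreducible_cip[OF irr(1)] by simp
  next
    case False
    have "cip (character (specht lam)) (character (specht mu)) = 0"
    proof (rule ccontr)
      assume nz: "\<not> ?thesis"
      obtain T where T: "rep_hom (sym_group n) (specht lam) (specht mu) T" "\<exists>u\<in>rep_space (specht lam). T u \<noteq> 0"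
        by (rule cip_hom[OF irr(1) reps(2) nz])
      have "invariant_subspace (sym_group n) (specht mu) (T ` rep_space (specht lam))"
        by (rule image_invariant[OF reps T(1)])
      moreover have "T ` rep_space (specht lam) \<noteq> {0}" using T(2) by auto
      ultimately have "T ` rep_space (specht lam) = rep_space (specht mu)"
        using irr(2) by (auto simp: irreducible_rep_def)
      then have "rep_iso (sym_group n) (specht lam) (specht mu)"
        unfolding rep_iso_alt bij_betw_def using T irreducible_hom_inj[OF irr(1) reps(2) T] by blast
      then show False using specht_iso_eq[OF lam mu] False by blast
    qed
    then show ?thesis using False by simp
  qed
qed

section \<open>Conjugacy in the symmetric groups\<close>

lemma in_orbit_iff: "permutation f \<Longrightarrow> y \<in> orbit f x \<longleftrightarrow> (\<exists>n. y = (f ^^ n) x)"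
  by (auto simp: orbit_altdef_permutation)

lemma orbit_eq: "permutation f \<Longrightarrow> y \<in> orbit f x \<Longrightarrow> orbit f y = orbit f x"
  by (rule orbit_cyclic_eq3[OF cyclic_on_orbit'])

lemma funpow_permutes: "f permutes A \<Longrightarrow> x \<in> A \<Longrightarrow> (f ^^ n) x \<in> A"
  by (induction n) (auto simp: permutes_in_image)

text \<open>A conjugating permutation is obtained by matching the orbits of \<open>\<sigma>\<close> and \<open>\<tau>\<close>, started at
  the representatives \<open>x i\<close> and \<open>y i\<close>.\<close>

lemma conjugating_permutation:
  assumes \<sigma>: "\<sigma> permutes A" and \<tau>: "\<tau> permutes A" and fin: "finite A"
    and x: "\<And>i. i \<in> I \<Longrightarrow> x i \<in> A" and y: "\<And>i. i \<in> I \<Longrightarrow> y i \<in> A"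
    and cx: "\<And>a. a \<in> A \<Longrightarrow> \<exists>i\<in>I. \<exists>n. a = (\<sigma> ^^ n) (x i)"
    and comp: "\<And>i j m n. i \<in> I \<Longrightarrow> j \<in> I \<Longrightarrow> (\<sigma> ^^ m) (x i) = (\<sigma> ^^ n) (x j) \<longleftrightarrow> (\<tau> ^^ m) (y i) = (\<tau> ^^ n) (y j)"
  obtains h where "h permutes A" "h \<circ> \<sigma> = \<tau> \<circ> h" "\<And>i. i \<in> I \<Longrightarrow> h (x i) = y i"
proof -
  \<comment> \<open>The \<open>n\<close>-th point of the orbit of \<open>x i\<close> goes to the
    \<open>n\<close>-th point of the orbit of \<open>y i\<close>; the assumption \<open>comp\<close>
    makes this independent of the description and injective.\<close>
  define h where "h a = (if a \<in> A then SOME b. \<exists>i\<in>I. \<exists>n. a = (\<sigma> ^^ n) (x i) \<and> b = (\<tau> ^^ n) (y i) else a)" for a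
  have hx: "h ((\<sigma> ^^ n) (x i)) = (\<tau> ^^ n) (y i)" if i: "i \<in> I" for i n
  proof -
    have "(\<sigma> ^^ n) (x i) \<in> A" using funpow_permutes[OF \<sigma> x[OF i]] .
    moreover have "(SOME b. \<exists>j\<in>I. \<exists>m. (\<sigma> ^^ n) (x i) = (\<sigma> ^^ m) (x j) \<and> b = (\<tau> ^^ m) (y j)) = (\<tau> ^^ n) (y i)"
    proof (rule some_equality)
      show "\<exists>j\<in>I. \<exists>m. (\<sigma> ^^ n) (x i) = (\<sigma> ^^ m) (x j) \<and> (\<tau> ^^ n) (y i) = (\<tau> ^^ m) (y j)" using i by blast
    next
      fix b assume "\<exists>j\<in>I. \<exists>m. (\<sigma> ^^ n) (x i) = (\<sigma> ^^ m) (x j) \<and> b = (\<tau> ^^ m) (y j)"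
      then show "b = (\<tau> ^^ n) (y i)" using comp[OF i] by metis
    qed
    ultimately show ?thesis by (simp add: h_def)
  qed
  have "inj_on h A"
  proof (rule inj_onI)
    fix a b assume "a \<in> A" "b \<in> A" "h a = h b"
    moreover obtain i n where i: "i \<in> I" "a = (\<sigma> ^^ n) (x i)" using cx \<open>a \<in> A\<close> by blast
    moreover obtain j m where j: "j \<in> I" "b = (\<sigma> ^^ m) (x j)" using cx \<open>b \<in> A\<close> by blast
    ultimately show "a = b" using comp[OF i(1) j(1)] hx by simp
  qed
  moreover have "h ` A \<subseteq> A"
    using cx hx funpow_permutes[OF \<tau> y] by fastforce
  ultimately have "bij_betw h A A"
    using fin by (simp add: bij_betw_def endo_inj_surj)
  then have "h permutes A" by (rule bij_imp_permutes) (simp add: h_def)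
  moreover have "h \<circ> \<sigma> = \<tau> \<circ> h"
  proof
    fix a
    show "(h \<circ> \<sigma>) a = (\<tau> \<circ> h) a"
    proof (cases "a \<in> A")
      case True
      then obtain i n where i: "i \<in> I" "a = (\<sigma> ^^ n) (x i)" using cx by blast
      then show ?thesis using hx[OF i(1), of n] hx[OF i(1), of "Suc n"] by simp
    next
      case False
      then show ?thesis using \<sigma> \<tau> by (simp add: h_def permutes_not_in)
    qed
  qed
  moreover have "h (x i) = y i" if "i \<in> I" for i using hx[OF that, of 0] by simp
  ultimately show thesis using that by blast
qed

text \<open>A prescribed set \<open>X0\<close> has to survive among the representatives. The choice
  \<open>pick\<close> depends on the orbit alone, so it selects a single point in each orbit that
  \<open>X0\<close> misses.\<close>

lemma orbit_representatives:
  assumes \<sigma>: "\<sigma> permutes A" and fin: "finite A" and X0: "X0 \<subseteq> A"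
    and d0: "\<And>x y. x \<in> X0 \<Longrightarrow> y \<in> X0 \<Longrightarrow> y \<in> orbit \<sigma> x \<Longrightarrow> x = y"
  obtains X where "X0 \<subseteq> X" "X \<subseteq> A" "\<And>a. a \<in> A \<Longrightarrow> \<exists>x\<in>X. a \<in> orbit \<sigma> x"
    "\<And>x y. x \<in> X \<Longrightarrow> y \<in> X \<Longrightarrow> y \<in> orbit \<sigma> x \<Longrightarrow> x = y"
proof -
  have p: "permutation \<sigma>" using \<sigma> fin permutation_permutes by blast
  note self = permutation_self_in_orbit[OF p]
  define pick where "pick z = (SOME x. x \<in> orbit \<sigma> z)" for z
  have pick: "pick z \<in> orbit \<sigma> z" for z unfolding pick_def by (rule someI[of _ z]) (rule self)
  have pick_eq: "pick z = pick w" if "z \<in> orbit \<sigma> w" for z w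
    unfolding pick_def orbit_eq[OF p that] ..
  let ?P = "{z \<in> A. orbit \<sigma> z \<inter> X0 = {}}"
  define X where "X = X0 \<union> pick ` ?P"
  have XA: "X \<subseteq> A" using X0 pick permutes_orbit_subset[OF \<sigma>] unfolding X_def by blast
  have cover: "\<exists>x\<in>X. a \<in> orbit \<sigma> x" if "a \<in> A" for a
  proof (cases "orbit \<sigma> a \<inter> X0 = {}")
    case True
    then have "pick a \<in> X" using that by (auto simp: X_def)
    moreover have "a \<in> orbit \<sigma> (pick a)" using orbit_eq[OF p pick] self by blast
    ultimately show ?thesis by blast
  next
    case False
    then obtain x where "x \<in> orbit \<sigma> a" "x \<in> X0" by blast
    then show ?thesis using orbit_eq[OF p, of x a] self[of a] by (auto simp: X_def)
  qed
  have P: "x = pick x" "orbit \<sigma> x \<inter> X0 = {}" if xP: "x \<in> pick ` ?P" for x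
  proof -
    obtain z where z: "x = pick z" "orbit \<sigma> z \<inter> X0 = {}" using xP by blast
    have "x \<in> orbit \<sigma> z" using z pick by simp
    then show "x = pick x" "orbit \<sigma> x \<inter> X0 = {}" using pick_eq[of x z] orbit_eq[OF p, of x z] z by auto
  qed
  have "x = y" if x: "x \<in> X" and y: "y \<in> X" and xy: "y \<in> orbit \<sigma> x" for x y
  proof -
    have yx: "x \<in> orbit \<sigma> y" using orbit_eq[OF p xy] self by blast
    consider "x \<in> X0" "y \<in> X0" | "x \<in> pick ` ?P" "y \<in> pick ` ?P" | "x \<in> pick ` ?P" "y \<in> X0" | "x \<in> X0" "y \<in> pick ` ?P"
      using x y by (auto simp: X_def)
    then show ?thesis
    proof cases
      case 1
      then show ?thesis using d0 xy by blast
    next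
      case 2
      then show ?thesis using P(1) pick_eq[OF xy] by metis
    next
      case 3
      then show ?thesis using P(2) xy by blast
    next
      case 4
      then show ?thesis using P(2) yx by blast
    qed
  qed
  note disj = this
  have "X0 \<subseteq> X" by (auto simp: X_def)
  then show thesis using XA cover disj by (rule that)
qed

text \<open>Two powers agree at a point exactly when the cycle length, which is the size of the
  orbit, divides the difference of the exponents.\<close>

lemma funpow_eq_iff:
  assumes "permutation \<sigma>" "permutation \<tau>" "card (orbit \<sigma> x) = card (orbit \<tau> y)"
  shows "(\<sigma> ^^ m) x = (\<sigma> ^^ n) x \<longleftrightarrow> (\<tau> ^^ m) y = (\<tau> ^^ n) y"
proof -
  have card: "card (orbit f z) = least_power f z" if f: "permutation f" for f and z :: "'z"
  proof -
    have "orbit f z = set (support f z)"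
      unfolding support_set[OF f] by (auto simp: orbit_altdef_permutation[OF f])
    then show ?thesis
      using distinct_card[OF cycle_of_permutation[OF f, of z]] by simp
  qed
  have le: "(f ^^ m) z = (f ^^ n) z \<longleftrightarrow> least_power f z dvd n - m" if f: "permutation f" and "m \<le> n"
    for f and z :: "'z" and m n
  proof -
    have "(f ^^ n) z = (f ^^ m) ((f ^^ (n - m)) z)"
      using that(2) by (metis funpow_add le_add_diff_inverse o_apply)
    moreover have "inj (f ^^ m)" using permutation_bijective[OF f] bij_is_inj inj_fn by blast
    ultimately have "(f ^^ m) z = (f ^^ n) z \<longleftrightarrow> z = (f ^^ (n - m)) z" by (simp add: inj_eq)
    then show ?thesis using least_power_dvd[OF f] by metis
  qed
  show ?thesis
    using le[OF assms(1), of m n x] le[OF assms(2), of m n y] le[OF assms(1), of n m x] le[OF assms(2), of n m y]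
      card[OF assms(1), of x] card[OF assms(2), of y] assms(3)
    by (metis nat_le_linear)
qed

text \<open>A permutation and its inverse have the same orbits. With representatives that include
  \<open>X0\<close>, sending the \<open>n\<close>-th iterate of a representative under
  \<open>\<sigma>\<close> to its \<open>n\<close>-th iterate under the inverse gives a conjugating
  permutation that fixes \<open>X0\<close> pointwise.\<close>

lemma conjugate_inverse:
  assumes \<sigma>: "\<sigma> permutes A" and fin: "finite A" and X0: "X0 \<subseteq> A"
    and d0: "\<And>x y. x \<in> X0 \<Longrightarrow> y \<in> X0 \<Longrightarrow> y \<in> orbit \<sigma> x \<Longrightarrow> x = y"
  obtains h where "h permutes A" "h \<circ> \<sigma> = inv' \<sigma> \<circ> h" "\<And>x. x \<in> X0 \<Longrightarrow> h x = x"
proof -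
  obtain X where X: "X0 \<subseteq> X" "X \<subseteq> A" "\<And>a. a \<in> A \<Longrightarrow> \<exists>x\<in>X. a \<in> orbit \<sigma> x"
    "\<And>x y. x \<in> X \<Longrightarrow> y \<in> X \<Longrightarrow> y \<in> orbit \<sigma> x \<Longrightarrow> x = y"
    using orbit_representatives[OF assms] by blast
  have p: "permutation \<sigma>" "permutation (inv' \<sigma>)"
    using \<sigma> fin permutation_permutes permutes_inv by blast+
  note oi = orbit_inv_eq[OF p(1)]
  have same: "x = y" if "x \<in> X" "y \<in> X" "(f ^^ m) x = (f ^^ n) y" "permutation f" "\<And>z. orbit f z = orbit \<sigma> z" for x y m n f
  proof -
    have "(f ^^ n) y \<in> orbit f x" "(f ^^ n) y \<in> orbit f y"
      using that(3) in_orbit_iff[OF that(4)] by metis+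
    then have "orbit f y = orbit f x" using orbit_eq[OF that(4)] by metis
    then have "y \<in> orbit \<sigma> x" using permutation_self_in_orbit[OF that(4), of y] that(5) by simp
    then show ?thesis using X(4) that(1,2) by blast
  qed
  show thesis
  proof (rule conjugating_permutation[OF \<sigma> permutes_inv[OF \<sigma>] fin, of X "\<lambda>x. x" "\<lambda>x. x"])
    show "\<exists>i\<in>X. \<exists>n. a = (\<sigma> ^^ n) i" if "a \<in> A" for a
      using X(3)[OF that] in_orbit_iff[OF p(1)] by blast
    show "(\<sigma> ^^ m) i = (\<sigma> ^^ n) j \<longleftrightarrow> (inv' \<sigma> ^^ m) i = (inv' \<sigma> ^^ n) j" if "i \<in> X" "j \<in> X" for i j m n
    proof (cases "i = j")
      case True
      then show ?thesis using funpow_eq_iff[OF p, of i i m n] oi by simp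
    next
      case False
      then show ?thesis using same[OF that _ p(1)] same[OF that _ p(2) oi] by blast
    qed
    fix h assume "h permutes A" "h \<circ> \<sigma> = inv' \<sigma> \<circ> h" "\<And>i. i \<in> X \<Longrightarrow> h i = i"
    then show thesis using that[of h] X(1) by blast
  qed (use X in auto)
qed

text \<open>Multiplying by a transposition splits a cycle that contains both of the transposed points.\<close>

lemma split_cycle:
  assumes \<sigma>: "\<sigma> permutes A" and fin: "finite A" and ab: "a \<noteq> b" "b \<in> orbit \<sigma> a"
  shows "b \<notin> orbit (\<sigma> \<circ> transpose a b) a"
proof -
  have p: "permutation \<sigma>" using \<sigma> fin permutation_permutes by blast
  have "a \<in> orbit \<sigma> b" using orbit_eq[OF p ab(2)] permutation_self_in_orbit[OF p] by blast
  then have ex: "\<exists>e. (\<sigma> ^^ e) b = a" using in_orbit_iff[OF p] by metis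
  \<comment> \<open>\<open>e\<close> is the number of steps from \<open>b\<close> to
    \<open>a\<close>. Under the product, \<open>a\<close> travels along the arc of the cycle that
    leaves \<open>b\<close> and is back after \<open>e\<close> steps, without meeting
    \<open>b\<close>.\<close>
  define e where "e = (LEAST e. (\<sigma> ^^ e) b = a)"
  have e: "(\<sigma> ^^ e) b = a" unfolding e_def by (rule LeastI_ex[OF ex])
  have emin: "(\<sigma> ^^ i) b \<noteq> a" if "i < e" for i using not_less_Least that unfolding e_def by blast
  have e0: "0 < e" using e ab(1) by (cases e) auto
  have enb: "(\<sigma> ^^ i) b \<noteq> b" if "0 < i" "i \<le> e" for i
  proof
    assume i: "(\<sigma> ^^ i) b = b"
    have "(\<sigma> ^^ ((e - i) + i)) b = (\<sigma> ^^ (e - i)) ((\<sigma> ^^ i) b)"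
      by (simp only: funpow_add o_apply)
    then have "(\<sigma> ^^ (e - i)) b = a" using e i that by simp
    then show False using emin[of "e - i"] that by simp
  qed
  let ?f = "\<sigma> \<circ> transpose a b"
  have step: "(?f ^^ i) a = (\<sigma> ^^ i) b" if "0 < i" "i \<le> e" for i
    using that
  proof (induction i)
    case (Suc i)
    show ?case
    proof (cases "i = 0")
      case False
      then have f: "(?f ^^ i) a = (\<sigma> ^^ i) b" using Suc.prems by (intro Suc.IH) auto
      have "(\<sigma> ^^ i) b \<noteq> a" "(\<sigma> ^^ i) b \<noteq> b" using emin[of i] enb[of i] False Suc.prems by auto
      then have t: "transpose a b ((\<sigma> ^^ i) b) = (\<sigma> ^^ i) b" by (rule transpose_apply_other)
      have "(?f ^^ Suc i) a = ?f ((?f ^^ i) a)" by (subst funpow.simps(2)) (rule o_apply)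
      also have "\<dots> = (\<sigma> ^^ Suc i) b" unfolding f by (simp add: t)
      finally show ?thesis .
    qed simp
  qed simp
  have fe: "(?f ^^ e) a = a" using step[OF e0 order_refl] e by (rule trans)
  show ?thesis
  proof
    assume "b \<in> orbit ?f a"
    then have "b \<in> {(?f ^^ m) a |m. m < e}" by (simp only: orbit_altdef_bounded[OF fe e0])
    then obtain m where m: "m < e" "b = (?f ^^ m) a" by blast
    show False
    proof (cases "m = 0")
      case True
      then show ?thesis using m ab(1) by simp
    next
      case False
      then have "(?f ^^ m) a = (\<sigma> ^^ m) b" using m(1) by (intro step) auto
      then show ?thesis using enb[of m] m False by (metis neq0_conv order_less_imp_le)
    qed
  qed
qed

subsection \<open>Cycle types\<close>

text \<open>A relation rather than a function of \<open>\<sigma>\<close>: the witness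
  \<open>xs\<close> orders one representative per cycle so that the cycle lengths form a partition,
  and two permutations of one type are matched along their lists.\<close>

definition has_type :: "nat \<Rightarrow> (nat \<Rightarrow> nat) \<Rightarrow> nat list \<Rightarrow> bool"
  where "has_type n \<sigma> lam \<longleftrightarrow> lam \<in> partitions n \<and> (\<exists>xs. set xs \<subseteq> {1..n} \<and>
    (\<forall>a\<in>{1..n}. \<exists>x\<in>set xs. a \<in> orbit \<sigma> x) \<and>
    (\<forall>i<length xs. \<forall>j<length xs. xs ! j \<in> orbit \<sigma> (xs ! i) \<longrightarrow> i = j) \<and>
    lam = map (\<lambda>x. card (orbit \<sigma> x)) xs)"

lemma has_type_exists:
  assumes \<sigma>: "\<sigma> permutes {1..n}"
  obtains lam where "has_type n \<sigma> lam"
proof -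
  obtain X where X: "X \<subseteq> {1..n}" "\<And>a. a \<in> {1..n} \<Longrightarrow> \<exists>x\<in>X. a \<in> orbit \<sigma> x"
    "\<And>x y. x \<in> X \<Longrightarrow> y \<in> X \<Longrightarrow> y \<in> orbit \<sigma> x \<Longrightarrow> x = y"
    by (rule orbit_representatives[OF \<sigma>, of "{}"]) auto
  have p: "permutation \<sigma>" using \<sigma> permutation_permutes by blast
  note self = permutation_self_in_orbit[OF p]
  let ?c = "\<lambda>x. card (orbit \<sigma> x)"
  have finX: "finite X" using X(1) finite_subset by blast
  \<comment> \<open>Sorting by decreasing orbit size makes the list of sizes a partition.\<close>
  define xs where "xs = rev (sort_key ?c (sorted_list_of_set X))"
  have xs: "set xs = X" "distinct xs" using finX by (auto simp: xs_def)
  have "sorted (rev (map ?c xs))" by (simp add: xs_def rev_map[symmetric])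
  then have srt: "sorted_wrt (\<ge>) (map ?c xs)" by (simp add: sorted_wrt_rev)
  have pos: "0 < ?c x" for x
    using finite_orbit[OF self] orbit_nonempty[of \<sigma> x] by (simp add: card_gt_0_iff)
  have "sum_list (map ?c xs) = (\<Sum>x\<in>X. ?c x)"
    using xs by (simp add: sum_list_distinct_conv_sum_set)
  also have "\<dots> = card (\<Union>x\<in>X. orbit \<sigma> x)"
  proof (rule card_UN_disjoint[symmetric])
    show "\<forall>i\<in>X. \<forall>j\<in>X. i \<noteq> j \<longrightarrow> orbit \<sigma> i \<inter> orbit \<sigma> j = {}"
    proof (intro ballI impI)
      fix i j assume ij: "i \<in> X" "j \<in> X" "i \<noteq> j"
      show "orbit \<sigma> i \<inter> orbit \<sigma> j = {}"
      proof (rule ccontr)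
        assume "orbit \<sigma> i \<inter> orbit \<sigma> j \<noteq> {}"
        then have "orbit \<sigma> i = orbit \<sigma> j" using orbit_eq[OF p] by blast
        then show False using X(3)[OF ij(1,2)] self[of j] ij(3) by blast
      qed
    qed
  qed (use finX finite_orbit[OF self] in auto)
  also have "(\<Union>x\<in>X. orbit \<sigma> x) = {1..n}"
    using X(1,2) permutes_orbit_subset[OF \<sigma>] by blast
  finally have "map ?c xs \<in> partitions n"
    using srt pos by (auto simp: partitions_def)
  moreover have "\<forall>i<length xs. \<forall>j<length xs. xs ! j \<in> orbit \<sigma> (xs ! i) \<longrightarrow> i = j"
    using X(3) xs by (metis nth_eq_iff_index_eq nth_mem)
  ultimately show thesis
    using that[of "map ?c xs"] X(1,2) xs unfolding has_type_def by blast
qed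

lemma has_type_conjugate:
  assumes \<sigma>: "\<sigma> permutes {1..n}" and \<tau>: "\<tau> permutes {1..n}" and "has_type n \<sigma> lam" "has_type n \<tau> lam"
  obtains h where "h permutes {1..n}" "h \<circ> \<sigma> = \<tau> \<circ> h"
proof -
  have p: "permutation \<sigma>" "permutation \<tau>" using \<sigma> \<tau> permutation_permutes by blast+
  obtain xs where xs: "set xs \<subseteq> {1..n}" "\<forall>a\<in>{1..n}. \<exists>x\<in>set xs. a \<in> orbit \<sigma> x"
    "\<forall>i<length xs. \<forall>j<length xs. xs ! j \<in> orbit \<sigma> (xs ! i) \<longrightarrow> i = j"
    "lam = map (\<lambda>x. card (orbit \<sigma> x)) xs" using assms(3) unfolding has_type_def by blast
  obtain ys where ys: "set ys \<subseteq> {1..n}" "\<forall>a\<in>{1..n}. \<exists>x\<in>set ys. a \<in> orbit \<tau> x"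
    "\<forall>i<length ys. \<forall>j<length ys. ys ! j \<in> orbit \<tau> (ys ! i) \<longrightarrow> i = j"
    "lam = map (\<lambda>x. card (orbit \<tau> x)) ys" using assms(4) unfolding has_type_def by blast
  have len: "length ys = length xs" using xs(4) ys(4) by (metis length_map)
  have crd: "card (orbit \<sigma> (xs ! i)) = card (orbit \<tau> (ys ! i))" if "i < length xs" for i
    using xs(4) ys(4) that len by (metis nth_map)
  have same: "i = j" if "i < length zs" "j < length zs" "(f ^^ m) (zs ! i) = (f ^^ k) (zs ! j)" "permutation f"
     "\<forall>i<length zs. \<forall>j<length zs. zs ! j \<in> orbit f (zs ! i) \<longrightarrow> i = j" for i j m k f and zs :: "nat list"
  proof -
    have "(f ^^ k) (zs ! j) \<in> orbit f (zs ! i)" "(f ^^ k) (zs ! j) \<in> orbit f (zs ! j)"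
      using that(3) in_orbit_iff[OF that(4)] by metis+
    then have "orbit f (zs ! j) = orbit f (zs ! i)" using orbit_eq[OF that(4)] by metis
    then have "zs ! j \<in> orbit f (zs ! i)" using permutation_self_in_orbit[OF that(4), of "zs ! j"] by simp
    then show ?thesis using that(1,2,5) by blast
  qed
  show thesis
  proof (rule conjugating_permutation[OF \<sigma> \<tau> _, of "{..<length xs}" "\<lambda>i. xs ! i" "\<lambda>i. ys ! i"])
    show "\<exists>i\<in>{..<length xs}. \<exists>m. a = (\<sigma> ^^ m) (xs ! i)" if "a \<in> {1..n}" for a
      using xs(2) that unfolding in_orbit_iff[OF p(1)] by (metis in_set_conv_nth lessThan_iff)
    show "(\<sigma> ^^ m) (xs ! i) = (\<sigma> ^^ k) (xs ! j) \<longleftrightarrow> (\<tau> ^^ m) (ys ! i) = (\<tau> ^^ k) (ys ! j)"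
      if "i \<in> {..<length xs}" "j \<in> {..<length xs}" for i j m k
    proof (cases "i = j")
      case True
      then show ?thesis using funpow_eq_iff[OF p crd] that by simp
    next
      case False
      then show ?thesis using same[OF _ _ _ p(1) xs(3), of i j] same[OF _ _ _ p(2) ys(3), of i j] that len by auto
    qed
    show "xs ! i \<in> {1..n}" "ys ! i \<in> {1..n}" if "i \<in> {..<length xs}" for i
      using that xs(1) ys(1) len nth_mem by (metis lessThan_iff subsetD)+
  qed (use that in auto)
qed

section \<open>Completeness of the Specht modules\<close>

lemma finite_partitions: "finite (partitions n)"
proof (rule finite_subset)
  show "partitions n \<subseteq> {xs. set xs \<subseteq> {..n} \<and> length xs \<le> n}"
  proof
    fix lam assume "lam \<in> partitions n"
    then have l: "\<forall>p\<in>set lam. 0 < p" "sum_list lam = n" by (auto simp: partitions_def)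
    have "length lam \<le> sum_list lam" using l(1) by (induction lam) auto
    then show "lam \<in> {xs. set xs \<subseteq> {..n} \<and> length xs \<le> n}"
      using l(2) member_le_sum_list[of _ lam] by auto
  qed
  show "finite {xs. set xs \<subseteq> {..n} \<and> length xs \<le> n}" by (rule finite_lists_length_le) simp
qed

definition class_fun :: "('g, 'm) monoid_scheme \<Rightarrow> ('g \<Rightarrow> complex) \<Rightarrow> bool"
  where "class_fun G f \<longleftrightarrow> (\<forall>g\<in>carrier G. \<forall>h\<in>carrier G. f (h \<otimes>\<^bsub>G\<^esub> g \<otimes>\<^bsub>G\<^esub> inv\<^bsub>G\<^esub> h) = f g)"

text \<open>Permutations of a common cycle type are conjugate, so the class functions lie in the
  span of as many indicator functions as there are partitions. The Specht characters are
  orthonormal, hence independent, and equally many; so every class function is a combination of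
  them, with inner products as coefficients.\<close>

lemma specht_expansion:
  assumes f: "class_fun (sym_group n) f" and g: "g \<in> carrier (sym_group n)"
  shows "f g = (\<Sum>\<tau>\<in>partitions n. finite_group.cip (sym_group n) (character (specht \<tau>)) f * character (specht \<tau>) g)"
proof -
  interpret finite_group "sym_group n" by (rule finite_group_sym)
  let ?G = "carrier (sym_group n)"
  let ?P = "partitions n"
  have G: "\<sigma> \<in> ?G \<longleftrightarrow> \<sigma> permutes {1..n}" for \<sigma> by (simp add: sym_group_def)
  \<comment> \<open>\<open>SOME\<close> turns the relation \<open>has_type\<close> into a function,
    and \<open>cl lam\<close> is the indicator of the permutations that it assigns to
    \<open>lam\<close>.\<close>
  define cl where "cl lam \<sigma> = (if \<sigma> \<in> ?G \<and> lam = (SOME lam. has_type n \<sigma> lam) then 1 else (0::complex))" for lam \<sigma>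
  \<comment> \<open>Functions are cut off outside the group, so that identities on the group become
    identities of functions and the linear algebra of function spaces applies.\<close>
  define res where "res f \<sigma> = (if \<sigma> \<in> ?G then f \<sigma> else (0::complex))" for f \<sigma>
  have type: "has_type n \<sigma> (SOME lam. has_type n \<sigma> lam)" if "\<sigma> \<in> ?G" for \<sigma>
    using has_type_exists that unfolding G by (metis someI)
  have span: "res f \<in> cfun.span (cl ` ?P)" if f: "class_fun (sym_group n) f" for f
  proof -
    define rp where "rp lam = (SOME \<sigma>. \<sigma> \<in> ?G \<and> (SOME lam. has_type n \<sigma> lam) = lam)" for lam
    have "res f = (\<Sum>lam\<in>?P. cscale (f (rp lam)) (cl lam))"
    proof
      fix \<sigma>
      show "res f \<sigma> = (\<Sum>lam\<in>?P. cscale (f (rp lam)) (cl lam)) \<sigma>"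
      proof (cases "\<sigma> \<in> ?G")
        case False
        then show ?thesis by (simp add: res_def sum_apply cscale_def cl_def)
      next
        case True
        let ?l = "SOME lam. has_type n \<sigma> lam"
        have lP: "?l \<in> ?P" using type[OF True] by (simp add: has_type_def)
        have rp: "rp ?l \<in> ?G" "(SOME lam. has_type n (rp ?l) lam) = ?l"
          using someI[of "\<lambda>\<sigma>'. \<sigma>' \<in> ?G \<and> (SOME lam. has_type n \<sigma>' lam) = ?l" \<sigma>] True unfolding rp_def by blast+
        then have "has_type n (rp ?l) ?l" using type[OF rp(1)] by simp
        then obtain h where h: "h permutes {1..n}" "h \<circ> rp ?l = \<sigma> \<circ> h"
          using has_type_conjugate[of "rp ?l" n \<sigma> ?l] rp(1) True type[OF True] unfolding G by metis
        have "h \<otimes>\<^bsub>sym_group n\<^esub> rp ?l \<otimes>\<^bsub>sym_group n\<^esub> inv\<^bsub>sym_group n\<^esub> h = \<sigma>"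
          using h G[of h] by (simp add: sym_group_mult comp_assoc permutes_inv_o)
        then have "f \<sigma> = f (rp ?l)" using f h(1) rp(1) G unfolding class_fun_def by metis
        moreover have "(\<Sum>lam\<in>?P. cscale (f (rp lam)) (cl lam)) \<sigma> = (\<Sum>lam\<in>?P. if lam = ?l then f (rp lam) else 0)"
          unfolding sum_apply by (intro sum.cong refl) (use True in \<open>simp add: cscale_def cl_def\<close>)
        ultimately show ?thesis using True lP finite_partitions by (simp add: res_def)
      qed
    qed
    moreover have "\<dots> \<in> cfun.span (cl ` ?P)"
      by (intro cfun.span_sum cfun.span_scale cfun.span_base) auto
    ultimately show ?thesis by simp
  qed
  let ?\<chi> = "\<lambda>lam. character (specht lam)"
  have cf: "class_fun (sym_group n) (?\<chi> lam)" if "lam \<in> ?P" for lam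
    using character_class[of "specht lam"] specht_rep[of lam] that
    by (auto simp: class_fun_def partitions_def)
  define E where "E lam = res (?\<chi> lam)" for lam
  have cip_res: "cip f (res f') = cip f f'" for f f' by (rule cip_cong) (auto simp: res_def)
  have cip_sum: "cip f (\<Sum>i\<in>I. cscale (c i) (F i)) = (\<Sum>i\<in>I. c i * cip f (F i))" for f I c and F :: "'i \<Rightarrow> (nat \<Rightarrow> nat) \<Rightarrow> complex"
  proof -
    have "(\<Sum>g\<in>?G. f (inv\<^bsub>sym_group n\<^esub> g) * (\<Sum>i\<in>I. cscale (c i) (F i)) g) =
      (\<Sum>g\<in>?G. \<Sum>i\<in>I. c i * (f (inv\<^bsub>sym_group n\<^esub> g) * F i g))"
      by (simp add: sum_apply cscale_def sum_distrib_left mult.left_commute)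
    also have "\<dots> = (\<Sum>i\<in>I. c i * (\<Sum>g\<in>?G. f (inv\<^bsub>sym_group n\<^esub> g) * F i g))"
      by (subst sum.swap) (simp add: sum_distrib_left)
    finally have eq: "(\<Sum>g\<in>?G. f (inv\<^bsub>sym_group n\<^esub> g) * (\<Sum>i\<in>I. cscale (c i) (F i)) g) =
      (\<Sum>i\<in>I. c i * (\<Sum>g\<in>?G. f (inv\<^bsub>sym_group n\<^esub> g) * F i g))" .
    show ?thesis
      unfolding cip_def eq by (subst sum_divide_distrib) (simp only: times_divide_eq_right)
  qed
  have orth: "cip (?\<chi> lam) (E mu) = (if lam = mu then 1 else 0)" if "lam \<in> ?P" "mu \<in> ?P" for lam mu
    unfolding E_def cip_res using specht_cip[OF that] .
  have inj: "inj_on E ?P"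
  proof (rule inj_onI)
    fix lam mu assume a: "lam \<in> ?P" "mu \<in> ?P" "E lam = E mu"
    show "lam = mu" using orth[OF a(1,1)] orth[OF a(1,2)] a(3) by (simp split: if_splits)
  qed
  have indep: "cfun.independent (E ` ?P)"
  proof (rule cfun.independent_if_scalars_zero)
    show "finite (E ` ?P)" using finite_partitions by simp
    fix c x assume s: "(\<Sum>x\<in>E ` ?P. cscale (c x) x) = 0" and x: "x \<in> E ` ?P"
    obtain lam where lam: "lam \<in> ?P" "x = E lam" using x by blast
    have z: "(\<Sum>mu\<in>?P. cscale (c (E mu)) (E mu)) = 0" using s by (simp add: sum.reindex[OF inj])
    have "0 = cip (?\<chi> lam) (\<Sum>mu\<in>?P. cscale (c (E mu)) (E mu))"
      unfolding z by (simp add: cip_def)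
    also have "\<dots> = (\<Sum>mu\<in>?P. if lam = mu then c (E mu) else 0)"
      unfolding cip_sum by (intro sum.cong refl) (simp add: orth[OF lam(1)])
    also have "\<dots> = c x" using lam finite_partitions by simp
    finally show "c x = 0" by simp
  qed
  \<comment> \<open>Otherwise adjoining \<open>res f\<close> would give more independent functions
    than the spanning functions \<open>cl\<close>, whose number is at most that of the
    partitions.\<close>
  have "res f \<in> cfun.span (E ` ?P)"
  proof (rule ccontr)
    assume not: "\<not> ?thesis"
    then have ind: "cfun.independent (insert (res f) (E ` ?P))"
      using indep by (rule cfun.independent_insertI)
    have "insert (res f) (E ` ?P) \<subseteq> cfun.span (cl ` ?P)"
      using span[OF f] span[OF cf] by (auto simp: E_def)
    then have "card (insert (res f) (E ` ?P)) \<le> card (cl ` ?P)"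
      using cfun.independent_span_bound[OF _ ind, of "cl ` ?P"] finite_partitions by simp
    also have "\<dots> \<le> card ?P" by (rule card_image_le[OF finite_partitions])
    also have "card ?P = card (E ` ?P)" using inj by (simp add: card_image)
    finally have "res f \<in> E ` ?P" using finite_partitions by (auto simp: card_insert_if split: if_splits)
    then show False using not cfun.span_base by blast
  qed
  then obtain c where c: "res f = (\<Sum>x\<in>E ` ?P. cscale (c x) x)"
    using cfun.span_finite[of "E ` ?P"] finite_partitions by auto
  then have c': "res f = (\<Sum>lam\<in>?P. cscale (c (E lam)) (E lam))" by (simp add: sum.reindex[OF inj])
  have co: "cip (?\<chi> lam) f = c (E lam)" if lam: "lam \<in> ?P" for lam
  proof -
    have "cip (?\<chi> lam) f = cip (?\<chi> lam) (res f)" by (simp add: cip_res)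
    also have "\<dots> = (\<Sum>mu\<in>?P. if lam = mu then c (E mu) else 0)"
      unfolding c' cip_sum by (intro sum.cong refl) (simp add: orth[OF lam])
    also have "\<dots> = c (E lam)" using lam finite_partitions by simp
    finally show ?thesis .
  qed
  have "f g = res f g" using g by (simp add: res_def)
  also have "\<dots> = (\<Sum>lam\<in>?P. c (E lam) * ?\<chi> lam g)"
    unfolding c' sum_apply using g by (intro sum.cong refl) (simp add: cscale_def E_def res_def)
  also have "\<dots> = (\<Sum>\<tau>\<in>?P. cip (?\<chi> \<tau>) f * ?\<chi> \<tau> g)" using co by simp
  finally show ?thesis .
qed

section \<open>Induced class functions\<close>

lemma finite_group_DirProd:
  assumes "finite_group G" "finite_group H"
  shows "finite_group (G \<times>\<times> H)"
proof -
  interpret G: finite_group G by fact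
  interpret H: finite_group H by fact
  show ?thesis
    using DirProd_group[OF G.is_group H.is_group] G.fin H.fin
    by (simp add: finite_group_def finite_group_axioms_def)
qed

lemma ind_cf_cong:
  assumes "\<And>h. h \<in> carrier H \<Longrightarrow> \<phi> h = \<psi> h"
  shows "ind_cf G H \<iota> \<phi> g = ind_cf G H \<iota> \<psi> g"
  unfolding ind_cf_def using assms by (intro arg_cong[where f = "\<lambda>z. z / _"] sum.cong refl) auto

lemma ind_cf_sum: "ind_cf G H \<iota> (\<lambda>h. \<Sum>i\<in>I. \<phi> i h) g = (\<Sum>i\<in>I. ind_cf G H \<iota> (\<phi> i) g)"
proof -
  have "(\<Sum>x\<in>carrier G. \<Sum>h\<in>carrier H. if g \<otimes>\<^bsub>G\<^esub> x = x \<otimes>\<^bsub>G\<^esub> \<iota> h then \<Sum>i\<in>I. \<phi> i h else 0) =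
    (\<Sum>x\<in>carrier G. \<Sum>h\<in>carrier H. \<Sum>i\<in>I. if g \<otimes>\<^bsub>G\<^esub> x = x \<otimes>\<^bsub>G\<^esub> \<iota> h then \<phi> i h else 0)"
    by (intro sum.cong refl) (simp add: sum.neutral)
  also have "\<dots> = (\<Sum>x\<in>carrier G. \<Sum>i\<in>I. \<Sum>h\<in>carrier H. if g \<otimes>\<^bsub>G\<^esub> x = x \<otimes>\<^bsub>G\<^esub> \<iota> h then \<phi> i h else 0)"
    by (intro sum.cong refl sum.swap)
  also have "\<dots> = (\<Sum>i\<in>I. \<Sum>x\<in>carrier G. \<Sum>h\<in>carrier H. if g \<otimes>\<^bsub>G\<^esub> x = x \<otimes>\<^bsub>G\<^esub> \<iota> h then \<phi> i h else 0)"
    by (rule sum.swap)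
  finally show ?thesis by (simp add: ind_cf_def sum_divide_distrib)
qed

lemma ind_cf_add: "ind_cf G H \<iota> (\<lambda>h. \<phi> h + \<psi> h) g = ind_cf G H \<iota> \<phi> g + ind_cf G H \<iota> \<psi> g"
  using ind_cf_sum[of G H \<iota> "\<lambda>b. if b then \<phi> else \<psi>" UNIV g] by (simp add: UNIV_bool add.commute)

text \<open>In the double sum each pair of \<open>y\<close> and \<open>l\<close> admits a single
  \<open>h\<close>, the conjugate of \<open>\<kappa> l\<close> by \<open>y\<close>, and
  \<open>x\<close> times \<open>\<iota> y\<close> becomes the new summation variable; summing over
  \<open>y\<close> gives a factor that cancels the order of \<open>H\<close>.\<close>

lemma ind_cf_trans:
  assumes G: "finite_group G" and H: "finite_group H" and \<iota>: "\<iota> \<in> hom H G" and \<kappa>: "\<kappa> \<in> hom L H"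
    and g: "g \<in> carrier G"
  shows "ind_cf G H \<iota> (ind_cf H L \<kappa> \<psi>) g = ind_cf G L (\<iota> \<circ> \<kappa>) \<psi> g"
proof -
  interpret G: finite_group G by fact
  interpret H: finite_group H by fact
  have \<iota>c: "\<iota> h \<in> carrier G" if "h \<in> carrier H" for h using \<iota> that by (auto simp: hom_def)
  have \<kappa>c: "\<kappa> l \<in> carrier H" if "l \<in> carrier L" for l using \<kappa> that by (auto simp: hom_def)
  let ?M = "of_nat (card (carrier L)) :: complex"
  define S where "S x = (\<Sum>l\<in>carrier L. if g \<otimes>\<^bsub>G\<^esub> x = x \<otimes>\<^bsub>G\<^esub> \<iota> (\<kappa> l) then \<psi> l else 0)" for x
  have inner: "(\<Sum>h\<in>carrier H. if g \<otimes>\<^bsub>G\<^esub> x = x \<otimes>\<^bsub>G\<^esub> \<iota> h then ind_cf H L \<kappa> \<psi> h else 0) =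
      (\<Sum>y\<in>carrier H. S (x \<otimes>\<^bsub>G\<^esub> \<iota> y)) / ?M" if x: "x \<in> carrier G" for x
  proof -
    have "(\<Sum>h\<in>carrier H. if g \<otimes>\<^bsub>G\<^esub> x = x \<otimes>\<^bsub>G\<^esub> \<iota> h then ind_cf H L \<kappa> \<psi> h else 0) =
      (\<Sum>h\<in>carrier H. \<Sum>y\<in>carrier H. \<Sum>l\<in>carrier L.
         if g \<otimes>\<^bsub>G\<^esub> x = x \<otimes>\<^bsub>G\<^esub> \<iota> h \<and> h \<otimes>\<^bsub>H\<^esub> y = y \<otimes>\<^bsub>H\<^esub> \<kappa> l then \<psi> l else 0) / ?M"
      unfolding ind_cf_def sum_divide_distrib by (intro sum.cong refl) (simp add: sum_divide_distrib)
    also have "(\<Sum>h\<in>carrier H. \<Sum>y\<in>carrier H. \<Sum>l\<in>carrier L.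
         if g \<otimes>\<^bsub>G\<^esub> x = x \<otimes>\<^bsub>G\<^esub> \<iota> h \<and> h \<otimes>\<^bsub>H\<^esub> y = y \<otimes>\<^bsub>H\<^esub> \<kappa> l then \<psi> l else 0) =
       (\<Sum>y\<in>carrier H. \<Sum>h\<in>carrier H. \<Sum>l\<in>carrier L.
         if g \<otimes>\<^bsub>G\<^esub> x = x \<otimes>\<^bsub>G\<^esub> \<iota> h \<and> h \<otimes>\<^bsub>H\<^esub> y = y \<otimes>\<^bsub>H\<^esub> \<kappa> l then \<psi> l else 0)"
      by (rule sum.swap)
    also have "\<dots> = (\<Sum>y\<in>carrier H. \<Sum>l\<in>carrier L. \<Sum>h\<in>carrier H.
         if g \<otimes>\<^bsub>G\<^esub> x = x \<otimes>\<^bsub>G\<^esub> \<iota> h \<and> h \<otimes>\<^bsub>H\<^esub> y = y \<otimes>\<^bsub>H\<^esub> \<kappa> l then \<psi> l else 0)"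
      by (intro sum.cong refl sum.swap)
    also have "\<dots> = (\<Sum>y\<in>carrier H. S (x \<otimes>\<^bsub>G\<^esub> \<iota> y))"
      unfolding S_def
    proof (intro sum.cong refl)
      fix y l assume y: "y \<in> carrier H" and l: "l \<in> carrier L"
      let ?h = "y \<otimes>\<^bsub>H\<^esub> \<kappa> l \<otimes>\<^bsub>H\<^esub> inv\<^bsub>H\<^esub> y"
      have hc: "?h \<in> carrier H" using y \<kappa>c[OF l] by simp
      have eq: "h \<otimes>\<^bsub>H\<^esub> y = y \<otimes>\<^bsub>H\<^esub> \<kappa> l \<longleftrightarrow> h = ?h" if "h \<in> carrier H" for h
        using that y \<kappa>c[OF l] by (metis H.inv_solve_right H.m_closed)
      have "(\<Sum>h\<in>carrier H. if g \<otimes>\<^bsub>G\<^esub> x = x \<otimes>\<^bsub>G\<^esub> \<iota> h \<and> h \<otimes>\<^bsub>H\<^esub> y = y \<otimes>\<^bsub>H\<^esub> \<kappa> l then \<psi> l else 0) =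
        (\<Sum>h\<in>carrier H. if h = ?h then (if g \<otimes>\<^bsub>G\<^esub> x = x \<otimes>\<^bsub>G\<^esub> \<iota> ?h then \<psi> l else 0) else 0)"
        by (intro sum.cong refl) (auto simp: eq)
      also have "\<dots> = (if g \<otimes>\<^bsub>G\<^esub> x = x \<otimes>\<^bsub>G\<^esub> \<iota> ?h then \<psi> l else 0)" using hc H.fin by simp
      also have "g \<otimes>\<^bsub>G\<^esub> x = x \<otimes>\<^bsub>G\<^esub> \<iota> ?h \<longleftrightarrow> g \<otimes>\<^bsub>G\<^esub> (x \<otimes>\<^bsub>G\<^esub> \<iota> y) = x \<otimes>\<^bsub>G\<^esub> \<iota> y \<otimes>\<^bsub>G\<^esub> \<iota> (\<kappa> l)"
      proof -
        have e: "\<iota> ?h \<otimes>\<^bsub>G\<^esub> \<iota> y = \<iota> y \<otimes>\<^bsub>G\<^esub> \<iota> (\<kappa> l)"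
          using hom_mult[OF \<iota>, of ?h y] hom_mult[OF \<iota>, of y "\<kappa> l"] hc y \<kappa>c[OF l]
          by (simp add: H.m_assoc)
        have "g \<otimes>\<^bsub>G\<^esub> x = x \<otimes>\<^bsub>G\<^esub> \<iota> ?h \<longleftrightarrow> g \<otimes>\<^bsub>G\<^esub> x \<otimes>\<^bsub>G\<^esub> \<iota> y = x \<otimes>\<^bsub>G\<^esub> \<iota> ?h \<otimes>\<^bsub>G\<^esub> \<iota> y"
          using g x y \<iota>c[OF hc] \<iota>c[OF y] by simp
        also have "\<dots> \<longleftrightarrow> g \<otimes>\<^bsub>G\<^esub> (x \<otimes>\<^bsub>G\<^esub> \<iota> y) = x \<otimes>\<^bsub>G\<^esub> \<iota> y \<otimes>\<^bsub>G\<^esub> \<iota> (\<kappa> l)"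
          using g x y \<iota>c[OF hc] \<iota>c[OF y] \<iota>c[OF \<kappa>c[OF l]] e by (simp add: G.m_assoc)
        finally show ?thesis .
      qed
      finally show "(\<Sum>h\<in>carrier H. if g \<otimes>\<^bsub>G\<^esub> x = x \<otimes>\<^bsub>G\<^esub> \<iota> h \<and> h \<otimes>\<^bsub>H\<^esub> y = y \<otimes>\<^bsub>H\<^esub> \<kappa> l then \<psi> l else 0) =
        (if g \<otimes>\<^bsub>G\<^esub> (x \<otimes>\<^bsub>G\<^esub> \<iota> y) = x \<otimes>\<^bsub>G\<^esub> \<iota> y \<otimes>\<^bsub>G\<^esub> \<iota> (\<kappa> l) then \<psi> l else 0)" .
    qed
    finally show ?thesis .
  qed
  have "ind_cf G H \<iota> (ind_cf H L \<kappa> \<psi>) g =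
      (\<Sum>x\<in>carrier G. (\<Sum>y\<in>carrier H. S (x \<otimes>\<^bsub>G\<^esub> \<iota> y)) / ?M) / of_nat (card (carrier H))"
    unfolding ind_cf_def[of G H] using inner by simp
  also have "(\<Sum>x\<in>carrier G. (\<Sum>y\<in>carrier H. S (x \<otimes>\<^bsub>G\<^esub> \<iota> y)) / ?M) =
      (\<Sum>y\<in>carrier H. \<Sum>x\<in>carrier G. S (x \<otimes>\<^bsub>G\<^esub> \<iota> y)) / ?M"
    unfolding sum_divide_distrib[symmetric] by (subst sum.swap) rule
  also have "(\<Sum>y\<in>carrier H. \<Sum>x\<in>carrier G. S (x \<otimes>\<^bsub>G\<^esub> \<iota> y)) = (\<Sum>y\<in>carrier H. \<Sum>x\<in>carrier G. S x)"
    by (intro sum.cong refl G.sum_rmult \<iota>c)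
  finally have "ind_cf G H \<iota> (ind_cf H L \<kappa> \<psi>) g = (\<Sum>x\<in>carrier G. S x) / ?M"
    using H.card_pos by simp
  then show ?thesis by (simp add: ind_cf_def[of G L] S_def)
qed

lemma ind_cf_prod:
  "ind_cf (G \<times>\<times> G') (H \<times>\<times> H') (map_prod \<iota> \<iota>') (\<lambda>(h, h'). \<phi> h * \<phi>' h') (g, g') =
    ind_cf G H \<iota> \<phi> g * ind_cf G' H' \<iota>' \<phi>' g'"
proof -
  define A where "A x h = (if g \<otimes>\<^bsub>G\<^esub> x = x \<otimes>\<^bsub>G\<^esub> \<iota> h then \<phi> h else 0)" for x h
  define B where "B x h = (if g' \<otimes>\<^bsub>G'\<^esub> x = x \<otimes>\<^bsub>G'\<^esub> \<iota>' h then \<phi>' h else 0)" for x h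
  define a where "a x = sum (A x) (carrier H)" for x
  define b where "b x = sum (B x) (carrier H')" for x
  have inner: "(\<Sum>q\<in>carrier H \<times> carrier H'. case q of (h, h') \<Rightarrow> A x h * B x' h') =
      (\<Sum>h\<in>carrier H. A x h) * (\<Sum>h\<in>carrier H'. B x' h)" for x x'
    by (simp add: sum_product sum.cartesian_product)
  have "(\<Sum>p\<in>carrier (G \<times>\<times> G'). \<Sum>q\<in>carrier (H \<times>\<times> H').
      if (g, g') \<otimes>\<^bsub>G \<times>\<times> G'\<^esub> p = p \<otimes>\<^bsub>G \<times>\<times> G'\<^esub> map_prod \<iota> \<iota>' q then (case q of (h, h') \<Rightarrow> \<phi> h * \<phi>' h') else 0) =
    (\<Sum>(x, x')\<in>carrier G \<times> carrier G'. (\<Sum>h\<in>carrier H. A x h) * (\<Sum>h\<in>carrier H'. B x' h))"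
    unfolding carrier_DirProd inner[symmetric]
    by (intro sum.cong refl) (auto simp: A_def B_def intro!: sum.cong)
  also have "\<dots> = (\<Sum>x\<in>carrier G. \<Sum>h\<in>carrier H. A x h) * (\<Sum>x\<in>carrier G'. \<Sum>h\<in>carrier H'. B x h)"
    unfolding a_def[symmetric] b_def[symmetric] by (simp add: sum_product sum.cartesian_product)
  finally show ?thesis
    by (simp add: ind_cf_def A_def B_def card_cartesian_product)
qed

lemma ind_cf_id:
  assumes G: "finite_group G" and \<phi>: "class_fun G \<phi>" and g: "g \<in> carrier G"
  shows "ind_cf G G id \<phi> g = \<phi> g"
proof -
  interpret finite_group G by fact
  have "(\<Sum>h\<in>carrier G. if g \<otimes>\<^bsub>G\<^esub> x = x \<otimes>\<^bsub>G\<^esub> id h then \<phi> h else 0) = \<phi> g" if x: "x \<in> carrier G" for x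
  proof -
    have "(\<Sum>h\<in>carrier G. if g \<otimes>\<^bsub>G\<^esub> x = x \<otimes>\<^bsub>G\<^esub> id h then \<phi> h else 0) =
      (\<Sum>h\<in>carrier G. if h = inv\<^bsub>G\<^esub> x \<otimes>\<^bsub>G\<^esub> g \<otimes>\<^bsub>G\<^esub> x then \<phi> h else 0)"
      using g x by (intro sum.cong refl if_cong) (metis id_apply inv_solve_left m_assoc m_closed inv_closed)+
    also have "\<dots> = \<phi> (inv\<^bsub>G\<^esub> x \<otimes>\<^bsub>G\<^esub> g \<otimes>\<^bsub>G\<^esub> x)" using fin g x by simp
    also have "\<dots> = \<phi> g" using \<phi> g x unfolding class_fun_def by (metis inv_closed inv_inv)
    finally show ?thesis .
  qed
  then show ?thesis using card_pos by (simp add: ind_cf_def)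
qed

text \<open>Right translation of the summation variable by \<open>w\<close> exchanges the two
  embeddings. With \<open>\<theta>\<close> relabelling the subgroup, this covers a conjugation that
  also permutes the factors of a product.\<close>

lemma ind_cf_conj:
  assumes G: "finite_group G" and \<theta>: "bij_betw \<theta> (carrier L) (carrier H)" and w: "w \<in> carrier G"
    and \<iota>: "\<And>l. l \<in> carrier L \<Longrightarrow> \<iota> (\<theta> l) \<in> carrier G" and \<iota>': "\<And>l. l \<in> carrier L \<Longrightarrow> \<iota>' l \<in> carrier G"
    and eq: "\<And>l. l \<in> carrier L \<Longrightarrow> w \<otimes>\<^bsub>G\<^esub> \<iota> (\<theta> l) = \<iota>' l \<otimes>\<^bsub>G\<^esub> w"
    and g: "g \<in> carrier G"
  shows "ind_cf G H \<iota> \<phi> g = ind_cf G L \<iota>' (\<lambda>l. \<phi> (\<theta> l)) g"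
proof -
  interpret finite_group G by fact
  define S where "S x = (\<Sum>l\<in>carrier L. if g \<otimes>\<^bsub>G\<^esub> x = x \<otimes>\<^bsub>G\<^esub> \<iota> (\<theta> l) then \<phi> (\<theta> l) else 0)" for x
  have "(\<Sum>x\<in>carrier G. \<Sum>l\<in>carrier L. if g \<otimes>\<^bsub>G\<^esub> x = x \<otimes>\<^bsub>G\<^esub> \<iota>' l then \<phi> (\<theta> l) else 0) = (\<Sum>x\<in>carrier G. S (x \<otimes>\<^bsub>G\<^esub> w))"
    unfolding S_def
  proof (intro sum.cong refl if_cong)
    fix x l assume x: "x \<in> carrier G" and l: "l \<in> carrier L"
    have "g \<otimes>\<^bsub>G\<^esub> x = x \<otimes>\<^bsub>G\<^esub> \<iota>' l \<longleftrightarrow> g \<otimes>\<^bsub>G\<^esub> x \<otimes>\<^bsub>G\<^esub> w = x \<otimes>\<^bsub>G\<^esub> \<iota>' l \<otimes>\<^bsub>G\<^esub> w"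
      using g x w \<iota>'[OF l] by simp
    also have "\<dots> \<longleftrightarrow> g \<otimes>\<^bsub>G\<^esub> (x \<otimes>\<^bsub>G\<^esub> w) = x \<otimes>\<^bsub>G\<^esub> w \<otimes>\<^bsub>G\<^esub> \<iota> (\<theta> l)"
      using g x w \<iota>'[OF l] \<iota>[OF l] eq[OF l] by (simp add: m_assoc)
    finally show "(g \<otimes>\<^bsub>G\<^esub> x = x \<otimes>\<^bsub>G\<^esub> \<iota>' l) = (g \<otimes>\<^bsub>G\<^esub> (x \<otimes>\<^bsub>G\<^esub> w) = x \<otimes>\<^bsub>G\<^esub> w \<otimes>\<^bsub>G\<^esub> \<iota> (\<theta> l))" .
  qed
  also have "\<dots> = (\<Sum>x\<in>carrier G. S x)" by (rule sum_rmult[OF w])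
  also have "\<dots> = (\<Sum>x\<in>carrier G. \<Sum>h\<in>carrier H. if g \<otimes>\<^bsub>G\<^esub> x = x \<otimes>\<^bsub>G\<^esub> \<iota> h then \<phi> h else 0)"
    unfolding S_def by (intro sum.cong refl sum.reindex_bij_betw[OF \<theta>])
  finally show ?thesis
    using bij_betw_same_card[OF \<theta>] by (simp add: ind_cf_def)
qed

text \<open>Where \<open>g x = x \<iota>(h)\<close>, a nonvanishing multiplicative function takes
  the same value at \<open>g\<close> and at \<open>\<iota> h\<close>, so it can be pulled out of the
  induction. Applied to \<open>sgnF\<close>, this reduces the \<epsilon> component to an
  inflation.\<close>

lemma ind_cf_mult:
  assumes G: "finite_group G" and \<iota>: "\<iota> \<in> hom H G" and g: "g \<in> carrier G"
    and c: "\<And>x y. x \<in> carrier G \<Longrightarrow> y \<in> carrier G \<Longrightarrow> c (x \<otimes>\<^bsub>G\<^esub> y) = c x * c y"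
    and nz: "\<And>x. x \<in> carrier G \<Longrightarrow> c x \<noteq> 0"
  shows "ind_cf G H \<iota> (\<lambda>h. c (\<iota> h) * \<phi> h) g = c g * ind_cf G H \<iota> \<phi> g"
proof -
  interpret finite_group G by fact
  have "(\<Sum>x\<in>carrier G. \<Sum>h\<in>carrier H. if g \<otimes>\<^bsub>G\<^esub> x = x \<otimes>\<^bsub>G\<^esub> \<iota> h then c (\<iota> h) * \<phi> h else 0) =
    (\<Sum>x\<in>carrier G. \<Sum>h\<in>carrier H. c g * (if g \<otimes>\<^bsub>G\<^esub> x = x \<otimes>\<^bsub>G\<^esub> \<iota> h then \<phi> h else 0))"
  proof (intro sum.cong refl)
    fix x h assume x: "x \<in> carrier G" and h: "h \<in> carrier H"
    have \<iota>h: "\<iota> h \<in> carrier G" using \<iota> h by (auto simp: hom_def)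
    have "c (\<iota> h) = c g" if "g \<otimes>\<^bsub>G\<^esub> x = x \<otimes>\<^bsub>G\<^esub> \<iota> h"
    proof -
      have "c (g \<otimes>\<^bsub>G\<^esub> x) = c (x \<otimes>\<^bsub>G\<^esub> \<iota> h)" using that by simp
      then have "c g * c x = c x * c (\<iota> h)" by (simp only: c[OF g x] c[OF x \<iota>h])
      then show ?thesis using nz[OF x] by simp
    qed
    then show "(if g \<otimes>\<^bsub>G\<^esub> x = x \<otimes>\<^bsub>G\<^esub> \<iota> h then c (\<iota> h) * \<phi> h else 0) = c g * (if g \<otimes>\<^bsub>G\<^esub> x = x \<otimes>\<^bsub>G\<^esub> \<iota> h then \<phi> h else 0)"
      by simp
  qed
  then show ?thesis by (simp add: ind_cf_def sum_distrib_left)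
qed

section \<open>Hyperoctahedral groups\<close>

abbreviation (input) S :: "nat \<Rightarrow> (nat \<Rightarrow> nat) monoid"
  where "S \<equiv> sym_group"

abbreviation (input) B :: "nat \<Rightarrow> ((nat \<Rightarrow> bit) \<times> (nat \<Rightarrow> nat)) monoid"
  where "B \<equiv> hyperoctahedral"

definition supp_fun :: "nat \<Rightarrow> (nat \<Rightarrow> bit) set"
  where "supp_fun m = {f. \<forall>i. i \<notin> {1..m} \<longrightarrow> f i = 0}"

lemma S_carrier: "carrier (S m) = {\<sigma>. \<sigma> permutes {1..m}}"
  by (simp add: sym_group_def)

lemma B_carrier: "carrier (B m) = supp_fun m \<times> carrier (S m)"
  by (auto simp: hyperoctahedral_def supp_fun_def)

lemma B_mult: "(f, \<sigma>) \<otimes>\<^bsub>B m\<^esub> (g, \<tau>) = (\<lambda>i. f i + g (inv' \<sigma> i), \<sigma> \<circ> \<tau>)"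
  by (simp add: hyperoctahedral_def sym_group_mult)

lemma B_one: "\<one>\<^bsub>B m\<^esub> = (\<lambda>_. 0, id)"
  by (simp add: hyperoctahedral_def sym_group_one)

lemma bit_cases: "x = 0 \<or> x = (1 :: bit)"
  by (metis bit_not_one_iff)

lemma bit_double: "x + x = (0 :: bit)"
  using bit_cases[of x] by auto

lemma supp_perm: "f \<in> supp_fun m \<Longrightarrow> \<sigma> permutes {1..m} \<Longrightarrow> (\<lambda>i. f (\<sigma> i)) \<in> supp_fun m"
  using permutes_in_image[of \<sigma> "{1..m}"] by (auto simp: supp_fun_def)

lemma supp_add: "f \<in> supp_fun m \<Longrightarrow> g \<in> supp_fun m \<Longrightarrow> (\<lambda>i. f i + g i) \<in> supp_fun m"
  by (simp add: supp_fun_def)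

lemma finite_supp_fun: "finite (supp_fun m)"
  and card_supp_fun: "card (supp_fun m) = 2 ^ m"
proof -
  have w: "(\<lambda>i. if i \<in> {i. f i \<noteq> 0} then 1 else 0) = f" for f :: "nat \<Rightarrow> bit"
  proof
    fix i
    show "(if i \<in> {i. f i \<noteq> 0} then 1 else 0) = f i" using bit_cases[of "f i"] by auto
  qed
  have b: "bij_betw (\<lambda>f. {i. f i \<noteq> 0}) (supp_fun m) (Pow {1..m})"
  proof (rule bij_betw_byWitness[where f' = "\<lambda>A i. if i \<in> A then 1 else 0"])
    show "\<forall>f\<in>supp_fun m. (\<lambda>i. if i \<in> {i. f i \<noteq> 0} then 1 else 0) = f"
      unfolding w by blast
    show "\<forall>A\<in>Pow {1..m}. {i. (if i \<in> A then 1 else 0) \<noteq> (0 :: bit)} = A" by auto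
    show "(\<lambda>f. {i. f i \<noteq> 0}) ` supp_fun m \<subseteq> Pow {1..m}" by (auto simp: supp_fun_def)
    show "(\<lambda>A i. if i \<in> A then 1 else (0 :: bit)) ` Pow {1..m} \<subseteq> supp_fun m"
      by (auto simp: supp_fun_def)
  qed
  show "card (supp_fun m) = 2 ^ m" using bij_betw_same_card[OF b] by (simp add: card_Pow)
  show "finite (supp_fun m)" using bij_betw_finite[OF b] by simp
qed

lemma B_inverse:
  assumes "f \<in> supp_fun m" "\<sigma> permutes {1..m}"
  shows "(\<lambda>i. f (\<sigma> i), inv' \<sigma>) \<in> carrier (B m)" "(\<lambda>i. f (\<sigma> i), inv' \<sigma>) \<otimes>\<^bsub>B m\<^esub> (f, \<sigma>) = \<one>\<^bsub>B m\<^esub>"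
  using assms supp_perm[OF assms]
  by (auto simp: B_carrier S_carrier permutes_inv B_mult B_one permutes_inv_inv permutes_inv_o bit_double
      simp del: add_bit_eq_xor)

lemma finite_group_B: "finite_group (B m)"
proof -
  have "group (B m)"
  proof (rule groupI)
    show "\<one>\<^bsub>B m\<^esub> \<in> carrier (B m)" by (simp add: B_carrier B_one S_carrier supp_fun_def permutes_id)
    fix x assume "x \<in> carrier (B m)"
    then obtain f \<sigma> where x: "x = (f, \<sigma>)" "f \<in> supp_fun m" "\<sigma> permutes {1..m}" by (auto simp: B_carrier S_carrier)
    show "\<one>\<^bsub>B m\<^esub> \<otimes>\<^bsub>B m\<^esub> x = x" by (simp add: x B_one B_mult del: add_bit_eq_xor)
    show "\<exists>y\<in>carrier (B m). y \<otimes>\<^bsub>B m\<^esub> x = \<one>\<^bsub>B m\<^esub>" using B_inverse[OF x(2,3)] x(1) by blast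
    fix y assume "y \<in> carrier (B m)"
    then obtain g \<tau> where y: "y = (g, \<tau>)" "g \<in> supp_fun m" "\<tau> permutes {1..m}" by (auto simp: B_carrier S_carrier)
    show "x \<otimes>\<^bsub>B m\<^esub> y \<in> carrier (B m)"
      using supp_add[OF x(2) supp_perm[OF y(2) permutes_inv[OF x(3)]]] permutes_compose[OF y(3) x(3)]
      by (simp add: x(1) y(1) B_mult B_carrier S_carrier)
    fix z assume "z \<in> carrier (B m)"
    then obtain h \<rho> where z: "z = (h, \<rho>)" by (cases z)
    have "inv' (\<sigma> \<circ> \<tau>) = inv' \<tau> \<circ> inv' \<sigma>" using x(3) y(3) by (simp add: o_inv_distrib permutes_bij)
    then show "x \<otimes>\<^bsub>B m\<^esub> y \<otimes>\<^bsub>B m\<^esub> z = x \<otimes>\<^bsub>B m\<^esub> (y \<otimes>\<^bsub>B m\<^esub> z)"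
      by (simp add: x(1) y(1) z B_mult comp_assoc add.assoc del: add_bit_eq_xor)
  qed
  moreover have "finite (carrier (B m))"
    by (simp add: B_carrier S_carrier finite_supp_fun finite_permutations)
  ultimately show ?thesis by (simp add: finite_group_def finite_group_axioms_def)
qed

lemma B_inv:
  assumes "f \<in> supp_fun m" "\<sigma> permutes {1..m}"
  shows "inv\<^bsub>B m\<^esub> (f, \<sigma>) = (\<lambda>i. f (\<sigma> i), inv' \<sigma>)"
proof -
  interpret finite_group "B m" by (rule finite_group_B)
  show ?thesis
    using B_inverse[OF assms] assms by (intro inv_equality) (auto simp: B_carrier S_carrier)
qed

lemma D2_carrier: "carrier D2 = {(f, \<sigma>) \<in> carrier (B 2). f 1 = f 2}"
proof -
  have s: "{1..2} = {1, 2::nat}" by auto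
  have "even (card {i \<in> {1..2}. f i = 1}) \<longleftrightarrow> f 1 = f 2" for f :: "nat \<Rightarrow> bit"
  proof -
    have "{i \<in> {1..2}. f i = 1} = (if f 1 = 1 then {1} else {}) \<union> (if f 2 = 1 then {2::nat} else {})"
      unfolding s by auto
    then show ?thesis using bit_cases[of "f 1"] bit_cases[of "f 2"] by auto
  qed
  then show ?thesis by (auto simp: D2_def)
qed

lemma finite_group_D2: "finite_group D2" and D2_hom: "id \<in> hom D2 (B 2)"
proof -
  interpret B: finite_group "B 2" by (rule finite_group_B)
  have im: "f (\<sigma> 1) = f (\<sigma> 2)" if "f 1 = f 2" "\<sigma> permutes {1..2}" for f :: "nat \<Rightarrow> bit" and \<sigma>
  proof -
    have "\<sigma> 1 \<in> {1..2}" "\<sigma> 2 \<in> {1..2}" using permutes_in_image[OF that(2)] by auto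
    then have "\<sigma> 1 = 1 \<or> \<sigma> 1 = 2" "\<sigma> 2 = 1 \<or> \<sigma> 2 = 2" by auto
    then show ?thesis using that(1) by auto
  qed
  have "subgroup (carrier D2) (B 2)"
  proof (rule B.subgroupI)
    show "carrier D2 \<subseteq> carrier (B 2)" by (auto simp: D2_carrier)
    have "\<one>\<^bsub>B 2\<^esub> \<in> carrier D2" using B.one_closed by (simp add: D2_carrier B_one)
    then show "carrier D2 \<noteq> {}" by blast
    fix a assume a: "a \<in> carrier D2"
    then obtain f \<sigma> where x: "a = (f, \<sigma>)" "f \<in> supp_fun 2" "\<sigma> permutes {1..2}" "f 1 = f 2"
      by (auto simp: D2_carrier B_carrier S_carrier)
    have ca: "a \<in> carrier (B 2)" using a by (auto simp: D2_carrier)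
    show "inv\<^bsub>B 2\<^esub> a \<in> carrier D2"
      using B.inv_closed[OF ca] im[OF x(4,3)] unfolding x(1) B_inv[OF x(2,3)] D2_carrier by simp
    fix b assume b: "b \<in> carrier D2"
    then obtain g \<tau> where y: "b = (g, \<tau>)" "g 1 = g 2" by (auto simp: D2_carrier)
    have cb: "b \<in> carrier (B 2)" using b by (auto simp: D2_carrier)
    show "a \<otimes>\<^bsub>B 2\<^esub> b \<in> carrier D2"
      using B.m_closed[OF ca cb] im[OF y(2) permutes_inv[OF x(3)]] x(4)
      unfolding x(1) y(1) B_mult D2_carrier by simp
  qed
  moreover have D: "D2 = (B 2)\<lparr>carrier := carrier D2\<rparr>" by (simp add: D2_def)
  ultimately have "group D2" using B.subgroup_imp_group by metis
  moreover have "finite (carrier D2)"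
    by (rule finite_subset[OF _ B.fin]) (auto simp: D2_carrier)
  ultimately show "finite_group D2" by (simp add: finite_group_def finite_group_axioms_def)
  show "id \<in> hom D2 (B 2)" by (auto simp: hom_def D2_carrier) (simp add: D2_def)
qed

section \<open>Juxtaposition of permutations and of signed permutations\<close>

lemma sym_juxt_comp:
  assumes "\<sigma>' permutes {1..k}" "\<tau>' permutes {1..l}"
  shows "sym_juxt k (\<sigma> \<circ> \<sigma>', \<tau> \<circ> \<tau>') = sym_juxt k (\<sigma>, \<tau>) \<circ> sym_juxt k (\<sigma>', \<tau>')"
proof
  fix i
  show "sym_juxt k (\<sigma> \<circ> \<sigma>', \<tau> \<circ> \<tau>') i = (sym_juxt k (\<sigma>, \<tau>) \<circ> sym_juxt k (\<sigma>', \<tau>')) i"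
  proof (cases "i \<le> k")
    case True
    then have "\<sigma>' i \<le> k"
      using permutes_in_image[OF assms(1), of i] permutes_not_in[OF assms(1), of i] by (cases "i = 0") auto
    then show ?thesis using True by (simp add: sym_juxt_def)
  next
    case False
    \<comment> \<open>Positivity keeps \<open>\<tau>' (i - k) + k\<close> above \<open>k\<close>,
      hence in the branch of the second factor.\<close>
    then have "0 < \<tau>' (i - k)"
      using permutes_in_image[OF assms(2), of "i - k"] permutes_not_in[OF assms(2), of "i - k"]
      by (cases "i - k \<le> l") auto
    then show ?thesis using False by (simp add: sym_juxt_def)
  qed
qed

lemma sym_juxt_permutes:
  assumes "\<sigma> permutes {1..k}" "\<tau> permutes {1..l}"
  shows "sym_juxt k (\<sigma>, \<tau>) permutes {1..k + l}"
    and "inv' (sym_juxt k (\<sigma>, \<tau>)) = sym_juxt k (inv' \<sigma>, inv' \<tau>)"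
proof -
  have i: "sym_juxt k (id, id) = id" by (auto simp: sym_juxt_def)
  have a: "sym_juxt k (inv' \<sigma>, inv' \<tau>) \<circ> sym_juxt k (\<sigma>, \<tau>) = id"
    "sym_juxt k (\<sigma>, \<tau>) \<circ> sym_juxt k (inv' \<sigma>, inv' \<tau>) = id"
    using sym_juxt_comp[OF assms, of "inv' \<sigma>" "inv' \<tau>"]
      sym_juxt_comp[OF permutes_inv[OF assms(1)] permutes_inv[OF assms(2)], of \<sigma> \<tau>]
    by (simp_all add: permutes_inv_o[OF assms(1)] permutes_inv_o[OF assms(2)] i)
  have bij: "bij (sym_juxt k (\<sigma>, \<tau>))" using a by (intro o_bij)
  have out: "sym_juxt k (\<sigma>, \<tau>) i = i" if "i \<notin> {1..k + l}" for i
  proof (cases "i = 0")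
    case True
    then show ?thesis using permutes_not_in[OF assms(1), of 0] by (simp add: sym_juxt_def)
  next
    case False
    then have "\<not> i \<le> k" "\<not> i - k \<le> l" using that by auto
    then show ?thesis using permutes_not_in[OF assms(2), of "i - k"] by (simp add: sym_juxt_def)
  qed
  show "sym_juxt k (\<sigma>, \<tau>) permutes {1..k + l}"
    unfolding permutes_def using out bij by (metis bij_pointE)
  show "inv' (sym_juxt k (\<sigma>, \<tau>)) = sym_juxt k (inv' \<sigma>, inv' \<tau>)"
    using a by (intro inv_unique_comp)
qed

lemma sym_juxt_hom: "sym_juxt k \<in> hom (S k \<times>\<times> S l) (S (k + l))"
  unfolding hom_def
  by (auto simp: S_carrier sym_juxt_permutes sym_group_mult sym_juxt_comp simp del: o_apply One_nat_def)

abbreviation fun_juxt :: "nat \<Rightarrow> (nat \<Rightarrow> bit) \<Rightarrow> (nat \<Rightarrow> bit) \<Rightarrow> nat \<Rightarrow> bit"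
  where "fun_juxt k f g \<equiv> (\<lambda>i. if i \<le> k then f i else g (i - k))"

lemma fun_juxt_supp:
  assumes "f \<in> supp_fun k" "g \<in> supp_fun l"
  shows "fun_juxt k f g \<in> supp_fun (k + l)"
  unfolding supp_fun_def
proof (intro CollectI allI impI)
  fix i assume "i \<notin> {1..k + l}"
  then have "i \<le> k \<Longrightarrow> i \<notin> {1..k}" "\<not> i \<le> k \<Longrightarrow> i - k \<notin> {1..l}" by auto
  then show "fun_juxt k f g i = 0" using assms by (auto simp: supp_fun_def)
qed

lemma hyp_juxt_hom: "hyp_juxt k \<in> hom (B k \<times>\<times> B l) (B (k + l))"
proof (rule homI)
  fix x assume "x \<in> carrier (B k \<times>\<times> B l)"
  then obtain f \<sigma> g \<tau> where x: "x = ((f, \<sigma>), (g, \<tau>))" "f \<in> supp_fun k" "\<sigma> permutes {1..k}"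
    "g \<in> supp_fun l" "\<tau> permutes {1..l}" by (auto simp: B_carrier S_carrier)
  show "hyp_juxt k x \<in> carrier (B (k + l))"
    using fun_juxt_supp[OF x(2,4)] sym_juxt_permutes(1)[OF x(3,5)]
    by (simp add: x(1) hyp_juxt_def B_carrier S_carrier)
  fix y assume "y \<in> carrier (B k \<times>\<times> B l)"
  then obtain f' \<sigma>' g' \<tau>' where y: "y = ((f', \<sigma>'), (g', \<tau>'))" "f' \<in> supp_fun k" "\<sigma>' permutes {1..k}"
    "g' \<in> supp_fun l" "\<tau>' permutes {1..l}" by (auto simp: B_carrier S_carrier)
  have pt: "(if i \<le> k then f' (inv' \<sigma> i) else g' (inv' \<tau> (i - k))) = fun_juxt k f' g' (inv' (sym_juxt k (\<sigma>, \<tau>)) i)" for i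
  proof (cases "i \<le> k")
    case True
    then have "inv' \<sigma> i \<le> k"
      using permutes_in_image[OF permutes_inv[OF x(3)], of i] permutes_not_in[OF permutes_inv[OF x(3)], of i]
      by (cases "i = 0") auto
    then show ?thesis unfolding sym_juxt_permutes(2)[OF x(3,5)] using True by (simp add: sym_juxt_def)
  next
    case False
    then have "0 < inv' \<tau> (i - k)"
      using permutes_in_image[OF permutes_inv[OF x(5)], of "i - k"] permutes_not_in[OF permutes_inv[OF x(5)], of "i - k"]
      by (cases "i - k \<le> l") auto
    then show ?thesis unfolding sym_juxt_permutes(2)[OF x(3,5)] using False by (simp add: sym_juxt_def)
  qed
  have add: "(if i \<le> k then f i + f' (inv' \<sigma> i) else g (i - k) + g' (inv' \<tau> (i - k))) =
      fun_juxt k f g i + fun_juxt k f' g' (inv' (sym_juxt k (\<sigma>, \<tau>)) i)" for i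
    unfolding pt[symmetric] by (simp del: add_bit_eq_xor)
  show "hyp_juxt k (x \<otimes>\<^bsub>B k \<times>\<times> B l\<^esub> y) = hyp_juxt k x \<otimes>\<^bsub>B (k + l)\<^esub> hyp_juxt k y"
    unfolding x(1) y(1) mult_DirProd B_mult hyp_juxt_def prod.case sym_juxt_comp[OF y(3,5)] add ..
qed

subsection \<open>Inflation from the symmetric group\<close>

text \<open>For a fixed summation element \<open>(e, \<rho>)\<close> the equation between the two
  products splits: the permutation parts satisfy the equation in the symmetric group, and the sign
  vectors of the subgroup element are then uniquely determined. Each solution in the symmetric
  groups thus lifts to exactly one solution here.\<close>

lemma ind_cf_inflate:
  assumes g: "(f, \<sigma>) \<in> carrier (B (k + l))"
  shows "ind_cf (B (k + l)) (B k \<times>\<times> B l) (hyp_juxt k) (\<lambda>(x, y). a (snd x) * b (snd y)) (f, \<sigma>) =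
    ind_cf (S (k + l)) (S k \<times>\<times> S l) (sym_juxt k) (\<lambda>(s, t). a s * b t) \<sigma>"
proof -
  have f: "f \<in> supp_fun (k + l)" and \<sigma>: "\<sigma> permutes {1..k + l}" using g by (auto simp: B_carrier S_carrier)
  let ?T = "\<lambda>\<rho>. \<Sum>q\<in>carrier (S k \<times>\<times> S l). if \<sigma> \<circ> \<rho> = \<rho> \<circ> sym_juxt k q then (case q of (s, t) \<Rightarrow> a s * b t) else 0"
  have inner: "(\<Sum>h\<in>carrier (B k \<times>\<times> B l). if (f, \<sigma>) \<otimes>\<^bsub>B (k + l)\<^esub> (e, \<rho>) = (e, \<rho>) \<otimes>\<^bsub>B (k + l)\<^esub> hyp_juxt k h
       then (case h of (x, y) \<Rightarrow> a (snd x) * b (snd y)) else 0) = ?T \<rho>"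
    if e: "e \<in> supp_fun (k + l)" and \<rho>: "\<rho> permutes {1..k + l}" for e \<rho>
  proof -
    \<comment> \<open>Comparing the first components of the two products at \<open>\<rho> i\<close>
      forces the juxtaposed sign vector to equal \<open>U\<close>; over \<open>bit\<close>,
      subtraction is addition.\<close>
    define U where "U i = f (\<rho> i) + e (inv' \<sigma> (\<rho> i)) + e (\<rho> i)" for i
    define u where "u i = (if i \<le> k then U i else 0)" for i
    \<comment> \<open>Position \<open>0 + k\<close> belongs to the first block, so \<open>v\<close>
      is given the value zero at 0, as membership in \<open>supp_fun l\<close> requires.\<close>
    define v where "v i = (if i = 0 then 0 else U (i + k))" for i
    have Us: "U \<in> supp_fun (k + l)"
      unfolding U_def[abs_def]
      using supp_add[OF supp_add[OF supp_perm[OF f \<rho>] supp_perm[OF e permutes_compose[OF \<rho> permutes_inv[OF \<sigma>]]]] supp_perm[OF e \<rho>]]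
      by (simp del: add_bit_eq_xor)
    have us: "u \<in> supp_fun k" and vs: "v \<in> supp_fun l" using Us by (auto simp: supp_fun_def u_def v_def)
    have cond: "(\<lambda>i. f i + e (inv' \<sigma> i)) = (\<lambda>i. e i + fun_juxt k x y (inv' \<rho> i)) \<longleftrightarrow> x = u \<and> y = v"
      if x: "x \<in> supp_fun k" and y: "y \<in> supp_fun l" for x y
    proof -
      have "(\<lambda>i. f i + e (inv' \<sigma> i)) = (\<lambda>i. e i + fun_juxt k x y (inv' \<rho> i)) \<longleftrightarrow>
        (\<forall>i. f (\<rho> i) + e (inv' \<sigma> (\<rho> i)) = e (\<rho> i) + fun_juxt k x y i)"
        unfolding fun_eq_iff using permutes_inverses[OF \<rho>] by metis
      also have "\<dots> \<longleftrightarrow> (\<forall>i. fun_juxt k x y i = U i)"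
      proof -
        have "p = q + r \<longleftrightarrow> r = p + q" for p q r :: bit
          using bit_double[of q] by (metis add.assoc add.commute add_0)
        then show ?thesis unfolding U_def by (intro all_cong1)
      qed
      also have "\<dots> \<longleftrightarrow> x = u \<and> y = v"
      proof
        assume h: "\<forall>i. fun_juxt k x y i = U i"
        have "x i = u i" for i using h[rule_format, of i] x by (auto simp: u_def supp_fun_def)
        moreover have "y i = v i" for i using h[rule_format, of "i + k"] y by (cases "i = 0") (auto simp: v_def supp_fun_def)
        ultimately show "x = u \<and> y = v" by auto
      qed (auto simp: u_def v_def)
      finally show ?thesis .
    qed
    let ?j = "\<lambda>(s, t). ((u, s), (v, t))"
    have "(\<Sum>h\<in>carrier (B k \<times>\<times> B l). if (f, \<sigma>) \<otimes>\<^bsub>B (k + l)\<^esub> (e, \<rho>) = (e, \<rho>) \<otimes>\<^bsub>B (k + l)\<^esub> hyp_juxt k h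
       then (case h of (x, y) \<Rightarrow> a (snd x) * b (snd y)) else 0) =
      (\<Sum>h\<in>?j ` carrier (S k \<times>\<times> S l). if \<sigma> \<circ> \<rho> = \<rho> \<circ> sym_juxt k (snd (fst h), snd (snd h))
       then (case h of (x, y) \<Rightarrow> a (snd x) * b (snd y)) else 0)"
    proof (rule sum.mono_neutral_cong_right)
      show "finite (carrier (B k \<times>\<times> B l))"
        using finite_group_DirProd[OF finite_group_B finite_group_B] by (simp add: finite_group_def finite_group_axioms_def)
      show "?j ` carrier (S k \<times>\<times> S l) \<subseteq> carrier (B k \<times>\<times> B l)" using us vs by (auto simp: B_carrier)
      show "\<forall>h\<in>carrier (B k \<times>\<times> B l) - ?j ` carrier (S k \<times>\<times> S l).
        (if (f, \<sigma>) \<otimes>\<^bsub>B (k + l)\<^esub> (e, \<rho>) = (e, \<rho>) \<otimes>\<^bsub>B (k + l)\<^esub> hyp_juxt k h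
          then (case h of (x, y) \<Rightarrow> a (snd x) * b (snd y)) else 0) = 0"
      proof
        fix h assume h: "h \<in> carrier (B k \<times>\<times> B l) - ?j ` carrier (S k \<times>\<times> S l)"
        obtain x s y t where d: "h = ((x, s), (y, t))" by (metis surj_pair)
        have xy: "x \<in> supp_fun k" "y \<in> supp_fun l" "(s, t) \<in> carrier (S k \<times>\<times> S l)"
          using h by (auto simp: d B_carrier)
        have "\<not> (x = u \<and> y = v)"
        proof
          assume "x = u \<and> y = v"
          then have "h = ?j (s, t)" by (simp add: d)
          then show False using h xy(3) by blast
        qed
        then show "(if (f, \<sigma>) \<otimes>\<^bsub>B (k + l)\<^esub> (e, \<rho>) = (e, \<rho>) \<otimes>\<^bsub>B (k + l)\<^esub> hyp_juxt k h
          then (case h of (x, y) \<Rightarrow> a (snd x) * b (snd y)) else 0) = 0"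
          using cond[OF xy(1,2)] unfolding d hyp_juxt_def B_mult prod.case by (simp only: prod.inject) auto
      qed
      fix h assume "h \<in> ?j ` carrier (S k \<times>\<times> S l)"
      then obtain s t where d: "h = ((u, s), (v, t))" by auto
      show "(if (f, \<sigma>) \<otimes>\<^bsub>B (k + l)\<^esub> (e, \<rho>) = (e, \<rho>) \<otimes>\<^bsub>B (k + l)\<^esub> hyp_juxt k h
          then (case h of (x, y) \<Rightarrow> a (snd x) * b (snd y)) else 0) =
        (if \<sigma> \<circ> \<rho> = \<rho> \<circ> sym_juxt k (snd (fst h), snd (snd h)) then (case h of (x, y) \<Rightarrow> a (snd x) * b (snd y)) else 0)"
        using cond[OF us vs] unfolding d hyp_juxt_def B_mult prod.case by (simp only: prod.inject) auto
    qed
    also have "\<dots> = ?T \<rho>"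
      by (subst sum.reindex) (auto simp: inj_on_def intro!: sum.cong)
    finally show ?thesis .
  qed
  have "(\<Sum>x\<in>carrier (B (k + l)). \<Sum>h\<in>carrier (B k \<times>\<times> B l). if (f, \<sigma>) \<otimes>\<^bsub>B (k + l)\<^esub> x = x \<otimes>\<^bsub>B (k + l)\<^esub> hyp_juxt k h
       then (case h of (x, y) \<Rightarrow> a (snd x) * b (snd y)) else 0) =
    (\<Sum>(e, \<rho>)\<in>supp_fun (k + l) \<times> carrier (S (k + l)). ?T \<rho>)"
    unfolding B_carrier[of "k + l"] by (intro sum.cong refl) (clarsimp simp only: inner S_carrier mem_Sigma_iff mem_Collect_eq split: prod.split)
  also have "\<dots> = (\<Sum>e\<in>supp_fun (k + l). \<Sum>\<rho>\<in>carrier (S (k + l)). ?T \<rho>)"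
    by (rule sum.cartesian_product[symmetric])
  \<comment> \<open>The summand does not depend on \<open>e\<close>; the number of sign vectors
    cancels against the powers of two in the orders of \<open>B k\<close> and
    \<open>B l\<close>.\<close>
  also have "\<dots> = 2 ^ (k + l) * (\<Sum>\<rho>\<in>carrier (S (k + l)). ?T \<rho>)" by (simp add: card_supp_fun)
  finally show ?thesis
    by (simp add: ind_cf_def B_carrier card_cartesian_product card_supp_fun sym_group_mult power_add)
qed

section \<open>Twists by one-dimensional characters\<close>

text \<open>Pull back along \<open>p\<close>, then multiply by a one-dimensional character
  \<open>c\<close>, on an unchanged space. The representations \<open>wreath_rep\<close> are of this
  kind, and so, up to isomorphism, is an outer product with a one-dimensional
  representation.\<close>

definition twist :: "('h \<Rightarrow> 'g) \<Rightarrow> ('h \<Rightarrow> complex) \<Rightarrow> ('g, 'a) rep \<Rightarrow> ('h, 'a) rep"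
  where "twist p c R = \<lparr>rep_space = rep_space R, rep_act = (\<lambda>h v. cscale (c h) (rep_act R (p h) v))\<rparr>"

lemma twist_rep:
  assumes G: "group G" and H: "group H" and p: "p \<in> hom H G" and R: "is_rep G R"
    and c: "\<And>x y. x \<in> carrier H \<Longrightarrow> y \<in> carrier H \<Longrightarrow> c (x \<otimes>\<^bsub>H\<^esub> y) = c x * c y" "c \<one>\<^bsub>H\<^esub> = 1"
  shows "is_rep H (twist p c R)"
    and "h \<in> carrier H \<Longrightarrow> character (twist p c R) h = c h * character R (p h)"
proof -
  have pc: "p h \<in> carrier G" if "h \<in> carrier H" for h using p that by (auto simp: hom_def)
  have one: "p \<one>\<^bsub>H\<^esub> = \<one>\<^bsub>G\<^esub>" using hom_one[OF p H G] .
  show "is_rep H (twist p c R)"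
  proof (rule is_repI)
    show "fdim (rep_space (twist p c R))" using rep_fdim[OF R] by (simp add: twist_def)
    show "rep_act (twist p c R) g v \<in> rep_space (twist p c R)" if "g \<in> carrier H" "v \<in> rep_space (twist p c R)" for g v
      using that rep_closed[OF R pc] rep_subspace[OF R] by (simp add: twist_def cfun.subspace_scale)
    show "linear_on_space (rep_space (twist p c R)) (rep_act (twist p c R) g)" if "g \<in> carrier H" for g
      unfolding twist_def using lin_cscale_map[OF rep_lin[OF R pc[OF that]]] by simp
    show "rep_act (twist p c R) \<one>\<^bsub>H\<^esub> v = v" if "v \<in> rep_space (twist p c R)" for v
      using that rep_one[OF R] by (simp add: twist_def one c)
    show "rep_act (twist p c R) (g \<otimes>\<^bsub>H\<^esub> h) v = rep_act (twist p c R) g (rep_act (twist p c R) h v)"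
      if "g \<in> carrier H" "h \<in> carrier H" "v \<in> rep_space (twist p c R)" for g h v
      using that rep_mult[OF R pc pc] lin_scale[OF rep_lin[OF R pc]] rep_closed[OF R pc] hom_mult[OF p]
      by (simp add: twist_def c mult.assoc)
  qed
  show "character (twist p c R) h = c h * character R (p h)" if "h \<in> carrier H"
    unfolding character_def twist_def using rep_lin[OF R pc[OF that]] rep_closed[OF R pc[OF that]]
    by simp (intro tr_cscale[OF rep_fdim[OF R]], auto)
qed

text \<open>Each element of \<open>G\<close> is the image of some \<open>h\<close> with
  \<open>c h = 1\<close>, and such an \<open>h\<close> acts in the twist as its image acts in
  \<open>R\<close>; a subspace invariant for the twist is therefore invariant for
  \<open>R\<close>.\<close>

lemma twist_irreducible:
  assumes G: "group G" and H: "group H" and p: "p \<in> hom H G" and R: "irreducible_rep G R"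
    and c: "\<And>x y. x \<in> carrier H \<Longrightarrow> y \<in> carrier H \<Longrightarrow> c (x \<otimes>\<^bsub>H\<^esub> y) = c x * c y" "c \<one>\<^bsub>H\<^esub> = 1"
    and surj: "\<And>g. g \<in> carrier G \<Longrightarrow> \<exists>h\<in>carrier H. p h = g \<and> c h = 1"
  shows "irreducible_rep H (twist p c R)"
  unfolding irreducible_rep_def
proof (intro conjI allI impI)
  have RR: "is_rep G R" using R by (simp add: irreducible_rep_def)
  show "is_rep H (twist p c R)" by (rule twist_rep(1)[OF G H p RR c])
  show "rep_space (twist p c R) \<noteq> {0}" using R by (simp add: irreducible_rep_def twist_def)
  fix U assume U: "invariant_subspace H (twist p c R) U"
  have "invariant_subspace G R U"
    unfolding invariant_subspace_def
  proof (intro conjI ballI)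
    fix g assume "g \<in> carrier G"
    then obtain h where h: "h \<in> carrier H" "p h = g" "c h = 1" using surj by blast
    then have "rep_act (twist p c R) h ` U \<subseteq> U" using U by (simp add: invariant_subspace_def)
    then show "rep_act R g ` U \<subseteq> U" using h by (simp add: twist_def)
  qed (use U in \<open>auto simp: invariant_subspace_def twist_def\<close>)
  then show "U = {0} \<or> U = rep_space (twist p c R)" using R by (simp add: irreducible_rep_def twist_def)
qed

lemma one_dim_rep_rep:
  assumes G: "group G" and c: "\<And>x y. x \<in> carrier G \<Longrightarrow> y \<in> carrier G \<Longrightarrow> c (x \<otimes>\<^bsub>G\<^esub> y) = c x * c y" "c \<one>\<^bsub>G\<^esub> = 1"
  shows "is_rep G (one_dim_rep c)" and "g \<in> carrier G \<Longrightarrow> character (one_dim_rep c) g = c g"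
proof -
  have F: "frame (rep_space (one_dim_rep c)) {()} (\<lambda>_ _. 1) (\<lambda>_ w. w ())"
    by (auto simp: frame_def one_dim_rep_def lin_fun_def cscale_def)
  have sub: "cfun.subspace (rep_space (one_dim_rep c))" by (simp add: one_dim_rep_def)
  show R: "is_rep G (one_dim_rep c)"
  proof (rule is_repI[OF fdimI[OF sub F]])
    show "linear_on_space (rep_space (one_dim_rep c)) (rep_act (one_dim_rep c) g)" for g
      by (auto simp: one_dim_rep_def linear_on_space_def cfun.scale_right_distrib mult.commute)
  qed (auto simp: one_dim_rep_def c)
  show "g \<in> carrier G \<Longrightarrow> character (one_dim_rep c) g = c g"
    by (subst char_frame[OF R F]) (auto simp: one_dim_rep_def cscale_def)
qed

section \<open>Pieri rules\<close>

text \<open>When the last \<open>k\<close> points lie in different cycles, a permutation conjugating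
  \<open>g\<close> to its inverse can be chosen to fix them; it then belongs to the first factor of
  the subgroup.\<close>

lemma inverse_conjugate_inv:
  assumes g: "g permutes {1..m + k}"
    and orb: "\<And>x y. x \<in> {m + 1..m + k} \<Longrightarrow> y \<in> {m + 1..m + k} \<Longrightarrow> y \<in> orbit g x \<Longrightarrow> x = y"
    and a: "\<And>h. h \<in> carrier (S m \<times>\<times> S k) \<Longrightarrow>
      a (sym_juxt m h \<otimes>\<^bsub>S (m + k)\<^esub> g \<otimes>\<^bsub>S (m + k)\<^esub> inv\<^bsub>S (m + k)\<^esub> (sym_juxt m h)) = (a g :: complex)"
  shows "a (inv' g) = a g"
proof -
  obtain h where h: "h permutes {1..m + k}" "h \<circ> g = inv' g \<circ> h" "\<And>x. x \<in> {m + 1..m + k} \<Longrightarrow> h x = x"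
    by (rule conjugate_inverse[OF g, of "{m + 1..m + k}"]) (use orb in auto)
  have hm: "h permutes {1..m}"
    by (rule permutes_superset[OF h(1)]) (use h(3) in auto)
  have j: "sym_juxt m (h, id) = h"
    using hm permutes_not_in[OF hm] by (auto simp: sym_juxt_def)
  have "sym_juxt m (h, id) \<otimes>\<^bsub>S (m + k)\<^esub> g \<otimes>\<^bsub>S (m + k)\<^esub> inv\<^bsub>S (m + k)\<^esub> (sym_juxt m (h, id)) = inv' g"
    unfolding j using h(1,2) by (simp add: S_carrier sym_group_mult comp_assoc permutes_inv_o)
  then show ?thesis using a[of "(h, id)"] hm by (simp add: S_carrier permutes_id)
qed

text \<open>If the last points lie in different cycles, \<open>inverse_conjugate_inv\<close>
  applies. Otherwise \<open>k = 2\<close>, and with \<open>s\<close> the transposition of the two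
  last points the product \<open>g s\<close> has them in different cycles. Its inverse is
  \<open>s\<close> times the inverse of \<open>g\<close>, so equivariance on the left and on the
  right brings out the same nonzero factor, which is cancelled.\<close>

lemma symmetric_coefficients:
  assumes k: "k = 1 \<or> k = 2" and g: "g \<in> carrier (S (m + k))"
    and c: "c (id, transpose 1 2) * c (id, transpose 1 2) = (1 :: complex)"
    and a: "\<And>h g. h \<in> carrier (S m \<times>\<times> S k) \<Longrightarrow> g \<in> carrier (S (m + k)) \<Longrightarrow>
      a (sym_juxt m h \<otimes>\<^bsub>S (m + k)\<^esub> g \<otimes>\<^bsub>S (m + k)\<^esub> inv\<^bsub>S (m + k)\<^esub> (sym_juxt m h)) = (a g :: complex)"
    and left: "\<And>s g. s \<in> (if k = 2 then {(id, transpose 1 2)} else {}) \<Longrightarrow> g \<in> carrier (S (m + k)) \<Longrightarrow>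
      a (sym_juxt m s \<otimes>\<^bsub>S (m + k)\<^esub> g) = c s * a g"
    and right: "\<And>s g. s \<in> (if k = 2 then {(id, transpose 1 2)} else {}) \<Longrightarrow> g \<in> carrier (S (m + k)) \<Longrightarrow>
      a (g \<otimes>\<^bsub>S (m + k)\<^esub> sym_juxt m s) = c s * a g"
  shows "a (inv\<^bsub>S (m + k)\<^esub> g) = a g"
proof -
  have gp: "g permutes {1..m + k}" using g by (simp add: S_carrier)
  show ?thesis
  proof (cases "k = 2 \<and> m + 2 \<in> orbit g (m + 1)")
    case False
    have p: "permutation g" using gp permutation_permutes by blast
    have sym: "y \<in> orbit g x \<Longrightarrow> x \<in> orbit g y" for x y
      using orbit_eq[OF p, of y x] permutation_self_in_orbit[OF p, of x] by simp
    have "x = y" if xy: "x \<in> {m + 1..m + k}" "y \<in> {m + 1..m + k}" "y \<in> orbit g x" for x y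
    proof (rule ccontr)
      assume "x \<noteq> y"
      then have "k = 2" using k xy by auto
      moreover have "x = m + 1 \<and> y = m + 2 \<or> x = m + 2 \<and> y = m + 1" using \<open>x \<noteq> y\<close> xy \<open>k = 2\<close> by auto
      ultimately show False using False xy(3) sym by blast
    qed
    then show ?thesis using inverse_conjugate_inv[OF gp _ a[OF _ g]] g by simp
  next
    case True
    then have k2: "k = 2" and orb: "m + 2 \<in> orbit g (m + 1)" by auto
    let ?s = "transpose (m + 1) (m + 2)"
    let ?e = "c (id, transpose 1 2)"
    have s: "sym_juxt m (id, transpose 1 2) = ?s"
    proof
      fix i
      show "sym_juxt m (id, transpose 1 2) i = ?s i"
        by (cases "i \<le> m"; cases "i = m + 1"; cases "i = m + 2") (auto simp: sym_juxt_def transpose_def)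
    qed
    have sp: "?s permutes {1..m + k}" using k2 by (intro permutes_swap_id) auto
    have gsp: "g \<circ> ?s permutes {1..m + k}" using permutes_compose[OF sp gp] .
    have p: "permutation (g \<circ> ?s)" using gsp permutation_permutes by blast
    have no: "m + 2 \<notin> orbit (g \<circ> ?s) (m + 1)" by (rule split_cycle[OF gp _ _ orb]) auto
    have sym: "y \<in> orbit (g \<circ> ?s) x \<Longrightarrow> x \<in> orbit (g \<circ> ?s) y" for x y
      using orbit_eq[OF p, of y x] permutation_self_in_orbit[OF p, of x] by simp
    have "x = y" if xy: "x \<in> {m + 1..m + k}" "y \<in> {m + 1..m + k}" "y \<in> orbit (g \<circ> ?s) x" for x y
    proof (rule ccontr)
      assume "x \<noteq> y"
      then have "x = m + 1 \<and> y = m + 2 \<or> x = m + 2 \<and> y = m + 1" using xy k2 by auto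
      then show False using no xy(3) sym by blast
    qed
    moreover have "g \<circ> ?s \<in> carrier (S (m + k))" using gsp by (simp add: S_carrier)
    ultimately have e1: "a (inv' (g \<circ> ?s)) = a (g \<circ> ?s)" using inverse_conjugate_inv[OF gsp _ a] by blast
    have "inv' (g \<circ> ?s) = ?s \<circ> inv' g"
      using gp by (simp add: o_inv_distrib permutes_bij bij_swap_iff)
    moreover have "a (?s \<circ> inv' g) = ?e * a (inv' g)"
      using left[of "(id, transpose 1 2)" "inv' g"] k2 permutes_inv[OF gp] unfolding s by (simp add: S_carrier sym_group_mult)
    moreover have "a (g \<circ> ?s) = ?e * a g"
      using right[of "(id, transpose 1 2)" g] k2 g unfolding s by (simp add: sym_group_mult)
    ultimately have "?e * a (inv' g) = ?e * a g" using e1 by simp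
    moreover have "?e \<noteq> 0" using c by auto
    ultimately show ?thesis using g by simp
  qed
qed

text \<open>By reciprocity the coefficients of the induced character are multiplicities on the
  subgroup, where \<open>symmetric_coefficients\<close> supplies the hypothesis of
  \<open>multiplicity_free\<close>. Being zero or one, they reduce the expansion in Specht
  characters to the set of summands.\<close>

lemma pieri:
  assumes lam: "lam \<in> partitions m" and k: "k = 1 \<or> k = 2"
    and \<chi>: "\<And>x y. x \<in> carrier (S k) \<Longrightarrow> y \<in> carrier (S k) \<Longrightarrow> \<chi> (x \<circ> y) = \<chi> x * \<chi> y" "\<chi> id = 1"
    and \<sigma>: "\<sigma> \<in> carrier (S (m + k))"
  shows "ind_cf (S (m + k)) (S m \<times>\<times> S k) (sym_juxt m) (\<lambda>(s, t). character (specht lam) s * \<chi> t) \<sigma> =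
    (\<Sum>\<tau>\<in>summands_ind lam k \<chi>. character (specht \<tau>) \<sigma>)"
proof -
  note sl = partitionsD(3)[OF lam]
  let ?G = "S (m + k)" and ?H = "S m \<times>\<times> S k"
  interpret G: finite_group ?G by (rule finite_group_sym)
  interpret Sm: finite_group "S m" by (rule finite_group_sym)
  interpret Sk: finite_group "S k" by (rule finite_group_sym)
  have H: "finite_group ?H" by (rule finite_group_DirProd[OF finite_group_sym finite_group_sym])
  interpret H: finite_group ?H by (rule H)
  note irr = specht_irreducible[OF lam]
  have spl: "is_rep (S m) (specht lam)" using irr by (simp add: irreducible_rep_def)
  have \<chi>': "\<And>x y. x \<in> carrier (S k) \<Longrightarrow> y \<in> carrier (S k) \<Longrightarrow> \<chi> (x \<otimes>\<^bsub>S k\<^esub> y) = \<chi> x * \<chi> y" "\<chi> \<one>\<^bsub>S k\<^esub> = 1"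
    using \<chi> by (auto simp: sym_group_mult sym_group_one)
  have od: "is_rep (S k) (one_dim_rep \<chi>)" "\<And>g. g \<in> carrier (S k) \<Longrightarrow> character (one_dim_rep \<chi>) g = \<chi> g"
    using one_dim_rep_rep[of "S k" \<chi>] Sk.is_group \<chi>' by auto
  note ot = outer_tensor_rep[OF spl od(1) Sm.is_group Sk.is_group]
  let ?R = "induced_rep ?G ?H (sym_juxt m) (specht lam \<boxtimes> one_dim_rep \<chi>)"
  let ?F = "ind_cf ?G ?H (sym_juxt m) (\<lambda>(s, t). character (specht lam) s * \<chi> t)"
  note ir = induced_rep_rep[OF finite_group_sym H sym_juxt_hom ot(1)]
  have ch: "character ?R g = ?F g" if "g \<in> carrier ?G" for g
    unfolding ir(2)[OF that] using ot(2) od(2) by (intro ind_cf_cong) auto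
  have cf: "class_fun ?G ?F"
    unfolding class_fun_def
  proof (intro ballI)
    fix g h assume g: "g \<in> carrier ?G" and h: "h \<in> carrier ?G"
    have hgh: "h \<otimes>\<^bsub>?G\<^esub> g \<otimes>\<^bsub>?G\<^esub> inv\<^bsub>?G\<^esub> h \<in> carrier ?G"
      using g h by (intro G.m_closed G.inv_closed)
    from G.character_class[OF ir(1) g h] show "?F (h \<otimes>\<^bsub>?G\<^esub> g \<otimes>\<^bsub>?G\<^esub> inv\<^bsub>?G\<^esub> h) = ?F g"
      unfolding ch[OF hgh] ch[OF g] .
  qed
  let ?c = "\<lambda>h. \<chi> (snd h)"
  have fsth: "fst \<in> hom ?H (S m)" by (auto simp: hom_def)
  have cH: "\<And>x y. x \<in> carrier ?H \<Longrightarrow> y \<in> carrier ?H \<Longrightarrow> ?c (x \<otimes>\<^bsub>?H\<^esub> y) = ?c x * ?c y" "?c \<one>\<^bsub>?H\<^esub> = 1"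
    using \<chi>' by auto
  \<comment> \<open>The outer product of \<open>specht lam\<close> with \<open>\<chi>\<close>,
    realised on the space of \<open>specht lam\<close>, where irreducibility is inherited through
    \<open>twist_irreducible\<close>.\<close>
  let ?L = "twist fst ?c (specht lam)"
  have L: "irreducible_rep ?H ?L"
  proof (rule twist_irreducible[OF Sm.is_group H.is_group fsth irr cH])
    fix g assume "g \<in> carrier (S m)"
    then show "\<exists>h\<in>carrier ?H. fst h = g \<and> \<chi> (snd h) = 1"
      using \<chi>(2) Sk.one_closed by (intro bexI[of _ "(g, id)"]) (auto simp: sym_group_one)
  qed
  have chL: "character ?L h = (case h of (s, t) \<Rightarrow> character (specht lam) s * \<chi> t)" if "h \<in> carrier ?H" for h
  proof -
    have "character ?L h = ?c h * character (specht lam) (fst h)"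
      by (rule twist_rep(2)[OF Sm.is_group H.is_group fsth spl _ _ that]) (use cH in blast)+
    then show ?thesis by (simp add: split_beta)
  qed
  let ?s = "(id, transpose 1 2) :: (nat \<Rightarrow> nat) \<times> (nat \<Rightarrow> nat)"
  \<comment> \<open>The transposition of the two added points acts on \<open>?L\<close> by the
    scalar that \<open>\<chi>\<close> assigns to it.\<close>
  let ?B = "if k = 2 then {?s} else {}"
  have BH: "?B \<subseteq> carrier ?H" by (auto simp: S_carrier permutes_id intro!: permutes_swap_id)
  have tr2: "transpose 1 2 \<in> carrier (S k)" if "k = 2" using that by (auto simp: S_carrier intro!: permutes_swap_id)
  \<comment> \<open>For \<open>k = 1\<close> the transposition lies outside \<open>S k\<close>,
    where nothing is assumed about \<open>\<chi>\<close>; the value one keeps \<open>c2\<close>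
    true.\<close>
  define c where "c h = (if k = 2 then \<chi> (snd h) else 1)" for h :: "(nat \<Rightarrow> nat) \<times> (nat \<Rightarrow> nat)"
  have c2: "c ?s * c ?s = 1"
    using \<chi>(1)[OF tr2 tr2] \<chi>(2) by (auto simp: c_def)
  have Bact: "rep_act ?L s v = cscale (c s) v" if "s \<in> ?B" "v \<in> rep_space ?L" for s v
  proof -
    have "rep_act (specht lam) id v = v" by (simp add: specht_act act_id)
    then show ?thesis using that by (auto simp: twist_def c_def split: if_splits)
  qed
  have mult: "G.cip (character (specht \<tau>)) ?F \<in> {0, 1}" if t: "\<tau> \<in> partitions (m + k)" for \<tau>
  proof -
    note irt = specht_irreducible[OF t]
    have rt: "is_rep ?G (specht \<tau>)" using irt by (simp add: irreducible_rep_def)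
    have "H.cip (character ?L) (\<lambda>h. character (specht \<tau>) (sym_juxt m h)) \<in> {0, 1}"
    proof (rule multiplicity_free[OF finite_group_sym H sym_juxt_hom irt L BH Bact])
      fix a :: "(nat \<Rightarrow> nat) \<Rightarrow> complex" and g
      assume a: "\<And>h g. h \<in> carrier ?H \<Longrightarrow> g \<in> carrier ?G \<Longrightarrow>
          a (sym_juxt m h \<otimes>\<^bsub>?G\<^esub> g \<otimes>\<^bsub>?G\<^esub> inv\<^bsub>?G\<^esub> sym_juxt m h) = a g"
        "\<And>s g. s \<in> ?B \<Longrightarrow> g \<in> carrier ?G \<Longrightarrow> a (sym_juxt m s \<otimes>\<^bsub>?G\<^esub> g) = c s * a g"
        "\<And>s g. s \<in> ?B \<Longrightarrow> g \<in> carrier ?G \<Longrightarrow> a (g \<otimes>\<^bsub>?G\<^esub> sym_juxt m s) = c s * a g"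
        "g \<in> carrier ?G"
      show "a (inv\<^bsub>?G\<^esub> g) = a g"
        by (rule symmetric_coefficients[OF k a(4) c2 a(1-3)])
    qed
    also have "H.cip (character ?L) (\<lambda>h. character (specht \<tau>) (sym_juxt m h)) =
      H.cip (\<lambda>h. character (specht \<tau>) (sym_juxt m h)) (\<lambda>(s, t). character (specht lam) s * \<chi> t)"
      by (subst H.cip_commute) (intro H.cip_cong refl chL)
    also have "\<dots> = G.cip (character (specht \<tau>)) ?F"
      using G.character_class[OF rt] by (intro G.frobenius[OF H sym_juxt_hom, symmetric])
    finally show ?thesis .
  qed
  have sm: "summands_ind lam k \<chi> = {\<tau> \<in> partitions (m + k). G.cip (character (specht \<tau>)) ?F \<noteq> 0}"
  proof -
    have "is_summand ?G (specht \<tau>) ?R \<longleftrightarrow> G.cip (character (specht \<tau>)) ?F \<noteq> 0" if t: "\<tau> \<in> partitions (m + k)" for \<tau>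
      unfolding G.is_summand_iff[OF specht_irreducible[OF t] ir(1)]
      using G.cip_cong[of "character (specht \<tau>)" "character (specht \<tau>)" "character ?R" ?F] ch by simp
    then show ?thesis unfolding summands_ind_def sl Let_def by blast
  qed
  have "?F \<sigma> = (\<Sum>\<tau>\<in>partitions (m + k). G.cip (character (specht \<tau>)) ?F * character (specht \<tau>) \<sigma>)"
    by (rule specht_expansion[OF cf \<sigma>])
  also have "\<dots> = (\<Sum>\<tau>\<in>summands_ind lam k \<chi>. character (specht \<tau>) \<sigma>)"
    unfolding sm using mult finite_partitions by (intro sum.mono_neutral_cong_right) auto
  finally show ?thesis .
qed

section \<open>One-dimensional Specht modules\<close>

lemma specht_scalar:
  assumes lam: "lam \<in> partitions n" and g: "g \<in> carrier (S n)"
    and "\<And>g t. g \<in> carrier (S n) \<Longrightarrow> tableau lam t \<Longrightarrow>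
      rep_act (specht lam) g (polytabloid lam t) = cscale (c g) (polytabloid lam t)"
  shows "character (specht lam) g = c g"
proof -
  interpret finite_group "S n" by (rule finite_group_sym)
  show ?thesis
  proof (rule scalar_irreducible[OF specht_irreducible[OF lam] _ g])
    fix g v assume g: "g \<in> carrier (S n)" and v: "v \<in> rep_space (specht lam)"
    show "rep_act (specht lam) g v = cscale (c g) v"
      using v unfolding specht_space
    proof (induction rule: span_induct_mem)
      case (step d x y)
      have x: "rep_act (specht lam) g x = cscale (c g) x" using step.hyps(1) assms(3)[OF g] by blast
      have "rep_act (specht lam) g (cscale d x + y) = cscale d (rep_act (specht lam) g x) + rep_act (specht lam) g y"
        by (auto simp: specht_act cscale_def)
      also have "\<dots> = cscale (c g) (cscale d x + y)"
        unfolding x step.IH cfun.scale_right_distrib by (simp add: mult.commute)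
      finally show ?case .
    qed (auto simp: specht_act cscale_def)
  qed
qed

text \<open>There is a single tabloid of this shape. The empty partition of zero is included because
  it occurs as a component of \<open>bispecht\<close>.\<close>

lemma specht_one_row:
  assumes "lam = [n] \<and> 0 < n \<or> lam = [] \<and> n = 0" and g: "g \<in> carrier (S n)"
  shows "character (specht lam) g = 1"
proof (rule specht_scalar[OF _ g])
  show "lam \<in> partitions n" using assms(1) by (auto simp: partitions_def)
  fix g t assume g: "g \<in> carrier (S n)" and t: "tableau lam t"
  let ?T = "if n = 0 then [] else [{1..n}]"
  have "tabloid lam t' = ?T" if "tableau lam t'" for t'
  proof (cases "n = 0")
    case False
    then have "lam = [n]" using assms(1) by auto
    moreover have "{c \<in> young_diagram [n]. fst c = 0} = young_diagram [n]" by (auto simp: young_diagram_def)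
    ultimately show ?thesis using that False by (simp add: tabloid_def tableau_def bij_betw_def)
  qed (use assms(1) in \<open>auto simp: tabloid_def\<close>)
  note eqT = this
  have "?T \<in> tabloids lam" using t unfolding tabloids_def eqT[OF t, symmetric] by blast
  then have tb: "tabloids lam = {?T}" using eqT unfolding tabloids_def by blast
  have sl: "sum_list lam = n" using assms(1) by auto
  have gi: "inv' g permutes {1..sum_list lam}" using g sl by (simp add: S_carrier permutes_inv)
  have gp: "g permutes {1..sum_list lam}" using g sl by (simp add: S_carrier)
  show "rep_act (specht lam) g (polytabloid lam t) = cscale 1 (polytabloid lam t)"
  proof
    fix T
    show "rep_act (specht lam) g (polytabloid lam t) T = cscale 1 (polytabloid lam t) T"
    proof (cases "T \<in> tabloids lam")
      case True
      then have "act (inv' g) T = T" using act_tabloids[OF gi True] tb by auto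
      then show ?thesis by (simp add: specht_act cscale_def)
    next
      case False
      then have "act (inv' g) T \<notin> tabloids lam"
        using act_tabloids[OF gp, of "act (inv' g) T"] act_inv'[OF gp, of T] by auto
      then have "polytabloid lam t (act (inv' g) T) = 0" "polytabloid lam t T = 0"
        using False polytabloid_supp[OF t] by blast+
      then show ?thesis by (simp add: specht_act cscale_def)
    qed
  qed
qed

text \<open>The diagram is a single column, so the whole group is a column stabiliser, on which
  polytabloids transform by the sign.\<close>

lemma specht_column:
  assumes g: "g \<in> carrier (S 2)"
  shows "character (specht [1, 1]) g = of_int (sign g)"
proof (rule specht_scalar[OF _ g])
  show "[1, 1] \<in> partitions 2" by (simp add: partitions_def)
  fix g t assume g: "g \<in> carrier (S 2)" and t: "tableau [1, 1] t"
  have col: "{c \<in> young_diagram [1, 1]. snd c = j} = (if j = 0 then young_diagram [1, 1] else {})" for j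
    by (auto simp: young_diagram_def nth_Cons split: nat.splits)
  have "g \<in> Cst [1, 1] t"
    unfolding cs_iff col using g t permutes_image[of g "{1..2}"]
    by (auto simp: S_carrier tableau_def bij_betw_def numeral_2_eq_2)
  then show "rep_act (specht [1, 1]) g (polytabloid [1, 1] t) = cscale (of_int (sign g)) (polytabloid [1, 1] t)"
    by (rule polytabloid_sign)
qed

section \<open>Characters of the representations of the hyperoctahedral groups\<close>

type_synonym hyp = "(nat \<Rightarrow> bit) \<times> (nat \<Rightarrow> nat)"

text \<open>The character of \<open>(1; S^\<lambda>)\<close>.\<close>

definition chi1 :: "nat list \<Rightarrow> (nat \<Rightarrow> bit) \<times> (nat \<Rightarrow> nat) \<Rightarrow> complex"
  where "chi1 lam = (\<lambda>(f, \<sigma>). character (specht lam) \<sigma>)"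

text \<open>The one-dimensional character \<open>(\<epsilon>; 1)\<close>. It is multiplicative under
  juxtaposition, which lets it be pulled out of inductions.\<close>

definition sgnF :: "nat \<Rightarrow> (nat \<Rightarrow> bit) \<times> (nat \<Rightarrow> nat) \<Rightarrow> complex"
  where "sgnF m = (\<lambda>(f, \<sigma>). \<Prod>i\<in>{1..m}. sign_F (f i))"

text \<open>The character of \<open>(\<epsilon>; S^\<mu>)\<close>, with its one-dimensional factor
  kept separate.\<close>

definition chie :: "nat list \<Rightarrow> (nat \<Rightarrow> bit) \<times> (nat \<Rightarrow> nat) \<Rightarrow> complex"
  where "chie mu x = sgnF (sum_list mu) x * character (specht mu) (snd x)"

lemma snd_hom: "snd \<in> hom (B m) (S m)"
  by (auto simp: hom_def B_carrier B_mult sym_group_mult)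

text \<open>Permuting the coordinates does not change a product over all of them.\<close>

lemma wreath_character_mult:
  assumes D: "\<And>x y. D (x + y) = D x * (D y :: complex)" and x: "x \<in> carrier (B m)"
  shows "(\<Prod>i\<in>{1..m}. D (fst (x \<otimes>\<^bsub>B m\<^esub> y) i)) = (\<Prod>i\<in>{1..m}. D (fst x i)) * (\<Prod>i\<in>{1..m}. D (fst y i))"
proof -
  obtain f \<sigma> where x': "x = (f, \<sigma>)" "\<sigma> permutes {1..m}" using x by (auto simp: B_carrier S_carrier)
  obtain g \<tau> where y: "y = (g, \<tau>)" by (cases y)
  have "(\<Prod>i\<in>{1..m}. D (g (inv' \<sigma> i))) = (\<Prod>i\<in>{1..m}. D (g i))"
    using prod.permute[OF permutes_inv[OF x'(2)], of "\<lambda>i. D (g i)"] by (simp add: comp_def)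
  then show ?thesis by (simp add: x'(1) y B_mult D prod.distrib del: add_bit_eq_xor)
qed

lemma wreath_rep_rep:
  assumes E: "is_rep (S m) E" and D: "\<And>x y. D (x + y) = D x * (D y :: complex)" "D 0 = 1"
  shows "is_rep (B m) (wreath_rep m D E)"
    and "x \<in> carrier (B m) \<Longrightarrow> character (wreath_rep m D E) x = (\<Prod>i\<in>{1..m}. D (fst x i)) * character E (snd x)"
proof -
  have eq: "wreath_rep m D E = twist snd (\<lambda>x. \<Prod>i\<in>{1..m}. D (fst x i)) E"
    by (simp add: wreath_rep_def twist_def fun_eq_iff split: prod.splits)
  have g: "group (S m)" "group (B m)"
    using finite_group_sym finite_group_B by (auto simp: finite_group_def)
  have m: "(\<Prod>i\<in>{1..m}. D (fst (x \<otimes>\<^bsub>B m\<^esub> y) i)) = (\<Prod>i\<in>{1..m}. D (fst x i)) * (\<Prod>i\<in>{1..m}. D (fst y i))"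
    if "x \<in> carrier (B m)" "y \<in> carrier (B m)" for x y
    by (rule wreath_character_mult) (use D that in auto)
  have o: "(\<Prod>i\<in>{1..m}. D (fst \<one>\<^bsub>B m\<^esub> i)) = 1" by (simp add: B_one D)
  show "is_rep (B m) (wreath_rep m D E)"
    unfolding eq by (rule twist_rep(1)[where c = "\<lambda>x. \<Prod>i\<in>{1..m}. D (fst x i)", OF g snd_hom E m o])
  show "x \<in> carrier (B m) \<Longrightarrow> character (wreath_rep m D E) x = (\<Prod>i\<in>{1..m}. D (fst x i)) * character E (snd x)"
    unfolding eq by (rule twist_rep(2)[where c = "\<lambda>x. \<Prod>i\<in>{1..m}. D (fst x i)", OF g snd_hom E m o])
qed

lemma sign_F_mult: "sign_F (x + y) = sign_F x * sign_F y"
  using bit_cases[of x] bit_cases[of y] by (auto simp: sign_F_def)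

lemma sgnF_mult: "x \<in> carrier (B m) \<Longrightarrow> sgnF m (x \<otimes>\<^bsub>B m\<^esub> y) = sgnF m x * sgnF m y"
  using wreath_character_mult[of sign_F x m y, OF sign_F_mult] by (simp add: sgnF_def split_beta)

lemma sgnF_nonzero: "sgnF m x \<noteq> 0"
  by (simp add: sgnF_def sign_F_def split_beta)

lemma sgnF_juxt: "sgnF (l + q) (hyp_juxt l (x, y)) = sgnF l x * sgnF q y"
proof -
  obtain f \<sigma> g \<tau> where xy: "x = (f, \<sigma>)" "y = (g, \<tau>)" by (cases x, cases y)
  have "(\<Prod>i\<in>{1..l + q}. sign_F (fun_juxt l f g i)) =
      (\<Prod>i\<in>{1..l}. sign_F (fun_juxt l f g i)) * (\<Prod>i\<in>{l + 1..l + q}. sign_F (fun_juxt l f g i))"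
    by (rule prod.ub_add_nat) simp
  also have "(\<Prod>i\<in>{1..l}. sign_F (fun_juxt l f g i)) = (\<Prod>i\<in>{1..l}. sign_F (f i))"
    by (intro prod.cong) auto
  also have "(\<Prod>i\<in>{l + 1..l + q}. sign_F (fun_juxt l f g i)) = (\<Prod>i\<in>{1..q}. sign_F (g i))"
    by (rule prod.reindex_bij_witness[of _ "\<lambda>i. i + l" "\<lambda>i. i - l"]) auto
  finally show ?thesis by (simp add: xy sgnF_def hyp_juxt_def)
qed

lemma finite_group_BB: "finite_group (B k \<times>\<times> B l)"
  by (intro finite_group_DirProd finite_group_B)

lemma bispecht_rep:
  assumes "lam \<in> partitions k" "mu \<in> partitions l"
  shows "is_rep (B (k + l)) (bispecht lam mu)"
    and "x \<in> carrier (B (k + l)) \<Longrightarrow> character (bispecht lam mu) x =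
      ind_cf (B (k + l)) (B k \<times>\<times> B l) (hyp_juxt k) (\<lambda>(x, y). chi1 lam x * chie mu y) x"
proof -
  note L = partitionsD(3)[OF assms(1)] and M = partitionsD(3)[OF assms(2)]
  have g: "group (B m)" for m using finite_group_B by (auto simp: finite_group_def)
  have s: "is_rep (S k) (specht lam)" "is_rep (S l) (specht mu)"
    using specht_rep[of lam] specht_rep[of mu] L M by auto
  note w1 = wreath_rep_rep[of k "specht lam" triv_F, OF s(1)]
  have r1: "is_rep (B k) (wreath_rep k triv_F (specht lam))"
    "\<And>x. x \<in> carrier (B k) \<Longrightarrow> character (wreath_rep k triv_F (specht lam)) x = chi1 lam x"
    using w1 by (auto simp: triv_F_def chi1_def split_beta)
  note w2 = wreath_rep_rep[of l "specht mu" sign_F, OF s(2) sign_F_mult]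
  have r2: "is_rep (B l) (wreath_rep l sign_F (specht mu))"
    "\<And>x. x \<in> carrier (B l) \<Longrightarrow> character (wreath_rep l sign_F (specht mu)) x = chie mu x"
    using w2 by (auto simp: sign_F_def chie_def sgnF_def M split_beta)
  note ot = outer_tensor_rep[OF r1(1) r2(1) g g]
  have b: "bispecht lam mu = induced_rep (B (k + l)) (B k \<times>\<times> B l) (hyp_juxt k)
      (wreath_rep k triv_F (specht lam) \<boxtimes> wreath_rep l sign_F (specht mu))"
    by (simp add: bispecht_def Let_def L M)
  note ir = induced_rep_rep[OF finite_group_B finite_group_BB hyp_juxt_hom ot(1)]
  show "is_rep (B (k + l)) (bispecht lam mu)" unfolding b by (rule ir(1))
  assume x: "x \<in> carrier (B (k + l))"
  show "character (bispecht lam mu) x =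
      ind_cf (B (k + l)) (B k \<times>\<times> B l) (hyp_juxt k) (\<lambda>(x, y). chi1 lam x * chie mu y) x"
    unfolding b ir(2)[OF x] using ot(2) r1(2) r2(2) by (intro ind_cf_cong) auto
qed

section \<open>Exchanging two blocks of coordinates\<close>

text \<open>Rearranges consecutive blocks of lengths \<open>k, l, p, q\<close> into the order
  \<open>k, p, l, q\<close>; the inverse is the same function with \<open>l\<close> and
  \<open>p\<close> exchanged.\<close>

definition block_swap :: "nat \<Rightarrow> nat \<Rightarrow> nat \<Rightarrow> nat \<Rightarrow> nat"
  where "block_swap k l p i =
    (if i \<le> k then i else if i \<le> k + l then i + p else if i \<le> k + l + p then i - l else i)"

lemma block_swap_permutes: "block_swap k l p permutes {1..k + l + (p + q)}"
proof -
  have inv: "block_swap k p l (block_swap k l p i) = i" for k l p i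
    by (simp add: block_swap_def, arith)
  have "bij (block_swap k l p)"
    by (rule o_bij[of "block_swap k p l"]) (auto simp: inv)
  moreover have "block_swap k l p i = i" if "i \<notin> {1..k + l + (p + q)}" for i
    using that by (auto simp: block_swap_def)
  ultimately show ?thesis unfolding permutes_def by (metis bij_pointE)
qed

text \<open>Bounds in place of membership in \<open>{1..k}\<close>, so that the fixed point 0 is no
  special case in the comparison of blocks.\<close>

lemma permutes_bounds:
  fixes \<sigma> :: "nat \<Rightarrow> nat"
  assumes "\<sigma> permutes {1..k}"
  shows "i \<le> k \<Longrightarrow> \<sigma> i \<le> k" "0 < i \<Longrightarrow> 0 < \<sigma> i" "k < i \<Longrightarrow> \<sigma> i = i"
proof -
  have d: "\<sigma> i = i \<or> (1 \<le> \<sigma> i \<and> \<sigma> i \<le> k)"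
    using permutes_in_image[OF assms, of i] permutes_not_in[OF assms, of i]
    by (cases "i \<in> {1..k}") auto
  show "i \<le> k \<Longrightarrow> \<sigma> i \<le> k" using d by linarith
  show "0 < i \<Longrightarrow> 0 < \<sigma> i" using d by linarith
  show "k < i \<Longrightarrow> \<sigma> i = i" by (rule permutes_not_in[OF assms]) simp
qed

text \<open>The block exchange conjugates the embedding with blocks in the order
  \<open>x, z, y, u\<close> into the one with order \<open>x, y, z, u\<close>; this is the
  intertwining equation that \<open>ind_cf_conj\<close> asks for. Multiplication in
  \<open>B n\<close> is given by the same formula for every \<open>n\<close>, so \<open>n\<close>
  stays free.\<close>

lemma block_swap_juxt:
  assumes x: "x \<in> carrier (B k)" and y: "y \<in> carrier (B p)" and z: "z \<in> carrier (B l)" and u: "u \<in> carrier (B q)"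
  shows "((\<lambda>_. 0), block_swap k l p) \<otimes>\<^bsub>B n\<^esub> hyp_juxt (k + l) (hyp_juxt k (x, z), hyp_juxt p (y, u)) =
    hyp_juxt (k + p) (hyp_juxt k (x, y), hyp_juxt l (z, u)) \<otimes>\<^bsub>B n\<^esub> ((\<lambda>_. 0), block_swap k l p)"
proof -
  obtain f1 \<sigma>1 where 1: "x = (f1, \<sigma>1)" "\<sigma>1 permutes {1..k}" using x by (auto simp: B_carrier S_carrier)
  obtain f2 \<sigma>2 where 2: "y = (f2, \<sigma>2)" "\<sigma>2 permutes {1..p}" using y by (auto simp: B_carrier S_carrier)
  obtain f3 \<sigma>3 where 3: "z = (f3, \<sigma>3)" "\<sigma>3 permutes {1..l}" using z by (auto simp: B_carrier S_carrier)
  obtain f4 \<sigma>4 where 4: "u = (f4, \<sigma>4)" "\<sigma>4 permutes {1..q}" using u by (auto simp: B_carrier S_carrier)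
  let ?w = "block_swap k l p"
  have w: "?w permutes {1..k + l + (p + 0)}" by (rule block_swap_permutes)
  have fb: "fun_juxt (k + l) (fun_juxt k f1 f3) (fun_juxt p f2 f4) i =
      fun_juxt (k + p) (fun_juxt k f1 f2) (fun_juxt l f3 f4) (?w i)" for i
    by (auto simp: block_swap_def ac_simps)
  have f: "fun_juxt (k + l) (fun_juxt k f1 f3) (fun_juxt p f2 f4) (inv' ?w i) =
      fun_juxt (k + p) (fun_juxt k f1 f2) (fun_juxt l f3 f4) i" for i
    unfolding fb permutes_inverses(1)[OF w] ..
  have s: "?w \<circ> sym_juxt (k + l) (sym_juxt k (\<sigma>1, \<sigma>3), sym_juxt p (\<sigma>2, \<sigma>4)) =
      sym_juxt (k + p) (sym_juxt k (\<sigma>1, \<sigma>2), sym_juxt l (\<sigma>3, \<sigma>4)) \<circ> ?w"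
  proof
    fix i
    note b = permutes_bounds[OF 1(2)] permutes_bounds[OF 2(2)] permutes_bounds[OF 3(2)] permutes_bounds[OF 4(2)]
    consider "i \<le> k" | "k < i" "i \<le> k + l" | "k + l < i" "i \<le> k + l + p" | "k + l + p < i" by linarith
    then show "(?w \<circ> sym_juxt (k + l) (sym_juxt k (\<sigma>1, \<sigma>3), sym_juxt p (\<sigma>2, \<sigma>4))) i =
      (sym_juxt (k + p) (sym_juxt k (\<sigma>1, \<sigma>2), sym_juxt l (\<sigma>3, \<sigma>4)) \<circ> ?w) i"
    proof cases
      case 1
      then show ?thesis using b(1)[of i] by (simp add: block_swap_def sym_juxt_def)
    next
      case 2
      then have "i - k \<le> l" by simp
      then show ?thesis using \<open>k < i\<close> \<open>i \<le> k + l\<close> b(7)[of "i - k"] b(8)[of "i - k"] by (simp add: block_swap_def sym_juxt_def)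
    next
      case 3
      then have "i - l - k = i - (k + l)" "i - (k + l) \<le> p" "k < i - l" "i - l \<le> k + p" by simp_all
      then show ?thesis using 3 b(4)[of "i - (k + l)"] b(5)[of "i - (k + l)"]
        by (simp add: block_swap_def sym_juxt_def)
    next
      case 4
      then have "\<not> i - (k + l) \<le> p" "\<not> i - (k + p) \<le> l" "i - (k + l) - p = i - (k + l + p)"
        "i - (k + p) - l = i - (k + l + p)" "0 < \<sigma>4 (i - (k + l + p))"
        using b(11)[of "i - (k + l + p)"] by simp_all
      then show ?thesis using 4 by (simp add: block_swap_def sym_juxt_def)
    qed
  qed
  show ?thesis
    unfolding 1(1) 2(1) 3(1) 4(1) hyp_juxt_def prod.case B_mult s f by simp
qed

section \<open>Products of bipartition characters\<close>

text \<open>Induction is unfolded to the product of all four groups, the two middle blocks are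
  exchanged, and the stages are refolded so that \<open>lam\<close> meets \<open>nu\<close> and
  \<open>mu\<close> meets \<open>xi\<close>. The decompositions over \<open>X\<close> and
  \<open>Y\<close> are assumptions, so that one statement serves rows, columns and empty
  components.\<close>

lemma bispecht_product:
  assumes p: "lam \<in> partitions k" "mu \<in> partitions l" "nu \<in> partitions p" "xi \<in> partitions q"
    and X: "\<And>\<sigma>. \<sigma> \<in> carrier (S (k + p)) \<Longrightarrow> ind_cf (S (k + p)) (S k \<times>\<times> S p) (sym_juxt k)
       (\<lambda>(s, t). character (specht lam) s * character (specht nu) t) \<sigma> = (\<Sum>\<tau>\<in>X. character (specht \<tau>) \<sigma>)"
    and Y: "\<And>\<sigma>. \<sigma> \<in> carrier (S (l + q)) \<Longrightarrow> ind_cf (S (l + q)) (S l \<times>\<times> S q) (sym_juxt l)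
       (\<lambda>(s, t). character (specht mu) s * character (specht xi) t) \<sigma> = (\<Sum>\<tau>\<in>Y. character (specht \<tau>) \<sigma>)"
    and XP: "X \<subseteq> partitions (k + p)" "Y \<subseteq> partitions (l + q)"
    and n: "n = k + l + (p + q)" and g: "g \<in> carrier (B n)"
  shows "ind_cf (B n) (B (k + l) \<times>\<times> B (p + q)) (hyp_juxt (k + l))
      (\<lambda>(x, y). character (bispecht lam mu) x * character (bispecht nu xi) y) g =
    (\<Sum>\<tau>\<in>X. \<Sum>\<rho>\<in>Y. character (bispecht \<tau> \<rho>) g)"
proof -
  note sl = partitionsD(3)[OF p(1)] partitionsD(3)[OF p(2)] partitionsD(3)[OF p(3)] partitionsD(3)[OF p(4)]
  have n': "n = k + p + (l + q)" using n by simp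
  let ?L1 = "(B k \<times>\<times> B l) \<times>\<times> (B p \<times>\<times> B q)" and ?L2 = "(B k \<times>\<times> B p) \<times>\<times> (B l \<times>\<times> B q)"
  let ?j1 = "map_prod (hyp_juxt k) (hyp_juxt p)" and ?j2 = "map_prod (hyp_juxt k) (hyp_juxt l)"
  let ?f1 = "\<lambda>(x, z). chi1 lam x * chie mu z" and ?f2 = "\<lambda>(y, u). chi1 nu y * chie xi u"
  let ?g1 = "\<lambda>(x, y). chi1 lam x * chi1 nu y" and ?g2 = "\<lambda>(z, u). chie mu z * chie xi u"
  define \<theta> :: "(hyp \<times> hyp) \<times> (hyp \<times> hyp) \<Rightarrow> (hyp \<times> hyp) \<times> (hyp \<times> hyp)"
    where "\<theta> = (\<lambda>((x, y), (z, u)). ((x, z), (y, u)))"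
  have jh: "map_prod (hyp_juxt a) (hyp_juxt c) \<in> hom ((B a \<times>\<times> B b) \<times>\<times> (B c \<times>\<times> B d)) (B (a + b) \<times>\<times> B (c + d))"
    for a b c d
    using hyp_juxt_hom[of a b] hyp_juxt_hom[of c d] by (auto simp: hom_def Pi_iff)
  have hn: "hyp_juxt a \<in> hom (B a \<times>\<times> B b) (B n)" if "n = a + b" for a b
    using hyp_juxt_hom[of a b] that by simp
  have hc: "hyp_juxt a v \<in> carrier (B (a + b))" if "v \<in> carrier (B a \<times>\<times> B b)" for a b v
    using hyp_juxt_hom[of a b] that by (auto simp: hom_def)
  have w: "((\<lambda>_. 0), block_swap k l p) \<in> carrier (B n)"
    using block_swap_permutes[of k l p q] n by (simp add: B_carrier S_carrier supp_fun_def)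
  have "ind_cf (B n) (B (k + l) \<times>\<times> B (p + q)) (hyp_juxt (k + l))
      (\<lambda>(x, y). character (bispecht lam mu) x * character (bispecht nu xi) y) g =
    ind_cf (B n) (B (k + l) \<times>\<times> B (p + q)) (hyp_juxt (k + l))
      (ind_cf (B (k + l) \<times>\<times> B (p + q)) ?L1 ?j1 (\<lambda>(v, v'). ?f1 v * ?f2 v')) g"
    by (rule ind_cf_cong) (auto simp: ind_cf_prod bispecht_rep(2)[OF p(1,2)] bispecht_rep(2)[OF p(3,4)])
  also have "\<dots> = ind_cf (B n) ?L1 (hyp_juxt (k + l) \<circ> ?j1) (\<lambda>(v, v'). ?f1 v * ?f2 v') g"
    by (rule ind_cf_trans[OF finite_group_B finite_group_BB hn[OF n] jh g])
  also have "\<dots> = ind_cf (B n) ?L2 (hyp_juxt (k + p) \<circ> ?j2) (\<lambda>v. (\<lambda>(v, v'). ?f1 v * ?f2 v') (\<theta> v)) g"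
  proof (rule ind_cf_conj[OF finite_group_B _ w _ _ _ g])
    show "bij_betw \<theta> (carrier ?L2) (carrier ?L1)"
      by (rule bij_betw_byWitness[where f' = "\<lambda>((x, z), (y, u)). ((x, y), (z, u))"]) (auto simp: \<theta>_def)
    fix v assume "v \<in> carrier ?L2"
    then obtain x y z u where v: "v = ((x, y), (z, u))" "x \<in> carrier (B k)" "y \<in> carrier (B p)"
      "z \<in> carrier (B l)" "u \<in> carrier (B q)" by auto
    show "(hyp_juxt (k + l) \<circ> ?j1) (\<theta> v) \<in> carrier (B n)"
      unfolding n v(1) using v(2-) by (auto simp: \<theta>_def intro!: hc)
    show "(hyp_juxt (k + p) \<circ> ?j2) v \<in> carrier (B n)"
      unfolding n' v(1) using v(2-) by (auto intro!: hc)
    show "((\<lambda>_. 0), block_swap k l p) \<otimes>\<^bsub>B n\<^esub> (hyp_juxt (k + l) \<circ> ?j1) (\<theta> v) =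
        (hyp_juxt (k + p) \<circ> ?j2) v \<otimes>\<^bsub>B n\<^esub> ((\<lambda>_. 0), block_swap k l p)"
      using block_swap_juxt[OF v(2,3,4,5), of n] by (simp add: v(1) \<theta>_def)
  qed
  also have "\<dots> = ind_cf (B n) ?L2 (hyp_juxt (k + p) \<circ> ?j2) (\<lambda>(v, v'). ?g1 v * ?g2 v') g"
    by (rule ind_cf_cong) (auto simp: \<theta>_def)
  also have "\<dots> = ind_cf (B n) (B (k + p) \<times>\<times> B (l + q)) (hyp_juxt (k + p))
      (ind_cf (B (k + p) \<times>\<times> B (l + q)) ?L2 ?j2 (\<lambda>(v, v'). ?g1 v * ?g2 v')) g"
    by (rule ind_cf_trans[OF finite_group_B finite_group_BB hn[OF n'] jh g, symmetric])
  also have "\<dots> = ind_cf (B n) (B (k + p) \<times>\<times> B (l + q)) (hyp_juxt (k + p))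
      (\<lambda>v. \<Sum>\<tau>\<in>X. \<Sum>\<rho>\<in>Y. (\<lambda>(x, y). chi1 \<tau> x * chie \<rho> y) v) g"
  proof (rule ind_cf_cong)
    fix v assume "v \<in> carrier (B (k + p) \<times>\<times> B (l + q))"
    then obtain x y where v: "v = (x, y)" "x \<in> carrier (B (k + p))" "y \<in> carrier (B (l + q))" by auto
    obtain f \<sigma> where x: "x = (f, \<sigma>)" by (cases x)
    obtain f' \<sigma>' where y: "y = (f', \<sigma>')" by (cases y)
    have \<sigma>: "\<sigma> \<in> carrier (S (k + p))" "\<sigma>' \<in> carrier (S (l + q))" using v x y by (auto simp: B_carrier)
    have 1: "ind_cf (B (k + p)) (B k \<times>\<times> B p) (hyp_juxt k) ?g1 x = (\<Sum>\<tau>\<in>X. chi1 \<tau> x)"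
      using ind_cf_inflate[of f \<sigma> k p "character (specht lam)" "character (specht nu)"] v(2) X[OF \<sigma>(1)]
      by (simp add: x chi1_def split_beta)
    \<comment> \<open>The factors \<open>sgnF\<close> on the two blocks are the restriction of one
      character of \<open>B (l + q)\<close>, which is pulled out; what remains is inflated from the
      symmetric groups.\<close>
    have "ind_cf (B (l + q)) (B l \<times>\<times> B q) (hyp_juxt l) ?g2 y =
      ind_cf (B (l + q)) (B l \<times>\<times> B q) (hyp_juxt l) (\<lambda>v. sgnF (l + q) (hyp_juxt l v) *
        (\<lambda>(z, u). character (specht mu) (snd z) * character (specht xi) (snd u)) v) y"
      by (rule ind_cf_cong) (auto simp: chie_def sl sgnF_juxt mult_ac)
    also have "\<dots> = sgnF (l + q) y * ind_cf (B (l + q)) (B l \<times>\<times> B q) (hyp_juxt l)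
        (\<lambda>(z, u). character (specht mu) (snd z) * character (specht xi) (snd u)) y"
      by (rule ind_cf_mult[OF finite_group_B hyp_juxt_hom v(3) sgnF_mult sgnF_nonzero])
    also have "\<dots> = sgnF (l + q) y * (\<Sum>\<rho>\<in>Y. character (specht \<rho>) \<sigma>')"
      using ind_cf_inflate[of f' \<sigma>' l q] v(3) Y[OF \<sigma>(2)] by (simp add: y)
    also have "\<dots> = (\<Sum>\<rho>\<in>Y. chie \<rho> y)"
      unfolding sum_distrib_left chie_def using XP(2) partitionsD(3) by (intro sum.cong refl) (auto simp: y)
    finally have 2: "ind_cf (B (l + q)) (B l \<times>\<times> B q) (hyp_juxt l) ?g2 y = (\<Sum>\<rho>\<in>Y. chie \<rho> y)" .
    show "ind_cf (B (k + p) \<times>\<times> B (l + q)) ?L2 ?j2 (\<lambda>(v, v'). ?g1 v * ?g2 v') v =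
      (\<Sum>\<tau>\<in>X. \<Sum>\<rho>\<in>Y. (\<lambda>(x, y). chi1 \<tau> x * chie \<rho> y) v)"
      unfolding v(1) ind_cf_prod 1 2 by (simp add: sum_product)
  qed
  also have "\<dots> = (\<Sum>\<tau>\<in>X. \<Sum>\<rho>\<in>Y. character (bispecht \<tau> \<rho>) g)"
    unfolding ind_cf_sum
  proof (intro sum.cong refl)
    fix \<tau> \<rho> assume "\<tau> \<in> X" "\<rho> \<in> Y"
    then have t: "\<tau> \<in> partitions (k + p)" "\<rho> \<in> partitions (l + q)" using XP by auto
    show "ind_cf (B n) (B (k + p) \<times>\<times> B (l + q)) (hyp_juxt (k + p)) (\<lambda>(x, y). chi1 \<tau> x * chie \<rho> y) g =
        character (bispecht \<tau> \<rho>) g"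
      using bispecht_rep(2)[OF t, of g] g by (simp add: n')
  qed
  finally show ?thesis .
qed

text \<open>The group \<open>S 0\<close> is trivial, so the subgroup is the whole group up to
  relabelling and induction changes nothing. This handles the component that meets an empty
  partition.\<close>

lemma pieri_empty:
  assumes lam: "lam \<in> partitions m" and \<sigma>: "\<sigma> \<in> carrier (S (m + 0))"
  shows "ind_cf (S (m + 0)) (S m \<times>\<times> S 0) (sym_juxt m)
      (\<lambda>(s, t). character (specht lam) s * character (specht []) t) \<sigma> = (\<Sum>\<tau>\<in>{lam}. character (specht \<tau>) \<sigma>)"
proof -
  interpret finite_group "S m" by (rule finite_group_sym)
  have R: "is_rep (S m) (specht lam)" using specht_rep[of lam] partitionsD(3)[OF lam] by simp
  have S0: "carrier (S 0) = {id}" by (auto simp: S_carrier)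
  have j: "sym_juxt m (s, id) = s" if "s \<in> carrier (S m)" for s
    using that permutes_not_in[of s "{1..m}"] by (auto simp: S_carrier sym_juxt_def)
  have e: "character (specht []) id = 1" using specht_one_row[of "[]" 0 id] S0 by simp
  have "ind_cf (S m) (S m \<times>\<times> S 0) (sym_juxt m)
      (\<lambda>(s, t). character (specht lam) s * character (specht []) t) \<sigma> =
    ind_cf (S m) (S m) id (\<lambda>s. (\<lambda>(s, t). character (specht lam) s * character (specht []) t) (s, id)) \<sigma>"
  proof (rule ind_cf_conj[OF finite_group_sym _ one_closed])
    show "bij_betw (\<lambda>s. (s, id)) (carrier (S m)) (carrier (S m \<times>\<times> S 0))"
      by (auto simp: bij_betw_def inj_on_def S0)
  qed (use \<sigma> j in auto)
  also have "\<dots> = character (specht lam) \<sigma>"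
    using character_class[OF R] \<sigma> e by (subst ind_cf_id[OF finite_group_sym]) (auto simp: class_fun_def)
  finally show ?thesis by simp
qed

lemma pieri_row:
  assumes lam: "lam \<in> partitions m" and k: "k = 1 \<or> k = 2" and \<sigma>: "\<sigma> \<in> carrier (S (m + k))"
  shows "ind_cf (S (m + k)) (S m \<times>\<times> S k) (sym_juxt m)
      (\<lambda>(s, t). character (specht lam) s * character (specht [k]) t) \<sigma> =
    (\<Sum>\<tau>\<in>summands_ind lam k (\<lambda>_. 1). character (specht \<tau>) \<sigma>)"
proof -
  have "ind_cf (S (m + k)) (S m \<times>\<times> S k) (sym_juxt m)
      (\<lambda>(s, t). character (specht lam) s * character (specht [k]) t) \<sigma> =
    ind_cf (S (m + k)) (S m \<times>\<times> S k) (sym_juxt m) (\<lambda>(s, t). character (specht lam) s * 1) \<sigma>"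
    by (rule ind_cf_cong) (use k in \<open>auto simp: specht_one_row[of _ k]\<close>)
  also have "\<dots> = (\<Sum>\<tau>\<in>summands_ind lam k (\<lambda>_. 1). character (specht \<tau>) \<sigma>)"
    by (rule pieri[OF lam k _ _ \<sigma>]) auto
  finally show ?thesis .
qed

lemma pieri_column:
  assumes lam: "lam \<in> partitions m" and \<sigma>: "\<sigma> \<in> carrier (S (m + 2))"
  shows "ind_cf (S (m + 2)) (S m \<times>\<times> S 2) (sym_juxt m)
      (\<lambda>(s, t). character (specht lam) s * character (specht [1, 1]) t) \<sigma> =
    (\<Sum>\<tau>\<in>add_two_sign lam. character (specht \<tau>) \<sigma>)"
proof -
  have "ind_cf (S (m + 2)) (S m \<times>\<times> S 2) (sym_juxt m)
      (\<lambda>(s, t). character (specht lam) s * character (specht [1, 1]) t) \<sigma> =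
    ind_cf (S (m + 2)) (S m \<times>\<times> S 2) (sym_juxt m) (\<lambda>(s, t). character (specht lam) s * of_int (sign t)) \<sigma>"
    by (rule ind_cf_cong) (auto simp: specht_column simp del: One_nat_def)
  also have "\<dots> = (\<Sum>\<tau>\<in>add_two_sign lam. character (specht \<tau>) \<sigma>)"
    unfolding add_two_sign_def
    by (rule pieri[OF lam _ _ _ \<sigma>]) (auto simp: S_carrier perm_sign sign_id)
  finally show ?thesis .
qed

lemma summands_partitions: "lam \<in> partitions m \<Longrightarrow> summands_ind lam k \<chi> \<subseteq> partitions (m + k)"
  by (auto simp: summands_ind_def Let_def dest: partitionsD(3))

section \<open>Induction from \<open>B\<^bsub>n-2\<^esub> \<times> D\<^sub>2\<close>\<close>

text \<open>The inner stage induces \<open>W\<close> from \<open>D2\<close> to \<open>B 2\<close>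
  and leaves \<open>V\<close> alone. Afterwards \<open>W\<close> enters only through the induced
  character, which is what the three cases of the theorem prescribe.\<close>

lemma induced_D2_rep:
  assumes V: "is_rep (B N) V" and W: "is_rep D2 W"
  shows "is_rep (B (N + 2)) (induced_rep (B (N + 2)) (B N \<times>\<times> D2) (hyp_juxt N) (V \<boxtimes> W))"
    and "g \<in> carrier (B (N + 2)) \<Longrightarrow>
      character (induced_rep (B (N + 2)) (B N \<times>\<times> D2) (hyp_juxt N) (V \<boxtimes> W)) g =
      ind_cf (B (N + 2)) (B N \<times>\<times> B 2) (hyp_juxt N)
        (\<lambda>(x, y). character V x * character (induced_rep (B 2) D2 id W) y) g"
proof -
  have gr: "group (B m)" "group D2" for m
    using finite_group_B[of m] finite_group_D2 by (auto simp: finite_group_def)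
  \<comment> \<open>Elements of \<open>D2\<close> are elements of \<open>B 2\<close>, so the
    inclusion into the intermediate group is the identity function.\<close>
  have \<kappa>: "map_prod id id \<in> hom (B N \<times>\<times> D2) (B N \<times>\<times> B 2)"
    using D2_hom by (auto simp: hom_def Pi_iff)
  then have j: "hyp_juxt N \<in> hom (B N \<times>\<times> D2) (B (N + 2))"
    using hyp_juxt_hom[of N 2] by (auto simp: hom_def Pi_iff)
  note ot = outer_tensor_rep[OF V W gr]
  note ir = induced_rep_rep[OF finite_group_B finite_group_DirProd[OF finite_group_B finite_group_D2] j ot(1)]
  show "is_rep (B (N + 2)) (induced_rep (B (N + 2)) (B N \<times>\<times> D2) (hyp_juxt N) (V \<boxtimes> W))" by (rule ir(1))
  assume g: "g \<in> carrier (B (N + 2))"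
  have cV: "class_fun (B N) (character V)"
    unfolding class_fun_def using finite_group.character_class[OF finite_group_B V] by blast
  have "character (induced_rep (B (N + 2)) (B N \<times>\<times> D2) (hyp_juxt N) (V \<boxtimes> W)) g =
      ind_cf (B (N + 2)) (B N \<times>\<times> D2) (hyp_juxt N \<circ> map_prod id id)
        (\<lambda>(x, w). character V x * character W w) g"
    unfolding ir(2)[OF g] map_prod.id comp_id using ot(2) by (intro ind_cf_cong) auto
  also have "\<dots> = ind_cf (B (N + 2)) (B N \<times>\<times> B 2) (hyp_juxt N)
      (ind_cf (B N \<times>\<times> B 2) (B N \<times>\<times> D2) (map_prod id id) (\<lambda>(x, w). character V x * character W w)) g"
    by (rule ind_cf_trans[OF finite_group_B finite_group_BB hyp_juxt_hom \<kappa> g, symmetric])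
  also have "\<dots> = ind_cf (B (N + 2)) (B N \<times>\<times> B 2) (hyp_juxt N)
      (\<lambda>(x, y). character V x * character (induced_rep (B 2) D2 id W) y) g"
  proof (rule ind_cf_cong)
    fix h assume "h \<in> carrier (B N \<times>\<times> B 2)"
    then obtain x y where h: "h = (x, y)" "x \<in> carrier (B N)" "y \<in> carrier (B 2)" by auto
    show "ind_cf (B N \<times>\<times> B 2) (B N \<times>\<times> D2) (map_prod id id) (\<lambda>(x, w). character V x * character W w) h =
        (\<lambda>(x, y). character V x * character (induced_rep (B 2) D2 id W) y) h"
      using induced_rep_rep(2)[OF finite_group_B finite_group_D2 D2_hom W h(3)]
      by (simp add: h(1) ind_cf_prod ind_cf_id[OF finite_group_B cV h(2)])
  qed
  finally show "character (induced_rep (B (N + 2)) (B N \<times>\<times> D2) (hyp_juxt N) (V \<boxtimes> W)) g =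
      ind_cf (B (N + 2)) (B N \<times>\<times> B 2) (hyp_juxt N)
        (\<lambda>(x, y). character V x * character (induced_rep (B 2) D2 id W) y) g" .
qed

lemma bispecht_sum_rep:
  assumes f: "finite J" and p: "\<And>i. i \<in> J \<Longrightarrow> \<tau> i \<in> partitions a" "\<And>i. i \<in> J \<Longrightarrow> \<rho> i \<in> partitions b"
  shows "is_rep (B (a + b)) (direct_sum J (\<lambda>i. bispecht (\<tau> i) (\<rho> i)))"
    and "g \<in> carrier (B (a + b)) \<Longrightarrow> character (direct_sum J (\<lambda>i. bispecht (\<tau> i) (\<rho> i))) g =
      (\<Sum>i\<in>J. character (bispecht (\<tau> i) (\<rho> i)) g)"
proof -
  have gr: "group (B (a + b))" using finite_group_B by (auto simp: finite_group_def)
  note d = direct_sum_rep[of J "B (a + b)" "\<lambda>i. bispecht (\<tau> i) (\<rho> i)", OF f bispecht_rep(1)[OF p] gr]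
  show "is_rep (B (a + b)) (direct_sum J (\<lambda>i. bispecht (\<tau> i) (\<rho> i)))"
    by (rule d(1))
  show "g \<in> carrier (B (a + b)) \<Longrightarrow> character (direct_sum J (\<lambda>i. bispecht (\<tau> i) (\<rho> i))) g =
      (\<Sum>i\<in>J. character (bispecht (\<tau> i) (\<rho> i)) g)"
    by (rule d(2))
qed

text \<open>Covers rows and columns at once. The summand \<open>bispecht nu []\<close> pairs
  \<open>nu\<close> with \<open>lam\<close> and leaves \<open>mu\<close> unchanged; the summand
  \<open>bispecht [] nu\<close> does the reverse.\<close>

lemma induced_D2_split:
  assumes lam: "lam \<in> partitions k" and mu: "mu \<in> partitions l" and nu: "nu \<in> partitions 2"
    and W: "is_rep D2 W"
    and iso: "rep_iso (B 2) (induced_rep (B 2) D2 id W) (direct_sum2 (bispecht nu []) (bispecht [] nu))"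
    and X: "\<And>m lam \<sigma>. lam \<in> partitions m \<Longrightarrow> \<sigma> \<in> carrier (S (m + 2)) \<Longrightarrow>
      ind_cf (S (m + 2)) (S m \<times>\<times> S 2) (sym_juxt m)
        (\<lambda>(s, t). character (specht lam) s * character (specht nu) t) \<sigma> = (\<Sum>\<tau>\<in>X lam. character (specht \<tau>) \<sigma>)"
    and XP: "\<And>m lam. lam \<in> partitions m \<Longrightarrow> X lam \<subseteq> partitions (m + 2)"
  shows "rep_iso (B (k + l + 2))
    (induced_rep (B (k + l + 2)) (B (k + l) \<times>\<times> D2) (hyp_juxt (k + l)) (bispecht lam mu \<boxtimes> W))
    (direct_sum2 (direct_sum (X lam) (\<lambda>\<tau>. bispecht \<tau> mu)) (direct_sum (X mu) (\<lambda>\<rho>. bispecht lam \<rho>)))"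
proof -
  have E: "[] \<in> partitions 0" by (simp add: partitions_def)
  note fin = finite_subset[OF XP finite_partitions]
  note r1 = bispecht_sum_rep[OF fin[OF lam], of "\<lambda>\<tau>. \<tau>" _ "\<lambda>_. mu", OF subsetD[OF XP[OF lam]] mu]
  note r2 = bispecht_sum_rep[OF fin[OF mu], of "\<lambda>_. lam" _ "\<lambda>\<rho>. \<rho>", OF lam subsetD[OF XP[OF mu]]]
  have n: "k + 2 + l = k + l + 2" "k + (l + 2) = k + l + 2" by simp_all
  have r1: "is_rep (B (k + l + 2)) (direct_sum (X lam) (\<lambda>\<tau>. bispecht \<tau> mu))"
    "g \<in> carrier (B (k + l + 2)) \<Longrightarrow> character (direct_sum (X lam) (\<lambda>\<tau>. bispecht \<tau> mu)) g =
      (\<Sum>\<tau>\<in>X lam. character (bispecht \<tau> mu) g)" for g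
    using r1[unfolded n] by blast+
  have r2: "is_rep (B (k + l + 2)) (direct_sum (X mu) (\<lambda>\<rho>. bispecht lam \<rho>))"
    "g \<in> carrier (B (k + l + 2)) \<Longrightarrow> character (direct_sum (X mu) (\<lambda>\<rho>. bispecht lam \<rho>)) g =
      (\<Sum>\<rho>\<in>X mu. character (bispecht lam \<rho>) g)" for g
    using r2[unfolded n] by blast+
  note I = induced_D2_rep[OF bispecht_rep(1)[OF lam mu] W]
  have b: "is_rep (B 2) (bispecht nu [])" "is_rep (B 2) (bispecht [] nu)"
    using bispecht_rep(1)[OF nu E] bispecht_rep(1)[OF E nu] unfolding add_0_right add_0_left .
  have i2: "is_rep (B 2) (induced_rep (B 2) D2 id W)"
    by (rule induced_rep_rep(1)[OF finite_group_B finite_group_D2 D2_hom W])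
  have ch: "character (induced_rep (B 2) D2 id W) y = character (bispecht nu []) y + character (bispecht [] nu) y"
    if "y \<in> carrier (B 2)" for y
    using rep_iso_char[OF i2 direct_sum2_rep(1)[OF b] iso that] direct_sum2_rep(2)[OF b that] by simp
  show ?thesis
  proof (rule finite_group.character_eq_iso[OF finite_group_B I(1) direct_sum2_rep(1)[OF r1(1) r2(1)]])
    fix g assume g: "g \<in> carrier (B (k + l + 2))"
    have "character (induced_rep (B (k + l + 2)) (B (k + l) \<times>\<times> D2) (hyp_juxt (k + l)) (bispecht lam mu \<boxtimes> W)) g =
      ind_cf (B (k + l + 2)) (B (k + l) \<times>\<times> B 2) (hyp_juxt (k + l))
        (\<lambda>v. (\<lambda>(x, y). character (bispecht lam mu) x * character (bispecht nu []) y) v +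
             (\<lambda>(x, y). character (bispecht lam mu) x * character (bispecht [] nu) y) v) g"
      unfolding I(2)[OF g] by (rule ind_cf_cong) (auto simp: ch distrib_left)
    also have "\<dots> = (\<Sum>\<tau>\<in>X lam. character (bispecht \<tau> mu) g) + (\<Sum>\<rho>\<in>X mu. character (bispecht lam \<rho>) g)"
    proof -
      \<comment> \<open>Here \<open>2 + 0\<close>, and \<open>0 + 2\<close> in the next claim,
        display the form \<open>p + q\<close> in which \<open>bispecht_product\<close> is
        stated.\<close>
      have 1: "ind_cf (B (k + l + 2)) (B (k + l) \<times>\<times> B (2 + 0)) (hyp_juxt (k + l))
          (\<lambda>(x, y). character (bispecht lam mu) x * character (bispecht nu []) y) g =
        (\<Sum>\<tau>\<in>X lam. \<Sum>\<rho>\<in>{mu}. character (bispecht \<tau> \<rho>) g)"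
        by (rule bispecht_product[OF lam mu nu E X[OF lam] pieri_empty[OF mu] XP[OF lam] _ _ g])
          (use mu in auto)
      have 2: "ind_cf (B (k + l + 2)) (B (k + l) \<times>\<times> B (0 + 2)) (hyp_juxt (k + l))
          (\<lambda>(x, y). character (bispecht lam mu) x * character (bispecht [] nu) y) g =
        (\<Sum>\<tau>\<in>{lam}. \<Sum>\<rho>\<in>X mu. character (bispecht \<tau> \<rho>) g)"
        by (rule bispecht_product[OF lam mu E nu pieri_empty[OF lam] X[OF mu] _ XP[OF mu] _ g])
          (use lam in auto)
      show ?thesis using 1 2 unfolding add_0_right add_0_left ind_cf_add by simp
    qed
    also have "\<dots> = character (direct_sum2 (direct_sum (X lam) (\<lambda>\<tau>. bispecht \<tau> mu))
        (direct_sum (X mu) (\<lambda>\<rho>. bispecht lam \<rho>))) g"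
      by (simp add: direct_sum2_rep(2)[OF r1(1) r2(1) g] r1(2)[OF g] r2(2)[OF g])
    finally show "character (induced_rep (B (k + l + 2)) (B (k + l) \<times>\<times> D2) (hyp_juxt (k + l)) (bispecht lam mu \<boxtimes> W)) g =
      character (direct_sum2 (direct_sum (X lam) (\<lambda>\<tau>. bispecht \<tau> mu)) (direct_sum (X mu) (\<lambda>\<rho>. bispecht lam \<rho>))) g" .
  qed
qed

text \<open>A single product with \<open>p = q = 1\<close>, in which each component receives one
  box.\<close>

lemma induced_D2_mixed:
  assumes lam: "lam \<in> partitions k" and mu: "mu \<in> partitions l" and W: "is_rep D2 W"
    and iso: "rep_iso (B 2) (induced_rep (B 2) D2 id W) (bispecht [1] [1])"
  shows "rep_iso (B (k + l + 2))
    (induced_rep (B (k + l + 2)) (B (k + l) \<times>\<times> D2) (hyp_juxt (k + l)) (bispecht lam mu \<boxtimes> W))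
    (direct_sum (add_box lam \<times> add_box mu) (\<lambda>(\<tau>, \<rho>). bispecht \<tau> \<rho>))"
proof -
  have E: "[1] \<in> partitions 1" by (simp add: partitions_def)
  have P: "add_box lam \<subseteq> partitions (k + 1)" "add_box mu \<subseteq> partitions (l + 1)"
    unfolding add_box_def by (rule summands_partitions[OF lam], rule summands_partitions[OF mu])
  have fin: "finite (add_box lam \<times> add_box mu)"
    by (intro finite_cartesian_product P[THEN finite_subset] finite_partitions)
  have sp: "(\<lambda>(\<tau>, \<rho>). bispecht \<tau> \<rho>) = (\<lambda>i. bispecht (fst i) (snd i))" by auto
  have m: "fst i \<in> partitions (k + 1)" "snd i \<in> partitions (l + 1)" if "i \<in> add_box lam \<times> add_box mu" for i
    using that P by auto
  note r = bispecht_sum_rep[of _ fst _ snd, OF fin m]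
  have n: "k + 1 + (l + 1) = k + l + 2" by simp
  have r: "is_rep (B (k + l + 2)) (direct_sum (add_box lam \<times> add_box mu) (\<lambda>(\<tau>, \<rho>). bispecht \<tau> \<rho>))"
    "g \<in> carrier (B (k + l + 2)) \<Longrightarrow>
      character (direct_sum (add_box lam \<times> add_box mu) (\<lambda>(\<tau>, \<rho>). bispecht \<tau> \<rho>)) g =
      (\<Sum>i\<in>add_box lam \<times> add_box mu. character (bispecht (fst i) (snd i)) g)" for g
    unfolding sp using r[unfolded n] by blast+
  note I = induced_D2_rep[OF bispecht_rep(1)[OF lam mu] W]
  have b: "is_rep (B 2) (bispecht [1] [1])"
    using bispecht_rep(1)[OF E E] by (simp add: numeral_2_eq_2)
  have i2: "is_rep (B 2) (induced_rep (B 2) D2 id W)"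
    by (rule induced_rep_rep(1)[OF finite_group_B finite_group_D2 D2_hom W])
  show ?thesis
  proof (rule finite_group.character_eq_iso[OF finite_group_B I(1) r(1)])
    fix g assume g: "g \<in> carrier (B (k + l + 2))"
    have "character (induced_rep (B (k + l + 2)) (B (k + l) \<times>\<times> D2) (hyp_juxt (k + l)) (bispecht lam mu \<boxtimes> W)) g =
      ind_cf (B (k + l + 2)) (B (k + l) \<times>\<times> B (1 + 1)) (hyp_juxt (k + l))
        (\<lambda>(x, y). character (bispecht lam mu) x * character (bispecht [1] [1]) y) g"
      unfolding I(2)[OF g] one_add_one by (rule ind_cf_cong) (auto simp: rep_iso_char[OF i2 b iso] simp del: One_nat_def)
    also have "\<dots> = (\<Sum>\<tau>\<in>add_box lam. \<Sum>\<rho>\<in>add_box mu. character (bispecht \<tau> \<rho>) g)"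
      unfolding add_box_def
      by (rule bispecht_product[OF lam mu E E pieri_row[OF lam] pieri_row[OF mu]
            P[unfolded add_box_def] _ g]) simp_all
    also have "\<dots> = character (direct_sum (add_box lam \<times> add_box mu) (\<lambda>(\<tau>, \<rho>). bispecht \<tau> \<rho>)) g"
      unfolding r(2)[OF g] by (simp add: sum.cartesian_product split_beta)
    finally show "character (induced_rep (B (k + l + 2)) (B (k + l) \<times>\<times> D2) (hyp_juxt (k + l)) (bispecht lam mu \<boxtimes> W)) g =
      character (direct_sum (add_box lam \<times> add_box mu) (\<lambda>(\<tau>, \<rho>). bispecht \<tau> \<rho>)) g" .
  qed
qed

theorem corollary7p7:
  fixes n :: nat
    and k l :: nat
    and lam mu :: "nat list"
    and W :: "((nat \<Rightarrow> bit) \<times> (nat \<Rightarrow> nat), 'w) rep"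
  assumes "n \<ge> 4"
    and "k + l = n - 2"
    and "lam \<in> partitions k"
    and "mu \<in> partitions l"
    and "irreducible_rep D2 W"
  shows
    "(rep_iso (hyperoctahedral 2) (induced_rep (hyperoctahedral 2) D2 id W)
        (direct_sum2 (bispecht [2] []) (bispecht [] [2])) \<longrightarrow>
      rep_iso (hyperoctahedral n)
        (induced_rep (hyperoctahedral n) (hyperoctahedral (n - 2) \<times>\<times> D2) (hyp_juxt (n - 2))
          (bispecht lam mu \<boxtimes> W))
        (direct_sum2 (direct_sum (add_two_triv lam) (\<lambda>\<tau>. bispecht \<tau> mu))
          (direct_sum (add_two_triv mu) (\<lambda>\<rho>. bispecht lam \<rho>)))) \<and>
     (rep_iso (hyperoctahedral 2) (induced_rep (hyperoctahedral 2) D2 id W)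
        (direct_sum2 (bispecht [1, 1] []) (bispecht [] [1, 1])) \<longrightarrow>
      rep_iso (hyperoctahedral n)
        (induced_rep (hyperoctahedral n) (hyperoctahedral (n - 2) \<times>\<times> D2) (hyp_juxt (n - 2))
          (bispecht lam mu \<boxtimes> W))
        (direct_sum2 (direct_sum (add_two_sign lam) (\<lambda>\<tau>. bispecht \<tau> mu))
          (direct_sum (add_two_sign mu) (\<lambda>\<rho>. bispecht lam \<rho>)))) \<and>
     (rep_iso (hyperoctahedral 2) (induced_rep (hyperoctahedral 2) D2 id W)
        (bispecht [1] [1]) \<longrightarrow>
      rep_iso (hyperoctahedral n)
        (induced_rep (hyperoctahedral n) (hyperoctahedral (n - 2) \<times>\<times> D2) (hyp_juxt (n - 2))
          (bispecht lam mu \<boxtimes> W))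
        (direct_sum (add_box lam \<times> add_box mu) (\<lambda>(\<tau>, \<rho>). bispecht \<tau> \<rho>)))"
proof -
  \<comment> \<open>The difference \<open>n - 2\<close> is truncated; the lower bound on
    \<open>n\<close> gives \<open>n = k + l + 2\<close>.\<close>
  have n: "n - 2 = k + l" "n = k + l + 2" using assms(1,2) by auto
  have W: "is_rep D2 W" using assms(5) by (simp add: irreducible_rep_def)
  have two: "[2] \<in> partitions 2" "[1, 1] \<in> partitions 2" by (auto simp: partitions_def)
  show ?thesis
    unfolding n(1) unfolding n(2)
    using induced_D2_split[OF assms(3,4) two(1) W, of add_two_triv]
      induced_D2_split[OF assms(3,4) two(2) W, of add_two_sign]
      induced_D2_mixed[OF assms(3,4) W]
      pieri_row[of _ _ 2] pieri_column summands_partitions[of _ _ 2]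
    unfolding add_two_triv_def add_two_sign_def by blast
qed

end
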